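(* Let $k$ be a field of characteristic $p>2$, let $\mathfrak g=\mathfrak g_{\bar 0}\oplus\mathfrak g_{\bar 1}$ be a restricted Lie superalgebra over $k$, and let $M=M_{\bar 0}\oplus M_{\bar 1}$ be a strongly abelian restricted Lie superalgebra on which $\mathfrak g$ operates (i.e. a restricted $\mathfrak g$-module, regarded as a restricted Lie superalgebra with zero bracket and zero $p$-map). Then the following is an exact sequence of (ungraded) $k$-vector spaces: $$0\to \mathrm H^1_*(\mathfrak g,M)\xrightarrow{\ i_1\ }\mathrm H^1(\mathfrak g,M)\xrightarrow{\ \bar\Psi\ }S(\mathfrak g_{\bar 0},M_{\bar 0}^{\mathfrak g})\xrightarrow{\ F_*\circ G_{s_0}\ }\mathrm H^2_*(\mathfrak g,M)\xrightarrow{\ \rho\ }\mathrm H^2(\mathfrak g,M)\xrightarrow{\ \Phi\ }S(\mathfrak g_{\bar 0},\mathrm H^1(\mathfrak g,M)),$$ where all the spaces and maps are those defined in the context.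
   Context: Conventions. All vector spaces are $\mathbb Z_2$-graded, all linear maps and cochains are even, $|v|$ is the degree of a homogeneous element. A Lie superalgebra over $k$ is understood in the usual sense (if $p=3$ this includes $[y,[y,y]]=0$ for odd $y$). $S(V,W)$ is the $k$-space of $p$-semilinear maps $f:V\to W$, i.e. $f(\alpha v_1+v_2)=\alpha^pf(v_1)+f(v_2)$. A restricted Lie superalgebra is a Lie superalgebra $\mathfrak g$ with a map $x\mapsto x^{[p]}$, $\mathfrak g_{\bar 0}\to\mathfrak g_{\bar 0}$, such that (a) $(cx)^{[p]}=c^px^{[p]}$ for $c\in k$; (b) $[x^{[p]},y]=(\mathrm{ad}\,x)^p(y)$ for $x\in\mathfrak g_{\bar 0}$, $y\in\mathfrak g$; (c) $(x+y)^{[p]}=x^{[p]}+y^{[p]}+\sum_{i=1}^{p-1}s_i(x,y)$ for $x,y\in\mathfrak g_{\bar 0}$, where $i\,s_i(x,y)$ is the coefficient of $\lambda^{i-1}$ in $(\mathrm{ad}(\lambda x+y))^{p-1}(x)$. It is strongly abelian if its bracket is zero and $x^{[p]}=0$ for all even $x$. A $\mathfrak g$-module $M$ is restricted if $x^p\cdot m=x^{[p]}\cdot m$ for $x\in\mathfrak g_{\bar 0}$. $M_{\bar 0}^{\mathfrak g}=\{m\in M_{\bar 0}: x\cdot m=0\ \forall x\in\mathfrak g\}$. $U(\mathfrak g)$ is the universal enveloping algebra, $\mathbf u(\mathfrak g)=U(\mathfrak g)/(x^p-x^{[p]}: x\in\mathfrak g_{\bar 0})$ the restricted enveloping algebra;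 $U(\mathfrak g)^+$ and $\mathbf u(\mathfrak g)^+$ are their ideals generated by $\mathfrak g$. For $A=U(\mathfrak g)$ or $\mathbf u(\mathfrak g)$ consider the complex of even $n$-linear maps $f:(A^+)^n\to M$ with $$\delta f(s_1,\dots,s_n)=s_1\cdot f(s_2,\dots,s_n)+\sum_{i=1}^{n-1}(-1)^if(s_1,\dots,s_is_{i+1},\dots,s_n)$$ (the $0$-cochains are the elements of $M_{\bar 0}$, $\delta m(s)=s\cdot m$). Its cohomology is $\mathrm H^n(\mathfrak g,M)$ for $A=U(\mathfrak g)$ and $\mathrm H^n_*(\mathfrak g,M)$ for $A=\mathbf u(\mathfrak g)$. By restriction to $\mathfrak g$, $\mathrm H^1(\mathfrak g,M)$ is identified with $Z^1(\mathfrak g,M)/B^1(\mathfrak g,M)$, where $Z^1(\mathfrak g,M)$ is the space of even linear $h:\mathfrak g\to M$ with $h([x_1,x_2])=x_1\cdot h(x_2)-(-1)^{|x_1||x_2|}x_2\cdot h(x_1)$ and $B^1(\mathfrak g,M)$ consists of the maps $x\mapsto x\cdot m$, $m\in M_{\bar 0}$. Extensions. A restricted extension of $M$ by $\mathfrak g$ is a pair $(E,\phi)$ with $E$ a restricted Lie superalgebra containing $M$ as an ideal (with its $p$-map) and $\phi:E\to\mathfrak g$ a surjective homomorphism of restricted Lie superalgebras with kernel $M$, inducing the given $\mathfrak g$-module structure on $M$. Two are equivalent if there is an isomorphism of restricted Lie superalgebras $\alpha:E\to E'$ fixing $M$ pointwise with $\phi'\alpha=\phi$. $\mathrm{Ext}_*(M,\mathfrak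 g)$ is the set of equivalence classes. Maps. - $i_1$ and $\rho$ are the canonical maps induced by composing cochains with the projection $U(\mathfrak g)^+\to\mathbf u(\mathfrak g)^+$. - $\bar\Psi$ is induced by $\Psi:Z^1(\mathfrak g,M)\to S(\mathfrak g_{\bar 0},M^{\mathfrak g}_{\bar 0})$, $h\mapsto h'$, $h'(x)=x^{p-1}\cdot h(x)-h(x^{[p]})$. - For $g\in S(\mathfrak g_{\bar 0},M^{\mathfrak g}_{\bar 0})$, $G_{s_0}(g)\in\mathrm{Ext}_*(M,\mathfrak g)$ is the class of the trivial (semidirect) extension $\mathfrak g\oplus M$ with bracket $[(x_1,m_1),(x_2,m_2)]=([x_1,x_2],x_1\cdot m_2-(-1)^{|x_1||x_2|}x_2\cdot m_1)$ and $p$-map $(x,m)^{[p]}=(x^{[p]},x^{p-1}\cdot m-g(x))$. - $F_*:\mathrm{Ext}_*(M,\mathfrak g)\to\mathrm H^2_*(\mathfrak g,M)$ is the canonical bijection whose inverse sends the class of a $2$-cocycle $g$ on $\mathbf u(\mathfrak g)^+$ to the class of $E_g=\mathfrak g\oplus M$, $\phi_g(x,m)=x$, with bracket $[(x_1,m_1),(x_2,m_2)]=([x_1,x_2],\,x_1\cdot m_2-(-1)^{|x_1||x_2|}x_2\cdot m_1+g(x_1,x_2)-(-1)^{|x_1||x_2|}g(x_2,x_1))$ and $p$-map $(x,m)^{[p]}=(x^{[p]},x^{p-1}\cdot m+g(x^{p-1},x))$. - $\Phi$ sends the class of a $2$-cocycle $g$ on $U(\mathfrak g)^+$ to the $p$-semilinear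 map sending $x\in\mathfrak g_{\bar 0}$ to the class in $\mathrm H^1(\mathfrak g,M)$ of $x_1\mapsto g(x^p-x^{[p]},x_1)-g(x_1,x^p-x^{[p]})$. *)

theory Defs
  imports
    "HOL-Algebra.Algebraic_Closure_Type"
    "HOL-Library.Poly_Mapping"
    "HOL-Library.Product_Plus"
    "HOL-Library.Z2"
begin

section \<open>Restricted Lie superalgebras and restricted modules\<close>

text \<open>
  A graded space is a whole type \<open>'v\<close> with scalar multiplication \<open>smul\<close> and
  homogeneous components \<open>part V 0\<close>, \<open>part V 1\<close> indexed by the field \<open>bit\<close>.
  The values of \<open>pmap\<close> outside \<open>part V 0\<close> never matter. The characteristic is
  always written \<open>CHAR('k)\<close>.
\<close>

record ('k, 'v) rlsa =
  smul :: "'k \<Rightarrow> 'v \<Rightarrow> 'v"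
  part :: "bit \<Rightarrow> 'v set"
  br :: "'v \<Rightarrow> 'v \<Rightarrow> 'v"
  pmap :: "'v \<Rightarrow> 'v"

definition super_space :: "('k::field, 'v::ab_group_add) rlsa \<Rightarrow> bool" where
  "super_space V \<longleftrightarrow>
     vector_space (smul V) \<and>
     (\<forall>i. module.subspace (smul V) (part V i)) \<and>
     part V 0 \<inter> part V 1 = {0} \<and>
     (\<forall>v. \<exists>a\<in>part V 0. \<exists>b\<in>part V 1. v = a + b)"

definition even_linear ::
  "('k::field, 'v::ab_group_add) rlsa \<Rightarrow> ('k, 'w::ab_group_add) rlsa \<Rightarrow> ('v \<Rightarrow> 'w) \<Rightarrow> bool" where
  "even_linear V W f \<longleftrightarrow>
     Vector_Spaces.linear (smul V) (smul W) f \<and> (\<forall>i. \<forall>v\<in>part V i. f v \<in> part W i)"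

definition even_bilinear ::
  "('k::field, 'u::ab_group_add) rlsa \<Rightarrow> ('k, 'v::ab_group_add) rlsa \<Rightarrow>
   ('k, 'w::ab_group_add) rlsa \<Rightarrow> ('u \<Rightarrow> 'v \<Rightarrow> 'w) \<Rightarrow> bool" where
  "even_bilinear U V W b \<longleftrightarrow>
     (\<forall>u. Vector_Spaces.linear (smul V) (smul W) (b u)) \<and>
     (\<forall>v. Vector_Spaces.linear (smul U) (smul W) (\<lambda>u. b u v)) \<and>
     (\<forall>i j. \<forall>u\<in>part U i. \<forall>v\<in>part V j. b u v \<in> part W (i + j))"

text \<open>Multiplication by the sign \<open>(-1)\<^sup>i\<^sup>j\<close>.\<close>

definition ksign :: "bit \<Rightarrow> bit \<Rightarrow> 'v::ab_group_add \<Rightarrow> 'v" where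
  "ksign i j v = (if i = 1 \<and> j = 1 then - v else v)"

definition lie_superalgebra :: "('k::field, 'v::ab_group_add) rlsa \<Rightarrow> bool" where
  "lie_superalgebra L \<longleftrightarrow>
     super_space L \<and> even_bilinear L L L (br L) \<and>
     (\<forall>i j. \<forall>x\<in>part L i. \<forall>y\<in>part L j. br L x y = - ksign i j (br L y x)) \<and>
     (\<forall>i j. \<forall>x\<in>part L i. \<forall>y\<in>part L j. \<forall>z.
        br L x (br L y z) = br L (br L x y) z + ksign i j (br L y (br L x z))) \<and>
     (CHAR('k) = 3 \<longrightarrow> (\<forall>y\<in>part L 1. br L y (br L y y) = 0))"

text \<open>
  An element of \<open>L[\<lambda>]\<close> is a polynomial with coefficients in \<open>L\<close>;
  \<open>ad_pencil L x y\<close> is \<open>ad (\<lambda>x + y)\<close> on \<open>L[\<lambda>]\<close>.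
\<close>

definition ad_pencil ::
  "('k, 'v::ab_group_add) rlsa \<Rightarrow> 'v \<Rightarrow> 'v \<Rightarrow> 'v poly \<Rightarrow> 'v poly" where
  "ad_pencil L x y P = pCons 0 (map_poly (br L x) P) + map_poly (br L y) P"

definition jacobson_s ::
  "('k::field, 'v::ab_group_add) rlsa \<Rightarrow> nat \<Rightarrow> 'v \<Rightarrow> 'v \<Rightarrow> 'v" where
  "jacobson_s L i x y =
     smul L (inverse (of_nat i)) (coeff ((ad_pencil L x y ^^ (CHAR('k) - 1)) [:x:]) (i - 1))"

definition restricted_lie_superalgebra :: "('k::field, 'v::ab_group_add) rlsa \<Rightarrow> bool" where
  "restricted_lie_superalgebra L \<longleftrightarrow>
     lie_superalgebra L \<and>
     (\<forall>x\<in>part L 0. pmap L x \<in> part L 0) \<and>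
     (\<forall>c. \<forall>x\<in>part L 0. pmap L (smul L c x) = smul L (c ^ CHAR('k)) (pmap L x)) \<and>
     (\<forall>x\<in>part L 0. \<forall>y. br L (pmap L x) y = (br L x ^^ CHAR('k)) y) \<and>
     (\<forall>x\<in>part L 0. \<forall>y\<in>part L 0.
        pmap L (x + y) = pmap L x + pmap L y + (\<Sum>i = 1..CHAR('k) - 1. jacobson_s L i x y))"

definition strongly_abelian :: "('k, 'v::zero) rlsa \<Rightarrow> bool" where
  "strongly_abelian L \<longleftrightarrow> (\<forall>x y. br L x y = 0) \<and> (\<forall>x\<in>part L 0. pmap L x = 0)"

definition rlsa_hom ::
  "('k::field, 'v::ab_group_add) rlsa \<Rightarrow> ('k, 'w::ab_group_add) rlsa \<Rightarrow> ('v \<Rightarrow> 'w) \<Rightarrow> bool" where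
  "rlsa_hom L L' f \<longleftrightarrow>
     even_linear L L' f \<and> (\<forall>x y. f (br L x y) = br L' (f x) (f y)) \<and>
     (\<forall>x\<in>part L 0. f (pmap L x) = pmap L' (f x))"

text \<open>Only the graded space underlying \<open>M\<close> enters here.\<close>

definition restricted_module ::
  "('k::field, 'g::ab_group_add) rlsa \<Rightarrow> ('k, 'm::ab_group_add) rlsa \<Rightarrow>
   ('g \<Rightarrow> 'm \<Rightarrow> 'm) \<Rightarrow> bool" where
  "restricted_module g M act \<longleftrightarrow>
     super_space M \<and> even_bilinear g M M act \<and>
     (\<forall>i j. \<forall>x\<in>part g i. \<forall>y\<in>part g j. \<forall>m.
        act (br g x y) m = act x (act y m) - ksign i j (act y (act x m))) \<and>
     (\<forall>x\<in>part g 0. \<forall>m. (act x ^^ CHAR('k)) m = act (pmap g x) m)"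

definition even_invariants :: "('k, 'm::zero) rlsa \<Rightarrow> ('g \<Rightarrow> 'm \<Rightarrow> 'm) \<Rightarrow> 'm set" where
  "even_invariants M act = {m \<in> part M 0. \<forall>x. act x m = 0}"


section \<open>Vector spaces as module records\<close>

text \<open>
  Spaces that are not whole types are \<open>module\<close> records of HOL-Algebra over the field
  \<open>ring_of_type_algebra\<close>. Where only the linear structure matters, the fields \<open>mult\<close>
  and \<open>one\<close> are left unspecified.
\<close>

definition vec_module :: "('k \<Rightarrow> 'v \<Rightarrow> 'v) \<Rightarrow> 'v set \<Rightarrow> ('k, 'v::ab_group_add) module" where
  "vec_module sc W =
     \<lparr>carrier = W, monoid.mult = undefined, one = undefined,
      ring.zero = 0, add = (+), module.smult = sc\<rparr>"

text \<open>The functions in \<open>F\<close>, on the domain \<open>D\<close> and with values in \<open>W\<close>, under pointwise operations.\<close>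

definition fun_module ::
  "'d set \<Rightarrow> ('k, 'w, 'z) module_scheme \<Rightarrow> ('d \<Rightarrow> 'w) set \<Rightarrow> ('k, 'd \<Rightarrow> 'w) module" where
  "fun_module D W F =
     \<lparr>carrier = F, monoid.mult = undefined, one = undefined,
      ring.zero = (\<lambda>d\<in>D. \<zero>\<^bsub>W\<^esub>),
      add = (\<lambda>f h. \<lambda>d\<in>D. f d \<oplus>\<^bsub>W\<^esub> h d),
      module.smult = (\<lambda>c f. \<lambda>d\<in>D. c \<odot>\<^bsub>W\<^esub> f d)\<rparr>"

text \<open>Quotient of a module (or of an algebra, if \<open>B\<close> is an ideal).\<close>

definition quot_module :: "('k, 'v, 'z) module_scheme \<Rightarrow> 'v set \<Rightarrow> ('k, 'v set) module" where
  "quot_module V B =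
     ring.extend (V Quot B) (module.fields (\<lambda>c C. \<Union>x\<in>C. B +>\<^bsub>V\<^esub> (c \<odot>\<^bsub>V\<^esub> x)))"

definition linear_maps ::
  "('k, 'v, 'y) module_scheme \<Rightarrow> ('k, 'w, 'z) module_scheme \<Rightarrow> ('v \<Rightarrow> 'w) set" where
  "linear_maps V W =
     {f \<in> carrier V \<rightarrow> carrier W.
        (\<forall>x\<in>carrier V. \<forall>y\<in>carrier V. f (x \<oplus>\<^bsub>V\<^esub> y) = f x \<oplus>\<^bsub>W\<^esub> f y) \<and>
        (\<forall>c. \<forall>x\<in>carrier V. f (c \<odot>\<^bsub>V\<^esub> x) = c \<odot>\<^bsub>W\<^esub> f x)}"

definition semilinear_maps ::
  "('k::field, 'v, 'y) module_scheme \<Rightarrow> ('k, 'w, 'z) module_scheme \<Rightarrow> ('k, 'v \<Rightarrow> 'w) module" where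
  "semilinear_maps V W =
     fun_module (carrier V) W
       {f \<in> carrier V \<rightarrow>\<^sub>E carrier W.
          \<forall>c. \<forall>v1\<in>carrier V. \<forall>v2\<in>carrier V.
            f ((c \<odot>\<^bsub>V\<^esub> v1) \<oplus>\<^bsub>V\<^esub> v2) = (c ^ CHAR('k) \<odot>\<^bsub>W\<^esub> f v1) \<oplus>\<^bsub>W\<^esub> f v2}"


section \<open>Enveloping algebras\<close>

datatype 'a free_mon = Free_Mon (letters: "'a list")

instantiation free_mon :: (type) monoid_add
begin

definition zero_free_mon :: "'a free_mon" where
  "0 = Free_Mon []"

definition plus_free_mon :: "'a free_mon \<Rightarrow> 'a free_mon \<Rightarrow> 'a free_mon" where
  "v + w = Free_Mon (letters v @ letters w)"

instance
  by standard (simp_all add: zero_free_mon_def plus_free_mon_def)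

end

text \<open>
  The free associative unital algebra on the set of all elements of \<open>g\<close>; the linearity
  relations that turn it into the tensor algebra are among \<open>env_relations\<close>.
\<close>

type_synonym ('k, 'g) free_alg = "'g free_mon \<Rightarrow>\<^sub>0 'k"

definition free_gen :: "'g \<Rightarrow> ('k::field, 'g) free_alg" where
  "free_gen x = Poly_Mapping.single (Free_Mon [x]) 1"

definition free_scal :: "'k \<Rightarrow> ('k::field, 'g) free_alg \<Rightarrow> ('k, 'g) free_alg" where
  "free_scal c a = Poly_Mapping.single 0 c * a"

definition free_algebra :: "('k::field, ('k, 'g) free_alg) module" where
  "free_algebra = ring.extend ring_of_type_algebra (module.fields free_scal)"

definition env_relations ::
  "('k::field, 'g::ab_group_add) rlsa \<Rightarrow> ('k, 'g) free_alg set" where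
  "env_relations g =
     {free_gen (x + y) - free_gen x - free_gen y | x y. True} \<union>
     {free_gen (smul g c x) - free_scal c (free_gen x) | c x. True} \<union>
     {free_gen x * free_gen y - ksign i j (free_gen y * free_gen x) - free_gen (br g x y)
        | x y i j. x \<in> part g i \<and> y \<in> part g j}"

text \<open>An algebra with the canonical map \<open>emb\<close> from \<open>g\<close>.\<close>

record ('k, 'g, 'a) env_alg = "('k, 'a) module" +
  emb :: "'g \<Rightarrow> 'a"

definition U_ideal :: "('k::field, 'g::ab_group_add) rlsa \<Rightarrow> ('k, 'g) free_alg set" where
  "U_ideal g = Idl\<^bsub>free_algebra\<^esub> (env_relations g)"

type_synonym ('k, 'g) U_elt = "('k, 'g) free_alg set"

definition U_alg ::
  "('k::field, 'g::ab_group_add) rlsa \<Rightarrow> ('k, 'g, ('k, 'g) U_elt) env_alg" where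
  "U_alg g =
     module.extend (quot_module free_algebra (U_ideal g))
       (env_alg.fields (\<lambda>x. U_ideal g +>\<^bsub>free_algebra\<^esub> free_gen x))"

text \<open>The element \<open>x\<^sup>p - x\<^sup>[\<^sup>p\<^sup>]\<close> of \<open>U(g)\<close>.\<close>

definition p_defect :: "('k::field, 'g::ab_group_add) rlsa \<Rightarrow> 'g \<Rightarrow> ('k, 'g) U_elt" where
  "p_defect g x =
     (emb (U_alg g) x [^]\<^bsub>U_alg g\<^esub> CHAR('k)) \<ominus>\<^bsub>U_alg g\<^esub> emb (U_alg g) (pmap g x)"

definition u_ideal :: "('k::field, 'g::ab_group_add) rlsa \<Rightarrow> ('k, 'g) U_elt set" where
  "u_ideal g = Idl\<^bsub>U_alg g\<^esub> (p_defect g ` part g 0)"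

type_synonym ('k, 'g) u_elt = "('k, 'g) U_elt set"

definition U_to_u ::
  "('k::field, 'g::ab_group_add) rlsa \<Rightarrow> ('k, 'g) U_elt \<Rightarrow> ('k, 'g) u_elt" where
  "U_to_u g s = u_ideal g +>\<^bsub>U_alg g\<^esub> s"

definition u_alg ::
  "('k::field, 'g::ab_group_add) rlsa \<Rightarrow> ('k, 'g, ('k, 'g) u_elt) env_alg" where
  "u_alg g =
     module.extend (quot_module (U_alg g) (u_ideal g))
       (env_alg.fields (\<lambda>x. U_to_u g (emb (U_alg g) x)))"

definition aug_ideal :: "('k, 'g, 'a) env_alg \<Rightarrow> 'a set" where
  "aug_ideal A = Idl\<^bsub>A\<^esub> (range (emb A))"

text \<open>
  The \<open>i\<close>-th homogeneous component of \<open>A\<close>: the span of the products of homogeneous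
  elements of \<open>g\<close> whose degrees add up to \<open>i\<close>.
\<close>

inductive_set alg_part ::
  "('k, 'g) rlsa \<Rightarrow> ('k, 'g, 'a) env_alg \<Rightarrow> bit \<Rightarrow> 'a set"
  for g :: "('k, 'g) rlsa" and A :: "('k, 'g, 'a) env_alg" and i :: bit where
  zero: "\<zero>\<^bsub>A\<^esub> \<in> alg_part g A i"
| add: "\<lbrakk>list_all2 (\<lambda>x d. x \<in> part g d) xs ds; sum_list ds = i; s \<in> alg_part g A i\<rbrakk> \<Longrightarrow>
     (c \<odot>\<^bsub>A\<^esub> foldr (\<lambda>x t. emb A x \<otimes>\<^bsub>A\<^esub> t) xs \<one>\<^bsub>A\<^esub>) \<oplus>\<^bsub>A\<^esub> s \<in> alg_part g A i"

text \<open>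
  The actions of the free algebra, of \<open>U(g)\<close> and of \<open>u(g)\<close> on \<open>M\<close>; the latter two are
  computed on representatives, and \<open>the_elem\<close> is meaningful because the result does not
  depend on them.
\<close>

definition free_act ::
  "('k::field, 'm::ab_group_add) rlsa \<Rightarrow> ('g \<Rightarrow> 'm \<Rightarrow> 'm) \<Rightarrow> ('k, 'g) free_alg \<Rightarrow> 'm \<Rightarrow> 'm" where
  "free_act M act a m =
     (\<Sum>w\<in>Poly_Mapping.keys a. smul M (Poly_Mapping.lookup a w) (foldr act (letters w) m))"

definition U_act ::
  "('k::field, 'm::ab_group_add) rlsa \<Rightarrow> ('g \<Rightarrow> 'm \<Rightarrow> 'm) \<Rightarrow> ('k, 'g) U_elt \<Rightarrow> 'm \<Rightarrow> 'm" where
  "U_act M act s m = the_elem ((\<lambda>a. free_act M act a m) ` s)"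

definition u_act ::
  "('k::field, 'm::ab_group_add) rlsa \<Rightarrow> ('g \<Rightarrow> 'm \<Rightarrow> 'm) \<Rightarrow> ('k, 'g) u_elt \<Rightarrow> 'm \<Rightarrow> 'm" where
  "u_act M act t m = the_elem ((\<lambda>s. U_act M act s m) ` t)"


section \<open>Cohomology\<close>

text \<open>An \<open>n\<close>-cochain is a function on the lists of length \<open>n\<close> over the augmentation ideal.\<close>

definition cochain_args :: "('k, 'g, 'a) env_alg \<Rightarrow> nat \<Rightarrow> 'a list set" where
  "cochain_args A n = {xs. length xs = n \<and> set xs \<subseteq> aug_ideal A}"

definition cochains ::
  "('k, 'g) rlsa \<Rightarrow> ('k::field, 'm::ab_group_add) rlsa \<Rightarrow> ('k, 'g, 'a) env_alg \<Rightarrow> nat \<Rightarrow>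
   ('a list \<Rightarrow> 'm) set" where
  "cochains g M A n =
     {f \<in> extensional (cochain_args A n).
        (\<forall>xs\<in>cochain_args A n. \<forall>i<n. \<forall>s\<in>aug_ideal A. \<forall>c.
           f (xs[i := (c \<odot>\<^bsub>A\<^esub> s) \<oplus>\<^bsub>A\<^esub> xs ! i]) = smul M c (f (xs[i := s])) + f xs) \<and>
        (\<forall>xs\<in>cochain_args A n. \<forall>ds.
           list_all2 (\<lambda>s d. s \<in> alg_part g A d) xs ds \<longrightarrow> f xs \<in> part M (sum_list ds))}"

text \<open>The differential from \<open>n\<close>-cochains to \<open>(n + 1)\<close>-cochains.\<close>

definition coboundary ::
  "('k::field, 'm::ab_group_add) rlsa \<Rightarrow> ('k, 'g, 'a) env_alg \<Rightarrow> ('a \<Rightarrow> 'm \<Rightarrow> 'm) \<Rightarrow> nat \<Rightarrow>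
   ('a list \<Rightarrow> 'm) \<Rightarrow> 'a list \<Rightarrow> 'm" where
  "coboundary M A aact n f =
     (\<lambda>xs\<in>cochain_args A (Suc n).
        aact (hd xs) (f (tl xs)) +
        (\<Sum>i = 1..n. smul M ((-1) ^ i)
           (f (take (i - 1) xs @ [xs ! (i - 1) \<otimes>\<^bsub>A\<^esub> xs ! i] @ drop (i + 1) xs))))"

definition cocycles ::
  "('k, 'g) rlsa \<Rightarrow> ('k::field, 'm::ab_group_add) rlsa \<Rightarrow> ('k, 'g, 'a) env_alg \<Rightarrow>
   ('a \<Rightarrow> 'm \<Rightarrow> 'm) \<Rightarrow> nat \<Rightarrow> ('k, 'a list \<Rightarrow> 'm) module" where
  "cocycles g M A aact n =
     fun_module (cochain_args A n) (vec_module (smul M) UNIV)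
       {f \<in> cochains g M A n. \<forall>xs\<in>cochain_args A (Suc n). coboundary M A aact n f xs = 0}"

definition coboundaries ::
  "('k, 'g) rlsa \<Rightarrow> ('k::field, 'm::ab_group_add) rlsa \<Rightarrow> ('k, 'g, 'a) env_alg \<Rightarrow>
   ('a \<Rightarrow> 'm \<Rightarrow> 'm) \<Rightarrow> nat \<Rightarrow> ('a list \<Rightarrow> 'm) set" where
  "coboundaries g M A aact n =
     (case n of 0 \<Rightarrow> {\<zero>\<^bsub>cocycles g M A aact n\<^esub>}
      | Suc k \<Rightarrow> coboundary M A aact k ` cochains g M A k)"

definition cohomology ::
  "('k, 'g) rlsa \<Rightarrow> ('k::field, 'm::ab_group_add) rlsa \<Rightarrow> ('k, 'g, 'a) env_alg \<Rightarrow>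
   ('a \<Rightarrow> 'm \<Rightarrow> 'm) \<Rightarrow> nat \<Rightarrow> ('k, ('a list \<Rightarrow> 'm) set) module" where
  "cohomology g M A aact n =
     quot_module (cocycles g M A aact n) (coboundaries g M A aact n)"

definition H ::
  "('k, 'g::ab_group_add) rlsa \<Rightarrow> ('k::field, 'm::ab_group_add) rlsa \<Rightarrow> ('g \<Rightarrow> 'm \<Rightarrow> 'm) \<Rightarrow>
   nat \<Rightarrow> ('k, (('k, 'g) U_elt list \<Rightarrow> 'm) set) module" where
  "H g M act n = cohomology g M (U_alg g) (U_act M act) n"

definition H_res ::
  "('k, 'g::ab_group_add) rlsa \<Rightarrow> ('k::field, 'm::ab_group_add) rlsa \<Rightarrow> ('g \<Rightarrow> 'm \<Rightarrow> 'm) \<Rightarrow>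
   nat \<Rightarrow> ('k, (('k, 'g) u_elt list \<Rightarrow> 'm) set) module" where
  "H_res g M act n = cohomology g M (u_alg g) (u_act M act) n"

text \<open>
  \<open>Z\<^sup>1(g,M)\<close>, \<open>B\<^sup>1(g,M)\<close> and their quotient. A map sending \<open>cls f\<close> to \<open>cls (T f)\<close> is,
  here and below, written as the union of the cosets of \<open>T f\<close> over all representatives \<open>f\<close>;
  this is a coset precisely if the map is well defined.
\<close>

definition lie_cocycles ::
  "('k, 'g::ab_group_add) rlsa \<Rightarrow> ('k::field, 'm::ab_group_add) rlsa \<Rightarrow> ('g \<Rightarrow> 'm \<Rightarrow> 'm) \<Rightarrow>
   ('k, 'g \<Rightarrow> 'm) module" where
  "lie_cocycles g M act =
     fun_module UNIV (vec_module (smul M) UNIV)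
       {h. even_linear g M h \<and>
           (\<forall>i j. \<forall>x\<in>part g i. \<forall>y\<in>part g j.
              h (br g x y) = act x (h y) - ksign i j (act y (h x)))}"

definition lie_coboundaries :: "('k, 'm) rlsa \<Rightarrow> ('g \<Rightarrow> 'm \<Rightarrow> 'm) \<Rightarrow> ('g \<Rightarrow> 'm) set" where
  "lie_coboundaries M act = (\<lambda>m x. act x m) ` part M 0"

definition lie_H1 ::
  "('k, 'g::ab_group_add) rlsa \<Rightarrow> ('k::field, 'm::ab_group_add) rlsa \<Rightarrow> ('g \<Rightarrow> 'm \<Rightarrow> 'm) \<Rightarrow>
   ('k, ('g \<Rightarrow> 'm) set) module" where
  "lie_H1 g M act = quot_module (lie_cocycles g M act) (lie_coboundaries M act)"

definition lie_class ::
  "('k, 'g::ab_group_add) rlsa \<Rightarrow> ('k::field, 'm::ab_group_add) rlsa \<Rightarrow> ('g \<Rightarrow> 'm \<Rightarrow> 'm) \<Rightarrow>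
   ('g \<Rightarrow> 'm) \<Rightarrow> ('g \<Rightarrow> 'm) set" where
  "lie_class g M act h = lie_coboundaries M act +>\<^bsub>lie_cocycles g M act\<^esub> h"

text \<open>Restriction to \<open>g\<close>, by which \<open>H g M act 1\<close> is identified with \<open>lie_H1 g M act\<close>.\<close>

definition restrict_H1 ::
  "('k, 'g::ab_group_add) rlsa \<Rightarrow> ('k::field, 'm::ab_group_add) rlsa \<Rightarrow> ('g \<Rightarrow> 'm \<Rightarrow> 'm) \<Rightarrow>
   (('k, 'g) U_elt list \<Rightarrow> 'm) set \<Rightarrow> ('g \<Rightarrow> 'm) set" where
  "restrict_H1 g M act C = (\<Union>f\<in>C. lie_class g M act (\<lambda>x. f [emb (U_alg g) x]))"


section \<open>Restricted extensions\<close>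

text \<open>
  The inclusion of \<open>M\<close> in the total algebra is recorded as an injective map \<open>inc\<close>.
\<close>

record ('k, 'g, 'm, 'e) extension =
  total :: "('k, 'e) rlsa"
  inc :: "'m \<Rightarrow> 'e"
  prj :: "'e \<Rightarrow> 'g"

definition restricted_extension ::
  "('k::field, 'g::ab_group_add) rlsa \<Rightarrow> ('k, 'm::ab_group_add) rlsa \<Rightarrow> ('g \<Rightarrow> 'm \<Rightarrow> 'm) \<Rightarrow>
   ('k, 'g, 'm, 'e::ab_group_add) extension \<Rightarrow> bool" where
  "restricted_extension g M act E \<longleftrightarrow>
     restricted_lie_superalgebra (total E) \<and>
     rlsa_hom M (total E) (inc E) \<and> inj (inc E) \<and>
     rlsa_hom (total E) g (prj E) \<and> surj (prj E) \<and>
     range (inc E) = {e. prj E e = 0} \<and>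
     (\<forall>e m. br (total E) e (inc E m) = inc E (act (prj E e) m))"

definition extension_equiv ::
  "('k::field, 'g, 'm, 'e::ab_group_add) extension \<Rightarrow> ('k, 'g, 'm, 'f::ab_group_add) extension \<Rightarrow>
   bool" where
  "extension_equiv E E' \<longleftrightarrow>
     (\<exists>\<alpha>. bij \<alpha> \<and> rlsa_hom (total E) (total E') \<alpha> \<and>
        (\<forall>m. \<alpha> (inc E m) = inc E' m) \<and> (\<forall>e. prj E' (\<alpha> e) = prj E e))"

text \<open>
  To obtain a set of classes, the additive group underlying an extension is fixed to be
  \<open>'g \<times> 'm\<close>. All other data (scalars, grading, bracket, \<open>p\<close>-map, inclusion, projection)
  are arbitrary. Every extension is, as a graded vector space, \<open>g \<oplus> M\<close>, hence equivalent to
  one of these.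
\<close>

definition ext_rel ::
  "('k::field, 'g::ab_group_add) rlsa \<Rightarrow> ('k, 'm::ab_group_add) rlsa \<Rightarrow> ('g \<Rightarrow> 'm \<Rightarrow> 'm) \<Rightarrow>
   ('k, 'g, 'm, 'g \<times> 'm) extension rel" where
  "ext_rel g M act =
     {(E, E'). restricted_extension g M act E \<and> restricted_extension g M act E' \<and>
        extension_equiv E E'}"

definition Ext_res ::
  "('k::field, 'g::ab_group_add) rlsa \<Rightarrow> ('k, 'm::ab_group_add) rlsa \<Rightarrow> ('g \<Rightarrow> 'm \<Rightarrow> 'm) \<Rightarrow>
   ('k, 'g, 'm, 'g \<times> 'm) extension set set" where
  "Ext_res g M act = Collect (restricted_extension g M act) // ext_rel g M act"

text \<open>
  \<open>swap_sign U V b u v\<close> is the bilinear extension of \<open>(u, v) \<mapsto> (-1)\<^sup>|\<^sup>u\<^sup>|\<^sup>|\<^sup>v\<^sup>| b u v\<close> from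
  homogeneous to arbitrary elements.
\<close>

definition comp_part :: "('k, 'v::ab_group_add) rlsa \<Rightarrow> bit \<Rightarrow> 'v \<Rightarrow> 'v" where
  "comp_part V i v = (THE a. a \<in> part V i \<and> v - a \<in> part V (i + 1))"

definition swap_sign ::
  "('k, 'u::ab_group_add) rlsa \<Rightarrow> ('k, 'v::ab_group_add) rlsa \<Rightarrow> ('u \<Rightarrow> 'v \<Rightarrow> 'w::ab_group_add) \<Rightarrow>
   'u \<Rightarrow> 'v \<Rightarrow> 'w" where
  "swap_sign U V b u v =
     (\<Sum>i\<in>{0, 1}. \<Sum>j\<in>{0, 1}. ksign i j (b (comp_part U i u) (comp_part V j v)))"

text \<open>
  The structure on \<open>g \<oplus> M\<close> obtained from the semidirect product by adding \<open>b\<close> to the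
  bracket and \<open>q\<close> to the \<open>p\<close>-map \<open>(x, m) \<mapsto> (x\<^sup>[\<^sup>p\<^sup>], x\<^sup>p\<^sup>-\<^sup>1\<cdot>m)\<close>.
\<close>

definition twisted_extension ::
  "('k::field, 'g::ab_group_add) rlsa \<Rightarrow> ('k, 'm::ab_group_add) rlsa \<Rightarrow> ('g \<Rightarrow> 'm \<Rightarrow> 'm) \<Rightarrow>
   ('g \<Rightarrow> 'g \<Rightarrow> 'm) \<Rightarrow> ('g \<Rightarrow> 'm) \<Rightarrow> ('k, 'g, 'm, 'g \<times> 'm) extension" where
  "twisted_extension g M act b q =
     \<lparr>total =
        \<lparr>smul = (\<lambda>c (x, m). (smul g c x, smul M c m)),
         part = (\<lambda>i. part g i \<times> part M i),
         br = (\<lambda>(x1, m1) (x2, m2).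
            (br g x1 x2, act x1 m2 - swap_sign g M act x2 m1 + b x1 x2)),
         pmap = (\<lambda>(x, m). (pmap g x, (act x ^^ (CHAR('k) - 1)) m + q x))\<rparr>,
      inc = (\<lambda>m. (0, m)), prj = fst\<rparr>"


section \<open>The spaces and maps of the sequence\<close>

definition g_even :: "('k, 'g::ab_group_add) rlsa \<Rightarrow> ('k, 'g) module" where
  "g_even g = vec_module (smul g) (part g 0)"

definition S_inv ::
  "('k::field, 'g::ab_group_add) rlsa \<Rightarrow> ('k, 'm::ab_group_add) rlsa \<Rightarrow> ('g \<Rightarrow> 'm \<Rightarrow> 'm) \<Rightarrow>
   ('k, 'g \<Rightarrow> 'm) module" where
  "S_inv g M act = semilinear_maps (g_even g) (vec_module (smul M) (even_invariants M act))"

definition S_H1 ::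
  "('k::field, 'g::ab_group_add) rlsa \<Rightarrow> ('k, 'm::ab_group_add) rlsa \<Rightarrow> ('g \<Rightarrow> 'm \<Rightarrow> 'm) \<Rightarrow>
   ('k, 'g \<Rightarrow> (('k, 'g) U_elt list \<Rightarrow> 'm) set) module" where
  "S_H1 g M act = semilinear_maps (g_even g) (H g M act 1)"

text \<open>Pull-back of cochains along \<open>U(g)\<^sup>+ \<rightarrow> u(g)\<^sup>+\<close>: \<open>i\<^sub>1\<close> for \<open>n = 1\<close>, \<open>\<rho>\<close> for \<open>n = 2\<close>.\<close>

definition pull_back ::
  "('k::field, 'g::ab_group_add) rlsa \<Rightarrow> ('k, 'm::ab_group_add) rlsa \<Rightarrow> ('g \<Rightarrow> 'm \<Rightarrow> 'm) \<Rightarrow>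
   nat \<Rightarrow> (('k, 'g) u_elt list \<Rightarrow> 'm) set \<Rightarrow> (('k, 'g) U_elt list \<Rightarrow> 'm) set" where
  "pull_back g M act n C =
     (\<Union>f\<in>C. coboundaries g M (U_alg g) (U_act M act) n
        +>\<^bsub>cocycles g M (U_alg g) (U_act M act) n\<^esub>
        (\<lambda>xs\<in>cochain_args (U_alg g) n. f (map (U_to_u g) xs)))"

definition Psi ::
  "('k::field, 'g::ab_group_add) rlsa \<Rightarrow> ('g \<Rightarrow> 'm::ab_group_add \<Rightarrow> 'm) \<Rightarrow> ('g \<Rightarrow> 'm) \<Rightarrow>
   'g \<Rightarrow> 'm" where
  "Psi g act h = (\<lambda>x\<in>part g 0. (act x ^^ (CHAR('k) - 1)) (h x) - h (pmap g x))"

definition Psi_bar ::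
  "('k::field, 'g::ab_group_add) rlsa \<Rightarrow> ('k, 'm::ab_group_add) rlsa \<Rightarrow> ('g \<Rightarrow> 'm \<Rightarrow> 'm) \<Rightarrow>
   (('k, 'g) U_elt list \<Rightarrow> 'm) set \<Rightarrow> 'g \<Rightarrow> 'm" where
  "Psi_bar g M act C = the_elem (Psi g act ` restrict_H1 g M act C)"

definition G_s0 ::
  "('k::field, 'g::ab_group_add) rlsa \<Rightarrow> ('k, 'm::ab_group_add) rlsa \<Rightarrow> ('g \<Rightarrow> 'm \<Rightarrow> 'm) \<Rightarrow>
   ('g \<Rightarrow> 'm) \<Rightarrow> ('k, 'g, 'm, 'g \<times> 'm) extension set" where
  "G_s0 g M act h =
     ext_rel g M act `` {twisted_extension g M act (\<lambda>x1 x2. 0) (\<lambda>x. - h x)}"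

definition E_cocycle ::
  "('k::field, 'g::ab_group_add) rlsa \<Rightarrow> ('k, 'm::ab_group_add) rlsa \<Rightarrow> ('g \<Rightarrow> 'm \<Rightarrow> 'm) \<Rightarrow>
   (('k, 'g) u_elt list \<Rightarrow> 'm) \<Rightarrow> ('k, 'g, 'm, 'g \<times> 'm) extension" where
  "E_cocycle g M act f =
     (let e = emb (u_alg g); b = (\<lambda>x1 x2. f [e x1, e x2]) in
      twisted_extension g M act
        (\<lambda>x1 x2. b x1 x2 - swap_sign g g b x2 x1)
        (\<lambda>x. f [e x [^]\<^bsub>u_alg g\<^esub> (CHAR('k) - 1), e x]))"

definition F_res_inv ::
  "('k::field, 'g::ab_group_add) rlsa \<Rightarrow> ('k, 'm::ab_group_add) rlsa \<Rightarrow> ('g \<Rightarrow> 'm \<Rightarrow> 'm) \<Rightarrow>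
   (('k, 'g) u_elt list \<Rightarrow> 'm) set \<Rightarrow> ('k, 'g, 'm, 'g \<times> 'm) extension set" where
  "F_res_inv g M act C = (\<Union>f\<in>C. ext_rel g M act `` {E_cocycle g M act f})"

definition F_res ::
  "('k::field, 'g::ab_group_add) rlsa \<Rightarrow> ('k, 'm::ab_group_add) rlsa \<Rightarrow> ('g \<Rightarrow> 'm \<Rightarrow> 'm) \<Rightarrow>
   ('k, 'g, 'm, 'g \<times> 'm) extension set \<Rightarrow> (('k, 'g) u_elt list \<Rightarrow> 'm) set" where
  "F_res g M act = inv_into (carrier (H_res g M act 2)) (F_res_inv g M act)"

text \<open>
  The Lie cocycle attached to \<open>x\<close> represents a class in \<open>lie_H1\<close>, which is transported to
  \<open>H g M act 1\<close> by the inverse of \<^const>\<open>restrict_H1\<close>.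
\<close>

definition Phi ::
  "('k::field, 'g::ab_group_add) rlsa \<Rightarrow> ('k, 'm::ab_group_add) rlsa \<Rightarrow> ('g \<Rightarrow> 'm \<Rightarrow> 'm) \<Rightarrow>
   (('k, 'g) U_elt list \<Rightarrow> 'm) set \<Rightarrow> 'g \<Rightarrow> (('k, 'g) U_elt list \<Rightarrow> 'm) set" where
  "Phi g M act C =
     (\<lambda>x\<in>part g 0.
        inv_into (carrier (H g M act 1)) (restrict_H1 g M act)
          (\<Union>f\<in>C. lie_class g M act
             (\<lambda>y. f [p_defect g x, emb (U_alg g) y] - f [emb (U_alg g) y, p_defect g x])))"

end

theory Submission
  imports Defs "HOL-Library.Function_Algebras" "HOL-Library.Multiset"
begin

text \<open>Write z_x for x^p - x^[p] with x even (\<open>zd\<close>). In U(g) the element z_x is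
  central (\<open>zd_central\<close>) and p-semilinear in x (\<open>zd_add\<close>,
  \<open>zd_scale\<close>); it acts as zero on M, and u(g) is the quotient of U(g) by these
  elements. The sequence therefore compares cochains on the two algebras, and what separates a
  cochain on U(g) from one on u(g) is its behaviour at the z_x.

  Both algebras are quotients of one free algebra, by ideals \<open>JU\<close> and
  \<open>Ju\<close>. A cochain is encoded as a linear or bilinear map on the free algebra that
  vanishes at 1 and on the ideal, so that i_1 and \<rho> become inclusions. A 1-cocycle c on U(g)
  has c(x^p) = x^(p-1).c(x), hence \<Psi> evaluates c at z_x (\<open>Psi_cocycle\<close>). A cochain
  on U(g) whose coboundary lives on u(g) descends to u(g) as soon as it vanishes at all z_x
  (\<open>cochain1_descends\<close>). This gives exactness at the first two terms.

  The composite of F and G is a connecting map as in the snake lemma: h goes to the class of d c,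
  where c is a cochain on U(g) with c(z_x) = h(x) and d c is a cocycle on u(g)
  (\<open>bounds\<close>, \<open>FG_eq\<close>). The bridge to extensions is
  \<open>tw_equiv_bounds\<close>: an equivalence of twisted extensions is the same thing as a
  cochain on U(g) with given coboundary and given values at the z_x. That the extension of a cocycle
  f is restricted follows by embedding it into the associative algebra on u(g) + M with product
  twisted by f, where the p-map is the p-th power and Jacobson's formula holds
  (\<open>restricted_EV\<close>). Exactness at the third and fourth terms is then formal, once
  values at z_x are known to be invariant (\<open>coboundary_zd_invariant\<close>).

  Finally \<Phi> sends f to the 1-cocycles f(z_x, .) - f(., z_x). If each of them is inner, given by
  some m(x), then m can be chosen p-semilinear (\<open>semilinear_choice\<close>), and f has to be
  changed by a coboundary so that it vanishes at the z_x. The cochain c needed for this has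
  prescribed values c(z_x s) = f(z_x, s) + eps(s) m(x) (\<open>descent_cochain\<close>,
  \<open>descent\<close>); with f = 0 the same construction defines the connecting map on all
  semilinear h. Such a c exists because of the Poincare-Birkhoff-Witt theorem, proved here by the
  diamond lemma (\<open>pbw_dual_functional\<close>): the monomials z^A x^b with all exponents in b
  below p form a basis of U(g) (\<open>nmon_independent\<close>, \<open>filt_normal_span\<close>),
  so values on monomials with a central factor can be prescribed.\<close>

abbreviation (input) klinear :: "('k::field \<Rightarrow> 'v::ab_group_add \<Rightarrow> 'v) \<Rightarrow> ('k \<Rightarrow> 'w::ab_group_add \<Rightarrow> 'w) \<Rightarrow> ('v \<Rightarrow> 'w) \<Rightarrow> bool"
  where "klinear \<equiv> Vector_Spaces.linear"

lemma klinearD: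
  assumes "klinear s t f"
  shows klinear_add: "f (x + y) = f x + f y" and klinear_scale: "f (s c x) = t c (f x)"
    and klinear_zero: "f 0 = 0" and klinear_minus: "f (- x) = - f x" and klinear_diff: "f (x - y) = f x - f y"
    and klinear_sum: "f (sum h A) = (\<Sum>a\<in>A. f (h a))"
    and klinear_domain: "vector_space s" and klinear_range: "vector_space t"
proof -
  interpret Vector_Spaces.linear s t f by fact
  show "f (x + y) = f x + f y" "f (s c x) = t c (f x)" "f 0 = 0" "f (- x) = - f x" "f (x - y) = f x - f y"
    "f (sum h A) = (\<Sum>a\<in>A. f (h a))" "vector_space s" "vector_space t"
    by (auto simp: add scale zero neg diff sum) unfold_locales
qed

lemma klinearI:
  assumes "vector_space s" "vector_space t" "\<And>x y. f (x + y) = f x + f y" "\<And>c x. f (s c x) = t c (f x)"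
  shows "klinear s t f"
  unfolding Vector_Spaces.linear_iff using assms by auto

section \<open>The free algebra\<close>

definition word :: "'g list \<Rightarrow> ('k::field, 'g) free_alg" where
  "word xs = Poly_Mapping.single (Free_Mon xs) 1"

lemma word_Nil [simp]: "word [] = 1"
  by (simp add: word_def zero_free_mon_def[symmetric])

lemma word_append: "word (xs @ ys) = word xs * word ys"
  by (simp add: word_def Poly_Mapping.mult_single plus_free_mon_def)

lemma word_single: "word [x] = free_gen x"
  by (simp add: word_def free_gen_def)

lemma word_Cons: "word (x # xs) = free_gen x * word xs"
  using word_append[of "[x]" xs] by (simp add: word_single)

lemma single_sum_induct [case_names zero sum]:
  assumes "P 0" and "\<And>p k v. P p \<Longrightarrow> P (Poly_Mapping.single k v + p)"
  shows "P (a :: 'a \<Rightarrow>\<^sub>0 'b::monoid_add)"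
proof (induction a rule: update_induct)
  case const show ?case by (rule assms(1))
next
  case (update f a b)
  have "Poly_Mapping.update a b f = Poly_Mapping.single a b + f"
    using update(1) by (intro poly_mapping_eqI)
      (auto simp: lookup_update lookup_add Poly_Mapping.lookup_single when_def Poly_Mapping.in_keys_iff)
  with assms(2)[OF update(3)] show ?case by simp
qed

lemma single_eq_scal_word: "Poly_Mapping.single w c = free_scal c (word (letters w))"
  by (simp add: free_scal_def word_def Poly_Mapping.mult_single)

lemma scal_commute: "a * Poly_Mapping.single 0 c = Poly_Mapping.single 0 c * (a :: ('k::field, 'g) free_alg)"
  by (induction a rule: single_sum_induct) (auto simp: Poly_Mapping.mult_single mult.commute distrib_left distrib_right)

lemma free_scal_mult_left: "free_scal c a * b = free_scal c (a * b)"
  by (simp add: free_scal_def mult.assoc)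

lemma free_scal_mult_right: "a * free_scal c b = free_scal c (a * b)"
  by (simp add: free_scal_def mult.assoc[symmetric] scal_commute)

lemma vector_space_free: "vector_space (free_scal :: 'k::field \<Rightarrow> ('k, 'g) free_alg \<Rightarrow> _)"
  by standard (simp_all add: free_scal_def algebra_simps Poly_Mapping.single_add Poly_Mapping.mult_single
    mult.assoc[symmetric])

interpretation FV: vector_space "free_scal :: 'k::field \<Rightarrow> ('k, 'g) free_alg \<Rightarrow> _"
  by (rule vector_space_free)

lemma free_scal_of_nat: "free_scal (of_nat n) a = of_nat n * a"
  by (simp add: free_scal_def Poly_Mapping.single_of_nat)

lemma free_alg_induct [case_names zero add]:
  assumes "P 0" and "\<And>c xs a. P a \<Longrightarrow> P (free_scal c (word xs) + a)"
  shows "P a"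
  by (induction a rule: single_sum_induct) (simp_all add: assms single_eq_scal_word)

text \<open>The linear map with values \<open>\<phi>\<close> on the basis of words. The
  augmentation, substitutions of letters, the action on the module, the PBW functionals and
  \<open>ext\<close> are all of this form.\<close>

definition word_lift :: "('k \<Rightarrow> 'v \<Rightarrow> 'v) \<Rightarrow> ('g list \<Rightarrow> 'v) \<Rightarrow> ('k::field, 'g) free_alg \<Rightarrow> 'v::ab_group_add" where
  "word_lift s \<phi> a = (\<Sum>w\<in>Poly_Mapping.keys a. s (Poly_Mapping.lookup a w) (\<phi> (letters w)))"

lemma word_lift_superset:
  assumes "vector_space s" "finite W" "Poly_Mapping.keys a \<subseteq> W"
  shows "word_lift s \<phi> a = (\<Sum>w\<in>W. s (Poly_Mapping.lookup a w) (\<phi> (letters w)))"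
proof -
  interpret vector_space s by fact
  show ?thesis unfolding word_lift_def
    by (rule sum.mono_neutral_left[OF assms(2,3)]) (auto simp: Poly_Mapping.in_keys_iff)
qed

lemma klinear_word_lift:
  assumes "vector_space s"
  shows "klinear free_scal s (word_lift s \<phi>)"
proof (rule klinearI[OF vector_space_free assms])
  interpret vector_space s by fact
  fix a b :: "('a, 'c) free_alg" and c
  let ?W = "Poly_Mapping.keys a \<union> Poly_Mapping.keys b"
  show "word_lift s \<phi> (a + b) = word_lift s \<phi> a + word_lift s \<phi> b"
    by (simp add: word_lift_superset[OF assms, of ?W] Poly_Mapping.keys_add lookup_add scale_left_distrib sum.distrib)
  have look: "Poly_Mapping.lookup (free_scal c a) w = c * Poly_Mapping.lookup a w" for w
    unfolding free_scal_def
    by (induction a rule: single_sum_induct)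
      (auto simp: Poly_Mapping.mult_single distrib_left lookup_add Poly_Mapping.lookup_single when_def)
  have "Poly_Mapping.keys (free_scal c a) \<subseteq> Poly_Mapping.keys a"
    by (auto simp: Poly_Mapping.in_keys_iff look)
  then show "word_lift s \<phi> (free_scal c a) = s c (word_lift s \<phi> a)"
    by (subst word_lift_superset[OF assms, of "Poly_Mapping.keys a"])
      (auto simp: look scale_sum_right word_lift_def)
qed

lemma word_lift_word [simp]: "vector_space s \<Longrightarrow> word_lift s \<phi> (word xs) = \<phi> xs"
  by (simp add: word_lift_def word_def vector_space_def)

lemma klinear_free_eqI:
  assumes "klinear free_scal s f" "klinear free_scal s h" "\<And>xs. f (word xs) = h (word xs)"
  shows "f a = h a"
  by (induction a rule: free_alg_induct) (simp_all add: klinearD[OF assms(1)] klinearD[OF assms(2)] assms(3))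

lemma klinear_compose: "klinear s t f \<Longrightarrow> klinear t u h \<Longrightarrow> klinear s u (\<lambda>x. h (f x))"
  by (rule klinearI) (simp_all add: klinearD)

lemma klinear_mult_left: "klinear free_scal free_scal (\<lambda>b :: ('k::field, 'g) free_alg. a * b)"
  by (rule klinearI) (simp_all add: vector_space_free free_scal_mult_right distrib_left)

lemma klinear_mult_right: "klinear free_scal free_scal (\<lambda>a :: ('k::field, 'g) free_alg. a * b)"
  by (rule klinearI) (simp_all add: vector_space_free free_scal_mult_left distrib_right)

lemma klinear_plus: "klinear s t f \<Longrightarrow> klinear s t h \<Longrightarrow> klinear s t (\<lambda>x. f x + h x)"
  apply (rule klinearI) 
  apply (auto simp: klinear_add klinear_scale dest: klinear_domain klinear_range)
  using klinear_range vector_space.vector_space_assms(1) by metis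

lemma klinear_scaled: "klinear s t f \<Longrightarrow> klinear s t (\<lambda>x. t c (f x))"
proof (rule klinearI)
  assume f: "klinear s t f"
  interpret vector_space t using f by (rule klinear_range)
  show "t c (f (x + y)) = t c (f x) + t c (f y)" "t c (f (s d x)) = t d (t c (f x))" for x y d
    by (simp_all add: klinear_add[OF f] klinear_scale[OF f] scale_right_distrib mult.commute)
qed (auto dest: klinear_domain klinear_range)

lemma klinear_uminus: "klinear s t f \<Longrightarrow> klinear s t (\<lambda>x. - f x)"
proof (rule klinearI)
  assume f: "klinear s t f"
  interpret vector_space t using f by (rule klinear_range)
  show "- f (x + y) = - f x + - f y" "- f (s d x) = t d (- f x)" for x y d
    by (simp_all add: klinear_add[OF f] klinear_scale[OF f])
qed (auto dest: klinear_domain klinear_range)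

lemma klinear_minus_fun: "klinear s t f \<Longrightarrow> klinear s t h \<Longrightarrow> klinear s t (\<lambda>x. f x - h x)"
  using klinear_plus[of s t f "\<lambda>x. - h x"] klinear_uminus[of s t h] by simp

lemma klinear_const_zero:
  assumes "vector_space s" "vector_space t"
  shows "klinear s t (\<lambda>x. 0)"
proof -
  interpret vector_space t by fact
  show ?thesis by (rule klinearI) (use assms in auto)
qed

text \<open>The augmentation, that is, the constant term.\<close>

definition eps :: "('k::field, 'g) free_alg \<Rightarrow> 'k" where
  "eps = word_lift (*) (\<lambda>xs. if xs = [] then 1 else 0)"

lemma vector_space_field: "vector_space ((*) :: 'k::field \<Rightarrow> 'k \<Rightarrow> 'k)"
  by standard (auto simp: algebra_simps)

lemma klinear_eps: "klinear free_scal (*) eps"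
  unfolding eps_def by (rule klinear_word_lift[OF vector_space_field])

lemmas eps_simps = klinear_add[OF klinear_eps] klinear_scale[OF klinear_eps] klinear_zero[OF klinear_eps]
  klinear_minus[OF klinear_eps] klinear_diff[OF klinear_eps] 

lemma eps_word: "eps (word xs) = (if xs = [] then 1 else 0)"
  by (simp add: eps_def vector_space_field)

lemma eps_1 [simp]: "eps 1 = 1"
  using eps_word[of "[]"] by simp

lemma eps_free_gen [simp]: "eps (free_gen x) = 0"
  using eps_word[of "[x]"] by (simp add: word_single)

lemma eps_mult: "eps (a * b) = eps a * eps b"
proof (induction a rule: free_alg_induct)
  case zero show ?case by (simp add: eps_simps)
next
  case (add c xs a)
  have "eps (word xs * b) = eps (word xs) * eps b"
    by (induction b rule: free_alg_induct)
       (auto simp: eps_simps free_scal_mult_right distrib_left word_append[symmetric] eps_word)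
  then show ?case using add by (simp add: distrib_right eps_simps free_scal_mult_left)
qed

lemma eps_power: "eps (a ^ n) = eps a ^ n"
  by (induction n) (auto simp: eps_mult)

text \<open>Such a set is also closed under \<open>free_scal\<close>, because scalars act as
  multiplication by elements of the ring.\<close>

definition two_sided :: "'a::ring_1 set \<Rightarrow> bool" where
  "two_sided J \<longleftrightarrow> 0 \<in> J \<and> (\<forall>a\<in>J. \<forall>b\<in>J. a + b \<in> J) \<and> (\<forall>a\<in>J. \<forall>b. a * b \<in> J \<and> b * a \<in> J)"

lemma two_sidedD:
  assumes "two_sided J"
  shows "0 \<in> J" "a \<in> J \<Longrightarrow> b \<in> J \<Longrightarrow> a + b \<in> J" "a \<in> J \<Longrightarrow> a * b \<in> J" "a \<in> J \<Longrightarrow> b * a \<in> J"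
    "a \<in> J \<Longrightarrow> - a \<in> J" "a \<in> J \<Longrightarrow> b \<in> J \<Longrightarrow> a - b \<in> J"
proof -
  show neg: "a \<in> J \<Longrightarrow> - a \<in> J" for a
    using assms by (metis mult_minus1 two_sided_def)
  show "a \<in> J \<Longrightarrow> b \<in> J \<Longrightarrow> a - b \<in> J" 
    using assms neg by (metis diff_conv_add_uminus two_sided_def)
qed (use assms in \<open>auto simp: two_sided_def\<close>)

lemma two_sided_scal: "two_sided J \<Longrightarrow> a \<in> J \<Longrightarrow> free_scal c a \<in> J"
  by (simp add: free_scal_def two_sidedD)

lemma two_sided_sum: "two_sided J \<Longrightarrow> (\<And>i. i \<in> I \<Longrightarrow> h i \<in> J) \<Longrightarrow> sum h I \<in> J"
  by (induction I rule: infinite_finite_induct) (auto simp: two_sidedD)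

text \<open>Type-class counterpart of \<open>Idl\<close>; \<open>presented.genideal_image\<close>
  compares the two.\<close>

definition gen_ideal :: "'a::ring_1 set \<Rightarrow> 'a set" where
  "gen_ideal S = {a. \<forall>T. two_sided T \<longrightarrow> S \<subseteq> T \<longrightarrow> a \<in> T}"

lemma two_sided_gen_ideal: "two_sided (gen_ideal S)"
  unfolding two_sided_def gen_ideal_def by (auto simp: two_sidedD)

lemma gen_ideal_superset: "S \<subseteq> gen_ideal S"
  by (auto simp: gen_ideal_def)

lemma gen_ideal_minimal: "two_sided T \<Longrightarrow> S \<subseteq> T \<Longrightarrow> gen_ideal S \<subseteq> T"
  by (auto simp: gen_ideal_def)

text \<open>The largest two-sided ideal in the kernel of an additive map.\<close>

lemma two_sided_core:
  assumes "\<And>a b. f (a + b) = f a + (f b :: 'b::ab_group_add)"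
  shows "two_sided {a :: 'a::ring_1. \<forall>b c. f (b * a * c) = 0}"
proof -
  have 0: "f 0 = 0" using assms[of 0 0] by simp
  show ?thesis unfolding two_sided_def
    by (auto simp: 0 assms distrib_left distrib_right) (metis mult.assoc)+
qed

lemma two_sided_eps: "two_sided {a. eps a = 0}"
  by (auto simp: two_sided_def eps_simps eps_mult)

text \<open>A nonempty word has a generator as left factor, so subtracting the constant term always
  lands in the ideal generated by the letters.\<close>

lemma aug_ideal_gen: "{a :: ('k::field, 'g) free_alg. eps a = 0} = gen_ideal (range free_gen)"
proof (intro equalityI subsetI)
  have "gen_ideal (range free_gen) \<subseteq> {a :: ('k, 'g) free_alg. eps a = 0}"
    by (rule gen_ideal_minimal) (auto simp: two_sided_eps)
  then show "a \<in> {a. eps a = 0}" if "a \<in> gen_ideal (range free_gen)" for a :: "('k, 'g) free_alg"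
    using that by auto
  have *: "a - free_scal (eps a) 1 \<in> gen_ideal (range free_gen)" for a :: "('k, 'g) free_alg"
  proof (induction a rule: free_alg_induct)
    case zero show ?case by (simp add: eps_simps two_sidedD[OF two_sided_gen_ideal])
  next
    case (add c xs a)
    have "word xs - free_scal (eps (word xs)) 1 \<in> gen_ideal (range free_gen)"
    proof (cases xs)
      case Nil then show ?thesis by (simp add: eps_simps two_sidedD[OF two_sided_gen_ideal])
    next
      case (Cons x ys)
      have "free_gen x * word ys \<in> gen_ideal (range free_gen)"
        by (rule two_sidedD(3)[OF two_sided_gen_ideal]) (rule subsetD[OF gen_ideal_superset], simp)
      then show ?thesis using Cons by (simp add: eps_mult word_Cons)
    qed
    then have "free_scal c (word xs - free_scal (eps (word xs)) 1) + (a - free_scal (eps a) 1) \<in> gen_ideal (range free_gen)"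
      by (intro two_sidedD(2)[OF two_sided_gen_ideal] two_sided_scal two_sided_gen_ideal add)
    then show ?case by (simp add: eps_simps FV.scale_right_diff_distrib FV.scale_left_distrib algebra_simps)
  qed
  show "a \<in> gen_ideal (range free_gen)" if "a \<in> {a. eps a = 0}" for a :: "('k, 'g) free_alg"
    using that *[of a] by simp
qed

section \<open>Jacobson's formula\<close>

lemma funpow_commute_fun:
  assumes "\<And>v. f (h v) = h (f v)"
  shows "(f ^^ n) (h v) = h ((f ^^ n) v)"
  by (induction n) (simp_all add: assms)

lemma additive_zero: "(\<And>a b. f (a + b) = f a + f (b :: 'a::group_add)) \<Longrightarrow> f 0 = (0 :: 'b::group_add)"
  by (metis add_0 add_right_imp_eq)

lemma additive_of_int:
  fixes f :: "'a::ring_1 \<Rightarrow> 'b::ring_1"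
  assumes "\<And>a b. f (a + b) = f a + f b"
  shows "f (of_int n * a) = of_int n * f a"
proof -
  have 0: "f 0 = 0" by (rule additive_zero) (rule assms)
  have neg: "f (- b) = - f b" for b using assms[of b "- b"] 0 by (simp add: add_eq_0_iff)
  have nat: "f (of_nat m * a) = of_nat m * f a" for m
    by (induction m) (auto simp: 0 assms distrib_right)
  show ?thesis
    by (cases n rule: int_cases2) (auto simp: nat neg)
qed

lemma additive_sum: "(\<And>a b. f (a + b) = f a + f (b :: 'a::ab_group_add)) \<Longrightarrow> f (sum h I) = (\<Sum>i\<in>I. f (h i) :: 'b::ab_group_add)"
  by (induction I rule: infinite_finite_induct) (auto simp: additive_zero)

lemma additive_funpow:
  fixes f :: "'a::plus \<Rightarrow> 'a"
  shows "(\<And>a b. f (a + b) = f a + f b) \<Longrightarrow> (f ^^ n) (a + b) = (f ^^ n) a + (f ^^ n) b"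
  by (induction n) auto

text \<open>Coefficient of l^i r^(n-i) in (l - r)^n; the exponent \<open>n + i\<close> has the
  parity of n - i and avoids truncated subtraction.\<close>

definition signed_choose :: "nat \<Rightarrow> nat \<Rightarrow> int" where
  "signed_choose n i = int (n choose i) * (- 1) ^ (n + i)"

lemma signed_choose_Suc: "signed_choose (Suc n) (Suc i) = signed_choose n i - signed_choose n (Suc i)"
  by (simp add: signed_choose_def algebra_simps)

lemma signed_choose_Suc_0: "signed_choose (Suc n) 0 = - signed_choose n 0"
  by (simp add: signed_choose_def)

text \<open>Binomial expansion for commuting additive operators. It is meant for left and right
  multiplication, whose difference is \<open>ad\<close>.\<close>

lemma funpow_diff_commuting:
  fixes l r :: "'a::ring_1 \<Rightarrow> 'a"
  assumes l: "\<And>a b. l (a + b) = l a + l b" and r: "\<And>a b. r (a + b) = r a + r b"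
    and lr: "\<And>a. l (r a) = r (l a)"
  shows "((\<lambda>a. l a - r a) ^^ n) v = (\<Sum>i\<le>n. of_int (signed_choose n i) * (l ^^ i) ((r ^^ (n - i)) v))"
proof (induction n)
  case 0 show ?case by (simp add: signed_choose_def)
next
  case (Suc n)
  let ?t = "\<lambda>n i. (l ^^ i) ((r ^^ (n - i)) v)"
  have L: "l (\<Sum>i\<le>n. of_int (signed_choose n i) * ?t n i)
      = (\<Sum>i\<le>n. of_int (signed_choose n i) * ?t (Suc n) (Suc i))"
    by (simp add: additive_sum[OF l] additive_of_int[OF l])
  have R: "r (\<Sum>i\<le>n. of_int (signed_choose n i) * ?t n i)
      = (\<Sum>i\<le>n. of_int (signed_choose n i) * ?t (Suc n) i)"
    unfolding additive_sum[OF r] additive_of_int[OF r]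
    by (intro sum.cong refl arg_cong[where f = "\<lambda>a. _ * a"]) 
      (simp add: funpow_commute_fun[where f = l and h = r, OF lr, symmetric] Suc_diff_le)
  have "(\<Sum>i\<le>n. of_int (signed_choose n i) * ?t (Suc n) i)
     = (\<Sum>i\<le>Suc n. of_int (signed_choose n i) * ?t (Suc n) i)"
    by (simp add: signed_choose_def binomial_eq_0)
  also have "\<dots> = of_int (signed_choose n 0) * ?t (Suc n) 0
     + (\<Sum>i\<le>n. of_int (signed_choose n (Suc i)) * ?t (Suc n) (Suc i))"
    by (rule sum.atMost_Suc_shift)
  finally have R': "(\<Sum>i\<le>n. of_int (signed_choose n i) * ?t (Suc n) i)
     = of_int (signed_choose n 0) * ?t (Suc n) 0
     + (\<Sum>i\<le>n. of_int (signed_choose n (Suc i)) * ?t (Suc n) (Suc i))" .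
  have "(\<Sum>i\<le>Suc n. of_int (signed_choose (Suc n) i) * ?t (Suc n) i) = 
     of_int (signed_choose (Suc n) 0) * ?t (Suc n) 0
     + (\<Sum>i\<le>n. of_int (signed_choose (Suc n) (Suc i)) * ?t (Suc n) (Suc i))"
    by (rule sum.atMost_Suc_shift)
  then show ?case using L R R' Suc.IH
    by (simp add: signed_choose_Suc signed_choose_Suc_0 left_diff_distrib sum_subtractf del: funpow.simps)
      (simp add: Suc.IH)
qed

lemma signed_choose_prime:
  assumes "prime p" "odd p" "i \<le> p"
  shows "int p dvd signed_choose p i - (if i = 0 then - 1 else if i = p then 1 else 0)"
  using assms dvd_choose_prime[of i p]
  by (cases "i = p") (auto simp: signed_choose_def prime_gt_0_nat intro!: dvd_mult2)

text \<open>By Pascal's rule, neighbouring coefficients for \<open>p - 1\<close> differ by a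
  coefficient for \<open>p\<close>, which \<open>p\<close> divides; the first one is 1 because
  \<open>p - 1\<close> is even.\<close>

lemma signed_choose_pred:
  assumes "prime p" "odd p"
  shows "i \<le> p - 1 \<Longrightarrow> int p dvd signed_choose (p - 1) i - 1"
proof (induction i)
  case 0 then show ?case using assms by (simp add: signed_choose_def)
next
  case (Suc i)
  have "signed_choose p (Suc i) = signed_choose (p - 1) i - signed_choose (p - 1) (Suc i)"
    using signed_choose_Suc[of "p - 1" i] assms(1) by (simp add: prime_gt_0_nat)
  moreover have "int p dvd signed_choose p (Suc i)"
    using signed_choose_prime[OF assms, of "Suc i"] Suc.prems prime_gt_0_nat[OF assms(1)]
    by (cases "Suc i = p") auto
  moreover have "int p dvd signed_choose (p - 1) i - 1" using Suc by simp
  ultimately show ?case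
    by (smt (verit, ccfv_threshold) dvd_diff_commute dvd_diff)
qed

lemma of_int_eq_char:
  assumes "of_nat p = (0 :: 'a::ring_1)" "int p dvd m - n"
  shows "of_int m = (of_int n :: 'a)"
proof -
  obtain d where "m = n + int p * d" using assms(2) by (metis add.commute diff_add_cancel dvdE)
  then show ?thesis using assms(1) by simp
qed

context
  fixes l r :: "'a::ring_1 \<Rightarrow> 'a" and p :: nat
  assumes l: "\<And>a b. l (a + b) = l a + l b" and r: "\<And>a b. r (a + b) = r a + r b"
    and lr: "\<And>a. l (r a) = r (l a)"
    and p: "prime p" "odd p" "of_nat p = (0 :: 'a)"
begin

lemma funpow_diff_char: "((\<lambda>a. l a - r a) ^^ p) v = (l ^^ p) v - (r ^^ p) v"
proof -
  have "((\<lambda>a. l a - r a) ^^ p) v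
      = (\<Sum>i\<le>p. of_int (if i = 0 then - 1 else if i = p then 1 else 0) * (l ^^ i) ((r ^^ (p - i)) v))"
    unfolding funpow_diff_commuting[OF l r lr]
    by (intro sum.cong refl arg_cong2[where f = "(*)"] of_int_eq_char[OF p(3)] signed_choose_prime p) auto
  also have "\<dots> = (\<Sum>i\<in>{0, p}. of_int (if i = 0 then - 1 else if i = p then 1 else 0) * (l ^^ i) ((r ^^ (p - i)) v))"
    by (rule sum.mono_neutral_right) auto
  also have "\<dots> = (l ^^ p) v - (r ^^ p) v" using prime_gt_0_nat[OF p(1)] by simp
  finally show ?thesis .
qed

text \<open>All signed binomials of \<open>p - 1\<close> are 1 modulo \<open>p\<close>. The
  resulting sum is also the one that arises from differentiating a p-th power in
  \<open>power_coeff_deriv\<close>.\<close>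

lemma funpow_diff_char_pred: "((\<lambda>a. l a - r a) ^^ (p - 1)) v = (\<Sum>i<p. (l ^^ i) ((r ^^ (p - 1 - i)) v))"
proof -
  have eq: "{..<p} = {..p - 1}" using prime_gt_0_nat[OF p(1)] by auto
  show ?thesis unfolding funpow_diff_commuting[OF l r lr] eq
  proof (intro sum.cong refl)
    fix i assume "i \<in> {..p - 1}"
    then have "of_int (signed_choose (p - 1) i) = (of_int 1 :: 'a)"
      by (intro of_int_eq_char[OF p(3)] signed_choose_pred p) auto
    then show "of_int (signed_choose (p - 1) i) * (l ^^ i) ((r ^^ (p - 1 - i)) v) = (l ^^ i) ((r ^^ (p - 1 - i)) v)"
      by simp
  qed
qed

end

text \<open>Polynomials over the noncommutative ring \<open>'a\<close> are represented by their coefficient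
  sequences; \<open>pencil a b\<close> is the operator \<open>\<lambda>a + b\<close>.\<close>

definition pencil :: "('v \<Rightarrow> 'v) \<Rightarrow> ('v \<Rightarrow> 'v) \<Rightarrow> (nat \<Rightarrow> 'v::ab_group_add) \<Rightarrow> nat \<Rightarrow> 'v" where
  "pencil a b s k = (case k of 0 \<Rightarrow> 0 | Suc j \<Rightarrow> a (s j)) + b (s k)"

definition pure :: "'v::zero \<Rightarrow> nat \<Rightarrow> 'v" where
  "pure v k = (if k = 0 then v else 0)"

lemma pencil_add:
  assumes "\<And>u v. a (u + v) = a u + a v" "\<And>u v. b (u + v) = b u + b v"
  shows "pencil a b (s + t) = pencil a b s + pencil a b t"
  by (rule ext) (auto simp: pencil_def assms split: nat.split)

context
  fixes x y :: "'a::ring_1"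
begin

definition lpencil where "lpencil = pencil ((*) x) ((*) y)"
definition rpencil where "rpencil = pencil (\<lambda>a. a * x) (\<lambda>a. a * y)"

lemma lpencil_apply: "lpencil s k = (case k of 0 \<Rightarrow> 0 | Suc j \<Rightarrow> x * s j) + y * s k"
  by (simp add: lpencil_def pencil_def)

lemma lpencil_add: "lpencil (s + t) = lpencil s + lpencil t"
  unfolding lpencil_def by (rule pencil_add) (simp_all add: distrib_left)

lemma rpencil_add: "rpencil (s + t) = rpencil s + rpencil t"
  unfolding rpencil_def by (rule pencil_add) (simp_all add: distrib_right)

lemma lpencil_rpencil: "lpencil (rpencil s) = rpencil (lpencil s)"
  by (rule ext) (auto simp: lpencil_def rpencil_def pencil_def algebra_simps split: nat.split)

text \<open>\<open>power_coeff n k\<close> is the coefficient of \<lambda>^k in (\<lambda>x +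
  y)^n.\<close>

definition power_coeff :: "nat \<Rightarrow> nat \<Rightarrow> 'a" where
  "power_coeff n = (lpencil ^^ n) (pure 1)"

lemma power_coeff_right: "power_coeff n = (rpencil ^^ n) (pure 1)"
proof (induction n)
  case 0 show ?case by (simp add: power_coeff_def)
next
  case (Suc n)
  have "power_coeff (Suc n) = (lpencil ^^ n) (lpencil (pure 1))"
    by (simp add: power_coeff_def funpow_swap1)
  also have "lpencil (pure 1) = rpencil (pure 1)"
    by (rule ext) (auto simp: lpencil_def rpencil_def pencil_def pure_def split: nat.split)
  also have "(lpencil ^^ n) (rpencil (pure 1)) = rpencil (power_coeff n)"
    unfolding power_coeff_def by (rule funpow_commute_fun) (rule lpencil_rpencil)
  finally show ?case by (simp add: Suc)
qed

text \<open>Leibniz rule: the derivative of (\<lambda>x + y)^n with respect to \<lambda> is the sum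
  of the products (\<lambda>x + y)^i x (\<lambda>x + y)^(n-1-i).\<close>

lemma power_coeff_deriv:
  "of_nat (Suc k) * power_coeff n (Suc k) = (\<Sum>i<n. (lpencil ^^ i) ((rpencil ^^ (n - 1 - i)) (pure x))) k"
proof (induction n arbitrary: k)
  case 0 show ?case by (simp add: power_coeff_def pure_def)
next
  case (Suc n)
  have lsum: "lpencil (\<Sum>i\<in>I. h i) = (\<Sum>i\<in>I. lpencil (h i))" for h and I :: "nat set"
    by (rule additive_sum[where f = lpencil]) (rule lpencil_add)
  have xr: "(rpencil ^^ n) (pure x) = (\<lambda>k. x * power_coeff n k)"
  proof -
    have "(rpencil ^^ n) ((\<lambda>s k. x * s k) (pure 1)) = (\<lambda>s k. x * s k) ((rpencil ^^ n) (pure 1))"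
      by (rule funpow_commute_fun) (auto simp: fun_eq_iff rpencil_def pencil_def algebra_simps split: nat.split)
    moreover have "(\<lambda>k. x * pure 1 k) = pure x" by (auto simp: pure_def)
    ultimately show ?thesis by (simp add: power_coeff_right)
  qed
  have "(\<Sum>i<Suc n. (lpencil ^^ i) ((rpencil ^^ (Suc n - 1 - i)) (pure x)))
     = (rpencil ^^ n) (pure x) + (\<Sum>i<n. (lpencil ^^ Suc i) ((rpencil ^^ (n - Suc i)) (pure x)))"
    by (subst sum.lessThan_Suc_shift) simp
  also have "(\<Sum>i<n. (lpencil ^^ Suc i) ((rpencil ^^ (n - Suc i)) (pure x)))
     = lpencil (\<Sum>i<n. (lpencil ^^ i) ((rpencil ^^ (n - 1 - i)) (pure x)))" 
    by (simp add: lsum)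
  finally have "(\<Sum>i<Suc n. (lpencil ^^ i) ((rpencil ^^ (Suc n - 1 - i)) (pure x)))
     = (rpencil ^^ n) (pure x) + lpencil (\<Sum>i<n. (lpencil ^^ i) ((rpencil ^^ (n - 1 - i)) (pure x)))" .
  from fun_cong[OF this, of k] have eq: "(\<Sum>i<Suc n. (lpencil ^^ i) ((rpencil ^^ (Suc n - 1 - i)) (pure x))) k
     = x * power_coeff n k + lpencil (\<Sum>i<n. (lpencil ^^ i) ((rpencil ^^ (n - 1 - i)) (pure x))) k"
    unfolding plus_fun_apply xr .
  have ps: "power_coeff (Suc n) (Suc k) = x * power_coeff n k + y * power_coeff n (Suc k)"
    by (simp add: power_coeff_def lpencil_def pencil_def)
  have cm: "of_nat m * (c * d) = c * (of_nat m * d)" for m and c d :: 'a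
    by (metis mult.assoc mult_of_nat_commute)
  show ?case
  proof (cases k)
    case 0
    then show ?thesis unfolding eq ps using Suc.IH[of 0] by (simp add: lpencil_apply[of "sum h I" for h I])
  next
    case (Suc j)
    have *: "of_nat (Suc (Suc j)) * (x * power_coeff n (Suc j)) = x * power_coeff n (Suc j) + x * (of_nat (Suc j) * power_coeff n (Suc j))"
      by (subst cm) (simp add: distrib_right distrib_left)
    show ?thesis unfolding eq ps unfolding Suc using Suc.IH[of j] Suc.IH[of "Suc j"] *
      by (simp add: lpencil_apply[of "sum h I" for h I] distrib_left cm del: of_nat_Suc)
  qed
qed

lemma power_coeff_sum: "(x + y) ^ n = (\<Sum>k\<le>n. power_coeff n k)" 
  and power_coeff_above: "n < k \<Longrightarrow> power_coeff n k = 0"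
proof (induction n arbitrary: k)
  case 0
  { case 1 show ?case by (simp add: power_coeff_def pure_def) next
    case 2 then show ?case by (simp add: power_coeff_def pure_def) }
next
  case (Suc n)
  have ps: "power_coeff (Suc n) k = (case k of 0 \<Rightarrow> 0 | Suc j \<Rightarrow> x * power_coeff n j) + y * power_coeff n k" for k
    by (auto simp: power_coeff_def lpencil_def pencil_def split: nat.split)
  { case 1
    have "(\<Sum>k\<le>Suc n. power_coeff (Suc n) k) = (\<Sum>k\<le>Suc n. case k of 0 \<Rightarrow> 0 | Suc j \<Rightarrow> x * power_coeff n j) + (\<Sum>k\<le>Suc n. y * power_coeff n k)"
      unfolding ps sum.distrib ..
    also have "(\<Sum>k\<le>Suc n. case k of 0 \<Rightarrow> 0 | Suc j \<Rightarrow> x * power_coeff n j) = x * (x + y) ^ n"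
      by (subst sum.atMost_Suc_shift) (simp add: Suc sum_distrib_left)
    also have "(\<Sum>k\<le>Suc n. y * power_coeff n k) = y * (x + y) ^ n"
      by (simp add: Suc sum_distrib_left)
    finally show ?case by (simp add: distrib_right)
  next
    case 2 then show ?case using Suc by (auto simp: ps split: nat.split) }
qed

lemma power_coeff_ends: "power_coeff n 0 = y ^ n" "power_coeff n n = x ^ n"
proof -
  show "power_coeff n 0 = y ^ n" by (induction n) (auto simp: power_coeff_def lpencil_def pencil_def pure_def)
  show "power_coeff n n = x ^ n"
  proof (induction n)
    case 0 show ?case by (simp add: power_coeff_def pure_def)
  next
    case (Suc n)
    have "power_coeff (Suc n) (Suc n) = x * power_coeff n n + y * power_coeff n (Suc n)"
      by (simp add: power_coeff_def lpencil_def pencil_def)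
    then show ?case by (simp add: Suc power_coeff_above)
  qed
qed

text \<open>The first claim evaluates (\<lambda>x + y)^p at \<lambda> = 1. For the second,
  \<open>funpow_diff_char_pred\<close> identifies the Leibniz sum of
  \<open>power_coeff_deriv\<close> with (ad(\<lambda>x + y))^(p-1) applied to
  \<open>x\<close>.\<close>

lemma power_add_char:
  assumes p: "prime p" "odd p" "of_nat p = (0 :: 'a)"
  shows "(x + y) ^ p = x ^ p + y ^ p + (\<Sum>i = 1..p - 1. power_coeff p i)"
    and "of_nat (Suc k) * power_coeff p (Suc k) = ((pencil (\<lambda>b. x * b - b * x) (\<lambda>b. y * b - b * y) ^^ (p - 1)) (pure x)) k"
proof -
  have "{..p} = insert 0 (insert p {1..p - 1})" using prime_gt_0_nat[OF p(1)] by auto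
  then show "(x + y) ^ p = x ^ p + y ^ p + (\<Sum>i = 1..p - 1. power_coeff p i)"
    using prime_gt_0_nat[OF p(1)] by (simp add: power_coeff_sum power_coeff_ends)
  have "pencil (\<lambda>b. x * b - b * x) (\<lambda>b. y * b - b * y) = (\<lambda>s. lpencil s - rpencil s)"
    by (auto simp: fun_eq_iff lpencil_def rpencil_def pencil_def split: nat.split)
  \<comment> \<open>\<open>funpow_diff_char_pred\<close> is applied in the pointwise ring of
    coefficient sequences, so \<open>p\<close> has to vanish there as well.\<close>
  moreover have "of_nat p = (0 :: nat \<Rightarrow> 'a)" 
  proof -
    have "of_nat n = (\<lambda>k :: nat. of_nat n :: 'a)" for n by (induction n) (auto simp: fun_eq_iff)
    then show ?thesis using p(3) by (simp add: fun_eq_iff)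
  qed
  ultimately show "of_nat (Suc k) * power_coeff p (Suc k) = ((pencil (\<lambda>b. x * b - b * x) (\<lambda>b. y * b - b * y) ^^ (p - 1)) (pure x)) k"
    using funpow_diff_char_pred[OF lpencil_add rpencil_add lpencil_rpencil p(1,2)] power_coeff_deriv
    by simp
qed

end

section \<open>Congruences modulo a two-sided ideal\<close>

definition cong_mod :: "'a::ring_1 set \<Rightarrow> 'a \<Rightarrow> 'a \<Rightarrow> bool" where
  "cong_mod Q a b \<longleftrightarrow> a - b \<in> Q"

context
  fixes Q :: "'a::ring_1 set"
  assumes Q: "two_sided Q"
begin

lemma cong_mod_refl: "cong_mod Q a a"
  by (simp add: cong_mod_def two_sidedD[OF Q])

lemma cong_mod_sym: "cong_mod Q a b \<Longrightarrow> cong_mod Q b a"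
  unfolding cong_mod_def using two_sidedD(5)[OF Q, of "a - b"] by simp

lemma cong_mod_trans: "cong_mod Q a b \<Longrightarrow> cong_mod Q b c \<Longrightarrow> cong_mod Q a c"
  unfolding cong_mod_def using two_sidedD(2)[OF Q, of "a - b" "b - c"] by simp

lemma cong_mod_add: "cong_mod Q a b \<Longrightarrow> cong_mod Q c d \<Longrightarrow> cong_mod Q (a + c) (b + d)"
  unfolding cong_mod_def using two_sidedD(2)[OF Q, of "a - b" "c - d"] by (simp add: algebra_simps)

lemma cong_mod_diff: "cong_mod Q a b \<Longrightarrow> cong_mod Q c d \<Longrightarrow> cong_mod Q (a - c) (b - d)"
  unfolding cong_mod_def using two_sidedD(6)[OF Q, of "a - b" "c - d"] by (simp add: algebra_simps)

lemma cong_mod_minus: "cong_mod Q a b \<Longrightarrow> cong_mod Q (- a) (- b)"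
  unfolding cong_mod_def using two_sidedD(5)[OF Q, of "a - b"] by (simp add: algebra_simps)

lemma cong_mod_mult:
  assumes "cong_mod Q a b" "cong_mod Q c d"
  shows "cong_mod Q (a * c) (b * d)"
proof -
  have "(a - b) * c + b * (c - d) \<in> Q"
    using assms unfolding cong_mod_def by (intro two_sidedD(2-4)[OF Q])
  then show ?thesis by (simp add: cong_mod_def algebra_simps)
qed

lemma cong_mod_power: "cong_mod Q a b \<Longrightarrow> cong_mod Q (a ^ n) (b ^ n)"
  by (induction n) (auto intro: cong_mod_mult cong_mod_refl)

lemma cong_mod_ksign: "cong_mod Q a b \<Longrightarrow> cong_mod Q (ksign i j a) (ksign i j b)"
  by (simp add: ksign_def cong_mod_minus)

lemma cong_mod_sum: "(\<And>i. i \<in> I \<Longrightarrow> cong_mod Q (f i) (h i)) \<Longrightarrow> cong_mod Q (sum f I) (sum h I)"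
  by (induction I rule: infinite_finite_induct) (auto intro: cong_mod_add cong_mod_refl)

lemma cong_mod_0_iff: "cong_mod Q a 0 \<longleftrightarrow> a \<in> Q"
  by (simp add: cong_mod_def)

lemma cong_mod_mem: "cong_mod Q a b \<Longrightarrow> b \<in> Q \<Longrightarrow> a \<in> Q"
  unfolding cong_mod_def using two_sidedD(2)[OF Q, of "a - b" b] by simp

end

lemma cong_mod_scal: "two_sided Q \<Longrightarrow> cong_mod Q a b \<Longrightarrow> cong_mod Q (free_scal c a) (free_scal c b)"
  unfolding free_scal_def by (intro cong_mod_mult cong_mod_refl)

lemma cong_mod_mono: "cong_mod Q a b \<Longrightarrow> Q \<subseteq> R \<Longrightarrow> cong_mod R a b"
  by (auto simp: cong_mod_def)

section \<open>Graded spaces\<close>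

locale graded_space =
  fixes V :: "('k::field, 'v::ab_group_add) rlsa"
  assumes super: "super_space V"
begin

sublocale vs: vector_space "smul V"
  using super by (simp add: super_space_def)

lemma part_subspace: "vs.subspace (part V i)"
  using super by (simp add: super_space_def)

lemma part_simps [simp]:
  shows part_0: "0 \<in> part V i"
    and part_add: "a \<in> part V i \<Longrightarrow> b \<in> part V i \<Longrightarrow> a + b \<in> part V i"
    and part_scale: "a \<in> part V i \<Longrightarrow> smul V c a \<in> part V i"
    and part_minus: "a \<in> part V i \<Longrightarrow> - a \<in> part V i"
    and part_diff: "a \<in> part V i \<Longrightarrow> b \<in> part V i \<Longrightarrow> a - b \<in> part V i"
  using vs.subspace_0[OF part_subspace] vs.subspace_add[OF part_subspace] vs.subspace_scale[OF part_subspace]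
    vs.subspace_neg[OF part_subspace] vs.subspace_diff[OF part_subspace] by auto

lemma part_sum: "(\<And>i. i \<in> I \<Longrightarrow> f i \<in> part V d) \<Longrightarrow> sum f I \<in> part V d"
  by (rule vs.subspace_sum[OF part_subspace])

lemma part_ksign [simp]: "a \<in> part V d \<Longrightarrow> ksign i j a \<in> part V d"
  by (simp add: ksign_def)

lemma decompose:
  obtains a b where "a \<in> part V 0" "b \<in> part V 1" "v = a + b"
  using super unfolding super_space_def by blast

lemma part_disjoint: "a \<in> part V 0 \<Longrightarrow> a \<in> part V 1 \<Longrightarrow> a = 0"
  using super unfolding super_space_def by blast

lemma part_disjoint': "a \<in> part V i \<Longrightarrow> a \<in> part V (i + 1) \<Longrightarrow> a = 0"
  by (cases i) (auto intro: part_disjoint)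

lemma graded_induct [consumes 0, case_names homogeneous add]:
  assumes "\<And>i a. a \<in> part V i \<Longrightarrow> P a" "\<And>a b. P a \<Longrightarrow> P b \<Longrightarrow> P (a + b)"
  shows "P v"
  using assms by (metis decompose)

lemma comp_part_eq:
  assumes "a \<in> part V i" "b \<in> part V (i + 1)"
  shows "comp_part V i (a + b) = a"
  unfolding comp_part_def
proof (rule the_equality)
  show "a \<in> part V i \<and> a + b - a \<in> part V (i + 1)" using assms by simp
  fix c assume c: "c \<in> part V i \<and> a + b - c \<in> part V (i + 1)"
  have "a - c = (a + b - c) - b" by simp
  then have "a - c \<in> part V (i + 1)" using c assms(2) by (metis part_diff)
  moreover have "a - c \<in> part V i" using c assms(1) by simp
  ultimately show "c = a" using part_disjoint'[of "a - c" i] by simp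
qed

lemma comp_part_homogeneous: 
  assumes "a \<in> part V i" shows "comp_part V j a = (if i = j then a else 0)"
proof (cases "i = j")
  case True then show ?thesis using comp_part_eq[of a j 0] assms by simp
next
  case False
  then have "j + 1 = i" by (cases i; cases j) auto
  then show ?thesis using comp_part_eq[of 0 j a] assms False by simp
qed

lemma comp_part_add: "comp_part V i (a + b) = comp_part V i a + comp_part V i b"
proof -
  obtain a0 a1 b0 b1 where *: "a0 \<in> part V 0" "a1 \<in> part V 1" "a = a0 + a1" "b0 \<in> part V 0" "b1 \<in> part V 1" "b = b0 + b1"
    by (metis decompose)
  have e0: "comp_part V 0 (u + v) = u" "comp_part V 1 (u + v) = v" if "u \<in> part V 0" "v \<in> part V 1" for u v
    using comp_part_eq[of u 0 v] comp_part_eq[of v 1 u] that by (auto simp: add.commute)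
  have ab: "a + b = (a0 + b0) + (a1 + b1)" using * by simp
  show ?thesis unfolding ab using * e0[of "a0 + b0" "a1 + b1"] e0[of a0 a1] e0[of b0 b1] by (cases i) auto
qed

lemma comp_part_scale: "comp_part V i (smul V c a) = smul V c (comp_part V i a)"
proof -
  obtain a0 a1 where *: "a0 \<in> part V 0" "a1 \<in> part V 1" "a = a0 + a1"
    by (metis decompose)
  have e0: "comp_part V 0 (u + v) = u" "comp_part V 1 (u + v) = v" if "u \<in> part V 0" "v \<in> part V 1" for u v
    using comp_part_eq[of u 0 v] comp_part_eq[of v 1 u] that by (auto simp: add.commute)
  then show ?thesis using * by (cases i) (auto simp: vs.scale_right_distrib)
qed

end

lemma even_bilinearD:
  assumes "even_bilinear U V W b"
  shows even_bilinear_left: "klinear (smul U) (smul W) (\<lambda>u. b u v)"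
    and even_bilinear_right: "klinear (smul V) (smul W) (b u)"
    and even_bilinear_part: "x \<in> part U i \<Longrightarrow> y \<in> part V j \<Longrightarrow> b x y \<in> part W (i + j)"
  using assms by (auto simp: even_bilinear_def)

lemmas even_bilinear_simps = 
  klinear_add[OF even_bilinear_left] klinear_add[OF even_bilinear_right]
  klinear_scale[OF even_bilinear_left] klinear_scale[OF even_bilinear_right]
  klinear_zero[OF even_bilinear_left] klinear_zero[OF even_bilinear_right]
  klinear_minus[OF even_bilinear_left] klinear_minus[OF even_bilinear_right]
  klinear_diff[OF even_bilinear_left] klinear_diff[OF even_bilinear_right]

lemma ksign_simps [simp]: "ksign 0 j v = v" "ksign i 0 v = v" "ksign 1 1 v = - v" "ksign i j 0 = 0"
  by (auto simp: ksign_def)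

lemma swap_sign_homogeneous:
  assumes "graded_space U" "graded_space V" "\<And>u. b u 0 = 0" "\<And>v. b 0 v = 0" "x \<in> part U i" "y \<in> part V j"
  shows "swap_sign U V b x y = ksign i j (b x y)"
  unfolding swap_sign_def graded_space.comp_part_homogeneous[OF assms(1,5)] graded_space.comp_part_homogeneous[OF assms(2,6)]
  using assms(3,4) by (cases i; cases j) auto

lemma even_bilinear_swap_sign:
  assumes "even_bilinear U V W b" "graded_space U" "graded_space V" "graded_space W"
  shows "even_bilinear U V W (swap_sign U V b)"
proof -
  interpret U: graded_space U by fact
  interpret V: graded_space V by fact
  interpret W: graded_space W by fact
  note bs = even_bilinear_simps[OF assms(1)]
  have k: "ksign i j (a + b) = ksign i j a + ksign i j b" "ksign i j (smul W c a) = smul W c (ksign i j a)" for i j a b c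
    by (auto simp: ksign_def)
  show ?thesis unfolding even_bilinear_def
  proof (intro conjI allI ballI)
    show "klinear (smul V) (smul W) (swap_sign U V b u)" for u
      by (rule klinearI[OF V.vs.vector_space_axioms W.vs.vector_space_axioms])
        (simp_all add: swap_sign_def V.comp_part_add V.comp_part_scale bs k W.vs.scale_right_distrib W.vs.scale_right_diff_distrib)
    show "klinear (smul U) (smul W) (\<lambda>u. swap_sign U V b u v)" for v
      by (rule klinearI[OF U.vs.vector_space_axioms W.vs.vector_space_axioms])
        (simp_all add: swap_sign_def U.comp_part_add U.comp_part_scale bs k W.vs.scale_right_distrib W.vs.scale_right_diff_distrib)
    show "swap_sign U V b u v \<in> part W (i + j)" if "u \<in> part U i" "v \<in> part V j" for u v i j
      using that swap_sign_homogeneous[OF assms(2,3), of b u i v j] even_bilinear_part[OF assms(1), of u i v j]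
      by (simp add: bs)
  qed
qed

section \<open>Brackets modulo the relations of the enveloping algebra\<close>

lemma bit_sum_simps [simp]: "(1::bit) + 1 = 0" by simp

text \<open>No Lie axiom is assumed for \<open>br V\<close>, only that brackets become
  supercommutators modulo \<open>Q\<close>. The axioms then hold modulo \<open>Q\<close> because
  they hold in associative algebras. This serves both for \<open>g\<close> itself and for proving
  that the extension of a cocycle is a restricted Lie superalgebra.\<close>

locale bracket_ideal = graded_space V for V :: "('k::field, 'v::ab_group_add) rlsa" +
  fixes Q :: "('k, 'v) free_alg set"
  assumes bilinear: "even_bilinear V V V (br V)" and Q: "two_sided Q" and relations: "env_relations V \<subseteq> Q"
begin

lemmas br_simps = even_bilinear_simps[OF bilinear]
lemmas br_part = even_bilinear_part[OF bilinear]

abbreviation cg (infix "\<simeq>" 50) where "cg \<equiv> cong_mod Q"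

lemmas cg_refl = cong_mod_refl[OF Q]
lemmas cg_sym = cong_mod_sym[OF Q]
lemmas cg_trans [trans] = cong_mod_trans[OF Q]
lemmas cg_intros = cong_mod_refl[OF Q] cong_mod_add[OF Q] cong_mod_diff[OF Q] cong_mod_minus[OF Q] cong_mod_mult[OF Q]
  cong_mod_power[OF Q] cong_mod_ksign[OF Q] cong_mod_sum[OF Q] cong_mod_scal[OF Q]

lemma gen_add: "free_gen (x + y) \<simeq> free_gen x + free_gen y"
proof -
  have "free_gen (x + y) - free_gen x - free_gen y \<in> env_relations V" unfolding env_relations_def by blast
  then show ?thesis using relations by (auto simp: cong_mod_def algebra_simps)
qed

lemma gen_scale: "free_gen (smul V c x) \<simeq> free_scal c (free_gen x)"
proof -
  have "free_gen (smul V c x) - free_scal c (free_gen x) \<in> env_relations V" unfolding env_relations_def by blast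
  then show ?thesis using relations by (auto simp: cong_mod_def algebra_simps)
qed

lemma gen_br:
  assumes "x \<in> part V i" "y \<in> part V j"
  shows "free_gen (br V x y) \<simeq> free_gen x * free_gen y - ksign i j (free_gen y * free_gen x)"
proof -
  have "free_gen x * free_gen y - ksign i j (free_gen y * free_gen x) - free_gen (br V x y) \<in> env_relations V"
    unfolding env_relations_def using assms by blast
  then have "free_gen x * free_gen y - ksign i j (free_gen y * free_gen x) \<simeq> free_gen (br V x y)"
    using relations by (auto simp: cong_mod_def algebra_simps)
  then show ?thesis by (rule cg_sym)
qed

lemma gen_0: "free_gen 0 \<in> Q"
proof -
  have "free_gen (smul V 0 0) \<simeq> free_scal 0 (free_gen 0)" by (rule gen_scale)
  then show ?thesis by (simp add: cong_mod_def)
qed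

lemma gen_minus: "free_gen (- x) \<simeq> - free_gen x"
  using gen_scale[of "-1" x] by simp

lemma gen_diff: "free_gen (x - y) \<simeq> free_gen x - free_gen y"
  using cg_trans[OF gen_add[of x "- y"] cong_mod_add[OF Q cg_refl gen_minus]] by simp

lemma gen_sum: "free_gen (sum f I) \<simeq> (\<Sum>i\<in>I. free_gen (f i))"
proof (induction I rule: infinite_finite_induct)
  case (insert x F)
  have "free_gen (f x + sum f F) \<simeq> free_gen (f x) + free_gen (sum f F)" by (rule gen_add)
  also have "\<dots> \<simeq> free_gen (f x) + (\<Sum>i\<in>F. free_gen (f i))" by (intro cg_intros insert)
  finally show ?case using insert by simp
qed (auto simp: cong_mod_def gen_0)

lemma gen_ksign: "free_gen (ksign i j x) \<simeq> ksign i j (free_gen x)"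
  by (auto simp: ksign_def gen_minus cg_refl)

lemma gen_br_even:
  assumes "x \<in> part V 0"
  shows "free_gen (br V x y) \<simeq> free_gen x * free_gen y - free_gen y * free_gen x"
proof (induction y rule: graded_induct)
  case (homogeneous i a)
  from gen_br[OF assms this] show ?case by simp
next
  case (add a b)
  have "free_gen (br V x (a + b)) \<simeq> free_gen (br V x a) + free_gen (br V x b)" 
    by (simp add: br_simps gen_add)
  also have "\<dots> \<simeq> (free_gen x * free_gen a - free_gen a * free_gen x) + (free_gen x * free_gen b - free_gen b * free_gen x)"
    by (intro cg_intros add)
  also have "\<dots> = free_gen x * (free_gen a + free_gen b) - (free_gen a + free_gen b) * free_gen x"
    by (simp add: algebra_simps)
  also have "\<dots> \<simeq> free_gen x * free_gen (a + b) - free_gen (a + b) * free_gen x"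
    by (intro cg_intros cg_sym[OF gen_add])
  finally show ?case .
qed

lemma gen_antisym:
  assumes "x \<in> part V i" "y \<in> part V j"
  shows "free_gen (br V x y + ksign i j (br V y x)) \<in> Q"
proof -
  have "free_gen (br V x y + ksign i j (br V y x)) \<simeq> free_gen (br V x y) + ksign i j (free_gen (br V y x))"
    by (intro cg_trans[OF gen_add] cg_intros gen_ksign)
  also have "\<dots> \<simeq> (free_gen x * free_gen y - ksign i j (free_gen y * free_gen x))
      + ksign i j (free_gen y * free_gen x - ksign j i (free_gen x * free_gen y))"
    by (intro cg_intros gen_br assms)
  also have "\<dots> = 0" by (cases i; cases j) auto
  finally show ?thesis by (simp add: cong_mod_def)
qed

text \<open>Supercommutators in an associative algebra satisfy the graded Jacobi identity; after
  expansion each choice of parities is a ring identity.\<close>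

lemma gen_jacobi_homogeneous:
  assumes x: "x \<in> part V i" and y: "y \<in> part V j" and z: "z \<in> part V l"
  shows "free_gen (br V x (br V y z) - br V (br V x y) z - ksign i j (br V y (br V x z))) \<in> Q"
proof -
  let ?X = "free_gen x" and ?Y = "free_gen y" and ?Z = "free_gen z"
  have b2: "free_gen (br V a (br V b c)) \<simeq> free_gen a * (free_gen b * free_gen c - ksign j l (free_gen c * free_gen b))
       - ksign i (j + l) ((free_gen b * free_gen c - ksign j l (free_gen c * free_gen b)) * free_gen a)" 
    if "a \<in> part V i" "b \<in> part V j" "c \<in> part V l" for a b c i j l
    by (rule cg_trans[OF gen_br[OF that(1) br_part[OF that(2,3)]]]) (intro cg_intros gen_br that)
  have b3: "free_gen (br V (br V x y) z) \<simeq> (?X * ?Y - ksign i j (?Y * ?X)) * ?Z - ksign (i + j) l (?Z * (?X * ?Y - ksign i j (?Y * ?X)))"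
    by (rule cg_trans[OF gen_br[OF br_part[OF x y] z]]) (intro cg_intros gen_br x y)
  have "free_gen (br V x (br V y z) - br V (br V x y) z - ksign i j (br V y (br V x z))) \<simeq>
     free_gen (br V x (br V y z)) - free_gen (br V (br V x y) z) - ksign i j (free_gen (br V y (br V x z)))"
    by (intro cg_trans[OF gen_diff] cg_intros gen_ksign gen_diff)
  also have "\<dots> \<simeq> (?X * (?Y * ?Z - ksign j l (?Z * ?Y)) - ksign i (j + l) ((?Y * ?Z - ksign j l (?Z * ?Y)) * ?X)) -
     ((?X * ?Y - ksign i j (?Y * ?X)) * ?Z - ksign (i + j) l (?Z * (?X * ?Y - ksign i j (?Y * ?X)))) -
     ksign i j (?Y * (?X * ?Z - ksign i l (?Z * ?X)) - ksign j (i + l) ((?X * ?Z - ksign i l (?Z * ?X)) * ?Y))"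
    by (intro cg_intros b2 b3 x y z)
  also have "\<dots> = 0"
    by (cases i; cases j; cases l) (simp_all add: algebra_simps)
  finally show ?thesis by (simp add: cong_mod_def)
qed

lemma gen_jacobi:
  assumes x: "x \<in> part V i" and y: "y \<in> part V j"
  shows "free_gen (br V x (br V y z) - br V (br V x y) z - ksign i j (br V y (br V x z))) \<in> Q"
proof (induction z rule: graded_induct)
  case (homogeneous l a)
  then show ?case by (rule gen_jacobi_homogeneous[OF assms])
next
  case (add a b)
  have k: "ksign i j (u + v) = ksign i j u + ksign i j v" for u v :: 'v by (auto simp: ksign_def)
  let ?f = "\<lambda>z. br V x (br V y z) - br V (br V x y) z - ksign i j (br V y (br V x z))"
  have "?f (a + b) = ?f a + ?f b" by (simp add: br_simps k)
  then have "free_gen (?f (a + b)) \<simeq> free_gen (?f a) + free_gen (?f b)" using gen_add by metis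
  then show ?case using add two_sidedD(2)[OF Q] cong_mod_mem[OF Q] by blast
qed

text \<open>Modulo \<open>Q\<close> the element [y,y] is 2y^2, which commutes with \<open>y\<close>;
  the argument is independent of the characteristic.\<close>

lemma gen_cube:
  assumes "y \<in> part V 1"
  shows "free_gen (br V y (br V y y)) \<in> Q"
proof -
  let ?Y = "free_gen y"
  have "free_gen (br V y (br V y y)) \<simeq> ?Y * (?Y * ?Y - ksign 1 1 (?Y * ?Y)) - ksign 1 (1 + 1) ((?Y * ?Y - ksign 1 1 (?Y * ?Y)) * ?Y)"
    by (rule cg_trans[OF gen_br[OF assms br_part[OF assms assms]]]) (intro cg_intros gen_br assms)
  also have "\<dots> = 0" by (simp add: algebra_simps)
  finally show ?thesis by (simp add: cong_mod_def)
qed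

lemma gen_ad_power:
  assumes "x \<in> part V 0"
  shows "free_gen ((br V x ^^ n) y) \<simeq> ((\<lambda>b. free_gen x * b - b * free_gen x) ^^ n) (free_gen y)"
proof (induction n)
  case 0 show ?case by (simp add: cg_refl)
next
  case (Suc n)
  have "free_gen (br V x ((br V x ^^ n) y)) \<simeq> free_gen x * free_gen ((br V x ^^ n) y) - free_gen ((br V x ^^ n) y) * free_gen x"
    by (rule gen_br_even[OF assms])
  also have "\<dots> \<simeq> free_gen x * ((\<lambda>b. free_gen x * b - b * free_gen x) ^^ n) (free_gen y) 
     - ((\<lambda>b. free_gen x * b - b * free_gen x) ^^ n) (free_gen y) * free_gen x"
    by (intro cg_intros Suc)
  finally show ?case by simp
qed

end

locale char_bracket_ideal = bracket_ideal V Q for V :: "('k::field, 'v::ab_group_add) rlsa" and Q +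
  assumes char_gt_2: "CHAR('k) > 2"
begin

lemma prime_char: "prime CHAR('k)"
  using char_gt_2 by (intro prime_CHAR_semidom) simp

lemma odd_char: "odd CHAR('k)"
  using prime_char char_gt_2 by (metis prime_odd_nat)

lemma of_nat_char_free: "of_nat CHAR('k) = (0 :: ('k, 'w) free_alg)"
proof -
  have "(of_nat CHAR('k) :: ('k, 'w) free_alg) = of_nat CHAR('k) * 1" by simp
  also have "\<dots> = free_scal (of_nat CHAR('k)) 1" by (rule free_scal_of_nat[symmetric])
  also have "\<dots> = free_scal 0 1" by (rule arg_cong[where f = "\<lambda>c. free_scal c 1"]) (rule of_nat_CHAR)
  also have "\<dots> = 0" by (rule FV.scale_zero_left)
  finally show ?thesis .
qed

lemma of_nat_invertible: 
  assumes "0 < i" "i < CHAR('k)" shows "of_nat i \<noteq> (0 :: 'k)"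
  using assms of_nat_eq_0_iff_char_dvd[where 'a = 'k, of i] by (auto dest: dvd_imp_le)

text \<open>Left and right multiplication by \<open>x\<close> commute, so in characteristic p the
  p-th power of their difference is the difference of their p-th powers.\<close>

lemma gen_p_commutator:
  assumes "x \<in> part V 0"
  shows "free_gen ((br V x ^^ CHAR('k)) y) \<simeq> free_gen x ^ CHAR('k) * free_gen y - free_gen y * free_gen x ^ CHAR('k)"
proof -
  have "((\<lambda>b. free_gen x * b - b * free_gen x) ^^ CHAR('k)) (free_gen y :: ('k, 'v) free_alg)
     = (((*) (free_gen x)) ^^ CHAR('k)) (free_gen y) - ((\<lambda>b. b * free_gen x) ^^ CHAR('k)) (free_gen y)"
    by (rule funpow_diff_char[OF _ _ _ prime_char odd_char of_nat_char_free]) (auto simp: algebra_simps)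
  moreover have "(((*) (free_gen x)) ^^ n) b = free_gen x ^ n * b" for n and b :: "('k, 'v) free_alg"
    by (induction n) (auto simp: mult.assoc)
  moreover have "((\<lambda>b. b * free_gen x) ^^ n) b = b * free_gen x ^ n" for n and b :: "('k, 'v) free_alg"
    by (induction n) (auto simp: mult.assoc power_commutes)
  ultimately show ?thesis using gen_ad_power[OF assms, of "CHAR('k)" y] by simp
qed

lemma pencil_0: "pencil a b s 0 = b (s 0)"
  and pencil_Suc: "pencil a b s (Suc j) = a (s j) + b (s (Suc j))"
  by (simp_all add: pencil_def)

lemma coeff_ad_pencil: "coeff (ad_pencil V x y P) = pencil (br V x) (br V y) (coeff P)"
  by (rule ext) (auto simp: ad_pencil_def pencil_def coeff_map_poly br_simps coeff_pCons split: nat.split)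

lemma coeff_ad_pencil_power: "coeff ((ad_pencil V x y ^^ n) [:x:]) = (pencil (br V x) (br V y) ^^ n) (pure x)"
proof (induction n)
  case 0 show ?case by (auto simp: fun_eq_iff pure_def coeff_pCons split: nat.split)
next
  case (Suc n) then show ?case by (simp add: coeff_ad_pencil)
qed

lemma pencil_part:
  assumes "x \<in> part V 0" "y \<in> part V 0"
  shows "(pencil (br V x) (br V y) ^^ n) (pure x) k \<in> part V 0"
proof (induction n arbitrary: k)
  case 0 show ?case using assms by (simp add: pure_def)
next
  case (Suc n)
  then show ?case using br_part[OF assms(1), of _ 0] br_part[OF assms(2), of _ 0]
    by (auto simp: pencil_def split: nat.split intro!: part_add)
qed

lemma gen_pencil:
  assumes x: "x \<in> part V 0" and y: "y \<in> part V 0"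
  shows "free_gen ((pencil (br V x) (br V y) ^^ n) (pure x) k) \<simeq>
    ((pencil (\<lambda>b. free_gen x * b - b * free_gen x) (\<lambda>b. free_gen y * b - b * free_gen y) ^^ n) (pure (free_gen x))) k"
proof (induction n arbitrary: k)
  case 0 show ?case using gen_0 by (auto simp: pure_def cong_mod_def two_sidedD[OF Q])
next
  case (Suc n)
  let ?s = "(pencil (br V x) (br V y) ^^ n) (pure x)"
  let ?t = "(pencil (\<lambda>b. free_gen x * b - b * free_gen x) (\<lambda>b. free_gen y * b - b * free_gen y) ^^ n) (pure (free_gen x))"
  have *: "free_gen (br V a (?s k)) \<simeq> free_gen a * ?t k - ?t k * free_gen a" if "a \<in> part V 0" for a k
    by (rule cg_trans[OF gen_br_even[OF that]]) (intro cg_intros Suc)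
  show ?case
  proof (cases k)
    case 0 then show ?thesis using *[OF y, of 0] by (simp add: pencil_0)
  next
    case (Suc j)
    have "free_gen (br V x (?s j) + br V y (?s (Suc j))) \<simeq> (free_gen x * ?t j - ?t j * free_gen x) + (free_gen y * ?t (Suc j) - ?t (Suc j) * free_gen y)"
      by (rule cg_trans[OF gen_add]) (intro cg_intros * x y)
    then show ?thesis using Suc by (simp add: pencil_Suc)
  qed
qed

lemma jacobson_s_part:
  assumes "x \<in> part V 0" "y \<in> part V 0"
  shows "jacobson_s V i x y \<in> part V 0"
  unfolding jacobson_s_def coeff_ad_pencil_power using pencil_part[OF assms] by simp

text \<open>Jacobson's formula in the free algebra, transported to \<open>V\<close>: by
  \<open>gen_pencil\<close> the commutator pencil is congruent to the bracket pencil, and the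
  division by \<open>i\<close> is possible because 0 < i < p.\<close>

lemma gen_power_add:
  assumes x: "x \<in> part V 0" and y: "y \<in> part V 0"
  shows "free_gen (x + y) ^ CHAR('k) \<simeq> free_gen x ^ CHAR('k) + free_gen y ^ CHAR('k)
     + free_gen (\<Sum>i = 1..CHAR('k) - 1. jacobson_s V i x y)"
proof -
  let ?p = "CHAR('k)"
  let ?c = "power_coeff (free_gen x) (free_gen y) ?p"
  note pa = power_add_char[OF prime_char odd_char of_nat_char_free]
  have *: "free_gen (jacobson_s V i x y) \<simeq> ?c i" if i: "i \<in> {1..?p - 1}" for i
  proof -
    obtain k where k: "i = Suc k" using i by (cases i) auto
    have nz: "of_nat i \<noteq> (0 :: 'k)" using i prime_gt_0_nat[OF prime_char] by (intro of_nat_invertible) auto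
    have "free_gen (jacobson_s V i x y) \<simeq> free_scal (inverse (of_nat i)) (free_gen ((pencil (br V x) (br V y) ^^ (?p - 1)) (pure x) k))"
      unfolding jacobson_s_def coeff_ad_pencil_power k by (simp add: gen_scale)
    also have "\<dots> \<simeq> free_scal (inverse (of_nat i)) (of_nat i * ?c i)"
      unfolding k pa(2) by (intro cg_intros gen_pencil x y)
    also have "\<dots> = ?c i" using nz by (simp flip: free_scal_of_nat)
    finally show ?thesis .
  qed
  have "free_gen (x + y) ^ ?p \<simeq> (free_gen x + free_gen y) ^ ?p"
    by (intro cg_intros gen_add)
  also have "\<dots> = free_gen x ^ ?p + free_gen y ^ ?p + (\<Sum>i = 1..?p - 1. ?c i)" by (rule pa(1))
  also have "\<dots> \<simeq> free_gen x ^ ?p + free_gen y ^ ?p + (\<Sum>i = 1..?p - 1. free_gen (jacobson_s V i x y))"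
    by (intro cg_intros cg_sym[OF *])
  also have "\<dots> \<simeq> free_gen x ^ ?p + free_gen y ^ ?p + free_gen (\<Sum>i = 1..?p - 1. jacobson_s V i x y)"
    by (intro cg_intros cg_sym[OF gen_sum])
  finally show ?thesis .
qed

end

section \<open>The Poincare--Birkhoff--Witt theorem\<close>

text \<open>Two reducible positions of a word overlap in one letter or are disjoint: the two kinds
  of ambiguity in the diamond lemma.\<close>

lemma two_adjacent_pairs:
  assumes "u @ a # b # v = u' @ c # d # v'" "length u < length u'"
  shows "(u' = u @ [a] \<and> c = b \<and> v = d # v') \<or> (\<exists>m. u' = u @ a # b # m \<and> v = m @ c # d # v')"
proof -
  have "\<exists>m. u' = u @ m \<and> a # b # v = m @ c # d # v'"
    using assms unfolding append_eq_append_conv2 by auto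
  then obtain m where m: "u' = u @ m" "a # b # v = m @ c # d # v'" by blast
  show ?thesis using m assms(2) by (cases m; cases "tl m") (auto simp: Cons_eq_append_conv)
qed

fun inversions :: "('a \<Rightarrow> 'a \<Rightarrow> bool) \<Rightarrow> 'a list \<Rightarrow> nat" where
  "inversions lt [] = 0"
| "inversions lt (x # xs) = length (filter (\<lambda>y. lt y x) xs) + inversions lt xs"

lemma inversions_swap:
  assumes "lt j i" "\<not> lt i j"
  shows "inversions lt (u @ j # i # v) < inversions lt (u @ i # j # v)"
  using assms by (induction u) auto

locale lie_super = graded_space g for g :: "('k::field, 'g::ab_group_add) rlsa" +
  assumes lie: "lie_superalgebra g"
begin

lemma bilinear: "even_bilinear g g g (br g)"
  using lie by (simp add: lie_superalgebra_def)

lemmas br_simps = even_bilinear_simps[OF bilinear]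
lemmas br_part = even_bilinear_part[OF bilinear]

lemma br_antisym: "x \<in> part g i \<Longrightarrow> y \<in> part g j \<Longrightarrow> br g x y = - ksign i j (br g y x)"
  using lie unfolding lie_superalgebra_def by blast

lemma br_jacobi: "x \<in> part g i \<Longrightarrow> y \<in> part g j \<Longrightarrow>
    br g x (br g y z) = br g (br g x y) z + ksign i j (br g y (br g x z))"
  using lie unfolding lie_superalgebra_def by blast

text \<open>Jacobi and antisymmetry give 3[y,[y,y]] = 0, which settles all characteristics other
  than 3; there the identity is an axiom.\<close>

lemma br_cube: 
  assumes y: "y \<in> part g 1"
  shows "br g y (br g y y) = 0"
proof (cases "CHAR('k) = 3")
  case True then show ?thesis using lie y unfolding lie_superalgebra_def by blast
next
  case False
  define c where "c = br g y (br g y y)"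
  have "c = br g (br g y y) y - c"
    using br_jacobi[OF y y, of y] by (simp add: c_def)
  moreover have "br g (br g y y) y = - c"
    using br_antisym[OF br_part[OF y y] y] by (simp add: c_def)
  ultimately have c: "c = - c - c" by simp
  have "smul g 3 c = smul g (1 + 1 + 1) c" by simp
  also have "\<dots> = c + c + c" by (simp only: vs.scale_left_distrib vs.scale_one)
  also have "\<dots> = (- c - c) + c + c" using c by (rule arg_cong[where f = "\<lambda>d. d + c + c"])
  finally have "smul g 3 c = 0" by simp
  moreover have "(3 :: 'k) \<noteq> 0"
  proof
    assume "(3 :: 'k) = 0"
    then have "CHAR('k) dvd 3" using of_nat_eq_0_iff_char_dvd[where 'a = 'k, of 3] by simp
    moreover have "CHAR('k) \<noteq> 1" using of_nat_CHAR[where 'a = 'k] by (metis of_nat_1 zero_neq_one)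
    moreover have "prime (3 :: nat)" by simp
    ultimately show False using False by (metis prime_nat_iff)
  qed
  ultimately show ?thesis by (simp add: c_def)
qed

lemma bracket_idealI: "two_sided Q \<Longrightarrow> env_relations g \<subseteq> Q \<Longrightarrow> bracket_ideal g Q"
  by unfold_locales (simp_all add: bilinear)

end

text \<open>A basis of homogeneous elements, and a linear order on it.\<close>

locale ordered_basis = lie_super g for g :: "('k::field, 'g::ab_group_add) rlsa" +
  fixes B :: "'g set" and lt :: "'g \<Rightarrow> 'g \<Rightarrow> bool"
  assumes two: "(2 :: 'k) \<noteq> 0"
    and independent: "vs.independent B" and spanning: "vs.span B = UNIV"
    and homogeneous: "B \<subseteq> part g 0 \<union> part g 1"
    and lt_irrefl: "\<not> lt a a" and lt_trans: "lt a b \<Longrightarrow> lt b c \<Longrightarrow> lt a c" and lt_total: "a \<noteq> b \<Longrightarrow> lt a b \<or> lt b a"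
begin

definition coef :: "'g \<Rightarrow> 'g \<Rightarrow> 'k" where "coef = vs.representation B"
definition deg :: "'g \<Rightarrow> bit" where "deg b = (if b \<in> part g 0 then 0 else 1)"
definition sgn :: "'g \<Rightarrow> 'g \<Rightarrow> 'k" where "sgn a b = (if deg a = 1 \<and> deg b = 1 then -1 else 1)"
definition red :: "'g \<Rightarrow> 'g \<Rightarrow> bool" where "red i j \<longleftrightarrow> lt j i \<or> (i = j \<and> deg i = 1)"
text \<open>A repeated odd letter satisfies 2yy = [y,y] in U(g), whence the factor 1/2 in its
  reduction.\<close>

definition half :: "'g \<Rightarrow> 'g \<Rightarrow> 'k" where "half i j = (if i = j then 1 / 2 else 1)"

lemma part_deg: "b \<in> B \<Longrightarrow> b \<in> part g (deg b)"
  using homogeneous by (auto simp: deg_def)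

lemma deg_eqI:
  assumes "b \<in> B" "b \<in> part g i" shows "deg b = i"
proof -
  have "b \<noteq> 0" using independent assms(1) vs.dependent_zero by blast
  then show ?thesis using part_disjoint[of b] assms(2) homogeneous by (cases i) (auto simp: deg_def)
qed

lemma finite_coef: "finite {l. coef x l \<noteq> 0}"
  unfolding coef_def by (rule vs.finite_representation)

lemma coef_basis: "coef x l \<noteq> 0 \<Longrightarrow> l \<in> B"
  unfolding coef_def by (rule vs.representation_ne_zero)

lemma coef_sum: "(\<Sum>l | coef x l \<noteq> 0. smul g (coef x l) l) = x"
  unfolding coef_def by (rule vs.sum_nonzero_representation_eq[OF independent]) (simp add: spanning)

text \<open>Projecting the expansion of \<open>x\<close> to its own degree shows that the terms of
  the other parity add up to zero; independence then kills their coefficients.\<close>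

lemma coef_homogeneous:
  assumes "x \<in> part g i" "coef x l \<noteq> 0"
  shows "l \<in> part g i"
proof (rule ccontr)
  assume "l \<notin> part g i"
  let ?S = "{l. coef x l \<noteq> 0}"
  have "x = comp_part g i x" using comp_part_homogeneous[OF assms(1)] by simp
  also have "\<dots> = comp_part g i (\<Sum>l\<in>?S. smul g (coef x l) l)" by (simp add: coef_sum)
  also have "\<dots> = (\<Sum>l\<in>?S. smul g (coef x l) (comp_part g i l))"
    by (simp add: additive_sum[of "comp_part g i", OF comp_part_add] comp_part_scale)
  also have "\<dots> = (\<Sum>l\<in>?S. if l \<in> part g i then smul g (coef x l) l else 0)"
  proof (intro sum.cong refl)
    fix l assume "l \<in> ?S"
    then have l: "l \<in> B" by (auto intro: coef_basis)
    then show "smul g (coef x l) (comp_part g i l) = (if l \<in> part g i then smul g (coef x l) l else 0)"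
      using comp_part_homogeneous[OF part_deg[OF l], of i] deg_eqI[OF l, of i] part_deg[OF l] by auto
  qed
  finally have eq: "x = (\<Sum>l\<in>?S. if l \<in> part g i then smul g (coef x l) l else 0)" .
  have "(\<Sum>l\<in>?S. smul g (if l \<in> part g i then 0 else coef x l) l)
     = (\<Sum>l\<in>?S. smul g (coef x l) l - (if l \<in> part g i then smul g (coef x l) l else 0))"
    by (rule sum.cong) auto
  also have "\<dots> = x - x" unfolding sum_subtractf coef_sum eq[symmetric] ..
  finally have "(\<Sum>l\<in>?S. smul g (if l \<in> part g i then 0 else coef x l) l) = 0" by simp
  from vs.independentD[OF independent finite_coef _ this, of l] coef_basis show False
    using assms(2) \<open>l \<notin> part g i\<close> by auto
qed

definition lext :: "('g \<Rightarrow> 'k) \<Rightarrow> 'g \<Rightarrow> 'k" where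
  "lext h x = (\<Sum>l | coef x l \<noteq> 0. coef x l * h l)"

lemma lext_superset: "finite W \<Longrightarrow> {l. coef x l \<noteq> 0} \<subseteq> W \<Longrightarrow> lext h x = (\<Sum>l\<in>W. coef x l * h l)"
  unfolding lext_def by (rule sum.mono_neutral_left) auto

lemma klinear_lext: "klinear (smul g) (*) (lext h)"
proof (rule klinearI[OF vs.vector_space_axioms vector_space_field])
  fix x y c
  have sp: "v \<in> vs.span B" for v by (simp add: spanning)
  let ?W = "{l. coef x l \<noteq> 0} \<union> {l. coef y l \<noteq> 0}"
  have "lext h (x + y) = (\<Sum>l\<in>?W. coef (x + y) l * h l)" "lext h x = (\<Sum>l\<in>?W. coef x l * h l)"
    "lext h y = (\<Sum>l\<in>?W. coef y l * h l)"
    by (rule lext_superset; auto simp: finite_coef; auto simp: coef_def vs.representation_add[OF independent sp sp])+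
  then show "lext h (x + y) = lext h x + lext h y"
    by (simp add: coef_def vs.representation_add[OF independent sp sp] distrib_right sum.distrib)
  have "lext h (smul g c x) = (\<Sum>l | coef x l \<noteq> 0. coef (smul g c x) l * h l)"
    by (rule lext_superset) (auto simp: finite_coef, auto simp: coef_def vs.representation_scale[OF independent sp])
  then show "lext h (smul g c x) = c * lext h x"
    by (simp add: lext_def coef_def vs.representation_scale[OF independent sp] sum_distrib_left mult.assoc)
qed

lemmas lext_simps = klinear_add[OF klinear_lext] klinear_scale[OF klinear_lext] klinear_zero[OF klinear_lext]
  klinear_minus[OF klinear_lext] klinear_diff[OF klinear_lext]

lemma lext_basis: "b \<in> B \<Longrightarrow> lext h b = h b"
proof -
  assume b: "b \<in> B"
  have "coef b l = (if l = b then 1 else 0)" for l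
    unfolding coef_def using vs.representation_basis[OF independent b] by simp
  then show ?thesis by (simp add: lext_def)
qed

lemma lext_cong: "(\<And>l. l \<in> B \<Longrightarrow> coef x l \<noteq> 0 \<Longrightarrow> h l = h' l) \<Longrightarrow> lext h x = lext h' x"
  unfolding lext_def by (intro sum.cong refl) (auto dest: coef_basis)

lemma lext_expand: "klinear (smul g) (*) f \<Longrightarrow> f x = lext f x"
  unfolding lext_def by (subst coef_sum[symmetric]) (simp add: klinear_sum klinear_scale)

lemma lext_add_fun: "lext (\<lambda>l. h l + h' l) x = lext h x + lext h' x"
  by (simp add: lext_def distrib_left sum.distrib)

lemma lext_scale_fun: "lext (\<lambda>l. c * h l) x = c * lext h x"
  by (simp add: lext_def sum_distrib_left mult.left_commute)

lemma lext_swap: "lext (\<lambda>l. lext (\<lambda>m. h l m) y) x = lext (\<lambda>m. lext (\<lambda>l. h l m) x) y"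
  unfolding lext_def sum_distrib_left by (subst sum.swap) (simp add: mult.left_commute)

text \<open>Reduction of a descent, or of a repeated odd letter, in a word given by its values \<open>h\<close>
  at all possible replacements.\<close>

definition reduct :: "('g list \<Rightarrow> 'k) \<Rightarrow> 'g \<Rightarrow> 'g \<Rightarrow> 'k" where
  "reduct h i j = (if i = j then 0 else sgn i j * h [j, i]) + half i j * lext (\<lambda>l. h [l]) (br g i j)"

lemma reduct_cong:
  assumes "i \<noteq> j \<Longrightarrow> h [j, i] = h' [j, i]" "\<And>l. l \<in> B \<Longrightarrow> h [l] = h' [l]"
  shows "reduct h i j = reduct h' i j"
proof -
  have "lext (\<lambda>l. h [l]) (br g i j) = lext (\<lambda>l. h' [l]) (br g i j)" by (rule lext_cong) (rule assms)
  then show ?thesis using assms(1) by (simp add: reduct_def)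
qed

lemma reduct_swap: "reduct (\<lambda>x. reduct (\<lambda>y. h x y) c d) a b = reduct (\<lambda>y. reduct (\<lambda>x. h x y) a b) c d"
proof -
  have l: "lext (\<lambda>l. (if P then 0 else u * h1 l) + w * h2 l) x = (if P then 0 else u * lext h1 x) + w * lext h2 x" 
    for P u w h1 h2 x by (simp add: lext_add_fun lext_scale_fun) (simp add: lext_def)
  show ?thesis unfolding reduct_def l 
    by (subst lext_swap) (simp add: algebra_simps)
qed

context
  fixes \<beta> :: "'g list \<Rightarrow> 'k"
begin

definition reducible :: "'g list \<Rightarrow> 'g list \<times> 'g \<times> 'g \<times> 'g list \<Rightarrow> bool" where
  "reducible w = (\<lambda>(u, i, j, v). w = u @ i # j # v \<and> red i j)"

text \<open>Dual version of rewriting to normal form: \<open>\<beta>\<close> prescribes a functional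
  on irreducible words, and \<open>nf w\<close> is its value at a normal form of \<open>w\<close>.
  The position to be reduced is an arbitrary choice; \<open>confluent_all\<close> shows that for
  basis words it does not matter.\<close>

function nf :: "'g list \<Rightarrow> 'k" where
  "nf w = (if \<exists>t. reducible w t then
     (case (SOME t. reducible w t) of (u, i, j, v) \<Rightarrow>
       (if i = j then 0 else sgn i j * nf (u @ j # i # v))
         + half i j * (\<Sum>l | coef (br g i j) l \<noteq> 0. coef (br g i j) l * nf (u @ l # v)))
     else \<beta> w)"
  by pat_completeness auto
termination
\<comment> \<open>A bracket term is shorter than the word; a swapped word has the same length and
  fewer inversions.\<close>
proof (relation "measures [length, inversions lt]")
  fix w u i j v and q :: "'g \<times> 'g \<times> 'g list" and r :: "'g \<times> 'g list"
  assume ex: "\<exists>t. reducible w t" and q: "(u, q) = (SOME t. reducible w t)" "(i, r) = q" "(j, v) = r"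
  have "reducible w (u, i, j, v)" using someI_ex[OF ex] q by metis
  then have w: "w = u @ i # j # v" "red i j" by (auto simp: reducible_def)
  show "(u @ l # v, w) \<in> measures [length, inversions lt]" for l by (simp add: w)
  assume "i \<noteq> j"
  then have "lt j i" "\<not> lt i j" using w(2) lt_irrefl lt_trans by (auto simp: red_def)
  then show "(u @ j # i # v, w) \<in> measures [length, inversions lt]" by (simp add: w inversions_swap)
qed simp

declare nf.simps [simp del]

lemma nf_irreducible: "(\<And>u i j v. w = u @ i # j # v \<Longrightarrow> \<not> red i j) \<Longrightarrow> nf w = \<beta> w"
  by (subst nf.simps) (auto simp: reducible_def)

lemma nf_reducible:
  assumes "w = u @ i # j # v" "red i j"
  obtains u' i' j' v' where "w = u' @ i' # j' # v'" "red i' j'" "nf w = reduct (\<lambda>x. nf (u' @ x @ v')) i' j'"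
proof -
  obtain u' i' j' v' where t: "(SOME t. reducible w t) = (u', i', j', v')" by (metis prod_cases4)
  have ex: "\<exists>t. reducible w t" using assms by (auto simp: reducible_def)
  then have "reducible w (u', i', j', v')" using someI_ex[OF ex] t by metis
  moreover have "nf w = reduct (\<lambda>x. nf (u' @ x @ v')) i' j'"
    by (subst nf.simps) (simp only: ex if_True t prod.case, simp add: reduct_def lext_def)
  ultimately show ?thesis using that by (auto simp: reducible_def)
qed

text \<open>Multilinear extension of a function on basis words to words in arbitrary elements of
  \<open>g\<close>.\<close>

fun mlin :: "('g list \<Rightarrow> 'k) \<Rightarrow> 'g list \<Rightarrow> 'k" where
  "mlin \<phi> [] = \<phi> []"
| "mlin \<phi> (x # xs) = lext (\<lambda>l. mlin (\<lambda>w. \<phi> (l # w)) xs) x"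

lemma mlin_basis: "set xs \<subseteq> B \<Longrightarrow> mlin \<phi> xs = \<phi> xs"
  by (induction xs arbitrary: \<phi>) (auto simp: lext_basis)

lemma klinear_lext_param:
  assumes "\<And>l. klinear (smul g) (*) (\<lambda>x. f l x)"
  shows "klinear (smul g) (*) (\<lambda>x. lext (\<lambda>l. f l x) a)"
  by (rule klinearI[OF vs.vector_space_axioms vector_space_field])
    (simp_all add: klinearD[OF assms] lext_add_fun lext_scale_fun)

lemma klinear_mlin: "klinear (smul g) (*) (\<lambda>x. mlin \<phi> (u @ x # v))"
proof (induction u arbitrary: \<phi>)
  case Nil show ?case by (simp add: klinear_lext)
next
  case (Cons a u)
  show ?case unfolding append_Cons mlin.simps by (rule klinear_lext_param[OF Cons])
qed

abbreviation nfl where "nfl \<equiv> mlin nf"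

definition confluent :: "'g list \<Rightarrow> bool" where
  "confluent w \<longleftrightarrow> (\<forall>u i j v. w = u @ i # j # v \<longrightarrow> red i j \<longrightarrow> nf w = reduct (\<lambda>x. nf (u @ x @ v)) i j)"

lemma lext_nf: "set u \<subseteq> B \<Longrightarrow> set v \<subseteq> B \<Longrightarrow> lext (\<lambda>l. nf (u @ l # v)) x = nfl (u @ x # v)"
proof -
  assume B: "set u \<subseteq> B" "set v \<subseteq> B"
  have "nfl (u @ x # v) = lext (\<lambda>l. nfl (u @ l # v)) x"
    by (rule lext_expand[OF klinear_mlin])
  also have "\<dots> = lext (\<lambda>l. nf (u @ l # v)) x"
    by (rule lext_cong) (use B in \<open>simp add: mlin_basis\<close>)
  finally show ?thesis by simp
qed

lemma sgn_simps: "sgn a b * sgn a b = 1" "sgn a b = sgn b a" "a = b \<Longrightarrow> deg a = 1 \<Longrightarrow> sgn a b = - 1"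
  by (auto simp: sgn_def)

lemma sgn_cases: "sgn a b = 1 \<or> sgn a b = - 1"
  by (simp add: sgn_def)

lemma ksign_scale: "a \<in> B \<Longrightarrow> b \<in> B \<Longrightarrow> ksign (deg a) (deg b) v = smul g (sgn a b) v"
  by (auto simp: sgn_def ksign_def)

lemma br_basis_antisym: "a \<in> B \<Longrightarrow> b \<in> B \<Longrightarrow> br g a b = smul g (- sgn a b) (br g b a)"
  using br_antisym[OF part_deg part_deg, of a b] by (auto simp: sgn_def ksign_def)

text \<open>The relation for a pair of basis letters holds, provided that all words of that length
  are confluent, for both orders of the letters.\<close>

lemma nf_swap_basis:
  assumes conf: "\<And>w. length w = length u + length v + 2 \<Longrightarrow> set w \<subseteq> B \<Longrightarrow> confluent w"
    and B: "set u \<subseteq> B" "set v \<subseteq> B" "a \<in> B" "b \<in> B"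
  shows "nf (u @ a # b # v) - sgn a b * nf (u @ b # a # v) = nfl (u @ br g a b # v)"
proof -
  have lt: "nf (u @ a # b # v) - sgn a b * nf (u @ b # a # v) = nfl (u @ br g a b # v)"
    if "lt b a" "a \<in> B" "b \<in> B" for a b
  proof -
    have "confluent (u @ a # b # v)" by (rule conf) (use that B in auto)
    then have "nf (u @ a # b # v) = reduct (\<lambda>x. nf (u @ x @ v)) a b"
      using that(1) unfolding confluent_def red_def by blast
    then show ?thesis using that lt_irrefl[of a] by (auto simp: reduct_def half_def lext_nf B)
  qed
  consider "lt b a" | "lt a b" | "a = b" "deg a = 0" | "a = b" "deg a = 1"
    using lt_total by (metis bit.exhaust)
  then show ?thesis
  proof cases
    case 1 then show ?thesis using lt B by blast
  next
    case 2
    have "nfl (u @ br g a b # v) = - sgn a b * nfl (u @ br g b a # v)"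
      unfolding br_basis_antisym[OF B(3,4)] by (rule klinear_scale[OF klinear_mlin])
    then have "nfl (u @ br g a b # v) = - sgn a b * (nf (u @ b # a # v) - sgn a b * nf (u @ a # b # v))"
      using lt[OF 2 B(4,3)] sgn_simps(2)[of a b] by simp
    also have "\<dots> = (sgn a b * sgn a b) * nf (u @ a # b # v) - sgn a b * nf (u @ b # a # v)"
      by (simp add: algebra_simps)
    finally show ?thesis by (simp add: sgn_simps(1))
  next
    case 3
    have "br g a a = - br g a a" using br_antisym[OF part_deg part_deg, of a a] B 3 by simp
    then have "smul g 2 (br g a a) = 0" using vs.scale_left_distrib[of 1 1 "br g a a"] by (simp add: eq_neg_iff_add_eq_0)
    then have "br g a a = 0" using two by simp
    then show ?thesis using 3 by (simp add: sgn_def klinear_zero[OF klinear_mlin])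
  next
    case 4
    have "confluent (u @ a # b # v)" by (rule conf) (use B in auto)
    then have "nf (u @ a # b # v) = reduct (\<lambda>x. nf (u @ x @ v)) a b"
      using 4 unfolding confluent_def red_def by blast
    then have "nf (u @ a # b # v) = 1/2 * nfl (u @ br g a b # v)"
      using 4 by (simp add: reduct_def half_def lext_nf B)
    then show ?thesis using 4 two by (simp add: sgn_def mult.commute)
  qed
qed

lemma klinear_vanish_homogeneous:
  assumes "klinear (smul g) (*) f" "\<And>l. l \<in> B \<Longrightarrow> l \<in> part g i \<Longrightarrow> f l = 0" "x \<in> part g i"
  shows "f x = 0"
  using lext_expand[OF assms(1), of x] coef_homogeneous[OF assms(3)] assms(2)
  by (auto simp: lext_def coef_basis intro!: sum.neutral)

text \<open>The expression is linear in \<open>x\<close> and in \<open>y\<close>, and a homogeneous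
  element involves only basis letters of its parity; \<open>nf_swap_basis\<close> settles
  those.\<close>

lemma nfl_swap:
  assumes conf: "\<And>w. length w = length u + length v + 2 \<Longrightarrow> set w \<subseteq> B \<Longrightarrow> confluent w"
    and B: "set u \<subseteq> B" "set v \<subseteq> B" and x: "x \<in> part g i" and y: "y \<in> part g j"
  shows "nfl (u @ x # y # v) - ksign i j (nfl (u @ y # x # v)) - nfl (u @ br g x y # v) = 0"
proof -
  have ks: "ksign i j c = (if i = 1 \<and> j = 1 then -1 else 1) * c" for c :: 'k by (simp add: ksign_def)
  let ?f = "\<lambda>x y. nfl (u @ x # y # v) - ksign i j (nfl (u @ y # x # v)) - nfl (u @ br g x y # v)"
  have l2: "klinear (smul g) (*) (\<lambda>y. nfl (u @ x # y # v))" for x using klinear_mlin[of nf "u @ [x]" v] by simp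
  have lb: "klinear (smul g) (*) (\<lambda>y. nfl (u @ br g x y # v))" "klinear (smul g) (*) (\<lambda>x. nfl (u @ br g x y # v))" for x y
    by (rule klinear_compose[OF even_bilinear_right[OF bilinear] klinear_mlin],
        rule klinear_compose[OF even_bilinear_left[OF bilinear] klinear_mlin])
  have ly: "klinear (smul g) (*) (\<lambda>y. ?f x y)" and lx: "klinear (smul g) (*) (\<lambda>x. ?f x y)" for x y
    unfolding ks
    by (intro klinear_minus_fun klinear_scaled[where t = "(*)"] lb l2 klinear_mlin)+
  show ?thesis
  proof (rule klinear_vanish_homogeneous[OF lx _ x], rule klinear_vanish_homogeneous[OF ly _ y])
    fix a b assume *: "a \<in> B" "a \<in> part g i" "b \<in> B" "b \<in> part g j"
    then have "sgn a b = (if i = 1 \<and> j = 1 then -1 else 1)" by (simp add: sgn_def deg_eqI)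
    then show "?f a b = 0" using nf_swap_basis[OF conf B *(1,3)] unfolding ks
      using * B by (simp add: mlin_basis)
  qed
qed

text \<open>Resolve a b c in both ways. All words involved are smaller, so \<open>nf\<close> may be
  rewritten freely on them, and the two results differ by values on contracted words that cancel by
  the Jacobi identity. Repeated odd letters use 2yy = [y,y], and a triple repetition comes down to
  [y,[y,y]] = 0.\<close>

lemma confluent_overlap:
  assumes conf: "\<And>w. (w, u @ a # b # c # v) \<in> measures [length, inversions lt] \<Longrightarrow> set w \<subseteq> B \<Longrightarrow> confluent w"
    and B: "set u \<subseteq> B" "set v \<subseteq> B" "a \<in> B" "b \<in> B" "c \<in> B" and red: "red a b" "red b c"
  shows "reduct (\<lambda>x. nf (u @ x @ c # v)) a b = reduct (\<lambda>x. nf (u @ a # x @ v)) b c"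
proof -
  \<comment> \<open>\<open>n2\<close> and \<open>n1\<close> evaluate words in which the three
    letters have been contracted to two elements of \<open>g\<close>, respectively to one.\<close>
  define n2 where "n2 x y = nfl (u @ x # y # v)" for x y
  define n1 where "n1 x = nfl (u @ x # v)" for x
  have n1: "klinear (smul g) (*) n1" unfolding n1_def by (rule klinear_mlin)
  note n1_simps = klinearD(1-5)[OF n1]
  note mem = part_deg[OF B(3)] part_deg[OF B(4)] part_deg[OF B(5)]
  have swap: "n2 x y - ksign i j (n2 y x) = n1 (br g x y)" if "x \<in> part g i" "y \<in> part g j" for x y i j
  proof -
    have "nfl (u @ x # y # v) - ksign i j (nfl (u @ y # x # v)) - nfl (u @ br g x y # v) = 0"
      by (rule nfl_swap[OF conf B(1,2) that]) auto
    then show ?thesis by (simp add: n1_def n2_def)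
  qed
  have lr: "lext (\<lambda>l. nf (u @ d # l # v)) x = n2 d x" "lext (\<lambda>l. nf (u @ l # d # v)) x = n2 x d" if "d \<in> B" for d x
    using lext_nf[of "u @ [d]" v x] lext_nf[of u "d # v" x] B that by (simp_all add: n2_def)
  have step: "nf (u' @ i # j # v') = (if i = j then 0 else sgn i j * nf (u' @ j # i # v')) + half i j * lext (\<lambda>l. nf (u' @ l # v')) (br g i j)"
    if "(u' @ i # j # v', u @ a # b # c # v) \<in> measures [length, inversions lt]" "set (u' @ i # j # v') \<subseteq> B" "red i j" for u' i j v'
    using conf[OF that(1,2)] that(3) by (auto simp: confluent_def reduct_def)
  have asym: "lt x y \<Longrightarrow> \<not> lt y x" for x y using lt_trans lt_irrefl by blast
  have inv1: "(u @ b # a # c # v, u @ a # b # c # v) \<in> measures [length, inversions lt]" if "lt b a"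
    using inversions_swap[of lt b a u "c # v"] that asym[OF that] by simp
  have inv2: "(u @ a # c # b # v, u @ a # b # c # v) \<in> measures [length, inversions lt]" if "lt c b"
    using inversions_swap[of lt c b "u @ [a]" "v"] that asym[OF that] by simp
  have inv12: "(u @ b # c # a # v, u @ a # b # c # v) \<in> measures [length, inversions lt]" if "lt b a" "lt c a"
    using inversions_swap[of lt b a u "c # v"] inversions_swap[of lt c a "u @ [b]" "v"] that asym[OF that(1)] asym[OF that(2)] by simp
  have inv21: "(u @ c # a # b # v, u @ a # b # c # v) \<in> measures [length, inversions lt]" if "lt c b" "lt c a"
    using inversions_swap[of lt c b "u @ [a]" "v"] inversions_swap[of lt c a u "b # v"] that asym[OF that(1)] asym[OF that(2)] by simp
  have r: "reduct (\<lambda>x. nf (u @ x @ c # v)) a b = (if a = b then 0 else sgn a b * nf (u @ b # a # c # v)) + half a b * n2 (br g a b) c"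
     "reduct (\<lambda>x. nf (u @ a # x @ v)) b c = (if b = c then 0 else sgn b c * nf (u @ a # c # b # v)) + half b c * n2 a (br g b c)"
    by (simp_all add: reduct_def lr B)
  have ksw: "n2 x y - (if i = 1 \<and> j = 1 then -1 else 1) * (n2 y x) = n1 (br g x y)" if "x \<in> part g i" "y \<in> part g j" for x y i j
    using swap[OF that] by (cases i; cases j) (simp_all add: ksign_def)
  have J1: "n2 (br g a b) c - (sgn a c * sgn b c) * n2 c (br g a b) = n1 (br g (br g a b) c)"
    using ksw[OF br_part[OF mem(1,2)] mem(3)] by (cases "deg a"; cases "deg b"; cases "deg c") (simp_all add: sgn_def)
  have J2: "n2 b (br g a c) - (sgn a b * sgn b c) * n2 (br g a c) b = n1 (br g b (br g a c))"
    using ksw[OF mem(2) br_part[OF mem(1,3)]] by (cases "deg a"; cases "deg b"; cases "deg c") (simp_all add: sgn_def)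
  have J3: "n2 a (br g b c) - (sgn a b * sgn a c) * n2 (br g b c) a = n1 (br g a (br g b c))"
    using ksw[OF mem(1) br_part[OF mem(2,3)]] by (cases "deg a"; cases "deg b"; cases "deg c") (simp_all add: sgn_def)
  have jac: "n1 (br g a (br g b c)) = n1 (br g (br g a b) c) + sgn a b * n1 (br g b (br g a c))"
    unfolding br_jacobi[OF mem(1,2)] ksign_scale[OF B(3,4)] by (simp add: n1_simps)
  consider "lt b a" "lt c b" | "a = b" "deg a = 1" "lt c b" | "lt b a" "b = c" "deg b = 1" | "a = b" "b = c" "deg a = 1"
    using red by (auto simp: red_def)
  then show ?thesis
  proof cases
    case 1
    then have ca: "lt c a" using lt_trans by blast
    have ne: "a \<noteq> b" "b \<noteq> c" "a \<noteq> c" using 1 ca lt_irrefl by auto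
    have "nf (u @ b # a # c # v) = sgn a c * nf (u @ b # c # a # v) + n2 b (br g a c)"
      using step[of "u @ [b]" a c v] inv1 1 B ca ne by (simp add: red_def half_def lr)
    moreover have "nf (u @ b # c # a # v) = sgn b c * nf (u @ c # b # a # v) + n2 (br g b c) a"
      using step[of u b c "a # v"] inv12 1 B ca ne by (simp add: red_def half_def lr)
    moreover have "nf (u @ a # c # b # v) = sgn a c * nf (u @ c # a # b # v) + n2 (br g a c) b"
      using step[of u a c "b # v"] inv2 1 B ca ne by (simp add: red_def half_def lr)
    moreover have "nf (u @ c # a # b # v) = sgn a b * nf (u @ c # b # a # v) + n2 c (br g a b)"
      using step[of "u @ [c]" a b v] inv21 1 B ca ne by (simp add: red_def half_def lr)
    ultimately have "reduct (\<lambda>x. nf (u @ x @ c # v)) a b - reduct (\<lambda>x. nf (u @ a # x @ v)) b c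
       = (n2 (br g a b) c - (sgn a c * sgn b c) * n2 c (br g a b))
        + sgn a b * (n2 b (br g a c) - (sgn a b * sgn b c) * n2 (br g a c) b)
        - (n2 a (br g b c) - (sgn a b * sgn a c) * n2 (br g b c) a)"
      unfolding r using ne sgn_cases[of a b] sgn_cases[of a c] sgn_cases[of b c]
      by (elim disjE) (simp_all add: half_def)
    then show ?thesis unfolding J1 J2 J3 jac by simp
  next
    case 2
    then have ne: "b \<noteq> c" using lt_irrefl by auto
    have "nf (u @ b # c # b # v) = sgn b c * nf (u @ c # b # b # v) + n2 (br g b c) b"
      using step[of u b c "b # v"] inv2 2 B ne by (simp add: red_def half_def lr)
    moreover have "nf (u @ c # b # b # v) = 1 / 2 * n2 c (br g b b)"
      using step[of "u @ [c]" b b v] inv21 2 B ne by (simp add: red_def half_def lr)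
    \<comment> \<open>Doubled, to clear the factor 1/2 that comes with the repeated odd
      letter.\<close>
    ultimately have "2 * (reduct (\<lambda>x. nf (u @ x @ c # v)) b b - reduct (\<lambda>x. nf (u @ b # x @ v)) b c)
       = (n2 (br g b b) c - (sgn b c * sgn b c) * n2 c (br g b b))
        - 2 * (n2 b (br g b c) - (sgn b b * sgn b c) * n2 (br g b c) b)"
      using r 2 ne sgn_cases[of b c] two
      by (elim disjE) (simp_all add: half_def sgn_simps(3) distrib_left right_diff_distrib mult.commute[of _ 2])
    also have "\<dots> = n1 (br g (br g b b) c) - 2 * n1 (br g b (br g b c))"
      using J1 J3 2 by simp
    also have "\<dots> = 0" using jac 2 by (simp add: sgn_simps(3))
    finally show ?thesis using two 2 by simp
  next
    case 3
    then have ne: "a \<noteq> b" using lt_irrefl by auto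
    have "nf (u @ b # a # b # v) = sgn a b * nf (u @ b # b # a # v) + n2 b (br g a b)"
      using step[of "u @ [b]" a b v] inv1 3 B ne by (simp add: red_def half_def lr)
    moreover have "nf (u @ b # b # a # v) = 1 / 2 * n2 (br g b b) a"
      using step[of u b b "a # v"] inv12 3 B ne by (simp add: red_def half_def lr)
    ultimately have "2 * (reduct (\<lambda>x. nf (u @ x @ b # v)) a b - reduct (\<lambda>x. nf (u @ a # x @ v)) b b)
       = 2 * (n2 (br g a b) b - (sgn a b * sgn b b) * n2 b (br g a b))
        - (n2 a (br g b b) - (sgn a b * sgn a b) * n2 (br g b b) a)"
      using r 3 ne sgn_cases[of a b] two
      by (elim disjE) (simp_all add: half_def sgn_simps(3) distrib_left right_diff_distrib mult.commute[of _ 2])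
    also have "\<dots> = 2 * n1 (br g (br g a b) b) - n1 (br g a (br g b b))"
      using J1 J3 3 by simp
    also have "\<dots> = 0"
    proof -
      have "br g b (br g a b) = smul g (sgn a b) (br g (br g a b) b)"
        using br_antisym[OF mem(2) br_part[OF mem(1,2)]] 3(3) by (cases "deg a") (simp_all add: sgn_def)
      then have "sgn a b * n1 (br g b (br g a b)) = n1 (br g (br g a b) b)"
        by (simp add: n1_simps) (simp add: mult.assoc[symmetric] sgn_simps(1))
      then show ?thesis using jac 3 by simp
    qed
    finally show ?thesis using two 3 by simp
  next
    case 4
    have "2 * (reduct (\<lambda>x. nf (u @ x @ b # v)) b b - reduct (\<lambda>x. nf (u @ b # x @ v)) b b)
      = n2 (br g b b) b - n2 b (br g b b)"
      using r 4 two by (simp add: half_def field_simps)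
    also have "\<dots> = - n1 (br g b (br g b b))" using J3 4 by (simp add: sgn_def) (metis minus_diff_eq)
    also have "\<dots> = 0" using br_cube[of b] mem(2) 4 by (simp add: n1_simps)
    finally show ?thesis using two 4 by simp
  qed
qed

text \<open>Diamond lemma, by induction on length and then on inversions. Overlapping positions are
  treated by \<open>confluent_overlap\<close>; reductions at disjoint positions commute by
  \<open>reduct_swap\<close>.\<close>

lemma confluent_all: "set w \<subseteq> B \<Longrightarrow> confluent w"
proof (induction w rule: wf_induct_rule[OF wf_measures[of "[length, inversions lt]"]])
  case (1 w)
  \<comment> \<open>One of two distinct positions lies further left; by symmetry it may be taken to
    be the first.\<close>
  have before: "reduct (\<lambda>x. nf (u @ x @ v)) a b = reduct (\<lambda>x. nf (u' @ x @ v')) c d"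
    if w: "w = u @ a # b # v" "w = u' @ c # d # v'" and red: "red a b" "red c d" and less: "length u < length u'"
    for u a b v u' c d v'
    using two_adjacent_pairs[OF w(2)[unfolded w(1)] less]
  proof (elim disjE exE conjE)
    assume *: "u' = u @ [a]" "c = b" "v = d # v'"
    have "reduct (\<lambda>x. nf (u @ x @ d # v')) a b = reduct (\<lambda>x. nf (u @ a # x @ v')) b d"
    proof (rule confluent_overlap)
      show "confluent w'" if "(w', u @ a # b # d # v') \<in> measures [length, inversions lt]" "set w' \<subseteq> B" for w'
        using 1(1)[OF _ that(2)] that(1) w(1) * by simp
    qed (use 1(2) w * red in auto)
    then show ?thesis using * by simp
  next
    fix m assume *: "u' = u @ a # b # m" "v = m @ c # d # v'"
    have wf: "nf (u @ x @ m @ c # d # v') = reduct (\<lambda>y. nf (u @ x @ m @ y @ v')) c d"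
      if "(u @ x @ m @ c # d # v', w) \<in> measures [length, inversions lt]" "set x \<subseteq> B" for x
    proof -
      have c: "confluent (u @ x @ m @ c # d # v')"
        by (rule 1(1)[OF that(1)]) (use 1(2) that w * in auto)
      show ?thesis using c[unfolded confluent_def, rule_format, of "u @ x @ m" c d v'] red(2) by simp
    qed
    have wf': "nf (u @ a # b # m @ y @ v') = reduct (\<lambda>x. nf (u @ x @ m @ y @ v')) a b"
      if "(u @ a # b # m @ y @ v', w) \<in> measures [length, inversions lt]" "set y \<subseteq> B" for y
    proof -
      have c: "confluent (u @ a # b # m @ y @ v')"
        by (rule 1(1)[OF that(1)]) (use 1(2) that w * in auto)
      show ?thesis using c[unfolded confluent_def, rule_format, of u a b "m @ y @ v'"] red(1) by simp
    qed
    have asym: "lt j i \<and> \<not> lt i j" if "red i j" "i \<noteq> j" for i j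
      using that lt_trans lt_irrefl unfolding red_def by blast
    have BB: "a \<in> B" "b \<in> B" "c \<in> B" "d \<in> B" using 1(2) unfolding w(1) * by auto
    have "reduct (\<lambda>x. nf (u @ x @ v)) a b = reduct (\<lambda>x. reduct (\<lambda>y. nf (u @ x @ m @ y @ v')) c d) a b"
    proof (rule reduct_cong)
      show "nf (u @ [b, a] @ v) = reduct (\<lambda>y. nf (u @ [b, a] @ m @ y @ v')) c d" if "a \<noteq> b"
        unfolding *(2) using asym[OF red(1) that] w(1) *(2) BB inversions_swap[of lt b a u v]
        by (intro wf) auto
      show "nf (u @ [l] @ v) = reduct (\<lambda>y. nf (u @ [l] @ m @ y @ v')) c d" if "l \<in> B" for l
        unfolding *(2) using w(1) *(2) that by (intro wf) auto
    qed
    also have "\<dots> = reduct (\<lambda>y. reduct (\<lambda>x. nf (u @ x @ m @ y @ v')) a b) c d"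
      by (rule reduct_swap)
    also have "\<dots> = reduct (\<lambda>y. nf (u' @ y @ v')) c d"
    proof (rule reduct_cong)
      show "reduct (\<lambda>x. nf (u @ x @ m @ [d, c] @ v')) a b = nf (u' @ [d, c] @ v')" if "c \<noteq> d"
        unfolding *(1) using asym[OF red(2) that] w(2) *(1) BB inversions_swap[of lt d c u' v']
          wf'[of "[d, c]"] by auto
      show "reduct (\<lambda>x. nf (u @ x @ m @ [l] @ v')) a b = nf (u' @ [l] @ v')" if "l \<in> B" for l
        unfolding *(1) using w(2) *(1) that wf'[of "[l]"] by auto
    qed
    finally show ?thesis .
  qed
  show ?case unfolding confluent_def
  proof (intro allI impI)
    fix u i j v assume w: "w = u @ i # j # v" and red: "red i j"
    obtain u' i' j' v' where *: "w = u' @ i' # j' # v'" "red i' j'" "nf w = reduct (\<lambda>x. nf (u' @ x @ v')) i' j'"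
      using nf_reducible[OF w red] .
    consider "length u < length u'" | "length u' < length u" | "length u = length u'" by linarith
    then show "nf w = reduct (\<lambda>x. nf (u @ x @ v)) i j"
    proof cases
      case 1 then show ?thesis using before[OF w *(1) red *(2)] *(3) by simp
    next
      case 2 then show ?thesis using before[OF *(1) w *(2) red] *(3) by simp
    next
      case 3 then show ?thesis using w * by auto
    qed
  qed
qed

text \<open>Reductions never increase the length of a word.\<close>

lemma nf_short:
  assumes "\<And>v. length v \<le> n \<Longrightarrow> \<beta> v = 0"
  shows "length w \<le> n \<Longrightarrow> nf w = 0"
proof (induction w rule: wf_induct_rule[OF wf_measures[of "[length, inversions lt]"]])
  case (1 w)
  show ?case
  proof (cases "\<exists>u i j v. w = u @ i # j # v \<and> red i j")
    case False
    then have "nf w = \<beta> w" by (intro nf_irreducible) blast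
    then show ?thesis using assms 1(2) by simp
  next
    case True
    then obtain u i j v where *: "w = u @ i # j # v" "red i j" "nf w = reduct (\<lambda>x. nf (u @ x @ v)) i j"
      using nf_reducible by metis
    have "reduct (\<lambda>x. nf (u @ x @ v)) i j = reduct (\<lambda>x. 0) i j"
    proof (rule reduct_cong)
      assume "i \<noteq> j"
      then have "lt j i" "\<not> lt i j" using *(2) lt_trans lt_irrefl unfolding red_def by blast+
      then have "(u @ [j, i] @ v, w) \<in> measures [length, inversions lt]" by (simp add: *(1) inversions_swap)
      then show "nf (u @ [j, i] @ v) = 0" by (rule 1(1)) (use 1(2) * in auto)
    next
      fix l show "nf (u @ [l] @ v) = 0" by (rule 1(1)) (use 1(2) * in auto)
    qed
    then show ?thesis using *(3) by (simp add: reduct_def lext_def)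
  qed
qed

lemma multilinear_vanish:
  assumes lin: "\<And>u v. klinear (smul g) (*) (\<lambda>x. G (u @ x # v))" and "\<And>u. set u \<subseteq> B \<Longrightarrow> G u = 0"
  shows "set ys \<subseteq> B \<Longrightarrow> G (ys @ xs) = 0"
proof (induction xs arbitrary: ys)
  case Nil then show ?case using assms(2) by simp
next
  case (Cons x xs)
  have "G (ys @ x # xs) = lext (\<lambda>l. G (ys @ l # xs)) x"
    by (rule lext_expand[OF lin])
  also have "\<dots> = lext (\<lambda>l. 0) x"
    by (rule lext_cong) (use Cons.IH[of "ys @ [l]" for l] Cons.prems in simp)
  finally show ?case by (simp add: lext_def)
qed

text \<open>It suffices to kill all products b r c with a relation \<open>r\<close>. When b and c
  are words in basis letters this is linearity and \<open>nfl_swap\<close>; multilinearity in the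
  letters of b and c gives the rest.\<close>

lemma nf_functional_relations:
  assumes "a \<in> gen_ideal (env_relations g)"
  shows "word_lift (*) nfl a = 0"
proof -
  let ?L = "word_lift (*) nfl :: ('k, 'g) free_alg \<Rightarrow> 'k"
  have L: "klinear free_scal (*) ?L" by (rule klinear_word_lift[OF vector_space_field])
  note L_simps = klinearD(1-5)[OF L]
  have Lw: "?L (word w) = nfl w" for w by (simp add: vector_space_field)
  have lin: "klinear (smul g) (*) (\<lambda>x. ?L (word (u @ x # v) * r))"
    "klinear (smul g) (*) (\<lambda>x. ?L (r * word (u @ x # v)))" for u v r
  proof (induction r rule: free_alg_induct)
    case zero
    { case 1 show ?case by (simp add: L_simps klinear_const_zero vs.vector_space_axioms vector_space_field)
    next case 2 show ?case by (simp add: L_simps klinear_const_zero vs.vector_space_axioms vector_space_field) }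
  next
    case (add c t r)
    { case 1
      show ?case using klinear_plus[OF klinear_scaled[OF klinear_mlin[of nf u "v @ t"], of c] add(1)]
        by (simp add: distrib_left free_scal_mult_right L_simps word_append[symmetric] Lw)
    next
      case 2
      show ?case using klinear_plus[OF klinear_scaled[OF klinear_mlin[of nf "t @ u" "v"], of c] add(2)]
        by (simp add: distrib_right free_scal_mult_left L_simps word_append[symmetric] Lw) }
  qed
  have basis: "?L (word u * r * word v) = 0" if r: "r \<in> env_relations g" and B: "set u \<subseteq> B" "set v \<subseteq> B" for u r v
  proof -
    have w3: "word u * free_gen x * word v = word (u @ x # v)" for x
      by (simp add: word_append word_Cons mult.assoc)
    have w4: "word u * (free_gen x * free_gen y) * word v = word (u @ x # y # v)" for x y
      by (simp add: word_append word_Cons mult.assoc)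
    have ksm: "word u * ksign i j a * word v = ksign i j (word u * a * word v)" "?L (ksign i j a) = ksign i j (?L a)" for i j a
      by (auto simp: ksign_def L_simps)
    consider x y where "r = free_gen (x + y) - free_gen x - free_gen y"
      | c x where "r = free_gen (smul g c x) - free_scal c (free_gen x)"
      | x y i j where "x \<in> part g i" "y \<in> part g j"
        "r = free_gen x * free_gen y - ksign i j (free_gen y * free_gen x) - free_gen (br g x y)"
      using r unfolding env_relations_def by blast
    then show ?thesis
    proof cases
      case 1 then show ?thesis
        by (simp add: left_diff_distrib right_diff_distrib w3 L_simps Lw klinear_add[OF klinear_mlin])
    next
      case 2 then show ?thesis
        by (simp add: left_diff_distrib right_diff_distrib w3 L_simps Lw klinear_scale[OF klinear_mlin]
          free_scal_mult_left free_scal_mult_right)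
    next
      case 3
      have "nfl (u @ x # y # v) - ksign i j (nfl (u @ y # x # v)) - nfl (u @ br g x y # v) = 0"
        by (rule nfl_swap[OF confluent_all B 3(1,2)])
      then show ?thesis using 3(3)
        by (simp add: left_diff_distrib right_diff_distrib w3 w4 ksm L_simps Lw)
    qed
  qed
  have words: "?L (word u * r * word v) = 0" if r: "r \<in> env_relations g" for u r v
  proof -
    have "?L (word u * r * word v) = 0" if "set v \<subseteq> B" for v
      using multilinear_vanish[of "\<lambda>u. ?L (word u * r * word v)" "[]" u] lin(1)[of _ _ "r * word v"] basis[OF r _ that]
      by (simp add: mult.assoc)
    then show ?thesis
      using multilinear_vanish[of "\<lambda>v. ?L (word u * r * word v)" "[]" v] lin(2)[of "word u * r"] by simp
  qed
  have "env_relations g \<subseteq> {a. \<forall>b c. ?L (b * a * c) = 0}"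
  proof (intro subsetI CollectI allI)
    fix r b c assume r: "r \<in> env_relations g"
    have "?L (word u * r * c) = 0" for u
      by (induction c rule: free_alg_induct) (simp_all add: L_simps distrib_left free_scal_mult_right words[OF r])
    then show "?L (b * r * c) = 0"
      by (induction b rule: free_alg_induct) (simp_all add: L_simps distrib_right free_scal_mult_left)
  qed
  then have "gen_ideal (env_relations g) \<subseteq> {a. \<forall>b c. ?L (b * a * c) = 0}"
    by (intro gen_ideal_minimal two_sided_core L_simps)
  then have "?L (1 * a * 1) = 0" using assms by blast
  then show ?thesis by simp
qed

end

definition irreducible_word :: "'g list \<Rightarrow> bool" where
  "irreducible_word w \<longleftrightarrow> set w \<subseteq> B \<and> (\<forall>u i j v. w = u @ i # j # v \<longrightarrow> \<not> red i j)"

text \<open>Take \<open>\<beta>\<close> to be the indicator of \<open>w0\<close>. The functional is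
  the coordinate of U(g) belonging to \<open>w0\<close>, so irreducible words are independent modulo
  the relations. Vanishing on all shorter words lets it read off leading terms.\<close>

theorem pbw_dual_functional:
  assumes "irreducible_word w0"
  obtains L where "klinear free_scal (*) L" "\<And>a. a \<in> gen_ideal (env_relations g) \<Longrightarrow> L a = 0"
    "\<And>w. irreducible_word w \<Longrightarrow> L (word w) = (if w = w0 then 1 else (0 :: 'k))"
    "\<And>w. set w \<subseteq> B \<Longrightarrow> length w < length w0 \<Longrightarrow> L (word w) = 0"
proof
  let ?b = "\<lambda>w. if w = w0 then 1 else 0 :: 'k"
  let ?L = "word_lift (*) (mlin (nf ?b))"
  show "klinear free_scal (*) ?L" by (rule klinear_word_lift[OF vector_space_field])
  show "?L a = 0" if "a \<in> gen_ideal (env_relations g)" for a by (rule nf_functional_relations[OF that])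
  show "?L (word w) = (if w = w0 then 1 else 0)" if "irreducible_word w" for w
  proof -
    have "nf ?b w = ?b w" by (rule nf_irreducible) (use that in \<open>unfold irreducible_word_def, blast\<close>)
    then show ?thesis using that by (simp add: vector_space_field irreducible_word_def mlin_basis)
  qed
  show "?L (word w) = 0" if "set w \<subseteq> B" "length w < length w0" for w
  proof -
    have "nf ?b w = 0" by (rule nf_short[where n = "length w"]) (use that in auto)
    then show ?thesis using that by (simp add: vector_space_field mlin_basis)
  qed
qed

end

text \<open>A basis of \<open>J\<close> together with the vectors \<open>w n\<close> is independent,
  so a linear map may be 0 on the former and arbitrary on the latter.\<close>

lemma extend_modulo_subspace:
  fixes s :: "'k::field \<Rightarrow> 'v::ab_group_add \<Rightarrow> 'v" and t :: "'k \<Rightarrow> 'w::ab_group_add \<Rightarrow> 'w" and w :: "'i \<Rightarrow> 'v"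
  assumes "vector_space s" "vector_space t" and J: "module.subspace s J"
    and indep: "\<And>S c n. finite S \<Longrightarrow> S \<subseteq> I \<Longrightarrow> (\<Sum>n\<in>S. s (c n) (w n)) \<in> J \<Longrightarrow> n \<in> S \<Longrightarrow> c n = 0"
  obtains h where "klinear s t h" "\<And>a. a \<in> J \<Longrightarrow> h a = 0" "\<And>n. n \<in> I \<Longrightarrow> h (w n) = \<gamma> n"
proof -
  interpret vector_space_pair s t using assms(1,2) by (simp add: vector_space_pair_def)
  have wJ: "w n \<notin> J" if "n \<in> I" for n
  proof
    assume "w n \<in> J"
    then have "(1 :: 'k) = 0" using that by (intro indep[of "{n}" "\<lambda>_. 1" n]) simp_all
    then show False by simp
  qed
  have inj: "inj_on w I"
  proof (rule inj_onI, rule ccontr)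
    fix m n assume *: "m \<in> I" "n \<in> I" "w m = w n" "m \<noteq> n"
    then have sum: "(\<Sum>i\<in>{m, n}. s (if i = m then 1 else - 1) (w i)) = 0" by simp
    have "(if m = m then 1 else - 1 :: 'k) = 0"
      by (rule indep[of "{m, n}" "\<lambda>i. if i = m then 1 else - 1" m])
        (use * in \<open>simp_all only: sum vs1.subspace_0[OF J]\<close>, simp_all)
    then show False by simp
  qed
  obtain A where A: "A \<subseteq> J" "vs1.independent A" "J \<subseteq> vs1.span A"
    using vs1.maximal_independent_subset[of J] by blast
  have "vs1.independent (A \<union> w ` I)"
    unfolding vs1.independent_explicit_finite_subsets
  proof (intro allI impI ballI)
    fix S u v assume S: "S \<subseteq> A \<union> w ` I" "finite S" and sum: "(\<Sum>v\<in>S. s (u v) v) = 0" and v: "v \<in> S"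
    define S1 where "S1 = S - w ` I"
    define N where "N = {n \<in> I. w n \<in> S}"
    have S1: "S1 \<subseteq> A" "finite S1" using S by (auto simp: S1_def)
    have wN: "w ` N = S \<inter> w ` I" by (auto simp: N_def)
    have injN: "inj_on w N" using inj by (rule inj_on_subset) (auto simp: N_def)
    have finN: "finite N" using finite_imageD[OF _ injN] wN S(2) by simp
    have split: "(\<Sum>v\<in>S1. s (u v) v) + (\<Sum>n\<in>N. s (u (w n)) (w n)) = 0"
    proof -
      have "S = S1 \<union> w ` N" "S1 \<inter> w ` N = {}" by (auto simp: S1_def wN)
      then have "(\<Sum>v\<in>S. s (u v) v) = (\<Sum>v\<in>S1. s (u v) v) + (\<Sum>v\<in>w ` N. s (u v) v)"
        using S1(2) finN by (simp only: sum.union_disjoint finite_imageI)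
      then show ?thesis using sum by (simp add: sum.reindex[OF injN])
    qed
    have "(\<Sum>v\<in>S1. s (u v) v) \<in> J"
      using S1 A(1) by (intro vs1.subspace_sum[OF J] vs1.subspace_scale[OF J]) auto
    moreover have "(\<Sum>n\<in>N. s (u (w n)) (w n)) = - (\<Sum>v\<in>S1. s (u v) v)"
      using split by (simp add: eq_neg_iff_add_eq_0 add.commute)
    ultimately have "(\<Sum>n\<in>N. s (u (w n)) (w n)) \<in> J" by (simp add: vs1.subspace_neg[OF J])
    then have N0: "u (w n) = 0" if "n \<in> N" for n
      using indep[of N "\<lambda>n. u (w n)" n] finN that by (auto simp: N_def)
    then have "(\<Sum>v\<in>S1. s (u v) v) = 0" using split by simp
    then have "u v = 0" if "v \<in> S1" for v
      using vs1.independentD[OF A(2) S1(2) S1(1) _ that] by blast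
    then show "u v = 0" using N0 v by (cases "v \<in> S1") (auto simp: S1_def N_def)
  qed
  from linear_independent_extend[OF this, of "\<lambda>v. if v \<in> w ` I then \<gamma> (inv_into I w v) else 0"]
  obtain h where h: "klinear s t h" "\<And>v. v \<in> A \<union> w ` I \<Longrightarrow> h v = (if v \<in> w ` I then \<gamma> (inv_into I w v) else 0)"
    by blast
  interpret h: Vector_Spaces.linear s t h by fact
  show ?thesis
  proof
    show "klinear s t h" by fact
    show "h (w n) = \<gamma> n" if "n \<in> I" for n
      using h(2)[of "w n"] that inj by (simp add: inv_into_f_f)
    show "h a = 0" if "a \<in> J" for a
    proof -
      have "h v = 0" if "v \<in> A" for v using h(2)[of v] that A(1) wJ by auto
      then have "h a = 0" if "a \<in> vs1.span A" for a
        using h.eq_0_on_span that by blast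
      then show ?thesis using that A(3) by blast
    qed
  qed
qed

section \<open>The length filtration of U(g) and its leading words\<close>

context ordered_basis
begin

definition env_ideal :: "('k, 'g) free_alg set" where "env_ideal = gen_ideal (env_relations g)"

sublocale env: bracket_ideal g env_ideal
  by (rule bracket_idealI) (simp_all add: env_ideal_def two_sided_gen_ideal gen_ideal_superset)

definition degs :: "'g list \<Rightarrow> bit" where "degs w = sum_list (map deg w)"

lemma degs_simps [simp]: "degs [] = 0" "degs (x # xs) = deg x + degs xs" "degs (xs @ ys) = degs xs + degs ys"
  by (simp_all add: degs_def)

lemma degs_mset: "mset xs = mset ys \<Longrightarrow> degs xs = degs ys"
  unfolding degs_def by (metis mset_map sum_mset_sum_list)

text \<open>The span, modulo the relations, of the words of parity \<open>i\<close> and length less than \<open>d\<close>.\<close>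

definition filt :: "nat \<Rightarrow> bit \<Rightarrow> ('k, 'g) free_alg set" where
  "filt d i = FV.span ({word w | w. set w \<subseteq> B \<and> length w < d \<and> degs w = i} \<union> env_ideal)"

lemma filt_closed:
  shows filt_add: "a \<in> filt d i \<Longrightarrow> b \<in> filt d i \<Longrightarrow> a + b \<in> filt d i"
    and filt_diff: "a \<in> filt d i \<Longrightarrow> b \<in> filt d i \<Longrightarrow> a - b \<in> filt d i"
    and filt_scale: "a \<in> filt d i \<Longrightarrow> free_scal c a \<in> filt d i"
    and filt_0: "0 \<in> filt d i"
    and filt_minus: "a \<in> filt d i \<Longrightarrow> - a \<in> filt d i"
  unfolding filt_def by (auto intro: FV.span_add FV.span_diff FV.span_scale FV.span_zero FV.span_neg)

lemma filt_sum: "(\<And>x. x \<in> S \<Longrightarrow> f x \<in> filt d i) \<Longrightarrow> sum f S \<in> filt d i"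
  unfolding filt_def by (rule FV.span_sum)

lemma filt_ideal: "a \<in> env_ideal \<Longrightarrow> a \<in> filt d i"
  unfolding filt_def by (rule FV.span_base) simp

lemma filt_word: "set w \<subseteq> B \<Longrightarrow> length w < d \<Longrightarrow> degs w = i \<Longrightarrow> word w \<in> filt d i"
  unfolding filt_def by (rule FV.span_base) blast

lemma filt_mono: "d \<le> e \<Longrightarrow> filt d i \<subseteq> filt e i"
  unfolding filt_def by (rule FV.span_mono) auto

lemma filt_induct [consumes 1, case_names word ideal add scale]:
  assumes "a \<in> filt d i"
    "\<And>w. set w \<subseteq> B \<Longrightarrow> length w < d \<Longrightarrow> degs w = i \<Longrightarrow> P (word w)"
    "\<And>a. a \<in> env_ideal \<Longrightarrow> P a" "\<And>a b. P a \<Longrightarrow> P b \<Longrightarrow> P (a + b)" "\<And>c a. P a \<Longrightarrow> P (free_scal c a)"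
  shows "P a"
  using assms(1) unfolding filt_def
proof (induction rule: FV.span_induct_alt)
  case base
  have "P 0" by (rule assms(3)) (rule two_sidedD(1)[OF env.Q])
  then show ?case .
next
  case (step c x y)
  then show ?case using assms(2-5) by blast
qed

lemma filt_cong: "a - b \<in> env_ideal \<Longrightarrow> b \<in> filt d i \<Longrightarrow> a \<in> filt d i"
  using filt_add[OF filt_ideal] by fastforce

lemma filt_mult_word: 
  assumes "set w \<subseteq> B" "length w + d \<le> e" "degs w + i = j"
  shows "b \<in> filt d i \<Longrightarrow> word w * b \<in> filt e j"
    and "b \<in> filt d i \<Longrightarrow> b * word w \<in> filt e j"
proof -
  show "b \<in> filt d i \<Longrightarrow> word w * b \<in> filt e j"
  proof (induction rule: filt_induct)
    case (word v) then show ?case unfolding word_append[symmetric] using assms by (intro filt_word) auto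
  next
    case (ideal a) then show ?case by (intro filt_ideal two_sidedD(4)[OF env.Q])
  qed (auto simp: distrib_left free_scal_mult_right intro: filt_closed)
  show "b \<in> filt d i \<Longrightarrow> b * word w \<in> filt e j"
  proof (induction rule: filt_induct)
    case (word v) then show ?case unfolding word_append[symmetric] using assms by (intro filt_word) (auto simp: add.commute)
  next
    case (ideal a) then show ?case by (intro filt_ideal two_sidedD(3)[OF env.Q])
  qed (auto simp: distrib_right free_scal_mult_left intro: filt_closed)
qed

text \<open>\<open>filt (Suc d)\<close> contains the words of length at most \<open>d\<close>, so
  the strict bounds combine to \<open>d + e\<close>.\<close>

lemma filt_mult:
  assumes "a \<in> filt (Suc d) i" "b \<in> filt e j" 
  shows "a * b \<in> filt (d + e) (i + j)"
  using assms(1)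
proof (induction rule: filt_induct)
  case (word w) then show ?case using assms(2) by (intro filt_mult_word(1)[OF _ _ _ assms(2)]) auto
next
  case (ideal a) then show ?case by (intro filt_ideal two_sidedD(3)[OF env.Q])
qed (auto simp: distrib_right free_scal_mult_left intro: filt_closed)

lemma filt_gen:
  assumes "x \<in> part g i"
  shows "free_gen x \<in> filt 2 i"
proof -
  have "free_gen x - (\<Sum>l | coef x l \<noteq> 0. free_scal (coef x l) (free_gen l)) \<in> env_ideal"
  proof -
    have "env.cg (free_gen (\<Sum>l | coef x l \<noteq> 0. smul g (coef x l) l)) (\<Sum>l | coef x l \<noteq> 0. free_gen (smul g (coef x l) l))"
      by (rule env.gen_sum)
    also have "env.cg \<dots> (\<Sum>l | coef x l \<noteq> 0. free_scal (coef x l) (free_gen l))"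
      by (intro env.cg_intros env.gen_scale)
    finally show ?thesis by (simp add: coef_sum cong_mod_def)
  qed
  then show ?thesis
  proof (rule filt_cong, intro filt_sum filt_scale)
    fix l assume "l \<in> {l. coef x l \<noteq> 0}"
    then have "l \<in> B" "deg l = i" using coef_basis coef_homogeneous[OF assms] deg_eqI by auto
    then show "free_gen l \<in> filt 2 i" using filt_word[of "[l]" 2 i] by (simp add: word_single)
  qed
qed

text \<open>Exchanging neighbours costs a bracket, that is, a combination of words with one letter
  less and the same parity.\<close>

lemma word_swap:
  assumes "set (u @ a # b # v) \<subseteq> B" 
  shows "word (u @ a # b # v) - free_scal (sgn a b) (word (u @ b # a # v)) \<in> filt (length (u @ a # b # v)) (degs (u @ a # b # v))"
proof -
  have ab: "a \<in> B" "b \<in> B" "set u \<subseteq> B" "set v \<subseteq> B" using assms by auto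
  have "free_gen a * free_gen b - free_scal (sgn a b) (free_gen b * free_gen a) - free_gen (br g a b) \<in> env_ideal"
  proof -
    have "ksign (deg a) (deg b) (free_gen b * free_gen a) = free_scal (sgn a b) (free_gen b * free_gen a :: ('k, 'g) free_alg)"
      by (auto simp: sgn_def ksign_def)
    then show ?thesis
      using env.cg_sym[OF env.gen_br[OF part_deg[OF ab(1)] part_deg[OF ab(2)]]] by (simp add: cong_mod_def)
  qed
  then have "free_gen a * free_gen b - free_scal (sgn a b) (free_gen b * free_gen a) \<in> filt 2 (deg a + deg b)"
    by (rule filt_cong) (intro filt_gen br_part part_deg ab)
  then have "(free_gen a * free_gen b - free_scal (sgn a b) (free_gen b * free_gen a)) * word v \<in> filt (2 + length v) (degs v + (deg a + deg b))"
    by (intro filt_mult_word(2)[OF ab(4)]) auto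
  then have "word u * ((free_gen a * free_gen b - free_scal (sgn a b) (free_gen b * free_gen a)) * word v) \<in> filt (length (u @ a # b # v)) (degs (u @ a # b # v))"
    by (intro filt_mult_word(1)[OF ab(3)]) (auto simp: ac_simps)
  then show ?thesis
    by (simp add: word_append word_Cons algebra_simps free_scal_mult_left free_scal_mult_right)
qed

lemma word_move:
  assumes "set (u @ x # v) \<subseteq> B"
  obtains s :: 'k where "s \<noteq> 0" "word (u @ x # v) - free_scal s (word (x # u @ v)) \<in> filt (length (u @ x # v)) (degs (u @ x # v))"
proof -
  have "\<exists>s :: 'k. s \<noteq> 0 \<and> word (u @ x # v) - free_scal s (word (x # u @ v)) \<in> filt (length (u @ x # v)) (degs (u @ x # v))"
    using assms
  proof (induction u arbitrary: v rule: rev_induct)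
    case Nil then show ?case by (intro exI[of _ 1]) (simp add: filt_0)
  next
    case (snoc y u)
    obtain s :: 'k where s: "s \<noteq> 0" "word (u @ x # y # v) - free_scal s (word (x # u @ y # v)) \<in> filt (length (u @ x # y # v)) (degs (u @ x # y # v))"
      using snoc.IH[of "y # v"] snoc.prems by auto
    have d: "degs (u @ y # x # v) = degs (u @ x # y # v)" by (rule degs_mset) simp
    have "(word (u @ y # x # v) - free_scal (sgn y x) (word (u @ x # y # v)))
       + free_scal (sgn y x) (word (u @ x # y # v) - free_scal s (word (x # u @ y # v)))
       \<in> filt (length (u @ y # x # v)) (degs (u @ y # x # v))"
    proof (intro filt_add filt_scale)
      show "word (u @ y # x # v) - free_scal (sgn y x) (word (u @ x # y # v)) \<in> filt (length (u @ y # x # v)) (degs (u @ y # x # v))"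
        by (rule word_swap) (use snoc.prems in simp)
      show "word (u @ x # y # v) - free_scal s (word (x # u @ y # v)) \<in> filt (length (u @ y # x # v)) (degs (u @ y # x # v))"
        using s(2) unfolding d by simp
    qed
    then have "word (u @ y # x # v) - free_scal (sgn y x * s) (word (x # u @ y # v)) \<in> filt (length (u @ y # x # v)) (degs (u @ y # x # v))"
      by (simp add: FV.scale_right_diff_distrib)
    moreover have "sgn y x * s \<noteq> 0" using s(1) sgn_cases[of y x] by auto
    ultimately show ?case
      by (intro exI[of _ "sgn y x * s"]) (simp del: degs_simps)
  qed
  then show ?thesis using that by blast
qed

text \<open>The associated graded algebra is supercommutative, so rearranging letters costs a
  nonzero scalar and lower terms.\<close>

lemma word_permute:
  assumes "mset xs = mset ys" "set xs \<subseteq> B"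
  obtains s :: 'k where "s \<noteq> 0" "word xs - free_scal s (word ys) \<in> filt (length xs) (degs xs)"
proof -
  have "\<exists>s :: 'k. s \<noteq> 0 \<and> word xs - free_scal s (word ys) \<in> filt (length xs) (degs xs)"
    using assms
  proof (induction xs arbitrary: ys)
    case Nil then show ?case by (intro exI[of _ 1]) (simp add: filt_0)
  next
    case (Cons x xs)
    have "x \<in> set ys" using Cons.prems(1) by (metis list.set_intros(1) mset_eq_setD)
    then obtain u v where ys: "ys = u @ x # v" by (meson split_list)
    have m: "mset xs = mset (u @ v)" using Cons.prems(1) ys by simp
    then obtain s :: 'k where s: "s \<noteq> 0" "word xs - free_scal s (word (u @ v)) \<in> filt (length xs) (degs xs)"
      using Cons.IH[of "u @ v"] Cons.prems(2) by auto
    have B: "set ys \<subseteq> B" using Cons.prems mset_eq_setD by metis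
    obtain s' :: 'k where s': "s' \<noteq> 0" "word ys - free_scal s' (word (x # u @ v)) \<in> filt (length ys) (degs ys)"
      using word_move[of u x v] B ys by auto
    have l: "length ys = length (x # xs)" "degs ys = degs (x # xs)" using Cons.prems(1) mset_eq_length degs_mset by metis+
    have "free_gen x * (word xs - free_scal s (word (u @ v))) \<in> filt (length (x # xs)) (degs (x # xs))"
      using filt_mult_word(1)[OF _ _ _ s(2), of "[x]" "length (x # xs)" "degs (x # xs)"] Cons.prems(2) by (simp add: word_single)
    then have "free_gen x * (word xs - free_scal s (word (u @ v))) - free_scal (s / s') (word ys - free_scal s' (word (x # u @ v))) \<in> filt (length (x # xs)) (degs (x # xs))"
      using s'(2) unfolding l by (rule filt_diff[OF _ filt_scale])
    then have "word (x # xs) - free_scal (s / s') (word ys) \<in> filt (length (x # xs)) (degs (x # xs))"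
      using s'(1) by (simp add: word_Cons algebra_simps FV.scale_right_diff_distrib free_scal_mult_right)
    moreover have "s / s' \<noteq> 0" using s s' by simp
    ultimately show ?case by blast
  qed
  then show ?thesis using that by blast
qed

text \<open>Exchanging the two equal odd letters changes the sign, so twice the word is a lower
  term, and 2 is invertible.\<close>

lemma word_square:
  assumes "set (a # a # v) \<subseteq> B" "deg a = 1"
  shows "word (a # a # v) \<in> filt (length (a # a # v)) (degs (a # a # v))"
proof -
  have "word ([] @ a # a # v) - free_scal (sgn a a) (word ([] @ a # a # v)) \<in> filt (length (a # a # v)) (degs (a # a # v))"
    using word_swap[of "[]" a a v] assms(1) by simp
  moreover have "word ([] @ a # a # v) - free_scal (sgn a a) (word ([] @ a # a # v)) = free_scal 2 (word (a # a # v))"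
    using FV.scale_left_distrib[of 1 1 "word (a # a # v) :: ('k, 'g) free_alg"] assms(2) by (simp add: sgn_simps(3))
  ultimately have "free_scal 2 (word (a # a # v)) \<in> filt (length (a # a # v)) (degs (a # a # v))" by simp
  from filt_scale[OF this, of "1 / 2"] two show ?thesis by simp
qed

lemma irreducible_word_exists:
  assumes "set_mset m \<subseteq> B" "\<And>i. deg i = 1 \<Longrightarrow> count m i \<le> 1"
  shows "\<exists>w. irreducible_word w \<and> mset w = m"
proof -
  have "\<exists>w. sorted_wrt (\<lambda>i j. \<not> lt j i) w \<and> mset w = m"
  proof (induction m)
    case empty show ?case by (rule exI[of _ "[]"]) simp
  next
    case (add x m)
    then obtain w where w: "sorted_wrt (\<lambda>i j. \<not> lt j i) w" "mset w = m" by blast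
    have 1: "\<not> lt b a" if "lt a x" "\<not> lt b x" for a b using that lt_trans by blast
    have 2: "\<not> lt x a" if "lt a x" for a using that lt_trans lt_irrefl by blast
    have srt: "sorted_wrt (\<lambda>i j. \<not> lt j i) (filter (\<lambda>y. lt y x) w @ x # filter (\<lambda>y. \<not> lt y x) w)"
      unfolding sorted_wrt_append sorted_wrt.simps set_filter list.set insert_iff
      by (intro conjI ballI sorted_wrt_filter w(1)) (use 1 2 in blast)+
    have "mset (filter (\<lambda>y. lt y x) w @ x # filter (\<lambda>y. \<not> lt y x) w) = add_mset x m"
      using w(2) multiset_partition[of m "\<lambda>y. lt y x"] by simp
    with srt show ?case by blast
  qed
  then obtain w where w: "sorted_wrt (\<lambda>i j. \<not> lt j i) w" "mset w = m" by blast
  have nred: "\<not> red i j" if "w = u @ i # j # v" for u i j v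
  proof
    assume "red i j"
    moreover have "\<not> lt j i" using w(1) unfolding that by (simp add: sorted_wrt_append)
    ultimately have ij: "i = j" "deg i = 1" by (auto simp: red_def)
    have "count (mset w) i \<ge> 2" unfolding that ij(1) by simp
    then show False using assms(2)[OF ij(2)] w(2) by simp
  qed
  have "set w \<subseteq> B" unfolding set_mset_mset[symmetric] w(2) by (rule assms(1))
  with nred have "irreducible_word w" unfolding irreducible_word_def by (intro conjI allI impI)
  then show ?thesis using w(2) by (intro exI[of _ w] conjI)
qed

end

section \<open>The basis z^A x^b of U(g), with z_i = i^p - i^[p] and exponents in b below p\<close>

locale ordered_basis_p = ordered_basis g B lt for g :: "('k::field, 'g::ab_group_add) rlsa" and B lt +
  assumes char_gt_2: "CHAR('k) > 2"
    and pmap_part: "x \<in> part g 0 \<Longrightarrow> pmap g x \<in> part g 0"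
begin

definition zgen :: "'g \<Rightarrow> ('k, 'g) free_alg" where
  "zgen x = free_gen x ^ CHAR('k) - free_gen (pmap g x)"

text \<open>The factors are multiplied in the order of some list enumerating the multiset; for even
  letters \<open>zmon_permute\<close> shows that the order is immaterial modulo the
  relations.\<close>

definition zmon :: "'g multiset \<Rightarrow> ('k, 'g) free_alg" where
  "zmon A = prod_list (map zgen (SOME w. mset w = A))"

definition sort_word :: "'g multiset \<Rightarrow> 'g list" where
  "sort_word b = (SOME w. irreducible_word w \<and> mset w = b)"

definition admissible :: "'g multiset set" where
  "admissible = {m. set_mset m \<subseteq> B \<and> (\<forall>i. deg i = 1 \<longrightarrow> count m i \<le> 1)}"

text \<open>Exponent patterns of the monomials z^A x^b: \<open>A\<close> consists of even basis
  letters, \<open>b\<close> has exponents below p, and at most 1 at odd letters.\<close>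

definition normal_pairs :: "('g multiset \<times> 'g multiset) set" where
  "normal_pairs = {(A, b). set_mset A \<subseteq> B \<and> (\<forall>i\<in>#A. deg i = 0) \<and> b \<in> admissible \<and> (\<forall>i. count b i < CHAR('k))}"

definition nmon :: "'g multiset \<times> 'g multiset \<Rightarrow> ('k, 'g) free_alg" where
  "nmon = (\<lambda>(A, b). zmon A * word (sort_word b))"

text \<open>Letters of the leading word of z^A x^b, since z_i has leading term i^p.\<close>

definition total_mset :: "'g multiset \<times> 'g multiset \<Rightarrow> 'g multiset" where
  "total_mset = (\<lambda>(A, b). b + repeat_mset CHAR('k) A)"

definition mdeg :: "'g multiset \<Rightarrow> bit" where "mdeg m = sum_mset (image_mset deg m)"

lemma mdeg_mset: "mdeg (mset w) = degs w"
  unfolding mdeg_def degs_def by (metis mset_map sum_mset_sum_list)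

lemma sort_word: "m \<in> admissible \<Longrightarrow> irreducible_word (sort_word m) \<and> mset (sort_word m) = m"
  unfolding sort_word_def by (rule someI_ex) (auto simp: admissible_def intro: irreducible_word_exists)

lemma odd_p: "odd CHAR('k)" and prime_p: "prime CHAR('k)"
proof -
  show "prime CHAR('k)" using char_gt_2 by (intro prime_CHAR_semidom) simp
  then show "odd CHAR('k)" using char_gt_2 by (metis prime_odd_nat)
qed

lemma deg_part_0: "i \<in> B \<Longrightarrow> deg i = 0 \<Longrightarrow> i \<in> part g 0"
  using part_deg by metis

lemma degs_replicate: "deg i = 0 \<Longrightarrow> degs (replicate n i) = 0"
  by (induction n) auto

lemma degs_concat_replicate: "(\<And>i. i \<in> set as \<Longrightarrow> deg i = 0) \<Longrightarrow> degs (concat (map (replicate n) as)) = 0"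
  by (induction as) (simp_all add: degs_replicate)

text \<open>The element i^[p] is a combination of single letters and p > 1, so each factor z_i
  contributes i^p up to shorter words.\<close>

lemma zmon_lead:
  assumes "set as \<subseteq> B" "\<And>i. i \<in> set as \<Longrightarrow> deg i = 0" "set v \<subseteq> B"
  shows "prod_list (map zgen as) * word v - word (concat (map (replicate CHAR('k)) as) @ v)
     \<in> filt (CHAR('k) * length as + length v) (degs v)"
  using assms
proof (induction as)
  case Nil show ?case by (simp add: filt_0)
next
  case (Cons i as)
  let ?p = "CHAR('k)" and ?r = "concat (map (replicate CHAR('k)) as) @ v"
  have i: "i \<in> B" "deg i = 0" using Cons.prems by auto
  have wr: "free_gen i ^ n = word (replicate n i)" for n
    by (induction n) (auto simp: word_Cons)
  have lr: "length ?r = ?p * length as + length v" by (induction as) auto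
  have dr: "degs ?r = degs v" using degs_concat_replicate[of as ?p] Cons.prems(2) by simp
  have Br: "set ?r \<subseteq> B" using Cons.prems by auto
  have z1: "free_gen (pmap g i) \<in> filt ?p 0"
    using filt_gen[OF pmap_part[OF deg_part_0[OF i]]] filt_mono[of 2 ?p 0] char_gt_2 by auto
  have z2: "zgen i \<in> filt (Suc ?p) 0"
    unfolding zgen_def wr using i z1 filt_mono[of ?p "Suc ?p" 0] 
    by (intro filt_diff filt_word) (auto simp: degs_replicate)
  have "zgen i * (prod_list (map zgen as) * word v - word ?r) \<in> filt (?p + (?p * length as + length v)) (0 + degs v)"
    by (intro filt_mult z2 Cons.IH) (use Cons.prems in auto)
  moreover have "free_gen (pmap g i) * word ?r \<in> filt (?p + (?p * length as + length v)) (degs v)"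
    by (intro filt_mult_word(2)[OF Br _ _ z1]) (simp_all only: lr dr, simp_all)
  ultimately have "zgen i * (prod_list (map zgen as) * word v - word ?r) - free_gen (pmap g i) * word ?r
     \<in> filt (?p + (?p * length as + length v)) (degs v)"
    by (intro filt_diff) (simp_all only: add_0)
  moreover have "zgen i * (prod_list (map zgen as) * word v - word ?r) - free_gen (pmap g i) * word ?r
     = prod_list (map zgen (i # as)) * word v - word (concat (map (replicate ?p) (i # as)) @ v)"
    by (simp add: zgen_def wr word_append algebra_simps)
  ultimately show ?case by (simp add: add.assoc)
qed

lemma mset_concat_replicate: "mset (concat (map (replicate n) as)) = repeat_mset n (mset as)"
  by (induction as) auto

lemma some_mset: "mset (SOME w. mset w = A) = A"
  by (rule someI_ex) (rule ex_mset)

lemma size_total: "size (total_mset (A, b)) = CHAR('k) * size A + size b"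
  by (simp add: total_mset_def)

lemma total_admissible:
  assumes "n \<in> normal_pairs" shows "total_mset n \<in> admissible"
proof -
  obtain A b where n: "n = (A, b)" by (cases n)
  have A: "count A i = 0" if "deg i = 1" for i
    using assms that unfolding n normal_pairs_def by (auto simp: not_in_iff[symmetric])
  have "i \<in> B" if "i \<in># total_mset n" for i
  proof -
    have "0 < count b i + CHAR('k) * count A i"
      using that by (simp add: n total_mset_def flip: count_greater_zero_iff)
    then have "i \<in># b \<or> i \<in># A" by (auto simp flip: count_greater_zero_iff)
    then show ?thesis using assms unfolding n normal_pairs_def admissible_def by auto
  qed
  moreover have "count (total_mset n) i \<le> 1" if "deg i = 1" for i
    using assms A[OF that] that unfolding n normal_pairs_def admissible_def total_mset_def by auto
  ultimately show ?thesis unfolding admissible_def by auto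
qed

text \<open>\<open>zmon_lead\<close> exhibits one arrangement of the leading letters, and
  \<open>word_permute\<close> passes to any other. The parity is that of \<open>b\<close> because
  the letters of \<open>A\<close> are even.\<close>

lemma nmon_lead:
  assumes "n \<in> normal_pairs" "mset w = total_mset n"
  obtains s :: 'k where "s \<noteq> 0" "nmon n - free_scal s (word w) \<in> filt (size (total_mset n)) (mdeg (snd n))" 
    "mdeg (total_mset n) = mdeg (snd n)"
proof -
  obtain A b where n: "n = (A, b)" by (cases n)
  let ?as = "SOME w. mset w = A"
  let ?v = "sort_word b"
  have b: "b \<in> admissible" using assms(1) by (simp add: n normal_pairs_def)
  have v: "set ?v \<subseteq> B" "mset ?v = b" using sort_word[OF b] by (auto simp: irreducible_word_def)
  have as: "set ?as \<subseteq> B" "\<And>i. i \<in> set ?as \<Longrightarrow> deg i = 0" 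
    using assms(1) some_mset[of A] unfolding n normal_pairs_def by (auto simp flip: set_mset_mset)
  let ?c = "concat (map (replicate CHAR('k)) ?as) @ ?v"
  have mc: "mset ?c = mset w" using assms(2) v(2) by (simp add: mset_concat_replicate some_mset n total_mset_def)
  have Bc: "set ?c \<subseteq> B" using as v by auto
  have lc: "length ?c = size (total_mset n)" using mc assms(2) by (metis size_mset)
  from degs_concat_replicate[OF as(2)] have dc: "degs ?c = mdeg b" using v(2) mdeg_mset[of ?v] by simp
  obtain s :: 'k where s: "s \<noteq> 0" "word ?c - free_scal s (word w) \<in> filt (length ?c) (degs ?c)"
    using word_permute[OF mc Bc] .
  have "prod_list (map zgen ?as) * word ?v - word ?c \<in> filt (CHAR('k) * length ?as + length ?v) (degs ?v)"
    by (rule zmon_lead[OF as v(1)])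
  moreover have "CHAR('k) * length ?as + length ?v = size (total_mset n)"
    using arg_cong[OF some_mset[of A], of size] arg_cong[OF v(2), of size] by (simp add: n size_total)
  ultimately have "nmon n - word ?c \<in> filt (size (total_mset n)) (mdeg b)"
    using v(2) mdeg_mset[of ?v] by (simp add: n nmon_def zmon_def)
  from filt_add[OF this s(2)[unfolded lc dc]] have "nmon n - free_scal s (word w) \<in> filt (size (total_mset n)) (mdeg (snd n))"
    by (simp add: n)
  moreover have "mdeg (total_mset n) = mdeg (snd n)" using dc mdeg_mset[of ?c] mc assms(2) by (simp add: n)
  ultimately show ?thesis using that s(1) by blast
qed

lemma total_inj:
  assumes "n \<in> normal_pairs" "n' \<in> normal_pairs" "total_mset n = total_mset n'"
  shows "n = n'"
proof -
  obtain A b A' b' where n: "n = (A, b)" "n' = (A', b')" by (cases n; cases n')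
  have *: "count b i + CHAR('k) * count A i = count b' i + CHAR('k) * count A' i" for i
    using arg_cong[OF assms(3), of "\<lambda>m. count m i"] by (simp add: n total_mset_def)
  have lt: "count b i < CHAR('k)" "count b' i < CHAR('k)" for i using assms(1,2) by (auto simp: n normal_pairs_def)
  have "count b i = count b' i" for i
    using arg_cong[OF *[of i], of "\<lambda>m. m mod CHAR('k)"] lt[of i] by simp
  moreover from this have "count A i = count A' i" for i using *[of i] char_gt_2 by simp
  ultimately show ?thesis by (simp add: n multiset_eq_iff)
qed

text \<open>Division with remainder by p, exponent by exponent. Exponents of odd letters are at most
  1, so they go entirely into the remainder \<open>b\<close>.\<close>

lemma total_surj:
  assumes "m \<in> admissible"
  obtains n where "n \<in> normal_pairs" "total_mset n = m"
proof -
  let ?p = "CHAR('k)"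
  have p0: "?p > 0" using char_gt_2 by simp
  define A where "A = Abs_multiset (\<lambda>i. count m i div ?p)"
  define b where "b = Abs_multiset (\<lambda>i. count m i mod ?p)"
  have ne: "i \<in> set_mset m" if "count m i div ?p > 0 \<or> count m i mod ?p > 0" for i
  proof (rule ccontr)
    assume "i \<notin># m"
    then have "count m i = 0" by (simp add: count_eq_zero_iff)
    then show False using that by simp
  qed
  have fin: "finite {i. count m i div ?p > 0}" "finite {i. count m i mod ?p > 0}"
    using ne by (blast intro: finite_subset[OF _ finite_set_mset[of m]])+
  have c: "count A i = count m i div ?p" "count b i = count m i mod ?p" for i
    using fin by (simp_all add: A_def b_def Abs_multiset_inverse)
  have s: "i \<in># m" if "i \<in># A \<or> i \<in># b" for i
  proof -
    have "count A i > 0 \<or> count b i > 0" using that by simp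
    then show ?thesis unfolding c by (rule ne)
  qed
  have "total_mset (A, b) = m" by (simp add: multiset_eq_iff total_mset_def c)
  moreover have "(A, b) \<in> normal_pairs"
    unfolding normal_pairs_def
  proof (intro CollectI case_prodI conjI ballI allI)
    show "set_mset A \<subseteq> B" using s assms by (auto simp: admissible_def)
    show "deg i = 0" if "i \<in># A" for i
    proof (rule ccontr)
      assume "deg i \<noteq> 0"
      then have "deg i = 1" by (cases "deg i") auto
      then have "count m i \<le> 1" using assms by (auto simp: admissible_def)
      then have "count A i = 0" using c(1)[of i] char_gt_2 by simp
      then show False using that by (simp add: count_eq_zero_iff)
    qed
    show "count b i < ?p" for i using c(2) p0 by simp
    have "count b i \<le> count m i" for i unfolding c(2) by (rule mod_less_eq_dividend)
    then have "count b i \<le> 1" if "deg i = 1" for i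
      using assms that le_trans[of "count b i" "count m i" 1] by (simp add: admissible_def)
    moreover have "set_mset b \<subseteq> B" using s assms by (auto simp: admissible_def)
    ultimately show "b \<in> admissible" by (simp add: admissible_def)
  qed
  ultimately show ?thesis using that by blast
qed

text \<open>Among the terms with nonzero coefficient choose one of largest total degree. The PBW
  functional of its leading word kills every other term: their leading words differ by
  \<open>total_inj\<close>, and the remaining words are too short.\<close>

lemma nmon_independent:
  assumes "finite S" "S \<subseteq> normal_pairs" "(\<Sum>n\<in>S. free_scal (c n) (nmon n)) \<in> env_ideal" "n \<in> S"
  shows "c n = 0"
proof (rule ccontr)
  assume "c n \<noteq> 0"
  define S' where "S' = {n \<in> S. c n \<noteq> 0}"
  have S': "finite S'" "n \<in> S'" using assms(1,4) \<open>c n \<noteq> 0\<close> by (simp_all add: S'_def)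
  have "finite ((\<lambda>n. size (total_mset n)) ` S')" "(\<lambda>n. size (total_mset n)) ` S' \<noteq> {}" using S' by auto
  from Max_in[OF this] Max_ge[OF this(1)]
  obtain n0 where n0: "n0 \<in> S'" "\<And>n. n \<in> S' \<Longrightarrow> size (total_mset n) \<le> size (total_mset n0)"
    by auto
  have N: "n \<in> normal_pairs" if "n \<in> S'" for n using that assms(2) by (auto simp: S'_def)
  have sw: "irreducible_word (sort_word (total_mset n))" "mset (sort_word (total_mset n)) = total_mset n" if "n \<in> S'" for n
    using sort_word[OF total_admissible[OF N[OF that]]] by auto
  have len: "length (sort_word (total_mset n)) = size (total_mset n)" if "n \<in> S'" for n
    using sw(2)[OF that] by (metis size_mset)
  obtain L where L: "klinear free_scal (*) L" "\<And>a. a \<in> gen_ideal (env_relations g) \<Longrightarrow> L a = 0"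
    "\<And>w. irreducible_word w \<Longrightarrow> L (word w) = (if w = sort_word (total_mset n0) then 1 else (0 :: 'k))"
    "\<And>w. set w \<subseteq> B \<Longrightarrow> length w < length (sort_word (total_mset n0)) \<Longrightarrow> L (word w) = 0"
    by (rule pbw_dual_functional[OF sw(1)[OF n0(1)]], rule that)
  note L_simps = klinearD(1-5)[OF L(1)]
  have filt0: "L a = 0" if "a \<in> filt d i" "d \<le> size (total_mset n0)" for a d i
    using that(1) by (induction rule: filt_induct) 
      (use L(2,4) that(2) len[OF n0(1)] in \<open>auto simp: L_simps env_ideal_def\<close>)
  have zero: "L (nmon n) = 0" if n: "n \<in> S'" "n \<noteq> n0" for n
  proof -
    obtain s :: 'k where s: "nmon n - free_scal s (word (sort_word (total_mset n))) \<in> filt (size (total_mset n)) (mdeg (snd n))"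
      using nmon_lead[OF N[OF n(1)] sw(2)[OF n(1)]] .
    have "total_mset n \<noteq> total_mset n0" using total_inj N n n0(1) by blast
    then have "sort_word (total_mset n) \<noteq> sort_word (total_mset n0)" using sw(2) n(1) n0(1) by metis
    then have "L (word (sort_word (total_mset n))) = 0" using L(3)[OF sw(1)[OF n(1)]] by simp
    then show ?thesis using filt0[OF s n0(2)[OF n(1)]] by (simp add: L_simps)
  qed
  obtain s :: 'k where s: "s \<noteq> 0" "nmon n0 - free_scal s (word (sort_word (total_mset n0))) \<in> filt (size (total_mset n0)) (mdeg (snd n0))"
    using nmon_lead[OF N[OF n0(1)] sw(2)[OF n0(1)]] .
  have Ln0: "L (nmon n0) = s" using filt0[OF s(2)] L(3)[OF sw(1)[OF n0(1)]] by (simp add: L_simps)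
  have "0 = L (\<Sum>n\<in>S. free_scal (c n) (nmon n))" using L(2) assms(3) by (simp add: env_ideal_def)
  also have "\<dots> = (\<Sum>n\<in>S. c n * L (nmon n))" by (simp add: klinear_sum[OF L(1)] L_simps)
  also have "\<dots> = (\<Sum>n\<in>S'. c n * L (nmon n))" 
    by (rule sum.mono_neutral_right) (auto simp: S'_def assms(1))
  also have "\<dots> = (\<Sum>n\<in>S'. if n = n0 then c n0 * s else 0)"
    by (rule sum.cong) (auto simp: zero Ln0)
  also have "\<dots> = c n0 * s" using n0(1) S'(1) by simp
  finally show False using s(1) n0(1) by (simp add: S'_def)
qed

definition normal_span :: "bit \<Rightarrow> ('k, 'g) free_alg set" where
  "normal_span i = FV.span (nmon ` {n \<in> normal_pairs. mdeg (snd n) = i} \<union> env_ideal)"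

text \<open>Induction on the length. A word with admissible letters is a multiple of a normal
  monomial up to shorter words; any other word contains an odd letter twice, can be permuted so that
  the two are adjacent, and is then a lower term by \<open>word_square\<close>.\<close>

lemma filt_normal_span: "filt d i \<subseteq> normal_span i"
proof (induction d)
  case 0
  have "filt 0 i \<subseteq> FV.span env_ideal" by (simp add: filt_def)
  also have "\<dots> \<subseteq> normal_span i" unfolding normal_span_def by (rule FV.span_mono) auto
  finally show ?case .
next
  case (Suc d)
  have "word w \<in> normal_span i" if w: "set w \<subseteq> B" "length w < Suc d" "degs w = i" for w
  proof (cases "length w < d")
    case True then show ?thesis using Suc filt_word w by blast
  next
    case False
    then have len: "length w = d" using w(2) by simp
    note low = subsetD[OF Suc]
    show ?thesis
    proof (cases "mset w \<in> admissible")
      case True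
      then obtain n where n: "n \<in> normal_pairs" "total_mset n = mset w" using total_surj by metis
      obtain s :: 'k where s: "s \<noteq> 0" "nmon n - free_scal s (word w) \<in> filt (size (total_mset n)) (mdeg (snd n))" 
        "mdeg (total_mset n) = mdeg (snd n)" using nmon_lead[OF n(1) n(2)[symmetric]] .
      have d: "mdeg (snd n) = i" using s(3) n(2) mdeg_mset w(3) by metis
      have "nmon n - free_scal s (word w) \<in> normal_span i"
        using low s(2) d n(2) len by simp
      moreover have "nmon n \<in> normal_span i" unfolding normal_span_def using n(1) d by (intro FV.span_base) auto
      ultimately have "free_scal (1 / s) (nmon n - (nmon n - free_scal s (word w))) \<in> normal_span i"
        unfolding normal_span_def by - (rule FV.span_scale, rule FV.span_diff)
      then show ?thesis using s(1) by simp
    next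
      case False
      then obtain i0 where i0: "deg i0 = 1" "count (mset w) i0 \<ge> 2"
        using w(1) by (auto simp: admissible_def not_le)
      have "repeat_mset 2 {#i0#} \<subseteq># mset w" using i0(2) by (auto simp: subseteq_mset_def)
      then obtain m where m: "mset w = repeat_mset 2 {#i0#} + m" by (metis subset_mset.add_diff_inverse)
      obtain v where "mset v = m" using ex_mset by blast
      then have mw: "mset w = mset (i0 # i0 # v)" using m by (simp add: numeral_2_eq_2)
      have B: "set (i0 # i0 # v) \<subseteq> B" using w(1) mw mset_eq_setD by metis
      have ld: "length (i0 # i0 # v) = d" "degs (i0 # i0 # v) = i"
        using len w(3) mw mset_eq_length degs_mset by metis+
      obtain s :: 'k where s: "word w - free_scal s (word (i0 # i0 # v)) \<in> filt (length w) (degs w)"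
        using word_permute[OF mw w(1)] .
      have "word w - free_scal s (word (i0 # i0 # v)) \<in> normal_span i" "word (i0 # i0 # v) \<in> normal_span i"
        using low s len w(3) word_square[OF B i0(1)] ld by auto
      then have "(word w - free_scal s (word (i0 # i0 # v))) + free_scal s (word (i0 # i0 # v)) \<in> normal_span i"
        unfolding normal_span_def by (intro FV.span_add FV.span_scale)
      then show ?thesis by simp
    qed
  qed
  then show ?case 
    unfolding filt_def normal_span_def 
    by (intro FV.span_minimal) (auto simp: normal_span_def intro: FV.span_base)
qed

lemma homogeneous_word_normal_span:
  assumes "list_all2 (\<lambda>x d. x \<in> part g d) xs ds"
  shows "word xs \<in> normal_span (sum_list ds)"
proof -
  have "word xs \<in> filt (Suc (length xs)) (sum_list ds)"
    using assms
  proof (induction rule: list_all2_induct)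
    case Nil show ?case using filt_word[of "[]" "Suc 0" 0] by simp
  next
    case (Cons x xs d ds)
    have "free_gen x * word xs \<in> filt (1 + Suc (length xs)) (d + sum_list ds)"
      using filt_gen[OF Cons(1)] by (intro filt_mult Cons) (simp add: numeral_2_eq_2)
    then show ?case by (simp only: word_Cons list.size sum_list.Cons add_Suc_right plus_1_eq_Suc add_0_right)
  qed
  then show ?thesis using filt_normal_span by blast
qed

text \<open>By independence, a linear map on U(g) may be prescribed freely on the normal monomials.
  This is the form in which PBW enters the descent of cocycles.\<close>

theorem normal_form_functional:
  assumes "vector_space t"
  obtains h where "klinear free_scal t h" "\<And>a. a \<in> env_ideal \<Longrightarrow> h a = 0" "\<And>n. n \<in> normal_pairs \<Longrightarrow> h (nmon n) = \<gamma> n"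
proof (rule extend_modulo_subspace[OF vector_space_free assms, where \<gamma> = \<gamma>])
  show "FV.subspace env_ideal"
    by (rule FV.subspaceI) (simp_all add: two_sidedD(1,2)[OF env.Q] two_sided_scal[OF env.Q])
  show "\<And>S c n. finite S \<Longrightarrow> S \<subseteq> normal_pairs \<Longrightarrow> (\<Sum>n\<in>S. free_scal (c n) (nmon n)) \<in> env_ideal \<Longrightarrow> n \<in> S \<Longrightarrow> c n = 0"
    by (rule nmon_independent)
qed (rule that)

end

section \<open>Cochains on the free algebra\<close>

definition homogeneous_words :: "('k, 'g) rlsa \<Rightarrow> bit \<Rightarrow> 'g list set" where
  "homogeneous_words g i = {xs. \<exists>ds. list_all2 (\<lambda>x d. x \<in> part g d) xs ds \<and> sum_list ds = i}"

definition fpart :: "('k::field, 'g) rlsa \<Rightarrow> bit \<Rightarrow> ('k, 'g) free_alg set" where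
  "fpart g i = FV.span (word ` homogeneous_words g i)"

lemma homogeneous_words_Nil: "[] \<in> homogeneous_words g 0"
  unfolding homogeneous_words_def by (auto intro!: exI[of _ "[]"])

lemma homogeneous_words_append:
  assumes "xs \<in> homogeneous_words g i" "ys \<in> homogeneous_words g j"
  shows "xs @ ys \<in> homogeneous_words g (i + j)"
proof -
  obtain ds es where "list_all2 (\<lambda>x d. x \<in> part g d) xs ds" "sum_list ds = i"
    "list_all2 (\<lambda>x d. x \<in> part g d) ys es" "sum_list es = j"
    using assms unfolding homogeneous_words_def by blast
  then have "list_all2 (\<lambda>x d. x \<in> part g d) (xs @ ys) (ds @ es) \<and> sum_list (ds @ es) = i + j"
    by (simp only: list_all2_appendI sum_list.append simp_thms)
  then show ?thesis unfolding homogeneous_words_def by blast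
qed

lemma homogeneous_words_single: "x \<in> part g i \<Longrightarrow> [x] \<in> homogeneous_words g i"
  unfolding homogeneous_words_def by (auto intro!: exI[of _ "[i]"])

lemma fpart_word: "xs \<in> homogeneous_words g i \<Longrightarrow> word xs \<in> fpart g i"
  unfolding fpart_def by (intro FV.span_base imageI)

lemma fpart_1: "1 \<in> fpart g 0"
  using fpart_word[OF homogeneous_words_Nil] by simp

lemma fpart_gen: "x \<in> part g i \<Longrightarrow> free_gen x \<in> fpart g i"
  using fpart_word[OF homogeneous_words_single] by (simp add: word_single)

lemma fpart_closed: 
  shows fpart_add: "a \<in> fpart g i \<Longrightarrow> b \<in> fpart g i \<Longrightarrow> a + b \<in> fpart g i"
    and fpart_diff: "a \<in> fpart g i \<Longrightarrow> b \<in> fpart g i \<Longrightarrow> a - b \<in> fpart g i"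
    and fpart_scale: "a \<in> fpart g i \<Longrightarrow> free_scal c a \<in> fpart g i"
    and fpart_0: "0 \<in> fpart g i"
  unfolding fpart_def by (auto intro: FV.span_add FV.span_diff FV.span_scale FV.span_zero)

lemma fpart_induct [consumes 1, case_names zero add]:
  assumes "a \<in> fpart g i" "P 0" "\<And>c xs a. xs \<in> homogeneous_words g i \<Longrightarrow> a \<in> fpart g i \<Longrightarrow> P a \<Longrightarrow> P (free_scal c (word xs) + a)"
  shows "P a"
proof -
  have "a \<in> fpart g i \<and> P a"
    using assms(1) unfolding fpart_def
  proof (induction rule: FV.span_induct_alt)
    case base then show ?case using assms(2) by (simp add: FV.span_zero)
  next
    case (step c x y)
    then obtain xs where xs: "xs \<in> homogeneous_words g i" "x = word xs" by blast
    have "free_scal c x + y \<in> FV.span (word ` homogeneous_words g i)"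
      using step by (intro FV.span_add FV.span_scale FV.span_base[of x]) auto
    then show ?case using step assms(3)[OF xs(1), of y c] xs(2) by (simp add: fpart_def)
  qed
  then show ?thesis by simp
qed

lemma fpart_mult:
  assumes "a \<in> fpart g i" "b \<in> fpart g j" shows "a * b \<in> fpart g (i + j)"
  using assms(1)
proof (induction rule: fpart_induct)
  case zero show ?case by (simp add: fpart_0)
next
  case (add c xs a)
  have "word xs * b \<in> fpart g (i + j)"
    using assms(2)
  proof (induction rule: fpart_induct)
    case zero show ?case by (simp add: fpart_0)
  next
    case (add c ys b)
    then show ?case using homogeneous_words_append[OF \<open>xs \<in> _\<close> add(1)]
      by (simp only: distrib_left free_scal_mult_right word_append[symmetric] fpart_add fpart_scale fpart_word)
  qed
  then show ?case using add by (simp only: distrib_right free_scal_mult_left fpart_add fpart_scale)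
qed

lemma fpart_power: "a \<in> fpart g 0 \<Longrightarrow> a ^ n \<in> fpart g 0"
  by (induction n) (use fpart_mult[of a g 0 _ 0] in \<open>auto simp: fpart_1\<close>)

lemma eps_fpart_1: "a \<in> fpart g 1 \<Longrightarrow> eps a = 0"
proof (induction rule: fpart_induct)
  case (add c xs a)
  then have "xs \<noteq> []" by (auto simp: homogeneous_words_def)
  then show ?case using add by (simp add: eps_simps eps_word)
qed (simp add: eps_simps)

text \<open>Substitution of letters. It is used for the projection from the letters of an extension
  to those of \<open>g\<close>, and for the identity.\<close>

definition fmap :: "('l \<Rightarrow> 'g) \<Rightarrow> ('k::field, 'l) free_alg \<Rightarrow> ('k, 'g) free_alg" where
  "fmap \<phi> = word_lift free_scal (\<lambda>w. word (map \<phi> w))"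

lemma klinear_fmap: "klinear free_scal free_scal (fmap \<phi>)"
  unfolding fmap_def by (rule klinear_word_lift[OF vector_space_free])

lemmas fmap_simps = klinearD(1-5)[OF klinear_fmap]

lemma fmap_word: "fmap \<phi> (word w) = word (map \<phi> w)"
  by (simp add: fmap_def vector_space_free)

lemma fmap_gen: "fmap \<phi> (free_gen x) = free_gen (\<phi> x)"
  using fmap_word[of \<phi> "[x]"] by (simp add: word_single)

lemma fmap_1: "fmap \<phi> 1 = 1"
  using fmap_word[of \<phi> "[]"] by simp

lemma fmap_mult: "fmap \<phi> (a * b) = fmap \<phi> a * fmap \<phi> b"
proof (induction a rule: free_alg_induct)
  case zero show ?case by (simp add: fmap_simps)
next
  case (add c xs a)
  have "fmap \<phi> (word xs * b) = fmap \<phi> (word xs) * fmap \<phi> b"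
    by (induction b rule: free_alg_induct)
       (auto simp: fmap_simps free_scal_mult_right distrib_left word_append[symmetric] fmap_word)
  then show ?case using add by (simp add: distrib_right fmap_simps free_scal_mult_left)
qed

lemma fmap_power: "fmap \<phi> (a ^ n) = fmap \<phi> a ^ n"
  by (induction n) (auto simp: fmap_mult fmap_1)

lemma fmap_id: "fmap (\<lambda>x. x) a = a"
  by (rule klinear_free_eqI[OF klinear_fmap]) (auto simp: fmap_word intro: klinearI vector_space_free)

lemma eps_fmap: "eps (fmap \<phi> a) = eps a"
  by (rule klinear_free_eqI[OF klinear_compose[OF klinear_fmap klinear_eps] klinear_eps]) (simp add: fmap_word eps_word)

section \<open>The action, the two ideals and normalised cochains on the free algebra\<close>

locale restricted_setting =
  fixes g :: "('k::field, 'g::ab_group_add) rlsa"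
    and M :: "('k, 'm::ab_group_add) rlsa"
    and act :: "'g \<Rightarrow> 'm \<Rightarrow> 'm"
  assumes char_gt_2: "CHAR('k) > 2"
    and restricted_g: "restricted_lie_superalgebra g"
    and restricted_M: "restricted_lie_superalgebra M"
    and abelian_M: "strongly_abelian M"
    and module_M: "restricted_module g M act"
begin

lemma lie_g: "lie_superalgebra g"
  using restricted_g unfolding restricted_lie_superalgebra_def by (rule conjunct1)

sublocale lie_super g
proof unfold_locales
  show "super_space g" using lie_g unfolding lie_superalgebra_def by (rule conjunct1)
qed (rule lie_g)

sublocale M: graded_space M
  using module_M by unfold_locales (simp add: restricted_module_def)

lemmas gvec = vs.vector_space_axioms
lemmas mvec = M.vs.vector_space_axioms

lemma pmap_part: "x \<in> part g 0 \<Longrightarrow> pmap g x \<in> part g 0"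
  and pmap_scale: "x \<in> part g 0 \<Longrightarrow> pmap g (smul g c x) = smul g (c ^ CHAR('k)) (pmap g x)"
  and pmap_br: "x \<in> part g 0 \<Longrightarrow> br g (pmap g x) y = (br g x ^^ CHAR('k)) y"
  and pmap_add: "x \<in> part g 0 \<Longrightarrow> y \<in> part g 0 \<Longrightarrow>
     pmap g (x + y) = pmap g x + pmap g y + (\<Sum>i = 1..CHAR('k) - 1. jacobson_s g i x y)"
  using restricted_g unfolding restricted_lie_superalgebra_def by blast+

lemma act_bilinear: "even_bilinear g M M act"
  using module_M by (simp add: restricted_module_def)

lemmas act_simps = even_bilinear_simps[OF act_bilinear]
lemmas act_part = even_bilinear_part[OF act_bilinear]

lemma act_br: "x \<in> part g i \<Longrightarrow> y \<in> part g j \<Longrightarrow> act (br g x y) m = act x (act y m) - ksign i j (act y (act x m))"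
  and act_pmap: "x \<in> part g 0 \<Longrightarrow> (act x ^^ CHAR('k)) m = act (pmap g x) m"
  using module_M unfolding restricted_module_def by blast+

lemma prime_p: "prime CHAR('k)"
  using char_gt_2 by (intro prime_CHAR_semidom) simp

abbreviation fa where "fa \<equiv> free_act M act"

lemma fa_eq: "fa a m = word_lift (smul M) (\<lambda>w. foldr act w m) a"
  by (simp add: free_act_def word_lift_def)

lemma klinear_fa: "klinear free_scal (smul M) (\<lambda>a. fa a m)"
  unfolding fa_eq by (rule klinear_word_lift[OF mvec])

lemmas fa_simps = klinearD(1-5)[OF klinear_fa]

lemma fa_word: "fa (word w) m = foldr act w m"
  by (simp add: fa_eq mvec)

lemma fa_gen [simp]: "fa (free_gen x) m = act x m"
  using fa_word[of "[x]"] by (simp add: word_single)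

lemma fa_1 [simp]: "fa 1 m = m"
  using fa_word[of "[]"] by simp

lemma klinear_foldr_act: "klinear (smul M) (smul M) (foldr act w)"
proof (induction w)
  case Nil show ?case by (auto intro!: klinearI mvec)
next
  case (Cons x w)
  show ?case using klinear_compose[OF Cons even_bilinear_right[OF act_bilinear, of x]] by (simp add: comp_def)
qed

lemma klinear_fa_right: "klinear (smul M) (smul M) (fa a)"
proof (induction a rule: free_alg_induct)
  case zero show ?case by (simp add: fa_simps klinear_const_zero mvec)
next
  case (add c xs a)
  show ?case using klinear_plus[OF klinear_scaled[OF klinear_foldr_act[of xs], of c] add] by (simp add: fa_simps fa_word)
qed

lemmas fa_right_simps = klinearD(1-5)[OF klinear_fa_right]

lemma fa_mult: "fa (a * b) m = fa a (fa b m)"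
proof (induction a rule: free_alg_induct)
  case zero show ?case by (simp add: fa_simps)
next
  case (add c xs a)
  have "fa (word xs * b) m = fa (word xs) (fa b m)"
    by (induction b rule: free_alg_induct)
       (simp_all add: fa_simps fa_right_simps free_scal_mult_right distrib_left word_append[symmetric] fa_word)
  then show ?case using add by (simp add: distrib_right fa_simps free_scal_mult_left)
qed

lemma fa_gen_power: "fa (free_gen x ^ n) m = (act x ^^ n) m"
  by (induction n) (simp_all add: fa_mult)

lemma fa_part: "a \<in> fpart g i \<Longrightarrow> m \<in> part M j \<Longrightarrow> fa a m \<in> part M (i + j)"
proof (induction rule: fpart_induct)
  case (add c xs a)
  then obtain ds where ds: "list_all2 (\<lambda>x d. x \<in> part g d) xs ds" "sum_list ds = i"
    unfolding homogeneous_words_def by blast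
  have "foldr act xs m \<in> part M (sum_list ds + j)"
    using ds(1)
  proof (induction rule: list_all2_induct)
    case Nil show ?case using \<open>m \<in> part M j\<close> by (simp only: foldr.simps id_apply sum_list.Nil add_0)
  next
    case (Cons x xs d ds)
    then show ?case using act_part[OF Cons(1) Cons(3)] by (simp only: foldr.simps comp_apply sum_list.Cons add.assoc)
  qed
  then show ?case using add ds(2) by (simp only: fa_simps fa_word M.part_add M.part_scale)
qed (simp only: fa_simps M.part_0)

subsection \<open>The ideals defining the two enveloping algebras\<close>

definition zd :: "'g \<Rightarrow> ('k, 'g) free_alg" where
  "zd x = free_gen x ^ CHAR('k) - free_gen (pmap g x)"

text \<open>\<open>JU\<close> and \<open>Ju\<close> are the kernels of the projections from the free
  algebra to U(g) and u(g), see \<open>presented_U\<close> and \<open>presented_u\<close>.\<close>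

definition JU :: "('k, 'g) free_alg set" where "JU = gen_ideal (env_relations g)"
definition Ju :: "('k, 'g) free_alg set" where "Ju = gen_ideal (env_relations g \<union> zd ` part g 0)"

sublocale JU: char_bracket_ideal g JU
proof -
  interpret bracket_ideal g JU
    by (rule bracket_idealI) (simp_all add: JU_def two_sided_gen_ideal gen_ideal_superset)
  show "char_bracket_ideal g JU" by unfold_locales (rule char_gt_2)
qed

lemma JU_subset_Ju: "JU \<subseteq> Ju"
  unfolding JU_def Ju_def using gen_ideal_superset[of "env_relations g \<union> zd ` part g 0"]
  by (intro gen_ideal_minimal two_sided_gen_ideal) blast

lemma two_sided_Ju: "two_sided Ju" by (simp add: Ju_def two_sided_gen_ideal)

lemma zd_Ju: "x \<in> part g 0 \<Longrightarrow> zd x \<in> Ju"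
  unfolding Ju_def using gen_ideal_superset[of "env_relations g \<union> zd ` part g 0"] by blast

lemma Ju_minimal: "two_sided T \<Longrightarrow> JU \<subseteq> T \<Longrightarrow> zd ` part g 0 \<subseteq> T \<Longrightarrow> Ju \<subseteq> T"
  unfolding Ju_def using gen_ideal_superset[of "env_relations g"] by (intro gen_ideal_minimal) (auto simp: JU_def)

lemma eps_zd [simp]: "eps (zd x) = 0"
  using prime_gt_0_nat[OF prime_p] by (simp add: zd_def eps_simps eps_power)

lemma fa_zd: "x \<in> part g 0 \<Longrightarrow> fa (zd x) m = 0"
  by (simp add: zd_def fa_simps fa_gen_power act_pmap)

lemma zd_fpart: "x \<in> part g 0 \<Longrightarrow> zd x \<in> fpart g 0"
  unfolding zd_def by (intro fpart_diff fpart_power fpart_gen pmap_part)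

lemma two_sided_annihilator: "two_sided {a. eps a = 0 \<and> (\<forall>m. fa a m = 0)}"
  unfolding two_sided_def by (auto simp: eps_simps fa_simps eps_mult fa_mult fa_right_simps)

lemma env_relations_annihilator: "env_relations g \<subseteq> {a. eps a = 0 \<and> (\<forall>m. fa a m = 0)}"
proof -
  have ks: "fa (ksign i j a) m = ksign i j (fa a m)" "eps a = 0 \<Longrightarrow> eps (ksign i j a) = 0" for i j a m
    by (auto simp: ksign_def fa_simps eps_simps)
  show ?thesis
    unfolding env_relations_def by (auto simp: eps_simps eps_mult fa_simps fa_mult act_simps ks act_br)
qed

text \<open>What the cochain calculus asks of an ideal. Both \<open>JU\<close> and \<open>Ju\<close>
  qualify, so the two cohomologies are treated at once.\<close>

definition good :: "('k, 'g) free_alg set \<Rightarrow> bool" where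
  "good J \<longleftrightarrow> two_sided J \<and> JU \<subseteq> J \<and> J \<subseteq> {a. eps a = 0 \<and> (\<forall>m. fa a m = 0)}"

lemma good_JU: "good JU"
  unfolding good_def JU_def
  by (auto simp: two_sided_gen_ideal dest!: subsetD[OF gen_ideal_minimal[OF two_sided_annihilator env_relations_annihilator]])

lemma good_Ju: "good Ju"
  unfolding good_def
proof (intro conjI two_sided_Ju JU_subset_Ju Ju_minimal two_sided_annihilator)
  show "JU \<subseteq> {a. eps a = 0 \<and> (\<forall>m. fa a m = 0)}" using good_JU by (simp only: good_def)
  show "zd ` part g 0 \<subseteq> {a. eps a = 0 \<and> (\<forall>m. fa a m = 0)}" by (auto simp: fa_zd)
qed

lemma goodD:
  assumes "good J"
  shows "two_sided J" "JU \<subseteq> J" "a \<in> J \<Longrightarrow> eps a = 0" "a \<in> J \<Longrightarrow> fa a m = 0"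
  using assms by (auto simp: good_def)

text \<open>The operator (ad x)^p is the commutator with x^p by \<open>gen_p_commutator\<close> and
  with x^[p] by \<open>pmap_br\<close>; hence the difference commutes with every letter.\<close>

lemma zd_central: 
  assumes x: "x \<in> part g 0"
  shows "zd x * a - a * zd x \<in> JU"
proof (induction a rule: free_alg_induct)
  case zero show ?case by (simp add: two_sidedD[OF JU.Q])
next
  case (add c xs a)
  have gen: "zd x * free_gen y - free_gen y * zd x \<in> JU" for y
  proof -
    let ?x = "free_gen x ^ CHAR('k)"
    have "JU.cg (?x * free_gen y - free_gen y * ?x) (free_gen (br g (pmap g x) y))"
      unfolding pmap_br[OF x] by (rule JU.cg_sym[OF JU.gen_p_commutator[OF x]])
    also have "JU.cg (free_gen (br g (pmap g x) y)) (free_gen (pmap g x) * free_gen y - free_gen y * free_gen (pmap g x))"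
      by (rule JU.gen_br_even[OF pmap_part[OF x]])
    finally show ?thesis by (simp add: cong_mod_def zd_def algebra_simps)
  qed
  have w: "zd x * word xs - word xs * zd x \<in> JU"
  proof (induction xs)
    case Nil show ?case by (simp add: two_sidedD[OF JU.Q])
  next
    case (Cons y ys)
    have "(zd x * free_gen y - free_gen y * zd x) * word ys + free_gen y * (zd x * word ys - word ys * zd x) \<in> JU"
      by (intro two_sidedD(2-4)[OF JU.Q] gen Cons)
    then show ?case by (simp add: word_Cons algebra_simps)
  qed
  have "free_scal c (zd x * word xs - word xs * zd x) + (zd x * a - a * zd x) \<in> JU"
    by (intro two_sidedD(2)[OF JU.Q] two_sided_scal[OF JU.Q] w add)
  then show ?case by (simp add: algebra_simps free_scal_mult_left free_scal_mult_right FV.scale_right_diff_distrib)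
qed

text \<open>The same Jacobson terms occur in (x + y)^p and in the p-map of x + y, and cancel in the
  difference.\<close>

lemma zd_add:
  assumes x: "x \<in> part g 0" and y: "y \<in> part g 0"
  shows "JU.cg (zd (x + y)) (zd x + zd y)"
proof -
  let ?s = "\<Sum>i = 1..CHAR('k) - 1. jacobson_s g i x y"
  have "JU.cg (zd (x + y)) ((free_gen x ^ CHAR('k) + free_gen y ^ CHAR('k) + free_gen ?s) - (free_gen (pmap g x) + free_gen (pmap g y) + free_gen ?s))"
    unfolding zd_def pmap_add[OF x y]
    by (intro JU.gen_power_add[OF x y] cong_mod_diff[OF JU.Q] JU.cg_trans[OF JU.gen_add] cong_mod_add[OF JU.Q] JU.gen_add JU.cg_refl)
  then show ?thesis by (simp add: zd_def algebra_simps)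
qed

lemma free_scal_power: "free_scal c a ^ n = free_scal (c ^ n) (a ^ n)"
  by (induction n) (simp_all add: free_scal_mult_left free_scal_mult_right mult.commute)

lemma zd_scale:
  assumes x: "x \<in> part g 0"
  shows "JU.cg (zd (smul g c x)) (free_scal (c ^ CHAR('k)) (zd x))"
proof -
  have "JU.cg (zd (smul g c x)) (free_scal c (free_gen x) ^ CHAR('k) - free_scal (c ^ CHAR('k)) (free_gen (pmap g x)))"
    unfolding zd_def pmap_scale[OF x]
    by (intro cong_mod_diff[OF JU.Q] cong_mod_power[OF JU.Q] JU.gen_scale)
  then show ?thesis by (simp add: zd_def free_scal_power FV.scale_right_diff_distrib)
qed

subsection \<open>Cochains, cocycles and coboundaries\<close>

text \<open>A cochain on the augmentation ideal of the quotient by \<open>J\<close>, extended to the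
  whole free algebra by the value 0 at 1. The algebra enters only through the ideal, so that
  restricted cochains are literally among the ordinary ones.\<close>

definition cochain1 :: "('k, 'g) free_alg set \<Rightarrow> (('k, 'g) free_alg \<Rightarrow> 'm) \<Rightarrow> bool" where
  "cochain1 J c \<longleftrightarrow> klinear free_scal (smul M) c \<and> c 1 = 0 \<and> (\<forall>a\<in>J. c a = 0) \<and> (\<forall>i. \<forall>a\<in>fpart g i. c a \<in> part M i)"

definition cochain2 :: "('k, 'g) free_alg set \<Rightarrow> (('k, 'g) free_alg \<Rightarrow> ('k, 'g) free_alg \<Rightarrow> 'm) \<Rightarrow> bool" where
  "cochain2 J f \<longleftrightarrow> (\<forall>b. klinear free_scal (smul M) (\<lambda>a. f a b)) \<and> (\<forall>a. klinear free_scal (smul M) (f a))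
     \<and> (\<forall>a. f 1 a = 0 \<and> f a 1 = 0) \<and> (\<forall>a\<in>J. \<forall>b. f a b = 0 \<and> f b a = 0)
     \<and> (\<forall>i j. \<forall>a\<in>fpart g i. \<forall>b\<in>fpart g j. f a b \<in> part M (i + j))"

text \<open>The \<open>eps\<close> terms in \<open>d0\<close> and \<open>d1\<close> restore the
  value 0 at 1. On the augmentation ideal they vanish, leaving the differentials of the
  complex.\<close>

definition d0 :: "'m \<Rightarrow> ('k, 'g) free_alg \<Rightarrow> 'm" where
  "d0 m a = fa a m - smul M (eps a) m"

definition d1 :: "(('k, 'g) free_alg \<Rightarrow> 'm) \<Rightarrow> ('k, 'g) free_alg \<Rightarrow> ('k, 'g) free_alg \<Rightarrow> 'm" where
  "d1 c a b = fa a (c b) - c (a * b) + smul M (eps b) (c a)"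

definition cocycle1 where
  "cocycle1 J c \<longleftrightarrow> cochain1 J c \<and> (\<forall>a b. c (a * b) = fa a (c b) + smul M (eps b) (c a))"

definition cocycle2 where
  "cocycle2 J f \<longleftrightarrow> cochain2 J f \<and>
     (\<forall>a b c. f (a * b) c = fa a (f b c) + f a (b * c) - smul M (eps c) (f a b))"

lemma cochain1D:
  assumes "cochain1 J c"
  shows "klinear free_scal (smul M) c" "c 1 = 0" "a \<in> J \<Longrightarrow> c a = 0" "a \<in> fpart g i \<Longrightarrow> c a \<in> part M i"
  using assms by (auto simp: cochain1_def)

lemma cochain2D:
  assumes "cochain2 J f"
  shows "klinear free_scal (smul M) (\<lambda>a. f a b)" "klinear free_scal (smul M) (f a)" "f 1 a = 0" "f a 1 = 0"
    "a \<in> J \<Longrightarrow> f a b = 0" "a \<in> J \<Longrightarrow> f b a = 0" "a \<in> fpart g i \<Longrightarrow> b \<in> fpart g j \<Longrightarrow> f a b \<in> part M (i + j)"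
  using assms by (auto simp: cochain2_def)

lemma cocycle1D: "cocycle1 J c \<Longrightarrow> cochain1 J c" "cocycle1 J c \<Longrightarrow> c (a * b) = fa a (c b) + smul M (eps b) (c a)"
  by (auto simp: cocycle1_def)

lemma cocycle2D: "cocycle2 J f \<Longrightarrow> cochain2 J f"
  "cocycle2 J f \<Longrightarrow> f (a * b) c = fa a (f b c) + f a (b * c) - smul M (eps c) (f a b)"
  by (auto simp: cocycle2_def)

lemma linear_cong: 
  assumes "klinear free_scal (smul M) c" "\<And>a. a \<in> J \<Longrightarrow> c a = 0" "cong_mod J a b"
  shows "c a = c b"
  using assms(2)[of "a - b"] assms(3) by (simp add: cong_mod_def klinear_diff[OF assms(1)])

lemma cochain1_mono: "J \<subseteq> J' \<Longrightarrow> cochain1 J' c \<Longrightarrow> cochain1 J c"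
  and cochain2_mono: "J \<subseteq> J' \<Longrightarrow> cochain2 J' f \<Longrightarrow> cochain2 J f"
  by (auto simp: cochain1_def cochain2_def)

lemma cocycle1_mono: "J \<subseteq> J' \<Longrightarrow> cocycle1 J' c \<Longrightarrow> cocycle1 J c"
  and cocycle2_mono: "J \<subseteq> J' \<Longrightarrow> cocycle2 J' f \<Longrightarrow> cocycle2 J f"
  using cochain1_mono cochain2_mono by (auto simp: cocycle1_def cocycle2_def)

lemma cocycle1_d0:
  assumes "good J" "m \<in> part M 0"
  shows "cocycle1 J (d0 m)"
  unfolding cocycle1_def cochain1_def
proof (intro conjI ballI allI)
  show "klinear free_scal (smul M) (d0 m)"
    by (rule klinearI[OF vector_space_free mvec])
      (simp_all add: d0_def fa_simps eps_simps M.vs.scale_left_distrib M.vs.scale_right_diff_distrib)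
  show "d0 m 1 = 0" by (simp add: d0_def)
  show "d0 m a = 0" if "a \<in> J" for a using goodD(3,4)[OF assms(1) that] by (simp add: d0_def)
  show "d0 m a \<in> part M i" if "a \<in> fpart g i" for i a
  proof -
    have "smul M (eps a) m \<in> part M i"
    proof (cases "i = 1")
      case True then show ?thesis using eps_fpart_1[of a g] that by simp
    next
      case False then have "i = 0" by (cases i) simp_all
      then show ?thesis using assms(2) by simp
    qed
    then show ?thesis unfolding d0_def using fa_part[OF that assms(2)] by (simp only: M.part_diff add_0_right)
  qed
  show "d0 m (a * b) = fa a (d0 m b) + smul M (eps b) (d0 m a)" for a b
    by (simp add: d0_def fa_mult fa_right_simps eps_mult M.vs.scale_right_diff_distrib mult.commute)
qed

lemma cocycle2_d1:
  assumes J: "good J" and c: "cochain1 J c"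
  shows "cocycle2 J (d1 c)"
  unfolding cocycle2_def cochain2_def
proof (intro conjI ballI allI)
  note lin = klinearD(1-5)[OF cochain1D(1)[OF c]]
  show "klinear free_scal (smul M) (\<lambda>a. d1 c a b)" for b
    by (rule klinearI[OF vector_space_free mvec])
      (simp_all add: d1_def lin fa_simps distrib_right free_scal_mult_left M.vs.scale_right_distrib M.vs.scale_right_diff_distrib mult.commute)
  show "klinear free_scal (smul M) (d1 c a)" for a
    by (rule klinearI[OF vector_space_free mvec])
      (simp_all add: d1_def lin fa_right_simps distrib_left free_scal_mult_right eps_simps M.vs.scale_left_distrib 
        M.vs.scale_right_distrib M.vs.scale_right_diff_distrib)
  show "d1 c 1 a = 0" "d1 c a 1 = 0" for a by (simp_all add: d1_def cochain1D(2)[OF c] fa_right_simps)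
  show "d1 c a b = 0" "d1 c b a = 0" if "a \<in> J" for a b
    using that two_sidedD(3,4)[OF goodD(1)[OF J] that, of b] goodD(3,4)[OF J] 
    by (simp_all add: d1_def cochain1D(3)[OF c] fa_right_simps)
  show "d1 c a b \<in> part M (i + j)" if a: "a \<in> fpart g i" and b: "b \<in> fpart g j" for a b i j
  proof -
    have "smul M (eps b) (c a) \<in> part M (i + j)"
    proof (cases "j = 1")
      case True then show ?thesis using eps_fpart_1[of b g] b by simp
    next
      case False then have "j = 0" by (cases j) simp_all
      then show ?thesis using cochain1D(4)[OF c a] by (simp only: add_0_right M.part_scale)
    qed
    then show ?thesis unfolding d1_def
      using fa_part[OF a cochain1D(4)[OF c b]] cochain1D(4)[OF c fpart_mult[OF a b]] by (simp only: M.part_diff M.part_add)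
  qed
  show "d1 c (a * b) e = fa a (d1 c b e) + d1 c a (b * e) - smul M (eps e) (d1 c a b)" for a b e
    by (simp add: d1_def fa_mult fa_right_simps eps_mult mult.assoc M.vs.scale_right_distrib M.vs.scale_right_diff_distrib mult.commute)
qed

subsection \<open>Extending cochains from generators\<close>

context
  fixes \<phi> :: "'l \<Rightarrow> 'g" and h :: "'l \<Rightarrow> 'm" and f :: "('k, 'g) free_alg \<Rightarrow> ('k, 'g) free_alg \<Rightarrow> 'm"
begin

text \<open>The solution e of e(ab) = a.e(b) + f(a,b) + eps(b) e(a) with values \<open>h\<close> on
  the letters. In other words, it is the \<open>M\<close>-component of the homomorphism from the
  free algebra on \<open>'l\<close> into the associative algebra with product (a,m)(b,n) = (ab, a.n
  + f(a,b) + eps(b) m).\<close>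

fun ext_word :: "'l list \<Rightarrow> 'm" where
  "ext_word [] = 0"
| "ext_word (x # w) = act (\<phi> x) (ext_word w) + f (free_gen (\<phi> x)) (word (map \<phi> w)) + (if w = [] then h x else 0)"

definition ext :: "('k, 'l) free_alg \<Rightarrow> 'm" where
  "ext = word_lift (smul M) ext_word"

lemma klinear_ext: "klinear free_scal (smul M) ext"
  unfolding ext_def by (rule klinear_word_lift[OF mvec])

lemmas ext_simps = klinearD(1-5)[OF klinear_ext]

lemma ext_word_eq: "ext (word w) = ext_word w"
  by (simp add: ext_def mvec)

lemma ext_1: "ext 1 = 0"
  using ext_word_eq[of "[]"] by simp

context
  fixes J
  assumes f: "cocycle2 J f"
begin

lemma ext_gen: "ext (free_gen x) = h x"
  using ext_word_eq[of "[x]"] cochain2D(4)[OF cocycle2D(1)[OF f]] by (simp add: word_single act_simps)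

text \<open>Induction on the words of the left factor; the cocycle identity of \<open>f\<close>,
  which is associativity of the twisted product, makes the step work.\<close>

lemma ext_mult: "ext (a * b) = fa (fmap \<phi> a) (ext b) + f (fmap \<phi> a) (fmap \<phi> b) + smul M (eps b) (ext a)"
proof (induction a rule: free_alg_induct)
  note fc = cocycle2D(1)[OF f]
  note fl = klinearD(1-5)[OF cochain2D(1)[OF fc]] klinearD(1-5)[OF cochain2D(2)[OF fc]]
  case zero show ?case by (simp add: ext_simps fmap_simps fa_simps fl)
next
  note fc = cocycle2D(1)[OF f]
  note fl = klinearD(1-5)[OF cochain2D(1)[OF fc]] klinearD(1-5)[OF cochain2D(2)[OF fc]]
  case (add c xs a)
  have step: "ext (free_gen x * b) = act (\<phi> x) (ext b) + f (free_gen (\<phi> x)) (fmap \<phi> b) + smul M (eps b) (h x)" for x b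
    by (induction b rule: free_alg_induct)
      (auto simp: ext_simps fmap_simps act_simps fl eps_simps distrib_left free_scal_mult_right word_Cons[symmetric] ext_word_eq
        fmap_word eps_word M.vs.scale_right_distrib M.vs.scale_left_distrib)
  have w: "ext (word xs * b) = fa (fmap \<phi> (word xs)) (ext b) + f (fmap \<phi> (word xs)) (fmap \<phi> b) + smul M (eps b) (ext (word xs))"
  proof (induction xs)
    case Nil show ?case by (simp add: fmap_1 cochain2D(3)[OF fc] ext_1)
  next
    case (Cons x xs)
    have "ext (word (x # xs) * b) = ext (free_gen x * (word xs * b))" by (simp add: word_Cons mult.assoc)
    also have "\<dots> = act (\<phi> x) (fa (fmap \<phi> (word xs)) (ext b) + f (fmap \<phi> (word xs)) (fmap \<phi> b) + smul M (eps b) (ext (word xs)))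
       + f (free_gen (\<phi> x)) (fmap \<phi> (word xs) * fmap \<phi> b) + smul M (eps (word xs) * eps b) (h x)"
      unfolding step[of x "word xs * b"] Cons by (simp add: fmap_mult eps_mult)
    also have "\<dots> = fa (fmap \<phi> (word (x # xs))) (ext b) + f (free_gen (\<phi> x) * fmap \<phi> (word xs)) (fmap \<phi> b)
       + smul M (eps b) (act (\<phi> x) (ext (word xs)) + f (free_gen (\<phi> x)) (fmap \<phi> (word xs)) + smul M (eps (word xs)) (h x))"
      unfolding cocycle2D(2)[OF f]
      by (simp add: act_simps word_Cons fmap_mult fmap_gen fa_mult M.vs.scale_right_distrib eps_fmap mult.commute)
    also have "act (\<phi> x) (ext (word xs)) + f (free_gen (\<phi> x)) (fmap \<phi> (word xs)) + smul M (eps (word xs)) (h x) = ext (word (x # xs))"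
      unfolding word_Cons[of x xs] step ..
    finally show ?case by (simp add: word_Cons fmap_mult fmap_gen)
  qed
  then show ?case using add
    by (simp add: distrib_right free_scal_mult_left ext_simps fmap_simps fa_simps fl M.vs.scale_right_distrib mult.commute)
qed

text \<open>The set is the kernel of the homomorphism into the quotient by \<open>J\<close> plus
  \<open>M\<close>, with the twisted product.\<close>

lemma two_sided_ext:
  assumes "good J"
  shows "two_sided {a. fmap \<phi> a \<in> J \<and> ext a = 0}"
  unfolding two_sided_def
  using two_sidedD[OF goodD(1)[OF assms]] goodD(3,4)[OF assms] cochain2D(5,6)[OF cocycle2D(1)[OF f]] 
  by (auto simp: fmap_simps ext_simps fmap_mult ext_mult fa_right_simps eps_fmap[of \<phi>, symmetric])

text \<open>For \<open>n = p - 1\<close> this is the \<open>M\<close>-component of a p-th power, and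
  it explains the p-map of the extension defined by a cocycle.\<close>

lemma ext_gen_power:
  "ext (free_gen x ^ Suc n) = (act (\<phi> x) ^^ n) (h x) + f (free_gen (\<phi> x) ^ n) (free_gen (\<phi> x))"
proof -
  have "ext (free_gen x ^ Suc n) = ext (free_gen x ^ n * free_gen x)" by (simp add: power_commutes)
  then show ?thesis unfolding ext_mult by (simp add: fmap_power fmap_gen fa_gen_power ext_gen)
qed

end

end

lemma ext_part:
  assumes f: "cocycle2 J f" and h: "\<And>i x. x \<in> part g i \<Longrightarrow> h x \<in> part M i"
  shows "a \<in> fpart g i \<Longrightarrow> ext (\<lambda>x. x) h f a \<in> part M i"
proof (induction rule: fpart_induct)
  case zero show ?case by (simp add: klinear_zero[OF klinear_ext])
next
  case (add c xs a)
  then obtain ds where ds: "list_all2 (\<lambda>x d. x \<in> part g d) xs ds" "sum_list ds = i"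
    unfolding homogeneous_words_def by blast
  have "ext_word (\<lambda>x. x) h f xs \<in> part M (sum_list ds)"
    using ds(1)
  proof (induction rule: list_all2_induct)
    case Nil then show ?case by simp
  next
    case (Cons x xs d ds)
    have xs: "xs \<in> homogeneous_words g (sum_list ds)" using Cons(2) unfolding homogeneous_words_def by blast
    have 1: "act x (ext_word (\<lambda>x. x) h f xs) \<in> part M (sum_list (d # ds))"
      using act_part[OF Cons(1,3)] by (simp only: sum_list.Cons)
    have 2: "f (free_gen x) (word xs) \<in> part M (sum_list (d # ds))"
      using cochain2D(7)[OF cocycle2D(1)[OF f] fpart_gen[OF Cons(1)] fpart_word[OF xs]] by (simp only: sum_list.Cons)
    have 3: "(if xs = [] then h x else 0) \<in> part M (sum_list (d # ds))"
      using h[OF Cons(1)] Cons(2) by (auto simp del: add_bit_eq_xor)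
    show ?case unfolding ext_word.simps list.map_ident using 1 2 3 by (simp only: M.part_add)
  qed
  then show ?case using add ds(2)
    by (simp only: klinear_add[OF klinear_ext] klinear_scale[OF klinear_ext] ext_word_eq M.part_add M.part_scale)
qed

end

section \<open>Which cochains on U(g) come from u(g)\<close>

context restricted_setting
begin

lemma two_nonzero: "(2 :: 'k) \<noteq> 0"
  using JU.of_nat_invertible[of 2] char_gt_2 by simp

lemma exists_ordered_basis: "\<exists>B lt. ordered_basis_p g B lt"
proof -
  obtain B where B: "B \<subseteq> part g 0 \<union> part g 1" "vs.independent B" "part g 0 \<union> part g 1 \<subseteq> vs.span B"
    using vs.maximal_independent_subset by blast
  have "v \<in> vs.span B" for v
  proof -
    obtain a b where "a \<in> part g 0" "b \<in> part g 1" "v = a + b" by (rule decompose)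
    then show ?thesis using B(3) vs.span_add[of a B b] by auto
  qed
  then have span: "vs.span B = UNIV" by auto
  obtain r :: "'g rel" where "well_order_on UNIV r" using well_order_on by blast
  then have r: "total_on UNIV r" "trans r" "antisym r"
    unfolding well_order_on_def linear_order_on_def partial_order_on_def preorder_on_def by auto
  define lt where "lt a b \<longleftrightarrow> (a, b) \<in> r \<and> a \<noteq> b" for a b
  have "\<not> lt a a" "lt a b \<Longrightarrow> lt b c \<Longrightarrow> lt a c" "a \<noteq> b \<Longrightarrow> lt a b \<or> lt b a" for a b c
    using r unfolding lt_def total_on_def trans_def antisym_def by blast+
  then have "ordered_basis_p g B lt"
    by (unfold_locales) (use B span two_nonzero char_gt_2 pmap_part in \<open>blast+\<close>)
  then show ?thesis by blast
qed

lemma vanish_Ju: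
  assumes "klinear free_scal (smul M) c" "\<And>a. a \<in> JU \<Longrightarrow> c a = 0"
    "\<And>x a b. x \<in> part g 0 \<Longrightarrow> c (a * zd x * b) = 0" and "a \<in> Ju"
  shows "c a = 0"
proof -
  have "JU \<subseteq> {a. \<forall>u v. c (u * a * v) = 0}"
    using assms(2) by (auto intro!: two_sidedD(3,4)[OF JU.Q])
  moreover have "zd ` part g 0 \<subseteq> {a. \<forall>u v. c (u * a * v) = 0}"
    using assms(3) by auto
  ultimately have "Ju \<subseteq> {a. \<forall>u v. c (u * a * v) = 0}"
    by (intro Ju_minimal two_sided_core klinear_add[OF assms(1)])
  then have "c (1 * a * 1) = 0" using assms(4) by blast
  then show ?thesis by simp
qed

lemma cochain1_cong: "cochain1 J c \<Longrightarrow> cong_mod J a b \<Longrightarrow> c a = c b"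
  using linear_cong[OF cochain1D(1)] cochain1D(3) by blast

lemma cochain2_cong_left: "cochain2 J f \<Longrightarrow> cong_mod J a b \<Longrightarrow> f a d = f b d"
  using linear_cong[where c = "\<lambda>a. f a d" and J = J] cochain2D(1,5) by blast

lemma cochain2_cong_right: "cochain2 J f \<Longrightarrow> cong_mod J a b \<Longrightarrow> f d a = f d b"
  using linear_cong[where c = "f d" and J = J] cochain2D(2,6) by blast

lemma cong_zd_central: "x \<in> part g 0 \<Longrightarrow> JU.cg (a * zd x) (zd x * a)"
  by (rule JU.cg_sym) (simp add: cong_mod_def zd_central)

text \<open>A cochain on \<open>U(g)\<^sup>+\<close> comes from \<open>u(g)\<^sup>+\<close> as soon as it vanishes on the central
  elements \<open>x\<^sup>p - x\<^sup>[\<^sup>p\<^sup>]\<close> and its coboundary comes from \<open>u(g)\<^sup>+\<close>.\<close>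

lemma cochain1_descends:
  assumes c: "cochain1 JU c" and f: "cocycle2 Ju (d1 c)" and z: "\<And>x. x \<in> part g 0 \<Longrightarrow> c (zd x) = 0"
  shows "cochain1 Ju c"
proof -
  have mult: "c (a * b) = fa a (c b) - d1 c a b + smul M (eps b) (c a)" for a b by (simp add: d1_def)
  note f0 = cochain2D(5,6)[OF cocycle2D(1)[OF f]]
  have "c (a * zd x * b) = 0" if x: "x \<in> part g 0" for a b x
  proof -
    have az: "c (a * zd x) = 0" unfolding mult[of a] using z[OF x] f0(2)[OF zd_Ju[OF x]] by (simp add: fa_right_simps)
    show ?thesis unfolding mult[of "a * zd x"] using az f0(1)[OF two_sidedD(4)[OF two_sided_Ju zd_Ju[OF x]]]
      by (simp add: fa_mult fa_zd[OF x] fa_right_simps)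
  qed
  then show ?thesis using c vanish_Ju[OF cochain1D(1,3)[OF c]] by (simp add: cochain1_def)
qed

lemma cocycle1_iff: "good J \<Longrightarrow> cocycle1 J c \<longleftrightarrow> cochain1 J c \<and> d1 c = (\<lambda>a b. 0)"
  unfolding cocycle1_def d1_def fun_eq_iff by (auto simp: algebra_simps)

lemma cocycle2_zero: "cocycle2 J (\<lambda>a b. 0)"
  by (simp add: cocycle2_def cochain2_def klinear_const_zero vector_space_free mvec fa_right_simps)

lemma cocycle1_descends:
  assumes c: "cocycle1 JU c" and z: "\<And>x. x \<in> part g 0 \<Longrightarrow> c (zd x) = 0"
  shows "cocycle1 Ju c"
  using cochain1_descends[OF cocycle1D(1)[OF c] _ z] c cocycle2_zero[of Ju]
  by (simp add: cocycle1_iff good_JU good_Ju)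

lemma cocycle2_zd_left:
  assumes f: "cocycle2 JU f" and x: "x \<in> part g 0"
  shows "f (zd x * a) b = f (zd x) (a * b) - smul M (eps b) (f (zd x) a)"
  unfolding cocycle2D(2)[OF f] by (simp add: fa_zd[OF x])

text \<open>Centrality moves a factor z_x to the left, and the cocycle identity then reduces every
  value on the ideal to values at z_x itself: in the left argument directly, in the right argument
  after an induction on words.\<close>

lemma cocycle2_descends:
  assumes f: "cocycle2 JU f" and l: "\<And>x a. x \<in> part g 0 \<Longrightarrow> f (zd x) a = 0"
    and r: "\<And>x y. x \<in> part g 0 \<Longrightarrow> f (free_gen y) (zd x) = 0"
  shows "cocycle2 Ju f"
proof -
  note fc = cocycle2D(1)[OF f]
  note f_simps = klinearD(1-5)[OF cochain2D(1)[OF fc]] klinearD(1-5)[OF cochain2D(2)[OF fc]]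
  have l': "f (zd x * a) b = 0" if "x \<in> part g 0" for x a b
    using cocycle2_zd_left[OF f that] by (simp add: l[OF that])
  have left: "f (u * zd x * v) b = 0" if x: "x \<in> part g 0" for x u v b
  proof -
    have "JU.cg (u * zd x * v) (zd x * u * v)"
      by (intro cong_mod_mult[OF JU.Q] cong_zd_central x JU.cg_refl)
    then show ?thesis using cochain2_cong_left[OF fc] l'[OF x, of "u * v"] by (simp add: mult.assoc)
  qed
  have rz: "f a (zd x) = 0" if x: "x \<in> part g 0" for a x
  proof (induction a rule: free_alg_induct)
    case zero show ?case by (simp add: f_simps)
  next
    case (add c xs a)
    have "f (word xs) (zd x) = 0"
    proof (induction xs)
      case Nil show ?case by (simp add: cochain2D(3)[OF fc])
    next
      case (Cons y ys)
      have "f (free_gen y) (word ys * zd x) = f (free_gen y) (zd x * word ys)"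
        by (rule cochain2_cong_right[OF fc cong_zd_central[OF x]])
      also have "\<dots> = f (free_gen y * zd x) (word ys) + smul M (eps (word ys)) (f (free_gen y) (zd x)) - fa (free_gen y) (f (zd x) (word ys))"
        unfolding cocycle2D(2)[OF f, of "free_gen y" "zd x"] by simp
      also have "\<dots> = 0" using left[OF x, of "free_gen y" 1] by (simp add: r[OF x] l[OF x] act_simps)
      finally show ?case unfolding word_Cons cocycle2D(2)[OF f] by (simp add: Cons act_simps)
    qed
    then show ?case using add by (simp add: f_simps)
  qed
  have right: "f b (u * zd x * v) = 0" if x: "x \<in> part g 0" for x u v b
  proof -
    have "JU.cg (u * zd x * v) (zd x * (u * v))"
      unfolding mult.assoc[symmetric] by (intro cong_mod_mult[OF JU.Q] cong_zd_central x JU.cg_refl)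
    then have "f b (u * zd x * v) = f b (zd x * (u * v))" by (rule cochain2_cong_right[OF fc])
    also have "\<dots> = f (b * zd x) (u * v) + smul M (eps (u * v)) (f b (zd x)) - fa b (f (zd x) (u * v))"
      unfolding cocycle2D(2)[OF f, of b "zd x"] by simp
    also have "\<dots> = 0" using left[OF x, of b 1] by (simp add: rz[OF x] l[OF x] fa_right_simps)
    finally show ?thesis .
  qed
  have "f a b = 0" "f b a = 0" if "a \<in> Ju" for a b
    using vanish_Ju[OF cochain2D(1)[OF fc] cochain2D(5)[OF fc] left that]
      vanish_Ju[OF cochain2D(2)[OF fc] cochain2D(6)[OF fc] right that] by auto
  then show ?thesis using f by (simp add: cocycle2_def cochain2_def)
qed

lemma cochain1_zd_semilinear:
  assumes c: "cochain1 JU c" and x: "x \<in> part g 0" and y: "y \<in> part g 0"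
  shows "c (zd (smul g a x + y)) = smul M (a ^ CHAR('k)) (c (zd x)) + c (zd y)"
proof -
  have "JU.cg (zd (smul g a x + y)) (free_scal (a ^ CHAR('k)) (zd x) + zd y)"
    by (intro JU.cg_trans[OF zd_add] cong_mod_add[OF JU.Q] zd_scale JU.cg_refl x y part_scale)
  then show ?thesis using cochain1_cong[OF c] by (simp add: klinearD[OF cochain1D(1)[OF c]])
qed

lemma cochain1_zd:
  assumes c: "cochain1 JU c"
  shows "c (free_gen x ^ CHAR('k)) = fa (free_gen x ^ (CHAR('k) - 1)) (c (free_gen x)) - d1 c (free_gen x ^ (CHAR('k) - 1)) (free_gen x)"
  unfolding d1_def using prime_gt_0_nat[OF prime_p]
  by (simp add: power_eq_if[of "free_gen x" "CHAR('k)"] power_commutes)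

text \<open>For a 2-cocycle \<open>f\<close> and a central \<open>z\<close> that annihilates \<open>M\<close>, the map \<open>a \<mapsto> f z a - f a z\<close> is a 1-cocycle.\<close>

lemma cocycle1_commutator:
  assumes f: "cocycle2 JU f" and x: "x \<in> part g 0"
  shows "cocycle1 JU (\<lambda>a. f (zd x) a - f a (zd x))"
  unfolding cocycle1_def cochain1_def
proof (intro conjI allI ballI)
  note fc = cocycle2D(1)[OF f]
  show "klinear free_scal (smul M) (\<lambda>a. f (zd x) a - f a (zd x))"
    by (intro klinear_minus_fun cochain2D(1,2)[OF fc])
  show "f (zd x) 1 - f 1 (zd x) = 0" by (simp add: cochain2D(3,4)[OF fc])
  show "f (zd x) a - f a (zd x) = 0" if "a \<in> JU" for a by (simp add: cochain2D(5,6)[OF fc that])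
  show "f (zd x) a - f a (zd x) \<in> part M i" if "a \<in> fpart g i" for a i
    using cochain2D(7)[OF fc zd_fpart[OF x] that] cochain2D(7)[OF fc that zd_fpart[OF x]] by (simp only: add_0 add_0_right M.part_diff)
  fix a b
  have 1: "f (zd x * a) b = f (zd x) (a * b) - smul M (eps b) (f (zd x) a)" by (rule cocycle2_zd_left[OF f x])
  have 2: "f (a * b) (zd x) = fa a (f b (zd x)) + f a (b * zd x)" unfolding cocycle2D(2)[OF f] by simp
  have 3: "f a (b * zd x) = f a (zd x * b)" by (rule cochain2_cong_right[OF fc cong_zd_central[OF x]])
  have 4: "f (a * zd x) b = f (zd x * a) b" by (rule cochain2_cong_left[OF fc cong_zd_central[OF x]])
  have 5: "f (a * zd x) b = fa a (f (zd x) b) + f a (zd x * b) - smul M (eps b) (f a (zd x))" by (rule cocycle2D(2)[OF f])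
  show "f (zd x) (a * b) - f (a * b) (zd x) = fa a (f (zd x) b - f b (zd x)) + smul M (eps b) (f (zd x) a - f a (zd x))"
  proof -
    have "f (zd x) (a * b) = f (zd x * a) b + smul M (eps b) (f (zd x) a)" by (simp add: 1)
    then have "f (zd x) (a * b) = fa a (f (zd x) b) + f a (zd x * b) - smul M (eps b) (f a (zd x)) + smul M (eps b) (f (zd x) a)"
      unfolding 4[symmetric] 5 .
    then show ?thesis unfolding 2 3 by (simp add: fa_right_simps M.vs.scale_right_diff_distrib)
  qed
qed

lemma cocycle1_determined:
  assumes c: "cocycle1 J c" and c': "cocycle1 J c'" and "\<And>x. c (free_gen x) = c' (free_gen x)"
  shows "c = c'"
proof
  fix a
  have "c (word xs) = c' (word xs)" for xs
    by (induction xs) (simp_all add: cochain1D(2)[OF cocycle1D(1)[OF c]] cochain1D(2)[OF cocycle1D(1)[OF c']] word_Cons cocycle1D(2)[OF c] cocycle1D(2)[OF c'] assms(3))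
  then show "c a = c' a" by (rule klinear_free_eqI[OF cochain1D(1)[OF cocycle1D(1)[OF c]] cochain1D(1)[OF cocycle1D(1)[OF c']]])
qed

subsection \<open>Cochains from Lie cochains\<close>

text \<open>The condition on \<eta> to be the restriction to \<open>g\<close> of a cochain on U(g)
  with coboundary \<open>f\<close>; \<open>lie_bound_d1\<close> and
  \<open>lie_bound_imp_coboundary\<close> are the two directions.\<close>

definition lie_bound :: "(('k, 'g) free_alg \<Rightarrow> ('k, 'g) free_alg \<Rightarrow> 'm) \<Rightarrow> ('g \<Rightarrow> 'm) \<Rightarrow> bool" where
  "lie_bound f \<eta> \<longleftrightarrow> even_linear g M \<eta> \<and> (\<forall>i j. \<forall>x\<in>part g i. \<forall>y\<in>part g j.
     f (free_gen x) (free_gen y) - ksign i j (f (free_gen y) (free_gen x)) + \<eta> (br g x y)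
       = act x (\<eta> y) - ksign i j (act y (\<eta> x)))"

lemma lie_bound_d1:
  assumes c: "cochain1 JU c"
  shows "lie_bound (d1 c) (\<lambda>x. c (free_gen x))"
  unfolding lie_bound_def even_linear_def
proof (intro conjI allI ballI)
  note lin = klinearD(1-5)[OF cochain1D(1)[OF c]]
  show "klinear (smul g) (smul M) (\<lambda>x. c (free_gen x))"
  proof (rule klinearI[OF gvec mvec])
    show "c (free_gen (x + y)) = c (free_gen x) + c (free_gen y)" for x y
      using cochain1_cong[OF c JU.gen_add[of x y]] by (simp add: lin)
    show "c (free_gen (smul g d x)) = smul M d (c (free_gen x))" for d x
      using cochain1_cong[OF c JU.gen_scale[of d x]] by (simp add: lin)
  qed
  show "c (free_gen x) \<in> part M i" if "x \<in> part g i" for x i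
    by (rule cochain1D(4)[OF c fpart_gen[OF that]])
  fix i j x y assume *: "x \<in> part g i" "y \<in> part g j"
  have "c (free_gen (br g x y)) = c (free_gen x * free_gen y) - ksign i j (c (free_gen y * free_gen x))"
    using cochain1_cong[OF c JU.gen_br[OF *]] by (auto simp: lin ksign_def)
  then show "d1 c (free_gen x) (free_gen y) - ksign i j (d1 c (free_gen y) (free_gen x)) + c (free_gen (br g x y))
       = act x (c (free_gen y)) - ksign i j (act y (c (free_gen x)))"
    by (auto simp: d1_def ksign_def algebra_simps)
qed

text \<open>On the free algebra there is no obstruction: \<open>ext\<close> solves the equation with
  any values on letters. The hypothesis says exactly that the solution kills the relations of U(g),
  and its kernel inside \<open>JU\<close> is an ideal.\<close>

lemma lie_bound_imp_coboundary:
  assumes f: "cocycle2 JU f" and b: "lie_bound f \<eta>"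
  obtains c where "cochain1 JU c" "d1 c = f" "\<And>x. c (free_gen x) = \<eta> x"
proof -
  define e where "e = ext (\<lambda>x. x) (\<lambda>x. - \<eta> x) f"
  note fc = cocycle2D(1)[OF f]
  have e_lin: "klinear free_scal (smul M) e" unfolding e_def by (rule klinear_ext)
  note e_simps = klinearD(1-5)[OF e_lin]
  have mult: "e (a * b) = fa a (e b) + f a b + smul M (eps b) (e a)" for a b
    unfolding e_def ext_mult[OF f] fmap_id ..
  have gen: "e (free_gen x) = - \<eta> x" for x unfolding e_def by (rule ext_gen[OF f])
  have \<eta>: "klinear (smul g) (smul M) \<eta>" "\<And>i x. x \<in> part g i \<Longrightarrow> \<eta> x \<in> part M i"
    and br: "\<And>i j x y. x \<in> part g i \<Longrightarrow> y \<in> part g j \<Longrightarrow> f (free_gen x) (free_gen y) - ksign i j (f (free_gen y) (free_gen x)) + \<eta> (br g x y)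
       = act x (\<eta> y) - ksign i j (act y (\<eta> x))"
    using b unfolding lie_bound_def even_linear_def by blast+
  have T: "two_sided {a. a \<in> JU \<and> e a = 0}"
    using two_sided_ext[OF f good_JU, of "\<lambda>x. x" "\<lambda>x. - \<eta> x"] unfolding fmap_id e_def .
  have "env_relations g \<subseteq> {a. a \<in> JU \<and> e a = 0}"
  proof (intro subsetI CollectI conjI)
    fix r assume r: "r \<in> env_relations g"
    then show "r \<in> JU" using JU.relations by blast
    consider x y where "r = free_gen (x + y) - free_gen x - free_gen y"
      | c x where "r = free_gen (smul g c x) - free_scal c (free_gen x)"
      | x y i j where "x \<in> part g i" "y \<in> part g j"
        "r = free_gen x * free_gen y - ksign i j (free_gen y * free_gen x) - free_gen (br g x y)"
      using r unfolding env_relations_def by blast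
    then show "e r = 0"
    proof cases
      case 1 then show ?thesis by (simp add: e_simps gen klinear_add[OF \<eta>(1)])
    next
      case 2 then show ?thesis by (simp add: e_simps gen klinear_scale[OF \<eta>(1)])
    next
      case 3
      have ks: "e (ksign i j a) = ksign i j (e a)" for a by (auto simp: ksign_def e_simps)
      have "e r = - (act x (\<eta> y) - ksign i j (act y (\<eta> x))) + (f (free_gen x) (free_gen y) - ksign i j (f (free_gen y) (free_gen x)) + \<eta> (br g x y))"
        unfolding 3(3) by (cases i; cases j) (simp_all add: e_simps mult gen act_simps)
      then show ?thesis unfolding br[OF 3(1,2)] by simp
    qed
  qed
  then have "JU \<subseteq> {a. a \<in> JU \<and> e a = 0}" unfolding JU_def[symmetric] using gen_ideal_minimal[OF T] by (simp add: JU_def)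
  then have kill: "e a = 0" if "a \<in> JU" for a using that by blast
  \<comment> \<open>The equation solved by \<open>e\<close> says that its coboundary is
    \<open>- f\<close>, whence the sign here and in the values on letters.\<close>
  define c where "c a = - e a" for a
  have "cochain1 JU c"
    unfolding cochain1_def c_def
  proof (intro conjI ballI allI)
    show "klinear free_scal (smul M) (\<lambda>a. - e a)" by (rule klinear_uminus[OF e_lin])
    show "- e 1 = 0" by (simp add: e_def ext_1)
    show "- e a = 0" if "a \<in> JU" for a using kill[OF that] by simp
    show "- e a \<in> part M i" if "a \<in> fpart g i" for a i
      unfolding e_def by (intro M.part_minus ext_part[OF f _ that] \<eta>(2))
  qed
  moreover have "d1 c = f"
    by (intro ext) (simp add: d1_def c_def mult fa_right_simps)
  moreover have "c (free_gen x) = \<eta> x" for x by (simp add: c_def gen)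
  ultimately show ?thesis using that by blast
qed

text \<open>The value of a cochain at x^p is determined by its values on letters and by its
  coboundary (\<open>cochain1_zd\<close>). This turns a condition at z_x into one on \<eta>, in the
  shape of the p-map condition for equivalences of extensions.\<close>

lemma coboundary_iff_lie_bound:
  assumes f: "cocycle2 JU f"
  shows "(\<exists>c. cochain1 JU c \<and> d1 c = f \<and> (\<forall>x\<in>part g 0. c (zd x) = h x)) \<longleftrightarrow>
    (\<exists>\<eta>. lie_bound f \<eta> \<and> (\<forall>x\<in>part g 0. f (free_gen x ^ (CHAR('k) - 1)) (free_gen x) + \<eta> (pmap g x)
        = (act x ^^ (CHAR('k) - 1)) (\<eta> x) - h x))" (is "?L \<longleftrightarrow> ?R")
proof -
  have zd: "c (zd x) = (act x ^^ (CHAR('k) - 1)) (c (free_gen x)) - f (free_gen x ^ (CHAR('k) - 1)) (free_gen x) - c (free_gen (pmap g x))"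
    if "cochain1 JU c" "d1 c = f" for c x
    using cochain1_zd[OF that(1), of x] unfolding zd_def klinear_diff[OF cochain1D(1)[OF that(1)]] that(2) fa_gen_power by simp
  show ?thesis
  proof
    assume ?L
    then obtain c where c: "cochain1 JU c" "d1 c = f" "\<forall>x\<in>part g 0. c (zd x) = h x" by blast
    have "lie_bound f (\<lambda>x. c (free_gen x))" using lie_bound_d1[OF c(1)] c(2) by simp
    moreover have "\<forall>x\<in>part g 0. f (free_gen x ^ (CHAR('k) - 1)) (free_gen x) + c (free_gen (pmap g x))
        = (act x ^^ (CHAR('k) - 1)) (c (free_gen x)) - h x"
      using c(3) zd[OF c(1,2)] by (simp add: algebra_simps)
    ultimately show ?R by blast
  next
    assume ?R
    then obtain \<eta> where \<eta>: "lie_bound f \<eta>" "\<forall>x\<in>part g 0. f (free_gen x ^ (CHAR('k) - 1)) (free_gen x) + \<eta> (pmap g x)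
        = (act x ^^ (CHAR('k) - 1)) (\<eta> x) - h x" by blast
    obtain c where c: "cochain1 JU c" "d1 c = f" "\<And>x. c (free_gen x) = \<eta> x"
      by (rule lie_bound_imp_coboundary[OF f \<eta>(1)], rule that)
    have "\<forall>x\<in>part g 0. c (zd x) = h x"
    proof
      fix x assume "x \<in> part g 0"
      then have eq: "f (free_gen x ^ (CHAR('k) - 1)) (free_gen x) + \<eta> (pmap g x) = (act x ^^ (CHAR('k) - 1)) (\<eta> x) - h x"
        using \<eta>(2) by blast
      show "c (zd x) = h x" unfolding zd[OF c(1,2)] c(3) diff_diff_eq eq by simp
    qed
    then show ?L using c by blast
  qed
qed

text \<open>By centrality \<open>c\<close> agrees on y z_x and z_x y. Since \<open>d1 c\<close>
  vanishes when one argument is z_x, the first value is y.c(z_x) and the second is z_x.c(y) =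
  0.\<close>

lemma coboundary_zd_invariant:
  assumes c: "cochain1 JU c" and f: "cocycle2 Ju (d1 c)" and x: "x \<in> part g 0"
  shows "c (zd x) \<in> even_invariants M act"
proof -
  note f0 = cochain2D(5,6)[OF cocycle2D(1)[OF f] zd_Ju[OF x]]
  have "act y (c (zd x)) = 0" for y
  proof -
    have "c (free_gen y * zd x) = act y (c (zd x))"
      using f0(2)[of "free_gen y"] unfolding d1_def by simp
    moreover have "c (zd x * free_gen y) = 0"
      using f0(1)[of "free_gen y"] unfolding d1_def by (simp add: fa_zd[OF x])
    ultimately show ?thesis using cochain1_cong[OF c cong_zd_central[OF x, of "free_gen y"]] by simp
  qed
  then show ?thesis using cochain1D(4)[OF c zd_fpart[OF x]] by (simp add: even_invariants_def)
qed

subsection \<open>Descending a cocycle\<close>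

lemma zmon_permute:
  assumes "mset xs = mset ys" "set xs \<subseteq> part g 0"
  shows "JU.cg (prod_list (map zd xs)) (prod_list (map zd ys))"
  using assms
proof (induction xs arbitrary: ys)
  case Nil then show ?case by (simp add: JU.cg_refl)
next
  case (Cons x xs)
  have "x \<in> set ys" using Cons.prems(1) by (metis list.set_intros(1) mset_eq_setD)
  then obtain u v where ys: "ys = u @ x # v" by (meson split_list)
  have x: "x \<in> part g 0" using Cons.prems by simp
  have "mset xs = mset (u @ v)" using Cons.prems(1) ys by simp
  then have IH: "JU.cg (prod_list (map zd xs)) (prod_list (map zd (u @ v)))" using Cons.IH[of "u @ v"] Cons.prems(2) by simp
  have "JU.cg (prod_list (map zd (x # xs))) (zd x * (prod_list (map zd u) * prod_list (map zd v)))"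
    using cong_mod_mult[OF JU.Q JU.cg_refl IH, of "zd x"] by simp
  also have "JU.cg (zd x * (prod_list (map zd u) * prod_list (map zd v))) (prod_list (map zd u) * zd x * prod_list (map zd v))"
    unfolding mult.assoc[symmetric] by (intro cong_mod_mult[OF JU.Q] JU.cg_sym[OF cong_zd_central[OF x]] JU.cg_refl)
  finally show ?case by (simp add: ys mult.assoc)
qed

text \<open>The required formula fixes \<open>c\<close> on every normal monomial with a central
  factor; on the others it is set to 0. When several central factors are present any of them may be
  used, because f(z_x, z_y w) is symmetric in x and y. Spanning and p-semilinearity extend the
  formula from basis elements to all \<open>s\<close> and all even \<open>x\<close>.\<close>

lemma descent_cochain:
  assumes f: "cocycle2 JU f"
    and m: "\<And>x. x \<in> part g 0 \<Longrightarrow> m x \<in> part M 0"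
    and semi: "\<And>a x y. x \<in> part g 0 \<Longrightarrow> y \<in> part g 0 \<Longrightarrow> m (smul g a x + y) = smul M (a ^ CHAR('k)) (m x) + m y"
    and comm: "\<And>x y. x \<in> part g 0 \<Longrightarrow> f (zd x) (free_gen y) - f (free_gen y) (zd x) = act y (m x)"
  obtains c where "cochain1 JU c" "\<And>x. c (free_gen x) = 0"
    "\<And>x s. x \<in> part g 0 \<Longrightarrow> c (zd x * s) = f (zd x) s + smul M (eps s) (m x)"
proof -
  obtain B lt where "ordered_basis_p g B lt" using exists_ordered_basis by blast
  then interpret O: ordered_basis_p g B lt .
  have OJ: "O.env_ideal = JU" by (simp add: O.env_ideal_def JU_def)
  have Oz: "O.zgen = zd" by (rule ext) (simp add: O.zgen_def zd_def)
  note fc = cocycle2D(1)[OF f]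
  note f_simps = klinearD(1-5)[OF cochain2D(1)[OF fc]] klinearD(1-5)[OF cochain2D(2)[OF fc]]
  \<comment> \<open>Both sides are 1-cocycles in \<open>a\<close>, and these are determined by their
    values on letters.\<close>
  have D: "f (zd x) a - f a (zd x) = d0 (m x) a" if x: "x \<in> part g 0" for x a
  proof -
    have "(\<lambda>a. f (zd x) a - f a (zd x)) = d0 (m x)"
      by (rule cocycle1_determined[OF cocycle1_commutator[OF f x] cocycle1_d0[OF good_JU m[OF x]]])
        (simp add: comm[OF x] d0_def)
    from fun_cong[OF this, of a] show ?thesis .
  qed
  \<comment> \<open>The symmetry behind the free choice of a central factor: z_y kills
    \<open>M\<close>, so \<open>D\<close> at z_y makes f(z_x, z_y) symmetric, and z_x commutes with
    z_y.\<close>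
  have zz: "f (zd x) (zd y * w) = f (zd y) (zd x * w)" if x: "x \<in> part g 0" and y: "y \<in> part g 0" for x y w
  proof -
    have "f (zd x) (zd y) = f (zd y) (zd x)" using D[OF x, of "zd y"] by (simp add: d0_def fa_zd[OF y])
    moreover have "f (zd x * zd y) w = f (zd y * zd x) w"
      by (rule cochain2_cong_left[OF fc]) (rule cong_zd_central[OF y])
    ultimately show ?thesis using cocycle2_zd_left[OF f x, of "zd y" w] cocycle2_zd_left[OF f y, of "zd x" w] by simp
  qed
  have np: "set_mset A \<subseteq> part g 0" if "(A, b) \<in> O.normal_pairs" for A b
    using that O.deg_part_0 unfolding O.normal_pairs_def by blast
  have np_remove: "(A - {#i#}, b) \<in> O.normal_pairs" if "(A, b) \<in> O.normal_pairs" for A b i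
    using that unfolding O.normal_pairs_def by (auto dest: in_diffD)
  have np_add: "(add_mset j A, b) \<in> O.normal_pairs" if "(A, b) \<in> O.normal_pairs" "j \<in> B" "j \<in> part g 0" for A b j
    using that O.deg_eqI[OF that(2,3)] unfolding O.normal_pairs_def by auto
  have nmon_add: "JU.cg (O.nmon (add_mset j A, b)) (zd j * O.nmon (A, b))" if "set_mset A \<subseteq> part g 0" "j \<in> part g 0" for A b j
  proof -
    let ?l = "\<lambda>A. SOME w. mset w = A"
    have l: "mset (?l A) = A" for A :: "'g multiset" by (rule O.some_mset)
    have "mset (?l (add_mset j A)) = mset (j # ?l A)" by (simp add: l)
    moreover have "set (?l (add_mset j A)) \<subseteq> part g 0" unfolding set_mset_mset[symmetric] l using that by simp
    ultimately have "JU.cg (prod_list (map zd (?l (add_mset j A)))) (prod_list (map zd (j # ?l A)))" by (rule zmon_permute)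
    then have "JU.cg (prod_list (map zd (?l (add_mset j A))) * word (O.sort_word b)) (prod_list (map zd (j # ?l A)) * word (O.sort_word b))"
      by (rule cong_mod_mult[OF JU.Q _ JU.cg_refl])
    then show ?thesis unfolding O.nmon_def O.zmon_def Oz prod.case by (simp add: mult.assoc)
  qed
  define pick where "pick A = (SOME i. i \<in># A)" for A :: "'g multiset"
  have pick: "pick A \<in># A" if "A \<noteq> {#}" for A unfolding pick_def by (rule someI_ex) (use that in \<open>simp only: multiset_nonemptyE ex_in_conv set_mset_eq_empty_iff simp_thms\<close>)
  define F where "F i w = f (zd i) w + smul M (eps w) (m i)" for i w
  define \<gamma> where "\<gamma> n = (if fst n = {#} then 0 else F (pick (fst n)) (O.nmon (fst n - {#pick (fst n)#}, snd n)))" for n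
  obtain c where c: "klinear free_scal (smul M) c" "\<And>a. a \<in> JU \<Longrightarrow> c a = 0" "\<And>n. n \<in> O.normal_pairs \<Longrightarrow> c (O.nmon n) = \<gamma> n"
    by (rule O.normal_form_functional[OF mvec, where \<gamma> = \<gamma>, unfolded OJ], rule that)
  note c_simps = klinearD(1-5)[OF c(1)]
  have c_cong: "c a = c b" if "JU.cg a b" for a b by (rule linear_cong[OF c(1,2) that])
  have F_lin: "klinear free_scal (smul M) (F i)" for i
    unfolding F_def by (rule klinear_plus[OF cochain2D(2)[OF fc]])
      (rule klinearI[OF vector_space_free mvec]; simp add: eps_simps M.vs.scale_left_distrib)
  have F_JU: "F i a = 0" if "a \<in> JU" for i a unfolding F_def using that cochain2D(6)[OF fc] goodD(3)[OF good_JU] by simp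
  \<comment> \<open>The factor picked in the definition of \<gamma> may differ from
    \<open>j\<close>; then both occur in the monomial and \<open>zz\<close> exchanges them.\<close>
  have basis: "c (zd j * O.nmon n) = F j (O.nmon n)" if j: "j \<in> B" "j \<in> part g 0" and n: "n \<in> O.normal_pairs" for j n
  proof -
    obtain A b where ab: "n = (A, b)" by (cases n)
    note nA = n[unfolded ab]
    define i where "i = pick (add_mset j A)"
    have i: "i \<in># add_mset j A" unfolding i_def by (rule pick) simp
    have "c (zd j * O.nmon (A, b)) = c (O.nmon (add_mset j A, b))"
      by (rule c_cong) (rule JU.cg_sym[OF nmon_add[OF np[OF nA] j(2)]])
    also have "\<dots> = F i (O.nmon (add_mset j A - {#i#}, b))"
      using c(3)[OF np_add[OF nA j]] by (simp add: \<gamma>_def i_def)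
    also have "\<dots> = F j (O.nmon (A, b))"
    proof (cases "i = j")
      case True then show ?thesis by simp
    next
      case False
      then have iA: "i \<in># A" using i by simp
      define A' where "A' = A - {#i#}"
      have A: "A = add_mset i A'" using iA by (simp add: A'_def)
      have A'j: "add_mset j A - {#i#} = add_mset j A'" using False by (simp add: A)
      have i0: "i \<in> part g 0" using np[OF nA] iA by blast
      have sub: "set_mset A' \<subseteq> part g 0" using np[OF nA] by (simp add: A)
      have "F i (O.nmon (add_mset j A', b)) = F i (zd j * O.nmon (A', b))"
        by (rule linear_cong[OF F_lin F_JU nmon_add[OF sub j(2)]])
      also have "\<dots> = F j (zd i * O.nmon (A', b))"
        unfolding F_def using zz[OF i0 j(2)] by (simp add: eps_mult)
      also have "\<dots> = F j (O.nmon (A, b))"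
        unfolding A by (rule linear_cong[OF F_lin F_JU JU.cg_sym[OF nmon_add[OF sub i0]]])
      finally show ?thesis unfolding A'j .
    qed
    finally show ?thesis unfolding ab .
  qed
  define N where "N = FV.span (O.nmon ` O.normal_pairs \<union> JU)"
  have N_mult: "zd j * a \<in> JU" if "a \<in> JU" for j a by (rule two_sidedD(4)[OF JU.Q that])
  \<comment> \<open>Normal monomials span modulo \<open>JU\<close>: known for words with homogeneous
    letters, and an arbitrary letter is split into its even and odd parts, one position at a
    time.\<close>
  have span: "a \<in> N" for a
  proof -
    have ns: "O.normal_span i \<subseteq> N" for i unfolding O.normal_span_def N_def OJ by (rule FV.span_mono) auto
    have hom: "word xs \<in> N" if "xs \<in> homogeneous_words g i" for xs i
      using O.homogeneous_word_normal_span that ns unfolding homogeneous_words_def by blast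
    have "word (ys @ xs) \<in> N" if "ys \<in> homogeneous_words g i" for xs ys i
      using that
    proof (induction xs arbitrary: ys i)
      case Nil then show ?case using hom by simp
    next
      case (Cons x xs)
      obtain a b where ab: "a \<in> part g 0" "b \<in> part g 1" "x = a + b" by (rule decompose)
      have "word (ys @ a # xs) \<in> N" "word (ys @ b # xs) \<in> N"
        using Cons.IH[OF homogeneous_words_append[OF Cons.prems homogeneous_words_single[OF ab(1)]]]
          Cons.IH[OF homogeneous_words_append[OF Cons.prems homogeneous_words_single[OF ab(2)]]] by simp_all
      moreover have "word (ys @ x # xs) - (word (ys @ a # xs) + word (ys @ b # xs)) \<in> JU"
      proof -
        have "word ys * (free_gen x - (free_gen a + free_gen b)) * word xs \<in> JU"
          using JU.gen_add[of a b] unfolding ab(3) cong_mod_def by (intro two_sidedD(3,4)[OF JU.Q])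
        then show ?thesis by (simp add: word_append word_Cons algebra_simps)
      qed
      then have "word (ys @ x # xs) - (word (ys @ a # xs) + word (ys @ b # xs)) \<in> N"
        unfolding N_def by (intro FV.span_base) simp
      ultimately have "(word (ys @ x # xs) - (word (ys @ a # xs) + word (ys @ b # xs))) + (word (ys @ a # xs) + word (ys @ b # xs)) \<in> N"
        unfolding N_def by (simp only: FV.span_add)
      then show ?case by simp
    qed
    from this[OF homogeneous_words_Nil] have "word xs \<in> N" for xs by simp
    then show ?thesis
      by (induction a rule: free_alg_induct) (simp_all add: N_def FV.span_zero FV.span_add FV.span_scale)
  qed
  have gen0: "c (zd j * a) = F j a" if j: "j \<in> B" "j \<in> part g 0" for j a
    using span[of a] unfolding N_def
  proof (induction rule: FV.span_induct_alt)
    case base show ?case by (simp add: c_simps klinear_zero[OF F_lin])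
  next
    case (step d x y)
    have "c (zd j * x) = F j x"
      using step(1)
    proof
      assume "x \<in> O.nmon ` O.normal_pairs" then show ?thesis using basis[OF j] by blast
    next
      assume "x \<in> JU" then show ?thesis using c(2)[OF N_mult] F_JU by simp
    qed
    then show ?case using step by (simp add: distrib_left free_scal_mult_right c_simps klinearD[OF F_lin])
  qed
  have m0: "m 0 = 0" using semi[of 0 0 1] by simp
  have m_sum: "m (\<Sum>l\<in>S. smul g (d l) l) = (\<Sum>l\<in>S. smul M (d l ^ CHAR('k)) (m l))" if "finite S" "S \<subseteq> part g 0" for S d
    using that by (induction S rule: finite_induct) (simp_all add: m0 semi part_sum subset_iff)
  have zd_0: "zd 0 \<in> JU"
    using zd_scale[of 0 0] prime_gt_0_nat[OF prime_p] by (simp add: cong_mod_def power_0_left)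
  have zd_sum: "JU.cg (zd (\<Sum>l\<in>S. smul g (d l) l)) (\<Sum>l\<in>S. free_scal (d l ^ CHAR('k)) (zd l))" if "finite S" "S \<subseteq> part g 0" for S d
    using that
  proof (induction S rule: finite_induct)
    case empty then show ?case using zd_0 by (simp add: cong_mod_def)
  next
    case (insert l S)
    have "JU.cg (zd (smul g (d l) l + (\<Sum>l\<in>S. smul g (d l) l))) (free_scal (d l ^ CHAR('k)) (zd l) + (\<Sum>l\<in>S. free_scal (d l ^ CHAR('k)) (zd l)))"
      using insert by (intro JU.cg_trans[OF zd_add] cong_mod_add[OF JU.Q] zd_scale insert part_scale part_sum) auto
    then show ?case using insert by simp
  qed
  \<comment> \<open>From basis letters to arbitrary even \<open>x\<close>: both sides are
    p-semilinear in \<open>x\<close>.\<close>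
  have main: "c (zd x * s) = f (zd x) s + smul M (eps s) (m x)" if x: "x \<in> part g 0" for x s
  proof -
    let ?S = "{l. O.coef x l \<noteq> 0}" and ?d = "\<lambda>l. O.coef x l ^ CHAR('k)"
    have S: "finite ?S" "?S \<subseteq> part g 0" "?S \<subseteq> B" using O.finite_coef O.coef_homogeneous[OF x] O.coef_basis by auto
    have zx: "JU.cg (zd x) (\<Sum>l\<in>?S. free_scal (?d l) (zd l))" using zd_sum[OF S(1,2), of "O.coef x"] by (simp add: O.coef_sum)
    have "c (zd x * s) = c ((\<Sum>l\<in>?S. free_scal (?d l) (zd l)) * s)"
      by (rule c_cong) (rule cong_mod_mult[OF JU.Q zx JU.cg_refl])
    also have "\<dots> = (\<Sum>l\<in>?S. smul M (?d l) (c (zd l * s)))"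
      by (simp add: sum_distrib_right klinear_sum[OF c(1)] free_scal_mult_left c_simps)
    also have "\<dots> = (\<Sum>l\<in>?S. smul M (?d l) (F l s))"
      by (rule sum.cong) (use gen0 S in auto)
    also have "\<dots> = f (\<Sum>l\<in>?S. free_scal (?d l) (zd l)) s + smul M (eps s) (\<Sum>l\<in>?S. smul M (?d l) (m l))"
      by (simp add: F_def klinear_sum[OF cochain2D(1)[OF fc]] f_simps M.vs.scale_right_distrib sum.distrib M.vs.scale_sum_right mult.commute)
    also have "f (\<Sum>l\<in>?S. free_scal (?d l) (zd l)) s = f (zd x) s" by (rule cochain2_cong_left[OF fc JU.cg_sym[OF zx]])
    also have "(\<Sum>l\<in>?S. smul M (?d l) (m l)) = m x" using m_sum[OF S(1,2), of "O.coef x"] by (simp add: O.coef_sum)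
    finally show ?thesis .
  qed
  \<comment> \<open>Monomials without central factor include the empty word and the single letters;
    this yields \<open>c 1 = 0\<close> and the vanishing on \<open>g\<close>.\<close>
  have empty: "({#}, b) \<in> O.normal_pairs \<Longrightarrow> c (word (O.sort_word b)) = 0" for b
    using c(3)[of "({#}, b)"] O.some_mset[of "{#}"] by (simp add: \<gamma>_def O.nmon_def O.zmon_def)
  have c1: "c 1 = 0"
  proof -
    have "{#} \<in> O.admissible" by (simp add: O.admissible_def)
    then have "mset (O.sort_word {#}) = {#}" using O.sort_word by blast
    moreover have "({#}, {#}) \<in> O.normal_pairs" using \<open>{#} \<in> O.admissible\<close> prime_gt_0_nat[OF prime_p] by (simp add: O.normal_pairs_def)
    ultimately show ?thesis using empty[of "{#}"] by simp
  qed
  have cB: "c (free_gen l) = 0" if l: "l \<in> B" for l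
  proof -
    have "{#l#} \<in> O.admissible" using l by (simp add: O.admissible_def)
    then have "mset (O.sort_word {#l#}) = {#l#}" using O.sort_word by blast
    then have "O.sort_word {#l#} = [l]" by simp
    moreover have "({#}, {#l#}) \<in> O.normal_pairs" using \<open>{#l#} \<in> O.admissible\<close> char_gt_2 by (simp add: O.normal_pairs_def)
    ultimately show ?thesis using empty[of "{#l#}"] by (simp add: word_single)
  qed
  have cg: "c (free_gen x) = 0" for x
  proof -
    have "c (free_gen x) = c (\<Sum>l | O.coef x l \<noteq> 0. free_gen (smul g (O.coef x l) l))"
      using c_cong[OF JU.gen_sum[of "\<lambda>l. smul g (O.coef x l) l" "{l. O.coef x l \<noteq> 0}"]] by (simp add: O.coef_sum)
    also have "\<dots> = (\<Sum>l | O.coef x l \<noteq> 0. smul M (O.coef x l) (c (free_gen l)))"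
      by (simp add: klinear_sum[OF c(1)] c_cong[OF JU.gen_scale] c_simps)
    also have "\<dots> = 0" using cB O.coef_basis by (intro sum.neutral) auto
    finally show ?thesis .
  qed
  have sortw: "O.sort_word b \<in> homogeneous_words g (O.mdeg b)" if "b \<in> O.admissible" for b
  proof -
    have sw: "set (O.sort_word b) \<subseteq> B" "mset (O.sort_word b) = b" using O.sort_word[OF that] by (auto simp: O.irreducible_word_def)
    have "xs \<in> homogeneous_words g (O.degs xs)" if "set xs \<subseteq> B" for xs
      using that
    proof (induction xs)
      case Nil show ?case using homogeneous_words_Nil by simp
    next
      case (Cons x xs)
      then show ?case using homogeneous_words_append[OF homogeneous_words_single[OF O.part_deg[of x]], of xs "O.degs xs"]
        by (simp only: O.degs_simps append_Cons append_Nil list.set insert_subset)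
    qed
    from this[OF sw(1)] show ?thesis unfolding O.mdeg_mset[symmetric] sw(2) .
  qed
  have nmon_part: "O.nmon (A, b) \<in> fpart g (O.mdeg b)" if n: "(A, b) \<in> O.normal_pairs" for A b
  proof -
    have "prod_list (map zd w) \<in> fpart g 0" if "set w \<subseteq> part g 0" for w
      using that by (induction w) (use fpart_1 fpart_mult[of _ g 0 _ 0] zd_fpart in \<open>simp_all\<close>)
    moreover have "set (SOME w. mset w = A) \<subseteq> part g 0" unfolding set_mset_mset[symmetric] O.some_mset by (rule np[OF n])
    ultimately have "O.zmon A \<in> fpart g 0" unfolding O.zmon_def Oz by blast
    moreover have "b \<in> O.admissible" using n by (simp add: O.normal_pairs_def)
    ultimately show ?thesis unfolding O.nmon_def prod.case
      using fpart_mult[of "O.zmon A" g 0 "word (O.sort_word b)" "O.mdeg b"] fpart_word[OF sortw] by (simp only: add_0)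
  qed
  have c_nmon: "c (O.nmon n) \<in> part M (O.mdeg (snd n))" if n: "n \<in> O.normal_pairs" for n
  proof -
    obtain A b where ab: "n = (A, b)" by (cases n)
    note nA = n[unfolded ab]
    show ?thesis
    proof (cases "A = {#}")
      case True then show ?thesis using c(3)[OF nA] by (simp add: ab \<gamma>_def)
    next
      case False
      define i where "i = pick A"
      have i: "i \<in> part g 0" using pick[OF False] np[OF nA] unfolding i_def by blast
      define w where "w = O.nmon (A - {#i#}, b)"
      have w: "w \<in> fpart g (O.mdeg b)" unfolding w_def by (rule nmon_part[OF np_remove[OF nA]])
      have "smul M (eps w) (m i) \<in> part M (O.mdeg b)"
      proof (cases "O.mdeg b = 1")
        case True then show ?thesis using eps_fpart_1[of w g] w by simp
      next
        case False then have "O.mdeg b = 0" by (cases "O.mdeg b") simp_all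
        then show ?thesis using m[OF i] by simp
      qed
      then have "F i w \<in> part M (O.mdeg b)"
        unfolding F_def using cochain2D(7)[OF fc zd_fpart[OF i] w] by (simp only: add_0 M.part_add)
      then show ?thesis using c(3)[OF nA] False by (simp add: ab \<gamma>_def i_def w_def)
    qed
  qed
  have c_part: "c a \<in> part M i" if "a \<in> fpart g i" for a i
    using that
  proof (induction rule: fpart_induct)
    case zero show ?case by (simp add: c_simps)
  next
    case (add d xs a)
    have "word xs \<in> O.normal_span i" using O.homogeneous_word_normal_span add(1) unfolding homogeneous_words_def by blast
    then have "c (word xs) \<in> part M i"
      unfolding O.normal_span_def OJ
    proof (induction rule: FV.span_induct_alt)
      case base show ?case by (simp add: c_simps)
    next
      case (step d x y)
      have "c x \<in> part M i" using step(1) c_nmon c(2) by auto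
      then show ?case using step by (simp add: c_simps)
    qed
    then show ?case using add by (simp add: c_simps)
  qed
  show ?thesis
  proof
    show "cochain1 JU c" unfolding cochain1_def using c(1,2) c1 c_part by blast
  qed (use cg main in auto)
qed

text \<open>With the cochain of \<open>descent_cochain\<close>, f + d1 c vanishes at (z_x, a) and at
  (y, z_x) for letters y, which suffices by \<open>cocycle2_descends\<close>. The case f = 0
  produces the connecting map; the general case gives exactness at ordinary H^2.\<close>

theorem descent:
  assumes f: "cocycle2 JU f"
    and m: "\<And>x. x \<in> part g 0 \<Longrightarrow> m x \<in> part M 0"
    and semi: "\<And>a x y. x \<in> part g 0 \<Longrightarrow> y \<in> part g 0 \<Longrightarrow> m (smul g a x + y) = smul M (a ^ CHAR('k)) (m x) + m y"
    and comm: "\<And>x y. x \<in> part g 0 \<Longrightarrow> f (zd x) (free_gen y) - f (free_gen y) (zd x) = act y (m x)"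
  shows "\<exists>c. cochain1 JU c \<and> (\<forall>x. c (free_gen x) = 0) \<and> (\<forall>x\<in>part g 0. c (zd x) = m x) \<and>
    cocycle2 Ju (\<lambda>a b. f a b + d1 c a b)"
proof -
  obtain c where c: "cochain1 JU c" "\<And>x. c (free_gen x) = 0"
    "\<And>x s. x \<in> part g 0 \<Longrightarrow> c (zd x * s) = f (zd x) s + smul M (eps s) (m x)"
  proof -
    assume that: "\<And>c. cochain1 JU c \<Longrightarrow> (\<And>x. c (free_gen x) = 0) \<Longrightarrow>
      (\<And>x s. x \<in> part g 0 \<Longrightarrow> c (zd x * s) = f (zd x) s + smul M (eps s) (m x)) \<Longrightarrow> thesis"
    show thesis
    proof (rule descent_cochain[of f m, OF f])
      show "m x \<in> part M 0" if "x \<in> part g 0" for x by (rule m[OF that])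
      show "m (smul g a x + y) = smul M (a ^ CHAR('k)) (m x) + m y" if "x \<in> part g 0" "y \<in> part g 0" for a x y
        by (rule semi[OF that])
      show "f (zd x) (free_gen y) - f (free_gen y) (zd x) = act y (m x)" if "x \<in> part g 0" for x y
        by (rule comm[OF that])
    qed (rule that)
  qed
  note fc = cocycle2D(1)[OF f]
  have z: "c (zd x) = m x" if "x \<in> part g 0" for x using c(3)[OF that, of 1] cochain2D(4)[OF fc] by simp
  have d: "cocycle2 JU (d1 c)" by (rule cocycle2_d1[OF good_JU c(1)])
  note dc = cocycle2D(1)[OF d]
  have fd: "cocycle2 JU (\<lambda>a b. f a b + d1 c a b)"
    unfolding cocycle2_def cochain2_def
    by (intro conjI allI ballI klinear_plus cochain2D(1,2)[OF fc] cochain2D(1,2)[OF dc] M.part_add cochain2D(7)[OF fc] cochain2D(7)[OF dc])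
      (simp_all add: cochain2D(3-6)[OF fc] cochain2D(3-6)[OF dc] cocycle2D(2)[OF f] cocycle2D(2)[OF d] fa_right_simps M.vs.scale_right_distrib)
  have "cocycle2 Ju (\<lambda>a b. f a b + d1 c a b)"
  proof (rule cocycle2_descends[OF fd])
    fix x assume x: "x \<in> part g 0"
    show "f (zd x) a + d1 c (zd x) a = 0" for a
      by (simp add: d1_def fa_zd[OF x] c(3)[OF x] z[OF x])
    have "c (free_gen y * zd x) = c (zd x * free_gen y)" for y
      by (rule cochain1_cong[OF c(1) cong_zd_central[OF x]])
    then show "f (free_gen y) (zd x) + d1 c (free_gen y) (zd x) = 0" for y
      by (simp add: d1_def z[OF x] c(3)[OF x] flip: comm[OF x])
  qed
  then show ?thesis using c(1,2) z by (intro exI[of _ c] conjI allI ballI)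
qed

end

section \<open>Twisted extensions\<close>

lemma fst_sum_pair: "fst (sum f A) = (\<Sum>a\<in>A. fst (f a))"
  by (induction A rule: infinite_finite_induct) auto

lemma rlsa_hom_compose:
  assumes "rlsa_hom L L' f" "rlsa_hom L' L'' h"
  shows "rlsa_hom L L'' (\<lambda>x. h (f x))"
proof -
  have "even_linear L L'' (\<lambda>x. h (f x))"
    using assms klinear_compose unfolding rlsa_hom_def even_linear_def by blast
  then show ?thesis using assms unfolding rlsa_hom_def even_linear_def by simp
qed

lemma extension_equiv_trans:
  assumes "extension_equiv E E'" "extension_equiv E' E''"
  shows "extension_equiv E E''"
proof -
  obtain \<alpha> \<beta> where "bij \<alpha>" "rlsa_hom (total E) (total E') \<alpha>" "\<And>m. \<alpha> (inc E m) = inc E' m" "\<And>e. prj E' (\<alpha> e) = prj E e"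
    "bij \<beta>" "rlsa_hom (total E') (total E'') \<beta>" "\<And>m. \<beta> (inc E' m) = inc E'' m" "\<And>e. prj E'' (\<beta> e) = prj E' e"
    using assms unfolding extension_equiv_def by blast
  then have "bij (\<lambda>x. \<beta> (\<alpha> x)) \<and> rlsa_hom (total E) (total E'') (\<lambda>x. \<beta> (\<alpha> x)) \<and> (\<forall>m. \<beta> (\<alpha> (inc E m)) = inc E'' m) \<and>
    (\<forall>e. prj E'' (\<beta> (\<alpha> e)) = prj E e)"
    using rlsa_hom_compose bij_comp[of \<alpha> \<beta>] by (auto simp: comp_def)
  then show ?thesis unfolding extension_equiv_def by (intro exI[of _ "\<lambda>x. \<beta> (\<alpha> x)"])
qed

context restricted_setting
begin

lemmas sw_bilinear = even_bilinear_swap_sign[OF act_bilinear graded_space_axioms M.graded_space_axioms M.graded_space_axioms]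
lemmas sw_simps = even_bilinear_simps[OF sw_bilinear]

lemma sw_homogeneous: "x \<in> part g i \<Longrightarrow> m \<in> part M j \<Longrightarrow> swap_sign g M act x m = ksign i j (act x m)"
  by (rule swap_sign_homogeneous[OF graded_space_axioms M.graded_space_axioms]) (simp_all add: act_simps)

lemma klinear_act_power: "klinear (smul M) (smul M) (act x ^^ n)"
proof (induction n)
  case 0 show ?case by (auto intro!: klinearI mvec)
next
  case (Suc n) show ?case using klinear_compose[OF Suc even_bilinear_right[OF act_bilinear, of x]] by (simp add: comp_def)
qed

abbreviation "tw \<equiv> twisted_extension g M act"

lemma tw_simps:
  "smul (total (tw b q)) c W = (smul g c (fst W), smul M c (snd W))"
  "part (total (tw b q)) i = part g i \<times> part M i"
  "br (total (tw b q)) W Y = (br g (fst W) (fst Y), act (fst W) (snd Y) - swap_sign g M act (fst Y) (snd W) + b (fst W) (fst Y))"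
  "pmap (total (tw b q)) W = (pmap g (fst W), (act (fst W) ^^ (CHAR('k) - 1)) (snd W) + q (fst W))"
  "inc (tw b q) m = (0, m)" "prj (tw b q) = fst"
  by (simp_all add: twisted_extension_def case_prod_unfold)

lemma graded_tw: "graded_space (total (tw b q))"
proof -
  let ?V = "total (tw b q)"
  have V: "vector_space (smul ?V)"
    by standard (simp_all add: tw_simps prod_eq_iff vs.scale_right_distrib vs.scale_left_distrib M.vs.scale_right_distrib M.vs.scale_left_distrib)
  interpret V: vector_space "smul ?V" by (rule V)
  have "V.subspace (part ?V i)" for i
    by (rule V.subspaceI) (auto simp: tw_simps zero_prod_def)
  moreover have "part ?V 0 \<inter> part ?V 1 = {0}"
    using part_disjoint M.part_disjoint by (auto simp: tw_simps zero_prod_def)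
  moreover have "\<exists>A\<in>part ?V 0. \<exists>B\<in>part ?V 1. W = A + B" for W
  proof -
    obtain a b where ab: "a \<in> part g 0" "b \<in> part g 1" "fst W = a + b" by (rule decompose)
    obtain m n where mn: "m \<in> part M 0" "n \<in> part M 1" "snd W = m + n" by (rule M.decompose)
    have "(a, m) \<in> part ?V 0" "(b, n) \<in> part ?V 1" "W = (a, m) + (b, n)" using ab mn by (simp_all add: tw_simps prod_eq_iff)
    then show ?thesis by blast
  qed
  ultimately show ?thesis using V by (simp add: graded_space_def super_space_def)
qed

lemma tw_bilinear:
  assumes b: "even_bilinear g g M b"
  shows "even_bilinear (total (tw b q)) (total (tw b q)) (total (tw b q)) (br (total (tw b q)))"
proof -
  interpret V: graded_space "total (tw b q)" by (rule graded_tw)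
  note b_simps = even_bilinear_simps[OF b]
  show ?thesis unfolding even_bilinear_def
  proof (intro conjI allI ballI)
    fix W
    show "klinear (smul (total (tw b q))) (smul (total (tw b q))) (br (total (tw b q)) W)"
      by (rule klinearI[OF V.vs.vector_space_axioms V.vs.vector_space_axioms])
        (simp_all add: tw_simps prod_eq_iff br_simps act_simps sw_simps b_simps M.vs.scale_right_distrib M.vs.scale_right_diff_distrib)
    show "klinear (smul (total (tw b q))) (smul (total (tw b q))) (\<lambda>Y. br (total (tw b q)) Y W)"
      by (rule klinearI[OF V.vs.vector_space_axioms V.vs.vector_space_axioms])
        (simp_all add: tw_simps prod_eq_iff br_simps act_simps sw_simps b_simps M.vs.scale_right_distrib M.vs.scale_right_diff_distrib)
  next
    fix i j W Y assume "W \<in> part (total (tw b q)) i" "Y \<in> part (total (tw b q)) j"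
    then have *: "fst W \<in> part g i" "snd W \<in> part M i" "fst Y \<in> part g j" "snd Y \<in> part M j" by (auto simp: tw_simps)
    have "swap_sign g M act (fst Y) (snd W) \<in> part M (i + j)"
      using even_bilinear_part[OF sw_bilinear *(3,2)] by (simp only: add.commute)
    then show "br (total (tw b q)) W Y \<in> part (total (tw b q)) (i + j)"
      unfolding tw_simps using br_part[OF *(1,3)] act_part[OF *(1,4)] even_bilinear_part[OF b *(1,3)]
      by (simp only: mem_Times_iff fst_conv snd_conv M.part_add M.part_diff simp_thms)
  qed
qed

text \<open>An equivalence fixes \<open>M\<close> and the projection, so it has the form (x, m) |->
  (x, m + \<eta> x); the two equations express compatibility with bracket and p-map.\<close>

lemma tw_equiv_iff:
  "extension_equiv (tw b q) (tw b' q') \<longleftrightarrow>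
    (\<exists>\<eta>. even_linear g M \<eta> \<and>
      (\<forall>x y. b x y + \<eta> (br g x y) = act x (\<eta> y) - swap_sign g M act y (\<eta> x) + b' x y) \<and>
      (\<forall>x\<in>part g 0. q x + \<eta> (pmap g x) = (act x ^^ (CHAR('k) - 1)) (\<eta> x) + q' x))" (is "?L \<longleftrightarrow> (\<exists>\<eta>. ?R \<eta>)")
proof
  assume ?L
  then obtain \<alpha> where \<alpha>: "rlsa_hom (total (tw b q)) (total (tw b' q')) \<alpha>" "\<And>m. \<alpha> (0, m) = (0, m)" "\<And>e. fst (\<alpha> e) = fst e"
    unfolding extension_equiv_def tw_simps by blast
  have lin: "klinear (smul (total (tw b q))) (smul (total (tw b' q'))) \<alpha>"
    and part: "\<And>i W. W \<in> part (total (tw b q)) i \<Longrightarrow> \<alpha> W \<in> part (total (tw b' q')) i"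
    and br: "\<And>W Y. \<alpha> (br (total (tw b q)) W Y) = br (total (tw b' q')) (\<alpha> W) (\<alpha> Y)"
    and pm: "\<And>W. W \<in> part (total (tw b q)) 0 \<Longrightarrow> \<alpha> (pmap (total (tw b q)) W) = pmap (total (tw b' q')) (\<alpha> W)"
    using \<alpha>(1) unfolding rlsa_hom_def even_linear_def by blast+
  define \<eta> where "\<eta> x = snd (\<alpha> (x, 0))" for x
  have \<alpha>_eq: "\<alpha> W = (fst W, \<eta> (fst W) + snd W)" for W
  proof -
    have "W = (fst W, 0) + (0, snd W)" by (simp add: prod_eq_iff)
    then have "\<alpha> W = \<alpha> (fst W, 0) + (0, snd W)" using klinear_add[OF lin] \<alpha>(2) by metis
    then show ?thesis using \<alpha>(3)[of "(fst W, 0)"] by (simp add: prod_eq_iff \<eta>_def)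
  qed
  have "even_linear g M \<eta>"
    unfolding even_linear_def
  proof (intro conjI allI ballI)
    show "klinear (smul g) (smul M) \<eta>"
    proof (rule klinearI[OF gvec mvec])
      show "\<eta> (x + y) = \<eta> x + \<eta> y" for x y
        using klinear_add[OF lin, of "(x, 0)" "(y, 0)"] by (simp add: \<alpha>_eq prod_eq_iff)
      show "\<eta> (smul g c x) = smul M c (\<eta> x)" for c x
        using klinear_scale[OF lin, of c "(x, 0)"] by (simp add: \<alpha>_eq tw_simps prod_eq_iff)
    qed
    show "\<eta> x \<in> part M i" if "x \<in> part g i" for i x
      using part[of "(x, 0)" i] that by (simp add: tw_simps \<alpha>_eq)
  qed
  moreover have "b x y + \<eta> (br g x y) = act x (\<eta> y) - swap_sign g M act y (\<eta> x) + b' x y" for x y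
    using br[of "(x, 0)" "(y, 0)"] by (simp add: \<alpha>_eq tw_simps act_simps sw_simps add.commute)
  moreover have "q x + \<eta> (pmap g x) = (act x ^^ (CHAR('k) - 1)) (\<eta> x) + q' x" if "x \<in> part g 0" for x
    using pm[of "(x, 0)"] that by (simp add: \<alpha>_eq tw_simps klinear_zero[OF klinear_act_power] add.commute)
  ultimately show "\<exists>\<eta>. ?R \<eta>" by blast
next
  assume "\<exists>\<eta>. ?R \<eta>"
  then obtain \<eta> where \<eta>: "even_linear g M \<eta>" 
    "\<And>x y. b x y + \<eta> (br g x y) = act x (\<eta> y) - swap_sign g M act y (\<eta> x) + b' x y"
    "\<And>x. x \<in> part g 0 \<Longrightarrow> q x + \<eta> (pmap g x) = (act x ^^ (CHAR('k) - 1)) (\<eta> x) + q' x" by blast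
  have lin: "klinear (smul g) (smul M) \<eta>" and part: "\<And>i x. x \<in> part g i \<Longrightarrow> \<eta> x \<in> part M i"
    using \<eta>(1) by (auto simp: even_linear_def)
  define \<alpha> where "\<alpha> W = (fst W, snd W + \<eta> (fst W))" for W
  have "bij \<alpha>"
    by (rule bij_betw_byWitness[where f' = "\<lambda>W. (fst W, snd W - \<eta> (fst W))"]) (auto simp: \<alpha>_def)
  moreover have "rlsa_hom (total (tw b q)) (total (tw b' q')) \<alpha>"
    unfolding rlsa_hom_def even_linear_def
  proof (intro conjI allI ballI)
    show "klinear (smul (total (tw b q))) (smul (total (tw b' q'))) \<alpha>"
      by (rule klinearI[OF graded_space.super[OF graded_tw, unfolded super_space_def, THEN conjunct1] graded_space.super[OF graded_tw, unfolded super_space_def, THEN conjunct1]])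
        (simp_all add: \<alpha>_def tw_simps klinearD[OF lin] M.vs.scale_right_distrib prod_eq_iff)
    show "\<alpha> W \<in> part (total (tw b' q')) i" if "W \<in> part (total (tw b q)) i" for W i
      using that part[of "fst W" i] by (auto simp: \<alpha>_def tw_simps)
    show "\<alpha> (br (total (tw b q)) W Y) = br (total (tw b' q')) (\<alpha> W) (\<alpha> Y)" for W Y
      using \<eta>(2)[of "fst W" "fst Y"] by (simp add: \<alpha>_def tw_simps act_simps sw_simps)
    show "\<alpha> (pmap (total (tw b q)) W) = pmap (total (tw b' q')) (\<alpha> W)" if "W \<in> part (total (tw b q)) 0" for W
      using \<eta>(3)[of "fst W"] that by (simp add: \<alpha>_def tw_simps klinear_add[OF klinear_act_power] add.assoc mem_Times_iff)
  qed
  moreover have "\<alpha> (0, m) = (0, m)" "fst (\<alpha> W) = fst W" for m W by (simp_all add: \<alpha>_def klinear_zero[OF lin])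
  ultimately show ?L unfolding extension_equiv_def tw_simps by (intro exI[of _ \<alpha>] conjI allI)
qed

definition gen2 :: "(('k, 'g) free_alg \<Rightarrow> ('k, 'g) free_alg \<Rightarrow> 'm) \<Rightarrow> 'g \<Rightarrow> 'g \<Rightarrow> 'm" where
  "gen2 f x y = f (free_gen x) (free_gen y)"

text \<open>\<open>bf\<close> and \<open>qf\<close> are the terms by which a cocycle changes the
  bracket and the p-map of the semidirect product.\<close>

definition bf :: "(('k, 'g) free_alg \<Rightarrow> ('k, 'g) free_alg \<Rightarrow> 'm) \<Rightarrow> 'g \<Rightarrow> 'g \<Rightarrow> 'm" where
  "bf f x y = gen2 f x y - swap_sign g g (gen2 f) y x"

definition qf :: "(('k, 'g) free_alg \<Rightarrow> ('k, 'g) free_alg \<Rightarrow> 'm) \<Rightarrow> 'g \<Rightarrow> 'm" where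
  "qf f x = f (free_gen x ^ (CHAR('k) - 1)) (free_gen x)"

lemma gen2_bilinear:
  assumes "cochain2 JU f"
  shows "even_bilinear g g M (gen2 f)"
  unfolding even_bilinear_def gen2_def
proof (intro conjI allI ballI)
  note f_simps = klinearD(1-5)[OF cochain2D(1)[OF assms]] klinearD(1-5)[OF cochain2D(2)[OF assms]]
  show "klinear (smul g) (smul M) (\<lambda>y. f (free_gen x) (free_gen y))" for x
    by (rule klinearI[OF gvec mvec])
      (simp_all add: cochain2_cong_right[OF assms JU.gen_add] cochain2_cong_right[OF assms JU.gen_scale] f_simps)
  show "klinear (smul g) (smul M) (\<lambda>x. f (free_gen x) (free_gen y))" for y
    by (rule klinearI[OF gvec mvec])
      (simp_all add: cochain2_cong_left[OF assms JU.gen_add] cochain2_cong_left[OF assms JU.gen_scale] f_simps)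
  show "f (free_gen x) (free_gen y) \<in> part M (i + j)" if "x \<in> part g i" "y \<in> part g j" for i j x y
    by (intro cochain2D(7)[OF assms] fpart_gen that)
qed

lemma gen2_swap_homogeneous:
  assumes "cochain2 JU f" "x \<in> part g i" "y \<in> part g j"
  shows "swap_sign g g (gen2 f) x y = ksign i j (gen2 f x y)"
  by (rule swap_sign_homogeneous[where b = "gen2 f", OF graded_space_axioms graded_space_axioms
      klinear_zero[OF even_bilinear_right[OF gen2_bilinear[OF assms(1)]]]
      klinear_zero[OF even_bilinear_left[OF gen2_bilinear[OF assms(1)]]] assms(2,3)])

lemma bf_bilinear:
  assumes f: "cochain2 JU f"
  shows "even_bilinear g g M (bf f)"
proof -
  note s = even_bilinear_swap_sign[OF gen2_bilinear[OF f] graded_space_axioms graded_space_axioms M.graded_space_axioms]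
  note g2 = gen2_bilinear[OF f]
  show ?thesis unfolding even_bilinear_def bf_def
  proof (intro conjI allI ballI)
    show "klinear (smul g) (smul M) (\<lambda>y. gen2 f x y - swap_sign g g (gen2 f) y x)" for x
      by (intro klinear_minus_fun even_bilinear_left[OF s] even_bilinear_right[OF g2])
    show "klinear (smul g) (smul M) (\<lambda>x. gen2 f x y - swap_sign g g (gen2 f) y x)" for y
      by (intro klinear_minus_fun even_bilinear_right[OF s] even_bilinear_left[OF g2])
    show "gen2 f x y - swap_sign g g (gen2 f) y x \<in> part M (i + j)" if "x \<in> part g i" "y \<in> part g j" for i j x y
      using even_bilinear_part[OF g2 that] even_bilinear_part[OF s that(2,1)] by (simp only: add.commute[of j i] M.part_diff)
  qed
qed

lemma bilinear_eqI:
  assumes "even_bilinear g g M b" "even_bilinear g g M b'" "\<And>i j x y. x \<in> part g i \<Longrightarrow> y \<in> part g j \<Longrightarrow> b x y = b' x y"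
  shows "b x y = b' x y"
proof -
  note s = even_bilinear_simps[OF assms(1)] even_bilinear_simps[OF assms(2)]
  show ?thesis
  proof (induction x rule: graded_induct)
    case (homogeneous i x)
    then show ?case by (induction y rule: graded_induct) (simp_all add: assms(3) s)
  qed (simp add: s)
qed

lemma ksign_commute: "ksign i j v = ksign j i v"
  by (auto simp: ksign_def)

text \<open>Both sides of the equation are bilinear, so homogeneous arguments suffice.\<close>

lemma lie_bound_iff:
  assumes f: "cochain2 JU f"
  shows "lie_bound f \<eta> \<longleftrightarrow> even_linear g M \<eta> \<and> (\<forall>x y. bf f x y + \<eta> (br g x y) = act x (\<eta> y) - swap_sign g M act y (\<eta> x))"
proof (cases "even_linear g M \<eta>")
  case False then show ?thesis by (simp add: lie_bound_def)
next
  case True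
  then have lin: "klinear (smul g) (smul M) \<eta>" and part: "\<And>i x. x \<in> part g i \<Longrightarrow> \<eta> x \<in> part M i"
    by (auto simp: even_linear_def)
  let ?l = "\<lambda>x y. bf f x y + \<eta> (br g x y)" and ?r = "\<lambda>x y. act x (\<eta> y) - swap_sign g M act y (\<eta> x)"
  note b = bf_bilinear[OF f]
  have l: "even_bilinear g g M ?l"
    unfolding even_bilinear_def
    by (intro conjI allI ballI klinear_plus even_bilinear_left[OF b] even_bilinear_right[OF b] M.part_add even_bilinear_part[OF b]
        klinear_compose[OF even_bilinear_left[OF bilinear] lin] klinear_compose[OF even_bilinear_right[OF bilinear] lin] part br_part)
  have r: "even_bilinear g g M ?r"
    unfolding even_bilinear_def
  proof (intro conjI allI ballI)
    show "klinear (smul g) (smul M) (?r x)" "klinear (smul g) (smul M) (\<lambda>x. ?r x x')" for x x'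
      by (intro klinear_minus_fun klinear_compose[OF lin even_bilinear_right[OF act_bilinear]] klinear_compose[OF lin even_bilinear_right[OF sw_bilinear]]
         even_bilinear_left[OF act_bilinear] even_bilinear_left[OF sw_bilinear])+
    show "?r x y \<in> part M (i + j)" if "x \<in> part g i" "y \<in> part g j" for i j x y
      using act_part[OF that(1) part[OF that(2)]] even_bilinear_part[OF sw_bilinear that(2) part[OF that(1)]]
      by (simp only: add.commute[of j i] M.part_diff)
  qed
  have hom: "?l x y = ?r x y \<longleftrightarrow> f (free_gen x) (free_gen y) - ksign i j (f (free_gen y) (free_gen x)) + \<eta> (br g x y)
       = act x (\<eta> y) - ksign i j (act y (\<eta> x))" if "x \<in> part g i" "y \<in> part g j" for x y i j
    unfolding bf_def gen2_swap_homogeneous[OF f that(2,1)] sw_homogeneous[OF that(2) part[OF that(1)]] ksign_commute[of j i] gen2_def ..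
  show ?thesis
    using bilinear_eqI[OF l r] hom True unfolding lie_bound_def by blast
qed

lemma cocycle2_plus:
  assumes f: "cocycle2 J f" and h: "cocycle2 J h"
  shows "cocycle2 J (\<lambda>a b. f a b + h a b)"
proof -
  note fc = cocycle2D(1)[OF f] and dc = cocycle2D(1)[OF h]
  show ?thesis
    unfolding cocycle2_def cochain2_def
    by (intro conjI allI ballI klinear_plus cochain2D(1,2)[OF fc] cochain2D(1,2)[OF dc] M.part_add cochain2D(7)[OF fc] cochain2D(7)[OF dc])
      (simp_all add: cochain2D(3-6)[OF fc] cochain2D(3-6)[OF dc] cocycle2D(2)[OF f] cocycle2D(2)[OF h] fa_right_simps M.vs.scale_right_distrib)
qed

lemma cocycle2_scale:
  assumes f: "cocycle2 J f"
  shows "cocycle2 J (\<lambda>a b. smul M c (f a b))"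
proof -
  note fc = cocycle2D(1)[OF f]
  show ?thesis
    unfolding cocycle2_def cochain2_def
    by (intro conjI allI ballI klinear_scaled cochain2D(1,2)[OF fc] M.part_scale cochain2D(7)[OF fc])
      (simp_all add: cochain2D(3-6)[OF fc] cocycle2D(2)[OF f] fa_right_simps M.vs.scale_right_distrib M.vs.scale_right_diff_distrib mult.commute)
qed

lemma cocycle2_diff: "cocycle2 J f \<Longrightarrow> cocycle2 J h \<Longrightarrow> cocycle2 J (\<lambda>a b. f a b - h a b)"
  using cocycle2_plus[of J f "\<lambda>a b. smul M (-1) (h a b)"] cocycle2_scale[of J h "-1"] by simp

text \<open>The relation defining the connecting map, as in the snake lemma: over U(g) the cocycle
  \<open>f\<close> is the coboundary of a cochain with values \<open>h\<close> at the central
  elements.\<close>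

definition bounds :: "(('k, 'g) free_alg \<Rightarrow> ('k, 'g) free_alg \<Rightarrow> 'm) \<Rightarrow> ('g \<Rightarrow> 'm) \<Rightarrow> bool" where
  "bounds f h \<longleftrightarrow> (\<exists>c. cochain1 JU c \<and> d1 c = f \<and> (\<forall>x\<in>part g 0. c (zd x) = h x))"

text \<open>The equations for an equivalence are those of \<open>coboundary_iff_lie_bound\<close>
  for the difference of the cocycles. With h = 0 this compares the extensions of two cocycles; with
  f' = 0 it compares the extension of \<open>f\<close> with the twist of the semidirect product by
  \<open>h\<close>.\<close>

lemma tw_equiv_bounds:
  assumes f: "cocycle2 JU f" and f': "cocycle2 JU f'"
  shows "extension_equiv (tw (bf f) (qf f)) (tw (bf f') (\<lambda>x. qf f' x - h x)) \<longleftrightarrow> bounds (\<lambda>a b. f a b - f' a b) h"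
proof -
  let ?d = "\<lambda>a b. f a b - f' a b"
  have d: "cocycle2 JU ?d" by (rule cocycle2_diff[OF f f'])
  have k: "ksign i j (u - v) = ksign i j u - ksign i j v" for i j and u v :: 'm by (auto simp: ksign_def)
  have "swap_sign g g (gen2 ?d) y x = swap_sign g g (gen2 f) y x - swap_sign g g (gen2 f') y x" for x y
    by (simp add: swap_sign_def gen2_def k algebra_simps)
  then have bd: "bf ?d x y = bf f x y - bf f' x y" for x y by (simp add: bf_def gen2_def)
  have e: "bf ?d x y + \<eta> (br g x y) = w \<longleftrightarrow> bf f x y + \<eta> (br g x y) = w + bf f' x y" for x y \<eta> w
    unfolding bd by (auto simp: algebra_simps)
  have e2: "?d a b + u = w - h x \<longleftrightarrow> f a b + u = w + (f' a b - h x)" for a b u w x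
    by (auto simp: algebra_simps)
  show ?thesis
    unfolding bounds_def coboundary_iff_lie_bound[OF d] lie_bound_iff[OF cocycle2D(1)[OF d]] tw_equiv_iff e qf_def e2 conj_assoc ..
qed

subsection \<open>The extension of a cocycle is restricted\<close>

context
  fixes f assumes f: "cocycle2 Ju f"
begin

lemma f_JU: "cocycle2 JU f" by (rule cocycle2_mono[OF JU_subset_Ju f])

lemma bf_bilinear_Ju: "even_bilinear g g M (bf f)"
  by (rule bf_bilinear[OF cocycle2D(1)[OF f_JU]])

definition EV :: "('k, 'g \<times> 'm) rlsa" where "EV = total (tw (bf f) (qf f))"

text \<open>The kernel of the homomorphism from the free algebra on the elements of the extension to
  u(g) + M with the product twisted by \<open>f\<close>.\<close>

definition EQ :: "('k, 'g \<times> 'm) free_alg set" where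
  "EQ = {a. fmap fst a \<in> Ju \<and> ext fst snd f a = 0}"

lemmas EV_simps = tw_simps[of "bf f" "qf f", folded EV_def]

text \<open>The bracket of the extension is the supercommutator in the twisted algebra; this is
  checked on each type of relation.\<close>

lemma EV_ideal: "char_bracket_ideal EV EQ"
proof -
  interpret V: graded_space EV unfolding EV_def by (rule graded_tw)
  note g_ext = ext_gen[OF f] and m_ext = ext_mult[OF f] and l_ext = klinearD(1-5)[OF klinear_ext]
  have "env_relations EV \<subseteq> EQ"
  proof
    fix r assume r: "r \<in> env_relations EV"
    then consider W Y where "r = free_gen (W + Y) - free_gen W - free_gen Y"
      | c W where "r = free_gen (smul EV c W) - free_scal c (free_gen W)"
      | W Y i j where "W \<in> part EV i" "Y \<in> part EV j"
        "r = free_gen W * free_gen Y - ksign i j (free_gen Y * free_gen W) - free_gen (br EV W Y)"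
      unfolding env_relations_def by blast
    then show "r \<in> EQ"
    proof cases
      case 1
      have "free_gen (fst W + fst Y) - free_gen (fst W) - free_gen (fst Y) \<in> JU"
        using JU.gen_add by (simp add: cong_mod_def algebra_simps)
      then show ?thesis using 1 JU_subset_Ju by (auto simp: EQ_def fmap_simps fmap_gen g_ext l_ext)
    next
      case 2
      have "free_gen (smul g c (fst W)) - free_scal c (free_gen (fst W)) \<in> JU"
        using JU.gen_scale by (simp add: cong_mod_def)
      then show ?thesis using 2 JU_subset_Ju by (auto simp: EQ_def fmap_simps fmap_gen g_ext l_ext EV_simps)
    next
      case 3
      have *: "fst W \<in> part g i" "snd W \<in> part M i" "fst Y \<in> part g j" "snd Y \<in> part M j" using 3(1,2) by (auto simp: EV_simps)
      have "free_gen (fst W) * free_gen (fst Y) - ksign i j (free_gen (fst Y) * free_gen (fst W)) - free_gen (br g (fst W) (fst Y)) \<in> JU"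
        using JU.cg_sym[OF JU.gen_br[OF *(1,3)]] by (simp add: cong_mod_def)
      moreover have "fmap fst (ksign i j a) = ksign i j (fmap fst a)" "ext fst snd f (ksign i j a) = ksign i j (ext fst snd f a)" for a
        by (auto simp: ksign_def fmap_simps l_ext)
      moreover have "ksign i j (u + v) = ksign i j u + ksign i j v" for u v :: 'm by (auto simp: ksign_def)
      ultimately show ?thesis using JU_subset_Ju
        unfolding 3(3) EQ_def mem_Collect_eq fmap_simps fmap_mult fmap_gen l_ext m_ext g_ext EV_simps bf_def
          gen2_swap_homogeneous[OF cocycle2D(1)[OF f_JU] *(3,1)] sw_homogeneous[OF *(3,2)]
        by (auto simp: gen2_def ksign_commute[of j i] fmap_mult fmap_gen m_ext g_ext)
    qed
  qed
  moreover have "two_sided EQ" unfolding EQ_def by (rule two_sided_ext[OF f good_Ju])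
  moreover have "even_bilinear EV EV EV (br EV)" unfolding EV_def by (rule tw_bilinear[OF bf_bilinear_Ju])
  ultimately show ?thesis using V.super char_gt_2 by unfold_locales
qed

lemma EV_faithful:
  assumes "free_gen W \<in> EQ" "fst W = 0" shows "W = 0"
  using assms ext_gen[OF f, of fst snd W] by (simp add: EQ_def prod_eq_iff)

lemma fst_br_power: "fst ((br EV W ^^ n) Y) = (br g (fst W) ^^ n) (fst Y)"
  by (induction n) (simp_all add: EV_simps)

text \<open>The extension embeds into an associative algebra in which its p-map is the p-th power,
  so every axiom holds modulo \<open>EQ\<close>. It then holds exactly, because the
  \<open>g\<close>-components agree by the axioms of \<open>g\<close> and an element of
  \<open>EQ\<close> that is a letter with zero \<open>g\<close>-component is zero
  (\<open>EV_faithful\<close>).\<close>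

lemma restricted_EV: "restricted_lie_superalgebra EV"
proof -
  interpret E: char_bracket_ideal EV EQ by (rule EV_ideal)
  let ?p = "CHAR('k)"
  have eqI: "W = Y" if "E.cg (free_gen W) (free_gen Y)" "fst W = fst Y" for W Y
  proof -
    have "free_gen (W - Y) \<in> EQ" using E.cg_trans[OF E.gen_diff cong_mod_diff[OF E.Q that(1) E.cg_refl[of "free_gen Y"]]] by (simp add: cong_mod_def)
    then have "W - Y = 0" using that(2) by (intro EV_faithful) simp_all
    then show ?thesis by simp
  qed
  have fst_k: "fst (ksign i j W) = ksign i j (fst W)" for i j and W :: "'g \<times> 'm" by (auto simp: ksign_def)
  have part: "W \<in> part EV i \<longleftrightarrow> fst W \<in> part g i \<and> snd W \<in> part M i" for W i by (auto simp: EV_simps mem_Times_iff)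
  have lie: "lie_superalgebra EV"
    unfolding lie_superalgebra_def
  proof (intro conjI allI ballI impI E.super E.bilinear)
    show "br EV W Y = - ksign i j (br EV Y W)" if "W \<in> part EV i" "Y \<in> part EV j" for i j W Y
    proof -
      have "br EV W Y + ksign i j (br EV Y W) = 0"
        using that br_antisym[of "fst W" i "fst Y" j] unfolding part
        by (intro EV_faithful E.gen_antisym) (simp_all add: fst_k EV_simps mem_Times_iff)
      then show ?thesis by (simp add: eq_neg_iff_add_eq_0)
    qed
    show "br EV W (br EV Y Z) = br EV (br EV W Y) Z + ksign i j (br EV Y (br EV W Z))" if "W \<in> part EV i" "Y \<in> part EV j" for i j W Y Z
    proof -
      have "br EV W (br EV Y Z) - br EV (br EV W Y) Z - ksign i j (br EV Y (br EV W Z)) = 0"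
        using that br_jacobi[of "fst W" i "fst Y" j "fst Z"] unfolding part
        by (intro EV_faithful E.gen_jacobi) (simp_all add: fst_k EV_simps mem_Times_iff)
      then show ?thesis by (simp add: algebra_simps)
    qed
    show "br EV Y (br EV Y Y) = 0" if "Y \<in> part EV 1" for Y
      using that br_cube[of "fst Y"] unfolding part
      by (intro EV_faithful E.gen_cube) (simp_all add: EV_simps mem_Times_iff)
  qed
  \<comment> \<open>The difference of the two sides has \<open>g\<close>-component z_x, which must
    vanish in the quotient: this is where the cocycle has to live on u(g).\<close>
  have pm: "E.cg (free_gen (pmap EV W)) (free_gen W ^ ?p)" if W: "W \<in> part EV 0" for W
  proof -
    have Suc: "Suc (?p - 1) = ?p" using prime_gt_0_nat[OF prime_p] by simp
    have e: "ext fst snd f (free_gen W ^ ?p) = (act (fst W) ^^ (?p - 1)) (snd W) + f (free_gen (fst W) ^ (?p - 1)) (free_gen (fst W))"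
      using ext_gen_power[OF f, of fst snd W "?p - 1"] unfolding Suc .
    have "ext fst snd f (free_gen W ^ ?p - free_gen (pmap EV W)) = 0"
      unfolding klinear_diff[OF klinear_ext] e ext_gen[OF f] by (simp add: EV_simps(4) qf_def)
    moreover have "fmap fst (free_gen W ^ ?p - free_gen (pmap EV W)) = zd (fst W)"
      by (simp add: fmap_simps fmap_power fmap_gen EV_simps(4) zd_def)
    moreover have "zd (fst W) \<in> Ju" using W unfolding part by (intro zd_Ju) simp
    ultimately have "free_gen W ^ ?p - free_gen (pmap EV W) \<in> EQ" unfolding EQ_def by simp
    then show ?thesis by - (rule E.cg_sym, simp add: cong_mod_def)
  qed
  have pm_part: "pmap EV W \<in> part EV 0" if W: "W \<in> part EV 0" for W
  proof -
    have "f (free_gen (fst W) ^ (?p - 1)) (free_gen (fst W)) \<in> part M (0 + 0)"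
      using W unfolding part by (intro cochain2D(7)[OF cocycle2D(1)[OF f]] fpart_power fpart_gen) auto
    moreover have "fa (free_gen (fst W) ^ (?p - 1)) (snd W) \<in> part M (0 + 0)"
      using W unfolding part by (intro fa_part fpart_power fpart_gen) auto
    ultimately show ?thesis using W pmap_part[of "fst W"] unfolding part by (simp add: EV_simps qf_def fa_gen_power)
  qed
  have pm_scale: "pmap EV (smul EV c W) = smul EV (c ^ ?p) (pmap EV W)" if W: "W \<in> part EV 0" for c W
  proof (rule eqI)
    have cX: "smul EV c W \<in> part EV 0" using W unfolding part by (simp add: EV_simps)
    have "E.cg (free_gen (pmap EV (smul EV c W))) (free_gen (smul EV c W) ^ ?p)" by (rule pm[OF cX])
    also have "E.cg \<dots> (free_scal c (free_gen W) ^ ?p)" by (intro cong_mod_power[OF E.Q] E.gen_scale)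
    also have "\<dots> = free_scal (c ^ ?p) (free_gen W ^ ?p)" by (rule free_scal_power)
    also have "E.cg \<dots> (free_scal (c ^ ?p) (free_gen (pmap EV W)))" by (intro cong_mod_scal[OF E.Q] E.cg_sym[OF pm[OF W]])
    also have "E.cg \<dots> (free_gen (smul EV (c ^ ?p) (pmap EV W)))" by (intro E.cg_sym[OF E.gen_scale])
    finally show "E.cg (free_gen (pmap EV (smul EV c W))) (free_gen (smul EV (c ^ ?p) (pmap EV W)))" .
    show "fst (pmap EV (smul EV c W)) = fst (smul EV (c ^ ?p) (pmap EV W))"
      using W pmap_scale[of "fst W" c] unfolding part by (simp add: EV_simps)
  qed
  have pm_br: "br EV (pmap EV W) Y = (br EV W ^^ ?p) Y" if W: "W \<in> part EV 0" for W Y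
  proof (rule eqI)
    have "E.cg (free_gen (br EV (pmap EV W) Y)) (free_gen (pmap EV W) * free_gen Y - free_gen Y * free_gen (pmap EV W))"
      by (rule E.gen_br_even[OF pm_part[OF W]])
    also have "E.cg \<dots> (free_gen W ^ ?p * free_gen Y - free_gen Y * free_gen W ^ ?p)"
      by (intro cong_mod_diff[OF E.Q] cong_mod_mult[OF E.Q] pm W E.cg_refl)
    also have "E.cg \<dots> (free_gen ((br EV W ^^ ?p) Y))" by (rule E.cg_sym[OF E.gen_p_commutator[OF W]])
    finally show "E.cg (free_gen (br EV (pmap EV W) Y)) (free_gen ((br EV W ^^ ?p) Y))" .
    show "fst (br EV (pmap EV W) Y) = fst ((br EV W ^^ ?p) Y)"
      using W pmap_br[of "fst W" "fst Y"] unfolding part fst_br_power by (simp add: EV_simps)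
  qed
  have pm_add: "pmap EV (W + Y) = pmap EV W + pmap EV Y + (\<Sum>i = 1..?p - 1. jacobson_s EV i W Y)" if W: "W \<in> part EV 0" and Y: "Y \<in> part EV 0" for W Y
  proof (rule eqI)
    let ?s = "\<Sum>i = 1..?p - 1. jacobson_s EV i W Y"
    have "E.cg (free_gen (pmap EV (W + Y))) (free_gen (W + Y) ^ ?p)" by (rule pm[OF E.part_add[OF W Y]])
    also have "E.cg \<dots> (free_gen W ^ ?p + free_gen Y ^ ?p + free_gen ?s)" by (rule E.gen_power_add[OF W Y])
    also have "E.cg \<dots> (free_gen (pmap EV W) + free_gen (pmap EV Y) + free_gen ?s)"
      by (intro cong_mod_add[OF E.Q] E.cg_sym[OF pm] W Y E.cg_refl)
    also have "E.cg \<dots> (free_gen (pmap EV W + pmap EV Y + ?s))"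
      by (rule E.cg_sym) (intro E.cg_trans[OF E.gen_add] cong_mod_add[OF E.Q] E.gen_add E.cg_refl)
    finally show "E.cg (free_gen (pmap EV (W + Y))) (free_gen (pmap EV W + pmap EV Y + ?s))" .
    have pen: "fst ((pencil (br EV W) (br EV Y) ^^ n) (pure W) k) = (pencil (br g (fst W)) (br g (fst Y)) ^^ n) (pure (fst W)) k" for n k
    proof (induction n arbitrary: k)
      case 0 show ?case by (simp add: pure_def)
    next
      case (Suc n) then show ?case by (cases k) (simp_all add: EV_simps E.pencil_0 E.pencil_Suc JU.pencil_0 JU.pencil_Suc)
    qed
    have "fst (jacobson_s EV i W Y) = jacobson_s g i (fst W) (fst Y)" for i
      unfolding jacobson_s_def E.coeff_ad_pencil_power JU.coeff_ad_pencil_power by (simp add: EV_simps pen)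
    then have "fst ?s = (\<Sum>i = 1..?p - 1. jacobson_s g i (fst W) (fst Y))" by (simp add: fst_sum_pair)
    then show "fst (pmap EV (W + Y)) = fst (pmap EV W + pmap EV Y + ?s)"
      using W Y pmap_add[of "fst W" "fst Y"] unfolding part by (simp add: EV_simps)
  qed
  show ?thesis unfolding restricted_lie_superalgebra_def
    by (intro conjI ballI allI lie pm_part pm_scale pm_br pm_add)
qed

theorem restricted_extension_cocycle: "restricted_extension g M act (tw (bf f) (qf f))"
proof -
  interpret E: char_bracket_ideal EV EQ by (rule EV_ideal)
  \<comment> \<open>Since p - 1 is positive, the zero operator is applied at least once
    below.\<close>
  have p1: "CHAR('k) - 1 = Suc (CHAR('k) - 2)" using char_gt_2 by simp
  have act0: "(act 0 ^^ (CHAR('k) - 1)) m = 0" for m unfolding p1 by (simp add: act_simps)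
  have pm0: "pmap g 0 = 0" using pmap_scale[of 0 0] prime_gt_0_nat[OF prime_p] by (simp add: power_0_left)
  have q0: "qf f 0 = 0"
  proof -
    have "qf f 0 = f (free_gen 0 ^ (CHAR('k) - 1)) 0"
      unfolding qf_def using cochain2_cong_right[OF cocycle2D(1)[OF f_JU], of "free_gen 0" 0] JU.gen_0 by (simp add: cong_mod_def)
    then show ?thesis by (simp add: klinear_zero[OF cochain2D(2)[OF cocycle2D(1)[OF f]]])
  qed
  note b_simps = even_bilinear_simps[OF bf_bilinear_Ju]
  have "rlsa_hom M EV (\<lambda>m. (0, m))"
    unfolding rlsa_hom_def even_linear_def
  proof (intro conjI allI ballI)
    show "klinear (smul M) (smul EV) (\<lambda>m. (0, m))"
      by (rule klinearI[OF mvec E.vs.vector_space_axioms]) (simp_all add: EV_simps)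
    show "(0, m) \<in> part EV i" if "m \<in> part M i" for m i using that by (simp add: EV_simps)
    show "(0, br M m n) = br EV (0, m) (0, n)" for m n
      using abelian_M by (simp add: strongly_abelian_def EV_simps br_simps act_simps sw_simps b_simps)
    show "(0, pmap M m) = pmap EV (0, m)" if "m \<in> part M 0" for m
      using abelian_M that act0 by (simp add: strongly_abelian_def EV_simps pm0 q0)
  qed
  moreover have "rlsa_hom EV g fst"
    unfolding rlsa_hom_def even_linear_def
  proof (intro conjI allI ballI)
    show "klinear (smul EV) (smul g) fst"
      by (rule klinearI[OF E.vs.vector_space_axioms gvec]) (simp_all add: EV_simps)
  qed (auto simp: EV_simps)
  moreover have "range (\<lambda>m. (0, m)) = {e :: 'g \<times> 'm. fst e = 0}" by (auto simp: image_iff prod_eq_iff)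
  moreover have "br EV e (0, m) = (0, act (fst e) m)" for e m by (simp add: EV_simps br_simps sw_simps b_simps)
  moreover have "inj (\<lambda>m :: 'm. (0 :: 'g, m))" "surj (fst :: 'g \<times> 'm \<Rightarrow> 'g)" by (auto simp: inj_def)
  moreover have "inc (tw (bf f) (qf f)) = (\<lambda>m. (0, m))" by (rule ext) (simp add: tw_simps)
  ultimately show ?thesis using restricted_EV unfolding restricted_extension_def EV_def[symmetric] tw_simps by simp
qed

end

text \<open>The p-map is a total function of which only the even part matters. The comparison of
  \<open>qf\<close> with \<open>- h\<close> is available on even elements only, hence this
  transfer.\<close>

lemma restricted_extension_cong:
  assumes "restricted_extension g M act (tw b q)" "\<And>x. x \<in> part g 0 \<Longrightarrow> q x = q' x"
  shows "restricted_extension g M act (tw b q')"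
proof -
  have e: "smul (total (tw b q')) = smul (total (tw b q))" "part (total (tw b q')) = part (total (tw b q))"
    "br (total (tw b q')) = br (total (tw b q))" "inc (tw b q') = inc (tw b q)" "prj (tw b q') = prj (tw b q)"
    by (simp_all add: twisted_extension_def)
  have j: "jacobson_s (total (tw b q')) = jacobson_s (total (tw b q))"
  proof -
    have "ad_pencil (total (tw b q')) = ad_pencil (total (tw b q))"
      by (intro ext) (simp only: ad_pencil_def e)
    then show ?thesis by (intro ext) (simp only: jacobson_s_def e)
  qed
  have p: "W \<in> part (total (tw b q)) 0 \<Longrightarrow> pmap (total (tw b q')) W = pmap (total (tw b q)) W" for W
    using assms(2) by (auto simp: tw_simps)
  interpret V: graded_space "total (tw b q)" by (rule graded_tw)
  let ?V = "total (tw b q)" and ?V' = "total (tw b q')"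
  have r: "restricted_lie_superalgebra ?V" "rlsa_hom M ?V (inc (tw b q))" "rlsa_hom ?V g (prj (tw b q))"
    and rest: "inj (inc (tw b q))" "surj (prj (tw b q))" "range (inc (tw b q)) = {e. prj (tw b q) e = 0}"
      "\<forall>e m. br ?V e (inc (tw b q) m) = inc (tw b q) (act (prj (tw b q) e) m)"
    using assms(1) unfolding restricted_extension_def by blast+
  have lie: "lie_superalgebra ?V' \<longleftrightarrow> lie_superalgebra ?V"
    by (simp only: lie_superalgebra_def super_space_def even_bilinear_def e)
  have lin: "even_linear M ?V' h \<longleftrightarrow> even_linear M ?V h" "even_linear ?V' g h' \<longleftrightarrow> even_linear ?V g h'" for h h'
    by (simp_all only: even_linear_def e)
  have L: "lie_superalgebra ?V" "\<And>x. x \<in> part ?V 0 \<Longrightarrow> pmap ?V x \<in> part ?V 0"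
    "\<And>c x. x \<in> part ?V 0 \<Longrightarrow> pmap ?V (smul ?V c x) = smul ?V (c ^ CHAR('k)) (pmap ?V x)"
    "\<And>x y. x \<in> part ?V 0 \<Longrightarrow> br ?V (pmap ?V x) y = (br ?V x ^^ CHAR('k)) y"
    "\<And>x y. x \<in> part ?V 0 \<Longrightarrow> y \<in> part ?V 0 \<Longrightarrow> pmap ?V (x + y) = pmap ?V x + pmap ?V y + (\<Sum>i = 1..CHAR('k) - 1. jacobson_s ?V i x y)"
    using r(1) unfolding restricted_lie_superalgebra_def by blast+
  have "restricted_lie_superalgebra ?V'"
    unfolding restricted_lie_superalgebra_def lie j e
    by (intro conjI ballI allI L(1)) (simp_all only: p V.part_scale V.part_add L(2-5))
  moreover have "rlsa_hom M ?V' (inc (tw b q'))"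
    using r(2) unfolding rlsa_hom_def lin e by (simp add: p even_linear_def)
  moreover have "rlsa_hom ?V' g (prj (tw b q'))"
    using r(3) unfolding rlsa_hom_def lin e by (simp add: p)
  ultimately show ?thesis unfolding restricted_extension_def e using rest by blast
qed

text \<open>Apply \<open>descent\<close> to the zero cocycle with m = h; invariance of the values of
  \<open>h\<close> is its hypothesis on commutators. The resulting d1 c lives on u(g), and its
  extension is the twist by \<open>h\<close> because c vanishes on \<open>g\<close> and has values
  \<open>h\<close> at the z_x.\<close>

lemma restricted_semilinear_twist:
  assumes m: "\<And>x. x \<in> part g 0 \<Longrightarrow> h x \<in> even_invariants M act"
    and semi: "\<And>a x y. x \<in> part g 0 \<Longrightarrow> y \<in> part g 0 \<Longrightarrow> h (smul g a x + y) = smul M (a ^ CHAR('k)) (h x) + h y"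
  shows "restricted_extension g M act (tw (\<lambda>x y. 0) (\<lambda>x. - h x))" "\<exists>f. cocycle2 Ju f \<and> bounds f h"
proof -
  have h1: "h x \<in> part M 0" if "x \<in> part g 0" for x
    using m[OF that] unfolding even_invariants_def by blast
  have h2: "0 - 0 = act y (h x)" if "x \<in> part g 0" for x y
  proof -
    have "act y (h x) = 0" using m[OF that] unfolding even_invariants_def by blast
    then show ?thesis by (simp only: diff_self)
  qed
  have ex: "\<exists>c. cochain1 JU c \<and> (\<forall>x. c (free_gen x) = 0) \<and> (\<forall>x\<in>part g 0. c (zd x) = h x) \<and> cocycle2 Ju (\<lambda>a b. 0 + d1 c a b)"
    by (rule descent[of "\<lambda>a b. 0" h, OF cocycle2_zero]) (fact h1, fact semi, fact h2)
  obtain c where c: "cochain1 JU c" "\<And>x. c (free_gen x) = 0" "\<And>x. x \<in> part g 0 \<Longrightarrow> c (zd x) = h x"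
    "cocycle2 Ju (\<lambda>a b. 0 + d1 c a b)" using ex by blast
  have d: "cocycle2 Ju (d1 c)" using c(4) by simp
  then show "\<exists>f. cocycle2 Ju f \<and> bounds f h" unfolding bounds_def
    by (intro exI[of _ "d1 c"] exI[of _ c] conjI ballI c refl)
  have dU: "cochain2 JU (d1 c)" by (rule cocycle2D(1)[OF f_JU[OF d]])
  have "bf (d1 c) x y = 0" for x y
  proof (rule bilinear_eqI[of "bf (d1 c)" "\<lambda>x y. 0", OF bf_bilinear[OF dU]])
    show "even_bilinear g g M (\<lambda>x y. 0)" unfolding even_bilinear_def by (intro conjI allI ballI klinear_const_zero gvec mvec M.part_0)
    show "bf (d1 c) x y = 0" if "x \<in> part g i" "y \<in> part g j" for i j x y
    proof -
      have "d1 c (free_gen x) (free_gen y) - ksign i j (d1 c (free_gen y) (free_gen x)) + 0 = act x 0 - ksign i j (act y 0)"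
        using lie_bound_d1[OF c(1)] that unfolding lie_bound_def c(2) by blast
      then have "d1 c (free_gen x) (free_gen y) - ksign i j (d1 c (free_gen y) (free_gen x)) = 0"
        by (simp only: act_simps ksign_simps add_0_right diff_self)
      then show ?thesis unfolding bf_def gen2_swap_homogeneous[OF dU that(2,1)] gen2_def ksign_commute[of j i] .
    qed
  qed
  then have b0: "bf (d1 c) = (\<lambda>x y. 0)" by (intro ext)
  have q0: "qf (d1 c) x = - h x" if "x \<in> part g 0" for x
  proof -
    have "h x = c (free_gen x ^ CHAR('k))"
      using c(3)[OF that] unfolding zd_def klinear_diff[OF cochain1D(1)[OF c(1)]] c(2) by (simp only: diff_zero)
    also have "\<dots> = - qf (d1 c) x"
      unfolding cochain1_zd[OF c(1)] c(2) qf_def by (simp only: fa_right_simps diff_0)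
    finally show ?thesis by (simp only: minus_minus)
  qed
  show "restricted_extension g M act (tw (\<lambda>x y. 0) (\<lambda>x. - h x))"
    by (rule restricted_extension_cong[OF restricted_extension_cocycle[OF d, unfolded b0] q0])
qed

end

section \<open>Quotient modules\<close>

lemma scalars_simps:
  "carrier (ring_of_type_algebra :: 'k::field ring) = UNIV" "x \<otimes>\<^bsub>ring_of_type_algebra\<^esub> y = x * y"
  "x \<oplus>\<^bsub>ring_of_type_algebra\<^esub> y = x + y" "\<one>\<^bsub>ring_of_type_algebra\<^esub> = 1"
  by (simp_all add: ring_of_type_algebra_def)

lemma quot_module_simps:
  "carrier (quot_module V B) = a_rcosets\<^bsub>V\<^esub> B" "monoid.mult (quot_module V B) = rcoset_mult V B"
  "monoid.one (quot_module V B) = B +>\<^bsub>V\<^esub> \<one>\<^bsub>V\<^esub>" "ring.zero (quot_module V B) = B" "ring.add (quot_module V B) = set_add V"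
  "c \<odot>\<^bsub>quot_module V B\<^esub> C = (\<Union>x\<in>C. B +>\<^bsub>V\<^esub> (c \<odot>\<^bsub>V\<^esub> x))"
  by (simp_all add: quot_module_def FactRing_def ring.defs module.defs)

lemma a_r_coset_eq: "B +>\<^bsub>V\<^esub> v = (\<lambda>b. b \<oplus>\<^bsub>V\<^esub> v) ` B"
  by (auto simp: a_r_coset_def r_coset_def)

lemma set_add_eq: "set_add V C D = {c \<oplus>\<^bsub>V\<^esub> d | c d. c \<in> C \<and> d \<in> D}"
  by (auto simp: set_add_def set_mult_def)

lemma a_rcosets_eq: "a_rcosets\<^bsub>V\<^esub> B = (\<lambda>v. B +>\<^bsub>V\<^esub> v) ` carrier V"
  by (auto simp: A_RCOSETS_def RCOSETS_def a_r_coset_def)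

lemma module_of_param:
  fixes N :: "('k::field, 'v, 'z) module_scheme" and h :: "'c::ab_group_add \<Rightarrow> 'v"
  assumes "vector_space s" "module.subspace s Z" and carrier: "carrier N = h ` Z"
    and add: "\<And>c d. c \<in> Z \<Longrightarrow> d \<in> Z \<Longrightarrow> h c \<oplus>\<^bsub>N\<^esub> h d = h (c + d)"
    and smult: "\<And>k c. c \<in> Z \<Longrightarrow> k \<odot>\<^bsub>N\<^esub> h c = h (s k c)" and zero: "\<zero>\<^bsub>N\<^esub> = h 0"
  shows "Module.module ring_of_type_algebra N"
proof -
  interpret vector_space s by fact
  note Z = subspace_0[OF assms(2)] subspace_add[OF assms(2)] subspace_scale[OF assms(2)] subspace_neg[OF assms(2)]
  show ?thesis
  proof (rule Module.moduleI)
    show "cring (ring_of_type_algebra :: 'k ring)" by (rule cring_from_type_algebra)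
    show "abelian_group N"
    proof (rule abelian_groupI)
      fix x assume "x \<in> carrier N"
      then obtain c where "c \<in> Z" "x = h c" using carrier by auto
      then show "\<exists>y\<in>carrier N. y \<oplus>\<^bsub>N\<^esub> x = \<zero>\<^bsub>N\<^esub>"
        using Z(4)[of c] by (intro bexI[of _ "h (- c)"]) (simp_all add: carrier add zero)
    qed (auto simp: carrier add zero Z add.assoc intro!: arg_cong[where f = h])
  qed (auto simp: carrier scalars_simps smult add Z scale_left_distrib scale_right_distrib)
qed

text \<open>\<open>V\<close> is the injective image under \<open>h\<close> of a subspace
  \<open>Z\<close> of a type-class vector space, so the quotient by the image of \<open>B\<close> is
  computed with \<open>Z\<close> and \<open>B\<close> alone. It is used for cohomology, with
  cocycles and coboundaries on the free algebra.\<close>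

locale param_quot =
  fixes V :: "('k::field, 'v, 'z) module_scheme" and h :: "'c::ab_group_add \<Rightarrow> 'v" and s :: "'k \<Rightarrow> 'c \<Rightarrow> 'c" and Z B :: "'c set"
  assumes vector_space_s: "vector_space s" and Z: "module.subspace s Z" and B: "module.subspace s B" and BZ: "B \<subseteq> Z"
    and carrier: "carrier V = h ` Z" and inj: "inj_on h Z"
    and add: "\<And>c d. c \<in> Z \<Longrightarrow> d \<in> Z \<Longrightarrow> h c \<oplus>\<^bsub>V\<^esub> h d = h (c + d)"
    and smult: "\<And>k c. c \<in> Z \<Longrightarrow> k \<odot>\<^bsub>V\<^esub> h c = h (s k c)"
begin

sublocale s: vector_space s by (rule vector_space_s)

lemma Z_closed: "0 \<in> Z" "c \<in> Z \<Longrightarrow> d \<in> Z \<Longrightarrow> c + d \<in> Z" "c \<in> Z \<Longrightarrow> s k c \<in> Z" "c \<in> Z \<Longrightarrow> d \<in> Z \<Longrightarrow> c - d \<in> Z"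
  using s.subspace_0[OF Z] s.subspace_add[OF Z] s.subspace_scale[OF Z] s.subspace_diff[OF Z] by auto

lemma B_closed: "0 \<in> B" "c \<in> B \<Longrightarrow> d \<in> B \<Longrightarrow> c + d \<in> B" "c \<in> B \<Longrightarrow> s k c \<in> B" "c \<in> B \<Longrightarrow> d \<in> B \<Longrightarrow> c - d \<in> B" "c \<in> B \<Longrightarrow> - c \<in> B"
  using s.subspace_0[OF B] s.subspace_add[OF B] s.subspace_scale[OF B] s.subspace_diff[OF B] s.subspace_neg[OF B] by auto

definition cls :: "'c \<Rightarrow> 'v set" where "cls c = h ` B +>\<^bsub>V\<^esub> h c"

definition Q :: "('k, 'v set) module" where "Q = quot_module V (h ` B)"

lemma cls_eq: "c \<in> Z \<Longrightarrow> cls c = h ` {d \<in> Z. d - c \<in> B}"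
proof -
  assume c: "c \<in> Z"
  have "cls c = (\<lambda>b. h (b + c)) ` B"
    unfolding cls_def a_r_coset_eq image_image using c BZ by (intro image_cong) (auto simp: add)
  also have "\<dots> = h ` {d \<in> Z. d - c \<in> B}"
  proof -
    have "{d \<in> Z. d - c \<in> B} = (\<lambda>b. b + c) ` B"
      using c BZ Z_closed(2) by (auto simp: image_iff intro!: bexI[of _ "_ - c"]) 
    then show ?thesis by (simp add: image_image)
  qed
  finally show ?thesis .
qed

lemma mem_cls_iff: "c \<in> Z \<Longrightarrow> v \<in> cls c \<longleftrightarrow> (\<exists>d\<in>Z. v = h d \<and> d - c \<in> B)"
  by (auto simp: cls_eq)

lemma cls_eq_iff: "c \<in> Z \<Longrightarrow> d \<in> Z \<Longrightarrow> cls c = cls d \<longleftrightarrow> c - d \<in> B"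
proof
  assume *: "c \<in> Z" "d \<in> Z"
  { assume "cls c = cls d"
    then have "h c \<in> cls d" using mem_cls_iff[of c "h c"] * B_closed(1) by auto
    then show "c - d \<in> B" using inj * by (auto simp: mem_cls_iff inj_on_eq_iff) }
  { assume cd: "c - d \<in> B"
    have "e - c \<in> B \<longleftrightarrow> e - d \<in> B" for e
      using B_closed(2)[OF _ cd, of "e - c"] B_closed(4)[OF _ cd, of "e - d"] by auto
    then show "cls c = cls d" using * by (simp add: cls_eq) }
qed

lemma carrier_Q: "carrier Q = cls ` Z"
  by (simp add: Q_def quot_module_simps a_rcosets_eq carrier image_image cls_def)

lemma cls_zero: "\<zero>\<^bsub>Q\<^esub> = cls 0"
proof -
  have "{d \<in> Z. d - 0 \<in> B} = B" using BZ by auto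
  then show ?thesis by (simp add: cls_eq Z_closed Q_def quot_module_simps)
qed

lemma cls_add: "c \<in> Z \<Longrightarrow> d \<in> Z \<Longrightarrow> cls c \<oplus>\<^bsub>Q\<^esub> cls d = cls (c + d)"
proof -
  assume *: "c \<in> Z" "d \<in> Z"
  have "{d' \<in> Z. d' - (c + d) \<in> B} = {c' + d' | c' d'. c' \<in> Z \<and> c' - c \<in> B \<and> d' \<in> Z \<and> d' - d \<in> B}" (is "?l = ?r")
  proof (intro equalityI subsetI)
    fix e assume "e \<in> ?l"
    then have "e = (e - d) + d" "e - d \<in> Z" "(e - d) - c \<in> B" "d - d \<in> B" using * Z_closed B_closed(1) by (auto simp: algebra_simps)
    then show "e \<in> ?r" using * by blast
  next
    fix e assume "e \<in> ?r"
    then obtain c' d' where e: "e = c' + d'" "c' \<in> Z" "c' - c \<in> B" "d' \<in> Z" "d' - d \<in> B" by blast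
    then have "(c' - c) + (d' - d) \<in> B" by (intro B_closed(2))
    then show "e \<in> ?l" using e Z_closed(2) by (simp add: algebra_simps)
  qed
  moreover have "set_add V (cls c) (cls d) = h ` {c' + d' | c' d'. c' \<in> Z \<and> c' - c \<in> B \<and> d' \<in> Z \<and> d' - d \<in> B}"
    unfolding set_add_eq cls_eq[OF *(1)] cls_eq[OF *(2)]
  proof (intro equalityI subsetI)
    fix v assume "v \<in> {u \<oplus>\<^bsub>V\<^esub> w | u w. u \<in> h ` {d \<in> Z. d - c \<in> B} \<and> w \<in> h ` {e \<in> Z. e - d \<in> B}}"
    then obtain c' d' where cd: "v = h c' \<oplus>\<^bsub>V\<^esub> h d'" "c' \<in> Z" "c' - c \<in> B" "d' \<in> Z" "d' - d \<in> B" by blast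
    show "v \<in> h ` {c' + d' | c' d'. c' \<in> Z \<and> c' - c \<in> B \<and> d' \<in> Z \<and> d' - d \<in> B}"
    proof (rule image_eqI[of _ h "c' + d'"])
      show "v = h (c' + d')" by (simp only: cd add)
      show "c' + d' \<in> {c' + d' | c' d'. c' \<in> Z \<and> c' - c \<in> B \<and> d' \<in> Z \<and> d' - d \<in> B}" using cd(2-5) by blast
    qed
  next
    fix v assume "v \<in> h ` {c' + d' | c' d'. c' \<in> Z \<and> c' - c \<in> B \<and> d' \<in> Z \<and> d' - d \<in> B}"
    then obtain c' d' where cd: "v = h (c' + d')" "c' \<in> Z" "c' - c \<in> B" "d' \<in> Z" "d' - d \<in> B" by blast
    show "v \<in> {u \<oplus>\<^bsub>V\<^esub> w | u w. u \<in> h ` {d \<in> Z. d - c \<in> B} \<and> w \<in> h ` {e \<in> Z. e - d \<in> B}}"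
    proof (rule CollectI, rule exI[of _ "h c'"], rule exI[of _ "h d'"], intro conjI)
      show "v = h c' \<oplus>\<^bsub>V\<^esub> h d'" unfolding add[OF cd(2,4)] by (rule cd(1))
      show "h c' \<in> h ` {d \<in> Z. d - c \<in> B}" using cd(2,3) by blast
      show "h d' \<in> h ` {e \<in> Z. e - d \<in> B}" using cd(4,5) by blast
    qed
  qed
  ultimately show ?thesis using cls_eq[OF Z_closed(2)[OF *]] by (simp add: Q_def quot_module_simps)
qed

text \<open>Maps on classes are defined as unions over all representatives. If every representative
  yields \<open>C\<close>, so does the union, the class being nonempty.\<close>

lemma union_cls:
  assumes "c \<in> Z" "\<And>d. d \<in> Z \<Longrightarrow> d - c \<in> B \<Longrightarrow> F (h d) = C"
  shows "(\<Union>v\<in>cls c. F v) = C"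
  using assms B_closed(1) by (auto simp: cls_eq)

lemma cls_smult: "c \<in> Z \<Longrightarrow> k \<odot>\<^bsub>Q\<^esub> cls c = cls (s k c)"
proof -
  assume c: "c \<in> Z"
  have "(\<Union>v\<in>cls c. h ` B +>\<^bsub>V\<^esub> (k \<odot>\<^bsub>V\<^esub> v)) = cls (s k c)"
  proof (rule union_cls[OF c])
    fix d assume d: "d \<in> Z" "d - c \<in> B"
    then have "s k d - s k c \<in> B" using B_closed(3)[OF d(2), of k] by (simp add: s.scale_right_diff_distrib)
    then have "cls (s k d) = cls (s k c)" using cls_eq_iff Z_closed(3) d(1) c by blast
    then show "h ` B +>\<^bsub>V\<^esub> (k \<odot>\<^bsub>V\<^esub> h d) = cls (s k c)" by (simp add: smult d cls_def)
  qed
  then show ?thesis by (simp add: Q_def quot_module_simps)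
qed

lemma module_Q: "Module.module ring_of_type_algebra Q"
  by (rule module_of_param[OF vector_space_s Z carrier_Q cls_add cls_smult cls_zero])

lemma linear_map_Q:
  assumes "\<And>c. c \<in> Z \<Longrightarrow> \<Theta> (cls c) = T c" "\<And>c. c \<in> Z \<Longrightarrow> T c \<in> carrier W"
    "\<And>c d. c \<in> Z \<Longrightarrow> d \<in> Z \<Longrightarrow> T (c + d) = T c \<oplus>\<^bsub>W\<^esub> T d" "\<And>k c. c \<in> Z \<Longrightarrow> T (s k c) = k \<odot>\<^bsub>W\<^esub> T c"
  shows "\<Theta> \<in> linear_maps Q W"
  using assms Z_closed by (auto simp: linear_maps_def carrier_Q cls_add cls_smult)

lemma kernel_Q:
  assumes "\<And>c. c \<in> Z \<Longrightarrow> \<Theta> (cls c) = T c"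
  shows "a_kernel Q W \<Theta> = cls ` {c \<in> Z. T c = \<zero>\<^bsub>W\<^esub>}"
  using assms by (auto simp: a_kernel_def kernel_def carrier_Q)

end

lemma fun_module_simps:
  "carrier (fun_module D W F) = F" "\<zero>\<^bsub>fun_module D W F\<^esub> = (\<lambda>d\<in>D. \<zero>\<^bsub>W\<^esub>)"
  "f \<oplus>\<^bsub>fun_module D W F\<^esub> f' = (\<lambda>d\<in>D. f d \<oplus>\<^bsub>W\<^esub> f' d)" "c \<odot>\<^bsub>fun_module D W F\<^esub> f = (\<lambda>d\<in>D. c \<odot>\<^bsub>W\<^esub> f d)"
  by (simp_all add: fun_module_def)

lemma vec_module_simps:
  "carrier (vec_module s W) = W" "\<zero>\<^bsub>vec_module s W\<^esub> = 0" "x \<oplus>\<^bsub>vec_module s W\<^esub> y = x + y" "c \<odot>\<^bsub>vec_module s W\<^esub> x = s c x"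
  by (simp_all add: vec_module_def)

lemma module_vec_module:
  assumes "vector_space s" "module.subspace s W"
  shows "Module.module ring_of_type_algebra (vec_module s W)"
  by (rule module_of_param[OF assms, of _ "\<lambda>x. x"]) (simp_all add: vec_module_simps)

lemma module_semilinear_maps:
  fixes V :: "('k::field, 'v, 'y) module_scheme" and W :: "('k, 'w, 'z) module_scheme"
  assumes W: "Module.module ring_of_type_algebra W"
    and V: "\<And>c v w. v \<in> carrier V \<Longrightarrow> w \<in> carrier V \<Longrightarrow> (c \<odot>\<^bsub>V\<^esub> v) \<oplus>\<^bsub>V\<^esub> w \<in> carrier V"
  shows "Module.module ring_of_type_algebra (semilinear_maps V W)"
proof -
  interpret W: Module.module ring_of_type_algebra W by (rule W)
  let ?S = "semilinear_maps V W"
  note ss = semilinear_maps_def fun_module_simps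
  note sc = W.smult_closed[unfolded scalars_simps, OF UNIV_I]
  have S_closed: "f d \<in> carrier W" if "f \<in> carrier ?S" "d \<in> carrier V" for f d using that by (auto simp: ss)
  have S_ext: "f = g" if "f \<in> carrier ?S" "g \<in> carrier ?S" "\<And>d. d \<in> carrier V \<Longrightarrow> f d = g d" for f g
    using that by (auto simp: ss intro: PiE_ext)
  have eq: "f ((c \<odot>\<^bsub>V\<^esub> v) \<oplus>\<^bsub>V\<^esub> w) = (c ^ CHAR('k) \<odot>\<^bsub>W\<^esub> f v) \<oplus>\<^bsub>W\<^esub> f w"
    if "f \<in> carrier ?S" "v \<in> carrier V" "w \<in> carrier V" for f c v w using that by (auto simp: ss)
  have addc: "f \<oplus>\<^bsub>?S\<^esub> g \<in> carrier ?S" if f: "f \<in> carrier ?S" and g: "g \<in> carrier ?S" for f g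
  proof -
    have "(f ((c \<odot>\<^bsub>V\<^esub> v) \<oplus>\<^bsub>V\<^esub> w)) \<oplus>\<^bsub>W\<^esub> (g ((c \<odot>\<^bsub>V\<^esub> v) \<oplus>\<^bsub>V\<^esub> w))
       = (c ^ CHAR('k) \<odot>\<^bsub>W\<^esub> (f v \<oplus>\<^bsub>W\<^esub> g v)) \<oplus>\<^bsub>W\<^esub> (f w \<oplus>\<^bsub>W\<^esub> g w)" if "v \<in> carrier V" "w \<in> carrier V" for c v w
      unfolding eq[OF f that] eq[OF g that]
      using S_closed[OF f that(1)] S_closed[OF g that(1)] S_closed[OF f that(2)] S_closed[OF g that(2)]
      by (simp add: W.smult_r_distr scalars_simps sc W.M.add.m_ac)
    then show ?thesis using S_closed[OF f] S_closed[OF g] by (simp add: ss V)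
  qed
  have smultc: "a \<odot>\<^bsub>?S\<^esub> f \<in> carrier ?S" if f: "f \<in> carrier ?S" for a f
  proof -
    have "a \<odot>\<^bsub>W\<^esub> f ((c \<odot>\<^bsub>V\<^esub> v) \<oplus>\<^bsub>V\<^esub> w) = (c ^ CHAR('k) \<odot>\<^bsub>W\<^esub> (a \<odot>\<^bsub>W\<^esub> f v)) \<oplus>\<^bsub>W\<^esub> (a \<odot>\<^bsub>W\<^esub> f w)"
      if "v \<in> carrier V" "w \<in> carrier V" for c v w
      unfolding eq[OF f that] using S_closed[OF f that(1)] S_closed[OF f that(2)]
      by (simp add: W.smult_r_distr scalars_simps sc mult.commute flip: W.smult_assoc1[unfolded scalars_simps, OF UNIV_I UNIV_I])
    then show ?thesis using S_closed[OF f] by (simp add: ss V sc)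
  qed
  have zeroc: "\<zero>\<^bsub>?S\<^esub> \<in> carrier ?S" by (simp add: ss V scalars_simps)
  show ?thesis
  proof (rule Module.moduleI)
    show "cring (ring_of_type_algebra :: 'k ring)" by (rule cring_from_type_algebra)
    show "abelian_group ?S"
    proof (rule abelian_groupI)
      fix f assume f: "f \<in> carrier ?S"
      show "\<exists>g\<in>carrier ?S. g \<oplus>\<^bsub>?S\<^esub> f = \<zero>\<^bsub>?S\<^esub>"
      proof (rule bexI[of _ "(- 1) \<odot>\<^bsub>?S\<^esub> f"])
        have "((- 1) \<odot>\<^bsub>W\<^esub> f d) \<oplus>\<^bsub>W\<^esub> f d = \<zero>\<^bsub>W\<^esub>" if "d \<in> carrier V" for d
          using W.smult_l_distr[unfolded scalars_simps, OF UNIV_I UNIV_I S_closed[OF f that], of "- 1" 1]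
            W.smult_one[unfolded scalars_simps, OF S_closed[OF f that]] W.smult_l_null[OF S_closed[OF f that]]
          by (simp add: ring_of_type_algebra_def)
        then show "((- 1) \<odot>\<^bsub>?S\<^esub> f) \<oplus>\<^bsub>?S\<^esub> f = \<zero>\<^bsub>?S\<^esub>" by (intro S_ext addc smultc f zeroc) (simp add: ss)
      qed (rule smultc[OF f])
    next
      fix f g k assume *: "f \<in> carrier ?S" "g \<in> carrier ?S" "k \<in> carrier ?S"
      show "(f \<oplus>\<^bsub>?S\<^esub> g) \<oplus>\<^bsub>?S\<^esub> k = f \<oplus>\<^bsub>?S\<^esub> (g \<oplus>\<^bsub>?S\<^esub> k)"
        by (rule S_ext[OF addc[OF addc[OF *(1,2)] *(3)] addc[OF *(1) addc[OF *(2,3)]]])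
          (use S_closed[OF *(1)] S_closed[OF *(2)] S_closed[OF *(3)] in \<open>simp add: semilinear_maps_def fun_module_simps(3) W.M.add.m_assoc\<close>)
    next
      fix f g assume *: "f \<in> carrier ?S" "g \<in> carrier ?S"
      show "f \<oplus>\<^bsub>?S\<^esub> g = g \<oplus>\<^bsub>?S\<^esub> f"
        by (rule S_ext[OF addc[OF *] addc[OF *(2,1)]])
          (use S_closed[OF *(1)] S_closed[OF *(2)] in \<open>simp add: semilinear_maps_def fun_module_simps(3) W.M.add.m_comm\<close>)
    next
      fix f assume f: "f \<in> carrier ?S"
      show "\<zero>\<^bsub>?S\<^esub> \<oplus>\<^bsub>?S\<^esub> f = f"
        by (rule S_ext[OF addc[OF zeroc f] f]) (use S_closed[OF f] in \<open>simp add: semilinear_maps_def fun_module_simps(2,3)\<close>)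
    qed (fact addc, fact zeroc)
  next
    fix a b f g assume f: "f \<in> carrier ?S" and g: "g \<in> carrier ?S"
    note cl = S_closed[OF f] S_closed[OF g]
    show "a \<odot>\<^bsub>?S\<^esub> f \<in> carrier ?S" by (rule smultc[OF f])
    show "(a \<oplus>\<^bsub>ring_of_type_algebra\<^esub> b) \<odot>\<^bsub>?S\<^esub> f = (a \<odot>\<^bsub>?S\<^esub> f) \<oplus>\<^bsub>?S\<^esub> (b \<odot>\<^bsub>?S\<^esub> f)"
      by (rule S_ext[OF smultc[OF f] addc[OF smultc[OF f] smultc[OF f]]])
        (use cl in \<open>simp add: semilinear_maps_def fun_module_simps(3,4) W.smult_l_distr scalars_simps(1)\<close>)
    show "a \<odot>\<^bsub>?S\<^esub> (f \<oplus>\<^bsub>?S\<^esub> g) = (a \<odot>\<^bsub>?S\<^esub> f) \<oplus>\<^bsub>?S\<^esub> (a \<odot>\<^bsub>?S\<^esub> g)"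
      by (rule S_ext[OF smultc[OF addc[OF f g]] addc[OF smultc[OF f] smultc[OF g]]])
        (use cl in \<open>simp add: semilinear_maps_def fun_module_simps(3,4) W.smult_r_distr scalars_simps(1)\<close>)
    show "(a \<otimes>\<^bsub>ring_of_type_algebra\<^esub> b) \<odot>\<^bsub>?S\<^esub> f = a \<odot>\<^bsub>?S\<^esub> (b \<odot>\<^bsub>?S\<^esub> f)"
      by (rule S_ext[OF smultc[OF f] smultc[OF smultc[OF f]]])
        (use cl in \<open>simp add: semilinear_maps_def fun_module_simps(3,4) W.smult_assoc1 scalars_simps(1)\<close>)
    show "\<one>\<^bsub>ring_of_type_algebra\<^esub> \<odot>\<^bsub>?S\<^esub> f = f"
      by (rule S_ext[OF smultc[OF f] f]) (use cl in \<open>simp add: semilinear_maps_def fun_module_simps(4) W.smult_one\<close>)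
  qed
qed

section \<open>Presentations of algebras\<close>

locale presented =
  fixes A :: "('k::field, 'a, 'z) module_scheme" and \<pi> :: "('k, 'g) free_alg \<Rightarrow> 'a" and J :: "('k, 'g) free_alg set"
  assumes carrier: "carrier A = range \<pi>" and kernel: "\<pi> a = \<pi> b \<longleftrightarrow> a - b \<in> J"
    and add: "\<pi> a \<oplus>\<^bsub>A\<^esub> \<pi> b = \<pi> (a + b)" and mult: "\<pi> a \<otimes>\<^bsub>A\<^esub> \<pi> b = \<pi> (a * b)"
    and pi_zero: "\<zero>\<^bsub>A\<^esub> = \<pi> 0" and one: "\<one>\<^bsub>A\<^esub> = \<pi> 1" and smult: "c \<odot>\<^bsub>A\<^esub> \<pi> a = \<pi> (free_scal c a)"
begin

lemma ring_A: "ring A"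
proof (rule ringI)
  show "abelian_group A"
  proof (rule abelian_groupI)
    fix x assume "x \<in> carrier A"
    then obtain a where "x = \<pi> a" using carrier by auto
    then show "\<exists>y\<in>carrier A. y \<oplus>\<^bsub>A\<^esub> x = \<zero>\<^bsub>A\<^esub>" by (intro bexI[of _ "\<pi> (- a)"]) (simp_all add: carrier add pi_zero)
  qed (auto simp: carrier add pi_zero add.assoc intro!: arg_cong[where f = \<pi>])
  show "Group.monoid A" by (rule monoidI) (auto simp: carrier mult one mult.assoc)
qed (auto simp: carrier add mult distrib_left distrib_right)

lemma mem_kernel: "a \<in> J \<longleftrightarrow> \<pi> a = \<pi> 0"
  using kernel[of a 0] by simp

lemma two_sided_J: "two_sided J"
  unfolding two_sided_def
proof (intro conjI ballI allI)
  have p: "\<pi> (a + b) = \<pi> (a' + b')" "\<pi> (a * b) = \<pi> (a' * b')" if "\<pi> a = \<pi> a'" "\<pi> b = \<pi> b'" for a b a' b'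
    using that add mult by metis+
  show "0 \<in> J" by (simp add: mem_kernel)
  show "a + b \<in> J" if "a \<in> J" "b \<in> J" for a b using p(1)[of a 0 b 0] that by (simp add: mem_kernel)
  show "a * b \<in> J" "b * a \<in> J" if "a \<in> J" for a b using p(2)[of a 0 b b] p(2)[of b b a 0] that by (simp_all add: mem_kernel)
qed

lemma minus: "\<ominus>\<^bsub>A\<^esub> \<pi> a = \<pi> (- a)"
proof -
  interpret ring A by (rule ring_A)
  show ?thesis by (rule minus_equality) (simp_all add: carrier add pi_zero)
qed

lemma power: "\<pi> a [^]\<^bsub>A\<^esub> (n :: nat) = \<pi> (a ^ n)"
proof (induction n)
  case 0 show ?case by (simp add: one)
next
  case (Suc n) 
  have "\<pi> a [^]\<^bsub>A\<^esub> Suc n = \<pi> a [^]\<^bsub>A\<^esub> n \<otimes>\<^bsub>A\<^esub> \<pi> a" by (simp add: nat_pow_def)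
  then show ?case using Suc by (simp add: mult power_commutes)
qed

lemma ideal_image:
  assumes "two_sided T" shows "ideal (\<pi> ` T) A"
proof (rule idealI[OF ring_A])
  interpret ring A by (rule ring_A)
  show "subgroup (\<pi> ` T) (add_monoid A)"
  proof (rule group.subgroupI)
    show "Group.group (add_monoid A)" by (rule add.is_group)
    show "inv\<^bsub>add_monoid A\<^esub> a \<in> \<pi> ` T" if "a \<in> \<pi> ` T" for a
      using that minus two_sidedD(5)[OF assms] unfolding a_inv_def by auto
  qed (use carrier add two_sidedD(1,2)[OF assms] in auto)
qed (use carrier mult two_sidedD(3,4)[OF assms] in auto)

lemma two_sided_preimage:
  assumes "ideal I A" shows "two_sided {a. \<pi> a \<in> I}"
proof -
  interpret ideal I A by (rule assms)
  show ?thesis unfolding two_sided_def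
    using a_closed I_l_closed I_r_closed additive_subgroup.zero_closed[OF ideal.axioms(1)[OF assms]] carrier by (auto simp: add[symmetric] mult[symmetric] pi_zero[symmetric])
qed

text \<open>Ideals of the quotient correspond to ideals of the free algebra that contain
  \<open>J\<close>.\<close>

lemma genideal_image: "Idl\<^bsub>A\<^esub> (\<pi> ` S) = \<pi> ` gen_ideal (S \<union> J)"
proof
  have "J \<union> S \<subseteq> gen_ideal (S \<union> J)" using gen_ideal_superset[of "S \<union> J"] by auto
  then show "Idl\<^bsub>A\<^esub> (\<pi> ` S) \<subseteq> \<pi> ` gen_ideal (S \<union> J)"
    unfolding genideal_def using ideal_image[OF two_sided_gen_ideal, of "S \<union> J"] by (intro Inter_lower) auto
  show "\<pi> ` gen_ideal (S \<union> J) \<subseteq> Idl\<^bsub>A\<^esub> (\<pi> ` S)"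
    unfolding genideal_def
  proof (rule Inter_greatest)
    fix I assume "I \<in> {I. ideal I A \<and> \<pi> ` S \<subseteq> I}"
    then have I: "ideal I A" "\<pi> ` S \<subseteq> I" by auto
    interpret ideal I A by (rule I(1))
    have "\<pi> a \<in> I" if "a \<in> J" for a using that additive_subgroup.zero_closed[OF ideal.axioms(1)[OF I(1)]] unfolding mem_kernel pi_zero by simp
    then have "gen_ideal (S \<union> J) \<subseteq> {a. \<pi> a \<in> I}" using I(2) by (intro gen_ideal_minimal two_sided_preimage[OF I(1)]) auto
    then show "\<pi> ` gen_ideal (S \<union> J) \<subseteq> I" by auto
  qed
qed

text \<open>A quotient of a quotient is again presented, by the larger ideal. This applies to U(g)
  over the free algebra and then to u(g) over U(g).\<close>

lemma presented_quotient:
  assumes T: "two_sided T" "J \<subseteq> T"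
  shows "presented (quot_module A (\<pi> ` T)) (\<lambda>a. \<pi> ` T +>\<^bsub>A\<^esub> \<pi> a) T"
proof -
  let ?c = "\<lambda>a. \<pi> ` T +>\<^bsub>A\<^esub> \<pi> a" and ?A = "quot_module A (\<pi> ` T)"
  have c: "?c a = \<pi> ` {b. b - a \<in> T}" for a
  proof -
    have "?c a = \<pi> ` ((\<lambda>t. t + a) ` T)" unfolding a_r_coset_eq image_image by (simp add: add)
    also have "(\<lambda>t. t + a) ` T = {b. b - a \<in> T}" by (auto simp: image_iff intro!: bexI[of _ "_ - a"])
    finally show ?thesis .
  qed
  have mem: "\<pi> b \<in> ?c a \<longleftrightarrow> b - a \<in> T" for a b
  proof
    assume "\<pi> b \<in> ?c a"
    then obtain b' where "\<pi> b = \<pi> b'" "b' - a \<in> T" unfolding c by auto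
    then have "(b - b') + (b' - a) \<in> T" using T kernel by (intro two_sidedD(2)[OF T(1)]) auto
    then show "b - a \<in> T" by simp
  qed (auto simp: c)
  have eq: "?c a = ?c b \<longleftrightarrow> a - b \<in> T" for a b
  proof
    assume "?c a = ?c b"
    then have "\<pi> a \<in> ?c b" using mem[of a a] two_sidedD(1)[OF T(1)] by auto
    then show "a - b \<in> T" by (simp add: mem)
  next
    assume ab: "a - b \<in> T"
    have "d - a \<in> T \<longleftrightarrow> d - b \<in> T" for d
      using two_sidedD(2)[OF T(1) _ ab, of "d - a"] two_sidedD(6)[OF T(1) _ ab, of "d - b"] by auto
    then show "?c a = ?c b" by (simp add: c)
  qed
  have un: "(\<Union>x\<in>?c a. F x) = C" if "\<And>b. b - a \<in> T \<Longrightarrow> F (\<pi> b) = C" for a F and C :: "'c set"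
  proof -
    have "(\<Union>x\<in>?c a. F x) = (\<Union>b\<in>{b. b - a \<in> T}. C)" unfolding c using that by auto
    also have "\<dots> = C"
    proof -
      have "a \<in> {b. b - a \<in> T}" using two_sidedD(1)[OF T(1)] by simp
      then have "C \<subseteq> (\<Union>b\<in>{b. b - a \<in> T}. C)" by (rule UN_upper)
      moreover have "(\<Union>b\<in>{b. b - a \<in> T}. C) \<subseteq> C" by (rule UN_least) (rule order_refl)
      ultimately show ?thesis by (rule antisym[rotated])
    qed
    finally show ?thesis .
  qed
  show ?thesis
  proof
    show "carrier ?A = range ?c" by (simp add: quot_module_simps a_rcosets_eq carrier image_image)
    show "?c a = ?c b \<longleftrightarrow> a - b \<in> T" for a b by (rule eq)
    show "?c a \<oplus>\<^bsub>?A\<^esub> ?c b = ?c (a + b)" for a b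
    proof -
      have "{e. e - (a + b) \<in> T} = {a' + b' | a' b'. a' - a \<in> T \<and> b' - b \<in> T}"
      proof (intro equalityI subsetI)
        fix e assume "e \<in> {e. e - (a + b) \<in> T}"
        then have "e = (e - b) + b \<and> (e - b) - a \<in> T \<and> b - b \<in> T" using two_sidedD(1)[OF T(1)] by (simp add: algebra_simps)
        then show "e \<in> {a' + b' | a' b'. a' - a \<in> T \<and> b' - b \<in> T}" by blast
      next
        fix e assume "e \<in> {a' + b' | a' b'. a' - a \<in> T \<and> b' - b \<in> T}"
        then obtain a' b' where "e = a' + b'" "(a' - a) + (b' - b) \<in> T" using two_sidedD(2)[OF T(1)] by blast
        then show "e \<in> {e. e - (a + b) \<in> T}" by (simp add: algebra_simps)
      qed
      note sets = this
      show ?thesis unfolding quot_module_simps set_add_eq c sets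
      proof (intro equalityI subsetI)
        fix v assume "v \<in> {x \<oplus>\<^bsub>A\<^esub> y | x y. x \<in> \<pi> ` {b. b - a \<in> T} \<and> y \<in> \<pi> ` {e. e - b \<in> T}}"
        then obtain a' b' where ab: "v = \<pi> a' \<oplus>\<^bsub>A\<^esub> \<pi> b'" "a' - a \<in> T" "b' - b \<in> T" by blast
        show "v \<in> \<pi> ` {a' + b' | a' b'. a' - a \<in> T \<and> b' - b \<in> T}"
        proof (rule image_eqI[of _ \<pi> "a' + b'"])
          show "v = \<pi> (a' + b')" by (simp only: ab add)
          show "a' + b' \<in> {a' + b' | a' b'. a' - a \<in> T \<and> b' - b \<in> T}" using ab(2,3) by blast
        qed
      next
        fix v assume "v \<in> \<pi> ` {a' + b' | a' b'. a' - a \<in> T \<and> b' - b \<in> T}"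
        then obtain a' b' where ab: "v = \<pi> (a' + b')" "a' - a \<in> T" "b' - b \<in> T" by blast
        show "v \<in> {x \<oplus>\<^bsub>A\<^esub> y | x y. x \<in> \<pi> ` {b. b - a \<in> T} \<and> y \<in> \<pi> ` {e. e - b \<in> T}}"
        proof (rule CollectI, rule exI[of _ "\<pi> a'"], rule exI[of _ "\<pi> b'"], intro conjI)
          show "v = \<pi> a' \<oplus>\<^bsub>A\<^esub> \<pi> b'" unfolding add by (rule ab(1))
        qed (use ab(2,3) in simp_all)
      qed
    qed
    show "?c a \<otimes>\<^bsub>?A\<^esub> ?c b = ?c (a * b)" for a b
      unfolding quot_module_simps rcoset_mult_def
    proof (rule un, rule un)
      fix a' b' assume "a' - a \<in> T" "b' - b \<in> T"
      then have "(a' - a) * b' + a * (b' - b) \<in> T" by (intro two_sidedD(2-4)[OF T(1)])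
      then have "?c (a' * b') = ?c (a * b)" unfolding eq by (simp add: algebra_simps)
      then show "\<pi> ` T +>\<^bsub>A\<^esub> \<pi> a' \<otimes>\<^bsub>A\<^esub> \<pi> b' = ?c (a * b)" by (simp add: mult)
    qed
    show "\<zero>\<^bsub>?A\<^esub> = ?c 0" unfolding quot_module_simps c by simp
    show "\<one>\<^bsub>?A\<^esub> = ?c 1" unfolding quot_module_simps one ..
    show "k \<odot>\<^bsub>?A\<^esub> ?c a = ?c (free_scal k a)" for k a
      unfolding quot_module_simps
    proof (rule un)
      fix b assume "b - a \<in> T"
      then have "?c (free_scal k b) = ?c (free_scal k a)"
        unfolding eq FV.scale_right_diff_distrib[symmetric] by (rule two_sided_scal[OF T(1)])
      then show "\<pi> ` T +>\<^bsub>A\<^esub> (k \<odot>\<^bsub>A\<^esub> \<pi> b) = ?c (free_scal k a)" by (simp add: smult)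
    qed
  qed
qed

end

lemma presented_free: "presented (free_algebra :: ('k::field, ('k, 'g) free_alg) module) (\<lambda>a. a) {0}"
  by unfold_locales (auto simp: free_algebra_def ring.defs module.defs ring_of_type_algebra_def)

section \<open>Cochains on a presented algebra\<close>

locale cochain_translation = restricted_setting g M act + P: presented A \<pi> J
  for g :: "('k::field, 'g::ab_group_add) rlsa" and M :: "('k, 'm::ab_group_add) rlsa" and act
    and A :: "('k, 'g, 'a) env_alg" and \<pi> :: "('k, 'g) free_alg \<Rightarrow> 'a" and J +
  fixes aact :: "'a \<Rightarrow> 'm \<Rightarrow> 'm"
  assumes goodJ: "good J" and emb: "emb A x = \<pi> (free_gen x)" and aact: "aact (\<pi> a) m = fa a m"
begin

definition rep :: "'a \<Rightarrow> ('k, 'g) free_alg" where "rep s = (SOME a. \<pi> a = s)"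

lemma rep_pi: "\<pi> (rep (\<pi> a)) = \<pi> a"
  unfolding rep_def by (rule someI[of _ a]) (rule refl)

lemma aug_eq: "aug_ideal A = \<pi> ` {a. eps a = 0}"
proof -
  have "range (emb A) = \<pi> ` range free_gen" by (auto simp: emb)
  then have "aug_ideal A = \<pi> ` gen_ideal (range free_gen \<union> J)"
    unfolding aug_ideal_def by (simp only: P.genideal_image)
  also have "gen_ideal (range free_gen \<union> J) = {a. eps a = 0}"
  proof
    show "gen_ideal (range free_gen \<union> J) \<subseteq> {a. eps a = 0}"
      using goodD(3)[OF goodJ] by (intro gen_ideal_minimal two_sided_eps) auto
    show "{a. eps a = 0} \<subseteq> gen_ideal (range free_gen \<union> J)"
      unfolding aug_ideal_gen using gen_ideal_superset[of "range free_gen \<union> J"]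
      by (intro gen_ideal_minimal two_sided_gen_ideal) auto
  qed
  finally show ?thesis .
qed

lemma eps_cong: "\<pi> a = \<pi> b \<Longrightarrow> eps a = eps b"
  using goodD(3)[OF goodJ, of "a - b"] by (simp add: P.kernel eps_simps)

lemma pi_aug: "\<pi> a \<in> aug_ideal A \<longleftrightarrow> eps a = 0"
proof
  assume "\<pi> a \<in> aug_ideal A"
  then obtain b where b: "\<pi> a = \<pi> b" "eps b = 0" unfolding aug_eq by blast
  then show "eps a = 0" using eps_cong[OF b(1)] by simp
next
  assume "eps a = 0"
  then show "\<pi> a \<in> aug_ideal A" unfolding aug_eq by blast
qed

lemma foldr_emb: "foldr (\<lambda>x t. emb A x \<otimes>\<^bsub>A\<^esub> t) xs \<one>\<^bsub>A\<^esub> = \<pi> (word xs)"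
  by (induction xs) (simp_all add: P.one emb P.mult word_Cons)

lemma alg_part_eq: "alg_part g A i = \<pi> ` fpart g i"
proof (intro equalityI subsetI)
  fix s assume "s \<in> alg_part g A i"
  then show "s \<in> \<pi> ` fpart g i"
  proof (induction rule: alg_part.induct)
    case zero show ?case unfolding P.pi_zero by (intro imageI fpart_0)
  next
    case (add xs ds s c)
    then obtain a where a: "a \<in> fpart g i" "s = \<pi> a" by blast
    have "xs \<in> homogeneous_words g i" using add(1,2) unfolding homogeneous_words_def by blast
    then have "free_scal c (word xs) + a \<in> fpart g i" by (intro fpart_add fpart_scale fpart_word a)
    then show ?case unfolding foldr_emb a(2) P.smult P.add by (rule imageI)
  qed
next
  fix s assume "s \<in> \<pi> ` fpart g i"
  then obtain a where a: "a \<in> fpart g i" "s = \<pi> a" by blast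
  from a(1) have "\<pi> a \<in> alg_part g A i"
  proof (induction rule: fpart_induct)
    case zero show ?case unfolding P.pi_zero[symmetric] by (rule alg_part.zero)
  next
    case (add c xs a)
    then obtain ds where "list_all2 (\<lambda>x d. x \<in> part g d) xs ds" "sum_list ds = i"
      unfolding homogeneous_words_def by blast
    from alg_part.add[OF this add(3), of c] show ?case unfolding foldr_emb P.smult P.add .
  qed
  then show "s \<in> alg_part g A i" by (simp only: a(2))
qed

lemma aug_cases: "s \<in> aug_ideal A \<Longrightarrow> (\<And>a. s = \<pi> a \<Longrightarrow> eps a = 0 \<Longrightarrow> thesis) \<Longrightarrow> thesis"
  unfolding aug_eq by blast

lemma aug_part_cases:
  assumes "\<pi> a \<in> alg_part g A d" "eps a = 0"
  obtains b where "b \<in> fpart g d" "\<pi> a = \<pi> b" "eps b = 0"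
proof -
  obtain b where b: "b \<in> fpart g d" "\<pi> a = \<pi> b" using assms(1) unfolding alg_part_eq by blast
  then show ?thesis using that eps_cong[OF b(2)] assms(2) by simp
qed

lemma args1: "xs \<in> cochain_args A 1 \<longleftrightarrow> (\<exists>a. xs = [\<pi> a] \<and> eps a = 0)"
proof
  assume "xs \<in> cochain_args A 1"
  then obtain s where "xs = [s]" "s \<in> aug_ideal A" by (auto simp: cochain_args_def length_Suc_conv)
  then show "\<exists>a. xs = [\<pi> a] \<and> eps a = 0" by (auto elim!: aug_cases)
qed (auto simp: cochain_args_def pi_aug)

lemma args2: "xs \<in> cochain_args A 2 \<longleftrightarrow> (\<exists>a b. xs = [\<pi> a, \<pi> b] \<and> eps a = 0 \<and> eps b = 0)"
proof
  assume "xs \<in> cochain_args A 2"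
  then obtain s t where "xs = [s, t]" "s \<in> aug_ideal A" "t \<in> aug_ideal A"
    by (auto simp: cochain_args_def numeral_2_eq_2 length_Suc_conv)
  then show "\<exists>a b. xs = [\<pi> a, \<pi> b] \<and> eps a = 0 \<and> eps b = 0" by (auto elim!: aug_cases)
qed (auto simp: cochain_args_def pi_aug)

lemma args3: "xs \<in> cochain_args A 3 \<longleftrightarrow> (\<exists>a b c. xs = [\<pi> a, \<pi> b, \<pi> c] \<and> eps a = 0 \<and> eps b = 0 \<and> eps c = 0)"
proof
  assume "xs \<in> cochain_args A 3"
  then obtain s t r where "xs = [s, t, r]" "s \<in> aug_ideal A" "t \<in> aug_ideal A" "r \<in> aug_ideal A"
    by (auto simp: cochain_args_def numeral_3_eq_3 length_Suc_conv)
  then show "\<exists>a b c. xs = [\<pi> a, \<pi> b, \<pi> c] \<and> eps a = 0 \<and> eps b = 0 \<and> eps c = 0" by (auto elim!: aug_cases)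
qed (auto simp: cochain_args_def pi_aug)

text \<open>Projection to the augmentation ideal along 1. Composing with it extends a cochain from
  the augmentation ideal to the whole algebra with value 0 at 1.\<close>

definition pl :: "('k, 'g) free_alg \<Rightarrow> ('k, 'g) free_alg" where "pl a = a - free_scal (eps a) 1"

lemma pl_simps: "eps (pl a) = 0" "eps a = 0 \<Longrightarrow> pl a = a" "pl (a + b) = pl a + pl b" "pl (free_scal c a) = free_scal c (pl a)" "pl 1 = 0"
  by (simp_all add: pl_def eps_simps FV.scale_left_distrib FV.scale_right_diff_distrib)

lemma pl_part: "a \<in> fpart g i \<Longrightarrow> pl a \<in> fpart g i"
proof (cases "i = 1")
  case True assume "a \<in> fpart g i"
  then show ?thesis using True eps_fpart_1[of a g] by (simp add: pl_simps(2))
next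
  case False
  then have "i = 0" by (cases i) simp_all
  moreover assume "a \<in> fpart g i"
  ultimately show ?thesis unfolding pl_def by (simp add: fpart_diff fpart_scale fpart_1)
qed

lemma cochain1_pl: "cochain1 J c \<Longrightarrow> c (pl a) = c a"
  unfolding pl_def by (simp add: klinear_diff[OF cochain1D(1)] klinear_scale[OF cochain1D(1)] cochain1D(2))

lemma cochain2_pl: "cochain2 J f \<Longrightarrow> f (pl a) (pl b) = f a b"
  unfolding pl_def
  by (simp add: klinear_diff[OF cochain2D(1)] klinear_scale[OF cochain2D(1)] klinear_diff[OF cochain2D(2)] klinear_scale[OF cochain2D(2)] cochain2D(3,4))

text \<open>\<open>L1\<close> and \<open>L2\<close> turn maps on the free algebra into functions on
  lists. The representatives chosen by \<open>rep\<close> do not matter for cochains, see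
  \<open>L1_apply\<close> and \<open>L2_apply\<close>.\<close>

definition L1 :: "(('k, 'g) free_alg \<Rightarrow> 'm) \<Rightarrow> 'a list \<Rightarrow> 'm" where
  "L1 c = (\<lambda>xs\<in>cochain_args A 1. c (rep (xs ! 0)))"

definition L2 :: "(('k, 'g) free_alg \<Rightarrow> ('k, 'g) free_alg \<Rightarrow> 'm) \<Rightarrow> 'a list \<Rightarrow> 'm" where
  "L2 f = (\<lambda>xs\<in>cochain_args A 2. f (rep (xs ! 0)) (rep (xs ! 1)))"

lemma rep_cong: "cong_mod J (rep (\<pi> a)) a"
  unfolding cong_mod_def P.kernel[symmetric] by (rule rep_pi)

lemma L1_apply: "cochain1 J c \<Longrightarrow> eps a = 0 \<Longrightarrow> L1 c [\<pi> a] = c a"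
  using cochain1_cong[OF _ rep_cong, of c a] args1 by (auto simp: L1_def)

lemma L2_apply: "cochain2 J f \<Longrightarrow> eps a = 0 \<Longrightarrow> eps b = 0 \<Longrightarrow> L2 f [\<pi> a, \<pi> b] = f a b"
  using cochain2_cong_left[OF _ rep_cong, of f a "rep (\<pi> b)"] cochain2_cong_right[OF _ rep_cong, of f a b] args2
  by (auto simp: L2_def)

text \<open>A preimage of a cochain on lists is obtained by evaluating it at the class of
  \<open>pl a\<close>.\<close>

lemma cochains1_image: "cochains g M A 1 = L1 ` {c. cochain1 J c}"
proof (intro equalityI subsetI)
  fix F assume F: "F \<in> cochains g M A 1"
  have Fe: "F \<in> extensional (cochain_args A 1)" using F by (simp add: cochains_def)
  have lin: "F [\<pi> (free_scal k a + b)] = smul M k (F [\<pi> a]) + F [\<pi> b]" if "eps a = 0" "eps b = 0" for k a b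
  proof -
    have b: "[\<pi> b] \<in> cochain_args A 1" "\<pi> a \<in> aug_ideal A" using that args1 pi_aug by auto
    have "F ([\<pi> b][0 := (k \<odot>\<^bsub>A\<^esub> \<pi> a) \<oplus>\<^bsub>A\<^esub> [\<pi> b] ! 0]) = smul M k (F ([\<pi> b][0 := \<pi> a])) + F [\<pi> b]"
      using F b unfolding cochains_def by blast
    then show ?thesis by (simp add: P.smult P.add)
  qed
  have part: "F [\<pi> a] \<in> part M i" if "a \<in> fpart g i" "eps a = 0" for a i
  proof -
    have b: "[\<pi> a] \<in> cochain_args A 1" using that args1 by auto
    have "\<pi> a \<in> alg_part g A i" using that(1) unfolding alg_part_eq by (rule imageI)
    then have "list_all2 (\<lambda>s d. s \<in> alg_part g A d) [\<pi> a] [i]" by simp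
    moreover have "\<forall>ds. list_all2 (\<lambda>s d. s \<in> alg_part g A d) [\<pi> a] ds \<longrightarrow> F [\<pi> a] \<in> part M (sum_list ds)"
      using F b unfolding cochains_def mem_Collect_eq by blast
    ultimately have "F [\<pi> a] \<in> part M (sum_list [i])" by blast
    then show ?thesis by (simp only: sum_list.Cons sum_list.Nil add_0_right)
  qed
  have F0: "F [\<pi> 0] = 0" using lin[of 0 0 1] by (simp add: eps_simps)
  define c where "c a = F [\<pi> (pl a)]" for a
  have "cochain1 J c" unfolding cochain1_def
  proof (intro conjI ballI allI)
    show "klinear free_scal (smul M) c"
    proof (rule klinearI[OF vector_space_free mvec])
      show "c (a + b) = c a + c b" for a b using lin[of "pl a" "pl b" 1] by (simp add: c_def pl_simps)
      show "c (free_scal k a) = smul M k (c a)" for k a using lin[of "pl a" 0 k] by (simp add: c_def pl_simps eps_simps F0)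
    qed
    show "c 1 = 0" by (simp add: c_def pl_simps F0)
    show "c a = 0" if "a \<in> J" for a
    proof -
      have "\<pi> a = \<pi> 0" using that by (simp add: P.mem_kernel)
      then show ?thesis using goodD(3)[OF goodJ that] F0 by (simp add: c_def pl_simps)
    qed
    show "c a \<in> part M i" if "a \<in> fpart g i" for a i unfolding c_def by (rule part[OF pl_part[OF that] pl_simps(1)])
  qed
  moreover have "F = L1 c"
  proof (rule extensionalityI[OF Fe])
    show "L1 c \<in> extensional (cochain_args A 1)" by (simp add: L1_def)
    fix xs assume "xs \<in> cochain_args A 1"
    then obtain a where "xs = [\<pi> a]" "eps a = 0" using args1 by auto
    then show "F xs = L1 c xs" using L1_apply[OF \<open>cochain1 J c\<close>] by (simp add: c_def pl_simps)
  qed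
  ultimately show "F \<in> L1 ` {c. cochain1 J c}" by blast
next
  fix F assume "F \<in> L1 ` {c. cochain1 J c}"
  then obtain c where c: "cochain1 J c" "F = L1 c" by blast
  note lin = klinearD(1-5)[OF cochain1D(1)[OF c(1)]]
  show "F \<in> cochains g M A 1" unfolding cochains_def
  proof (intro CollectI conjI ballI allI impI)
    show "F \<in> extensional (cochain_args A 1)" by (simp add: c(2) L1_def)
    fix xs assume "xs \<in> cochain_args A 1"
    then obtain a where a: "xs = [\<pi> a]" "eps a = 0" using args1 by auto
    { fix i s k assume "(i :: nat) < 1" "s \<in> aug_ideal A"
      then obtain b where b: "s = \<pi> b" "eps b = 0" and i: "i = 0" by (auto elim: aug_cases)
      have e: "eps (free_scal k b + a) = 0" by (simp add: eps_simps a b)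
      show "F (xs[i := (k \<odot>\<^bsub>A\<^esub> s) \<oplus>\<^bsub>A\<^esub> xs ! i]) = smul M k (F (xs[i := s])) + F xs"
        using L1_apply[OF c(1) e] L1_apply[OF c(1) a(2)] L1_apply[OF c(1) b(2)]
        by (simp add: a(1) b(1) i P.smult P.add c(2) lin) }
    { fix ds assume "list_all2 (\<lambda>s d. s \<in> alg_part g A d) xs ds"
      then obtain d where d: "ds = [d]" "\<pi> a \<in> alg_part g A d" by (auto simp: a(1) list_all2_Cons1)
      obtain b where b: "b \<in> fpart g d" "\<pi> a = \<pi> b" "eps b = 0" using aug_part_cases[OF d(2) a(2)] .
      have "F xs = c b" unfolding a(1) b(2) c(2) by (rule L1_apply[OF c(1) b(3)])
      then show "F xs \<in> part M (sum_list ds)" using cochain1D(4)[OF c(1) b(1)] by (simp only: d(1) sum_list.Cons sum_list.Nil add_0_right) }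
  qed
qed

lemma cochains2_image: "cochains g M A 2 = L2 ` {f. cochain2 J f}"
proof (intro equalityI subsetI)
  fix F assume F: "F \<in> cochains g M A 2"
  have Fe: "F \<in> extensional (cochain_args A 2)" using F by (simp add: cochains_def)
  have lin: "F ([\<pi> b, \<pi> c][i := (k \<odot>\<^bsub>A\<^esub> \<pi> a) \<oplus>\<^bsub>A\<^esub> [\<pi> b, \<pi> c] ! i]) = smul M k (F ([\<pi> b, \<pi> c][i := \<pi> a])) + F [\<pi> b, \<pi> c]"
    if "eps a = 0" "eps b = 0" "eps c = 0" "i < 2" for k a b c i
  proof -
    have b: "[\<pi> b, \<pi> c] \<in> cochain_args A 2" "\<pi> a \<in> aug_ideal A" using that args2 pi_aug by auto
    show ?thesis using F b that(4) unfolding cochains_def by blast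
  qed
  have l1: "F [\<pi> (free_scal k a + b), \<pi> c] = smul M k (F [\<pi> a, \<pi> c]) + F [\<pi> b, \<pi> c]"
    and l2: "F [\<pi> c, \<pi> (free_scal k a + b)] = smul M k (F [\<pi> c, \<pi> a]) + F [\<pi> c, \<pi> b]"
    if "eps a = 0" "eps b = 0" "eps c = 0" for k a b c
    using lin[of a b c 0 k] lin[of a c b 1 k] that by (simp_all add: P.smult P.add)
  have part: "F [\<pi> a, \<pi> b] \<in> part M (i + j)" if "a \<in> fpart g i" "eps a = 0" "b \<in> fpart g j" "eps b = 0" for a b i j
  proof -
    have b: "[\<pi> a, \<pi> b] \<in> cochain_args A 2" using that args2 by auto
    have "\<pi> a \<in> alg_part g A i" "\<pi> b \<in> alg_part g A j" using that(1,3) unfolding alg_part_eq by (auto intro: imageI)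
    then have "list_all2 (\<lambda>s d. s \<in> alg_part g A d) [\<pi> a, \<pi> b] [i, j]" by simp
    moreover have "\<forall>ds. list_all2 (\<lambda>s d. s \<in> alg_part g A d) [\<pi> a, \<pi> b] ds \<longrightarrow> F [\<pi> a, \<pi> b] \<in> part M (sum_list ds)"
      using F b unfolding cochains_def mem_Collect_eq by blast
    ultimately have "F [\<pi> a, \<pi> b] \<in> part M (sum_list [i, j])" by blast
    then show ?thesis by (simp only: sum_list.Cons sum_list.Nil add_0_right)
  qed
  have F0: "F [\<pi> 0, \<pi> b] = 0" "F [\<pi> b, \<pi> 0] = 0" if "eps b = 0" for b
    using l1[of 0 0 b 1] l2[of 0 0 b 1] that by (simp_all add: eps_simps)
  define f where "f a b = F [\<pi> (pl a), \<pi> (pl b)]" for a b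
  have "cochain2 J f" unfolding cochain2_def
  proof (intro conjI ballI allI)
    show "klinear free_scal (smul M) (\<lambda>a. f a b)" for b
    proof (rule klinearI[OF vector_space_free mvec])
      show "f (a + c) b = f a b + f c b" for a c using l1[of "pl a" "pl c" "pl b" 1] by (simp add: f_def pl_simps)
      show "f (free_scal k a) b = smul M k (f a b)" for k a using l1[of "pl a" 0 "pl b" k] by (simp add: f_def pl_simps eps_simps F0)
    qed
    show "klinear free_scal (smul M) (f b)" for b
    proof (rule klinearI[OF vector_space_free mvec])
      show "f b (a + c) = f b a + f b c" for a c using l2[of "pl a" "pl c" "pl b" 1] by (simp add: f_def pl_simps)
      show "f b (free_scal k a) = smul M k (f b a)" for k a using l2[of "pl a" 0 "pl b" k] by (simp add: f_def pl_simps eps_simps F0)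
    qed
    show "f 1 a = 0" "f a 1 = 0" for a by (simp_all add: f_def pl_simps F0)
    show "f a b = 0" "f b a = 0" if "a \<in> J" for a b
    proof -
      have "\<pi> a = \<pi> 0" using that by (simp add: P.mem_kernel)
      then show "f a b = 0" "f b a = 0" using goodD(3)[OF goodJ that] F0[of "pl b"] by (simp_all add: f_def pl_simps)
    qed
    show "f a b \<in> part M (i + j)" if "a \<in> fpart g i" "b \<in> fpart g j" for a b i j
      unfolding f_def by (rule part[OF pl_part[OF that(1)] pl_simps(1) pl_part[OF that(2)] pl_simps(1)])
  qed
  moreover have "F = L2 f"
  proof (rule extensionalityI[OF Fe])
    show "L2 f \<in> extensional (cochain_args A 2)" by (simp add: L2_def)
    fix xs assume "xs \<in> cochain_args A 2"
    then obtain a b where "xs = [\<pi> a, \<pi> b]" "eps a = 0" "eps b = 0" using args2 by auto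
    then show "F xs = L2 f xs" using L2_apply[OF \<open>cochain2 J f\<close>] by (simp add: f_def pl_simps)
  qed
  ultimately show "F \<in> L2 ` {f. cochain2 J f}" by blast
next
  fix F assume "F \<in> L2 ` {f. cochain2 J f}"
  then obtain f where f: "cochain2 J f" "F = L2 f" by blast
  note lin = klinearD(1-5)[OF cochain2D(1)[OF f(1)]] klinearD(1-5)[OF cochain2D(2)[OF f(1)]]
  show "F \<in> cochains g M A 2" unfolding cochains_def
  proof (intro CollectI conjI ballI allI impI)
    show "F \<in> extensional (cochain_args A 2)" by (simp add: f(2) L2_def)
    fix xs assume "xs \<in> cochain_args A 2"
    then obtain a b where a: "xs = [\<pi> a, \<pi> b]" "eps a = 0" "eps b = 0" using args2 by auto
    { fix i s k assume i: "(i :: nat) < 2" and "s \<in> aug_ideal A"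
      then obtain c where c: "s = \<pi> c" "eps c = 0" by (auto elim: aug_cases)
      have e: "eps (free_scal k c + a) = 0" "eps (free_scal k c + b) = 0" by (simp_all add: eps_simps a c)
      note ap = L2_apply[OF f(1)]
      show "F (xs[i := (k \<odot>\<^bsub>A\<^esub> s) \<oplus>\<^bsub>A\<^esub> xs ! i]) = smul M k (F (xs[i := s])) + F xs"
      proof (cases "i = 0")
        case True
        then show ?thesis using ap[OF e(1) a(3)] ap[OF c(2) a(3)] ap[OF a(2,3)] by (simp add: a(1) c(1) P.smult P.add f(2) lin)
      next
        case False
        then have "i = 1" using i by simp
        then show ?thesis using ap[OF a(2) e(2)] ap[OF a(2) c(2)] ap[OF a(2,3)] by (simp add: a(1) c(1) P.smult P.add f(2) lin)
      qed }
    { fix ds assume "list_all2 (\<lambda>s d. s \<in> alg_part g A d) xs ds"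
      then obtain d e where d: "ds = [d, e]" "\<pi> a \<in> alg_part g A d" "\<pi> b \<in> alg_part g A e" by (auto simp: a(1) list_all2_Cons1)
      obtain a' where a': "a' \<in> fpart g d" "\<pi> a = \<pi> a'" "eps a' = 0" using aug_part_cases[OF d(2) a(2)] .
      obtain b' where b': "b' \<in> fpart g e" "\<pi> b = \<pi> b'" "eps b' = 0" using aug_part_cases[OF d(3) a(3)] .
      have "F xs = f a' b'" unfolding a(1) a'(2) b'(2) f(2) by (rule L2_apply[OF f(1) a'(3) b'(3)])
      then show "F xs \<in> part M (sum_list ds)" using cochain2D(7)[OF f(1) a'(1) b'(1)]
        by (simp only: d(1) sum_list.Cons sum_list.Nil add_0_right) }
  qed
qed

lemma coboundary1_L1:
  assumes c: "cochain1 J c"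
  shows "coboundary M A aact 1 (L1 c) = L2 (d1 c)"
proof (rule extensionalityI[where A = "cochain_args A 2"])
  have s: "Suc 1 = (2 :: nat)" by simp
  show "coboundary M A aact 1 (L1 c) \<in> extensional (cochain_args A 2)" by (simp only: coboundary_def s restrict_extensional)
  show "L2 (d1 c) \<in> extensional (cochain_args A 2)" by (simp add: L2_def)
  fix xs assume xs: "xs \<in> cochain_args A 2"
  then obtain a b where a: "xs = [\<pi> a, \<pi> b]" "eps a = 0" "eps b = 0" using args2 by auto
  have ab: "eps (a * b) = 0" by (simp add: eps_mult a)
  have "coboundary M A aact 1 (L1 c) xs = aact (\<pi> a) (L1 c [\<pi> b]) + smul M (- 1) (L1 c [\<pi> a \<otimes>\<^bsub>A\<^esub> \<pi> b])"
    using xs unfolding coboundary_def s by (simp add: a(1))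
  also have "\<dots> = fa a (c b) - c (a * b)"
    by (simp add: aact P.mult L1_apply[OF c a(3)] L1_apply[OF c ab])
  also have "\<dots> = d1 c a b" by (simp add: d1_def a)
  also have "\<dots> = L2 (d1 c) xs" unfolding a(1) by (rule L2_apply[symmetric, OF cocycle2D(1)[OF cocycle2_d1[OF goodJ c]] a(2,3)])
  finally show "coboundary M A aact 1 (L1 c) xs = L2 (d1 c) xs" .
qed

lemma coboundary2_L2:
  assumes f: "cochain2 J f" and a: "eps a = 0" "eps b = 0" "eps c = 0"
  shows "coboundary M A aact 2 (L2 f) [\<pi> a, \<pi> b, \<pi> c] = fa a (f b c) - f (a * b) c + f a (b * c)"
proof -
  have s: "Suc 2 = (3 :: nat)" by simp
  have xs: "[\<pi> a, \<pi> b, \<pi> c] \<in> cochain_args A 3" using args3 a by blast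
  have i: "{1..2::nat} = {1, 2}" by auto
  have ab: "eps (a * b) = 0" "eps (b * c) = 0" by (simp_all add: eps_mult a)
  have "coboundary M A aact 2 (L2 f) [\<pi> a, \<pi> b, \<pi> c]
     = aact (\<pi> a) (L2 f [\<pi> b, \<pi> c]) + (smul M (- 1) (L2 f [\<pi> a \<otimes>\<^bsub>A\<^esub> \<pi> b, \<pi> c]) + L2 f [\<pi> a, \<pi> b \<otimes>\<^bsub>A\<^esub> \<pi> c])"
    using xs unfolding coboundary_def s i by (simp add: numeral_2_eq_2)
  also have "\<dots> = fa a (f b c) - f (a * b) c + f a (b * c)"
    by (simp add: aact P.mult L2_apply[OF f] a ab)
  finally show ?thesis .
qed

lemma cocycles1_carrier: "carrier (cocycles g M A aact 1) = L1 ` {c. cocycle1 J c}"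
proof -
  have iff: "(\<forall>xs\<in>cochain_args A (Suc 1). coboundary M A aact 1 (L1 c) xs = 0) \<longleftrightarrow> cocycle1 J c" if c: "cochain1 J c" for c
  proof -
    have s: "Suc 1 = (2 :: nat)" by simp
    note dc = cocycle2D(1)[OF cocycle2_d1[OF goodJ c]]
    have "(\<forall>xs\<in>cochain_args A 2. L2 (d1 c) xs = 0) \<longleftrightarrow> (\<forall>a b. eps a = 0 \<longrightarrow> eps b = 0 \<longrightarrow> d1 c a b = 0)"
    proof
      assume l: "\<forall>xs\<in>cochain_args A 2. L2 (d1 c) xs = 0"
      show "\<forall>a b. eps a = 0 \<longrightarrow> eps b = 0 \<longrightarrow> d1 c a b = 0"
      proof (intro allI impI)
        fix a b :: "('k, 'g) free_alg" assume "eps a = 0" "eps b = 0"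
        moreover then have "[\<pi> a, \<pi> b] \<in> cochain_args A 2" unfolding args2 by blast
        ultimately show "d1 c a b = 0" using l L2_apply[OF dc, of a b] by (metis (no_types))
      qed
    next
      assume r: "\<forall>a b. eps a = 0 \<longrightarrow> eps b = 0 \<longrightarrow> d1 c a b = 0"
      show "\<forall>xs\<in>cochain_args A 2. L2 (d1 c) xs = 0"
      proof
        fix xs assume "xs \<in> cochain_args A 2"
        then obtain a b where "xs = [\<pi> a, \<pi> b]" "eps a = 0" "eps b = 0" using args2 by auto
        then show "L2 (d1 c) xs = 0" using r L2_apply[OF dc, of a b] by simp
      qed
    qed
    also have "\<dots> \<longleftrightarrow> d1 c = (\<lambda>a b. 0)"
    proof
      assume r: "\<forall>a b. eps a = 0 \<longrightarrow> eps b = 0 \<longrightarrow> d1 c a b = 0"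
      show "d1 c = (\<lambda>a b. 0)"
      proof (intro ext)
        fix a b show "d1 c a b = 0" unfolding cochain2_pl[OF dc, symmetric, of a b] using r pl_simps(1) by blast
      qed
    qed simp
    finally show ?thesis unfolding coboundary1_L1[OF c] s using c by (simp add: cocycle1_iff[OF goodJ])
  qed
  have c1: "c \<in> {c. cocycle1 J c} \<Longrightarrow> cochain1 J c" for c by (simp add: cocycle1_def)
  show ?thesis
    unfolding cocycles_def fun_module_simps cochains1_image using iff c1 by blast
qed

lemma cocycles2_carrier: "carrier (cocycles g M A aact 2) = L2 ` {f. cocycle2 J f}"
proof -
  have s: "Suc 2 = (3 :: nat)" by simp
  have iff: "(\<forall>xs\<in>cochain_args A (Suc 2). coboundary M A aact 2 (L2 f) xs = 0) \<longleftrightarrow> cocycle2 J f" if f: "cochain2 J f" for f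
  proof
    assume l: "\<forall>xs\<in>cochain_args A (Suc 2). coboundary M A aact 2 (L2 f) xs = 0"
    have z: "f (a * b) c = fa a (f b c) + f a (b * c)" if "eps a = 0" "eps b = 0" "eps c = 0" for a b c
    proof -
      have "[\<pi> a, \<pi> b, \<pi> c] \<in> cochain_args A 3" using args3 that by blast
      then have "coboundary M A aact 2 (L2 f) [\<pi> a, \<pi> b, \<pi> c] = 0" using l unfolding s by blast
      then show ?thesis unfolding coboundary2_L2[OF f that] by (simp add: algebra_simps)
    qed
    \<comment> \<open>The identity is known on the augmentation ideal. Splitting off the constant
      terms extends it to all arguments and produces the \<open>eps\<close> term.\<close>
    have "f (a * b) c = fa a (f b c) + f a (b * c) - smul M (eps c) (f a b)" for a b c
    proof -
      note lin = klinearD(1,2)[OF cochain2D(1)[OF f]] klinearD(1,2)[OF cochain2D(2)[OF f]]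
      note f1 = cochain2D(3,4)[OF f]
      have dec: "a = pl a + free_scal (eps a) 1" for a by (simp add: pl_def)
      have "f ((pl a + free_scal (eps a) 1) * (pl b + free_scal (eps b) 1)) (pl c + free_scal (eps c) 1)
        = fa (pl a + free_scal (eps a) 1) (f (pl b + free_scal (eps b) 1) (pl c + free_scal (eps c) 1))
          + f (pl a + free_scal (eps a) 1) ((pl b + free_scal (eps b) 1) * (pl c + free_scal (eps c) 1))
          - smul M (eps c) (f (pl a + free_scal (eps a) 1) (pl b + free_scal (eps b) 1))"
        using z[OF pl_simps(1) pl_simps(1) pl_simps(1), of a b c]
        by (simp add: distrib_left distrib_right free_scal_mult_left free_scal_mult_right lin f1 fa_simps fa_right_simps M.vs.scale_right_distrib)
      then show ?thesis by (simp only: dec[symmetric])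
    qed
    then show "cocycle2 J f" using f unfolding cocycle2_def by blast
  next
    assume f2: "cocycle2 J f"
    show "\<forall>xs\<in>cochain_args A (Suc 2). coboundary M A aact 2 (L2 f) xs = 0"
    proof
      fix xs assume "xs \<in> cochain_args A (Suc 2)"
      then obtain a b c where a: "xs = [\<pi> a, \<pi> b, \<pi> c]" "eps a = 0" "eps b = 0" "eps c = 0" using args3 unfolding s by blast
      show "coboundary M A aact 2 (L2 f) xs = 0"
        unfolding a(1) coboundary2_L2[OF f a(2-4)] cocycle2D(2)[OF f2] by (simp add: a(4))
    qed
  qed
  have c1: "c \<in> {c. cocycle2 J c} \<Longrightarrow> cochain2 J c" for c by (simp add: cocycle2_def)
  show ?thesis
    unfolding cocycles_def fun_module_simps cochains2_image using iff c1 by blast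
qed

lemma coboundaries2_eq: "coboundaries g M A aact 2 = L2 ` d1 ` {c. cochain1 J c}"
proof -
  have "coboundaries g M A aact 2 = coboundary M A aact 1 ` cochains g M A 1"
    by (simp add: coboundaries_def numeral_2_eq_2)
  then show ?thesis unfolding cochains1_image image_image using coboundary1_L1 by simp
qed

lemma coboundaries1_eq: "coboundaries g M A aact 1 = L1 ` d0 ` part M 0"
proof -
  have args0: "cochain_args A 0 = {[]}" by (auto simp: cochain_args_def)
  have c0: "coboundary M A aact 0 F = L1 (d0 (F []))" if "F [] \<in> part M 0" for F
  proof (rule extensionalityI[where A = "cochain_args A 1"])
    show "coboundary M A aact 0 F \<in> extensional (cochain_args A 1)" by (simp only: coboundary_def One_nat_def restrict_extensional)
    show "L1 (d0 (F [])) \<in> extensional (cochain_args A 1)" by (simp add: L1_def)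
    fix xs assume xs: "xs \<in> cochain_args A 1"
    then obtain a where a: "xs = [\<pi> a]" "eps a = 0" using args1 by auto
    have "coboundary M A aact 0 F xs = fa a (F [])" using xs by (simp add: coboundary_def a(1) aact)
    also have "\<dots> = d0 (F []) a" by (simp add: d0_def a)
    also have "\<dots> = L1 (d0 (F [])) xs" unfolding a(1) by (rule L1_apply[symmetric, OF cocycle1D(1)[OF cocycle1_d0[OF goodJ that]] a(2)])
    finally show "coboundary M A aact 0 F xs = L1 (d0 (F [])) xs" .
  qed
  have mem: "F [] \<in> part M 0" if "F \<in> cochains g M A 0" for F
  proof -
    have "list_all2 (\<lambda>s d. s \<in> alg_part g A d) [] []" by simp
    then have "F [] \<in> part M (sum_list [])" using that args0 unfolding cochains_def by blast
    then show ?thesis by simp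
  qed
  have ex: "\<exists>F\<in>cochains g M A 0. F [] = m" if "m \<in> part M 0" for m
    by (rule bexI[of _ "\<lambda>xs\<in>{[]}. m"]) (use that in \<open>simp_all add: cochains_def args0\<close>)
  have "coboundaries g M A aact 1 = coboundary M A aact 0 ` cochains g M A 0"
    by (simp add: coboundaries_def)
  also have "\<dots> = (\<lambda>F. L1 (d0 (F []))) ` cochains g M A 0"
    by (intro image_cong refl c0 mem)
  also have "\<dots> = L1 ` d0 ` part M 0"
  proof (intro equalityI subsetI)
    fix y assume "y \<in> L1 ` d0 ` part M 0"
    then obtain m where m: "m \<in> part M 0" "y = L1 (d0 m)" by blast
    obtain F where "F \<in> cochains g M A 0" "F [] = m" using ex[OF m(1)] by blast
    then show "y \<in> (\<lambda>F. L1 (d0 (F []))) ` cochains g M A 0" using m(2) by blast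
  qed (use mem in blast)
  finally show ?thesis .
qed

definition sc1 :: "'k \<Rightarrow> (('k, 'g) free_alg \<Rightarrow> 'm) \<Rightarrow> ('k, 'g) free_alg \<Rightarrow> 'm" where
  "sc1 k c = (\<lambda>a. smul M k (c a))"

definition sc2 :: "'k \<Rightarrow> (('k, 'g) free_alg \<Rightarrow> ('k, 'g) free_alg \<Rightarrow> 'm) \<Rightarrow> ('k, 'g) free_alg \<Rightarrow> ('k, 'g) free_alg \<Rightarrow> 'm" where
  "sc2 k f = (\<lambda>a b. smul M k (f a b))"

lemma vector_space_sc1: "vector_space sc1"
  by unfold_locales (simp_all add: sc1_def fun_eq_iff M.vs.scale_right_distrib M.vs.scale_left_distrib)

lemma vector_space_sc2: "vector_space sc2"
  by unfold_locales (simp_all add: sc2_def fun_eq_iff M.vs.scale_right_distrib M.vs.scale_left_distrib)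

lemma cochain1_closed: "cochain1 J (0 :: ('k, 'g) free_alg \<Rightarrow> 'm)" "cochain1 J c \<Longrightarrow> cochain1 J d \<Longrightarrow> cochain1 J (c + d)" "cochain1 J c \<Longrightarrow> cochain1 J (sc1 k c)"
proof -
  show "cochain1 J (0 :: ('k, 'g) free_alg \<Rightarrow> 'm)"
    using klinear_const_zero[OF vector_space_free mvec] by (simp add: cochain1_def zero_fun_def)
  show "cochain1 J (c + d)" if "cochain1 J c" "cochain1 J d"
    using klinear_plus[OF cochain1D(1)[OF that(1)] cochain1D(1)[OF that(2)]] that by (simp add: cochain1_def plus_fun_def)
  show "cochain1 J (sc1 k c)" if "cochain1 J c"
    using klinear_scaled[OF cochain1D(1)[OF that], of k] that by (simp add: cochain1_def sc1_def)
qed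

lemma cocycle1_closed: "cocycle1 J (0 :: ('k, 'g) free_alg \<Rightarrow> 'm)" "cocycle1 J c \<Longrightarrow> cocycle1 J d \<Longrightarrow> cocycle1 J (c + d)" "cocycle1 J c \<Longrightarrow> cocycle1 J (sc1 k c)"
  using cochain1_closed unfolding cocycle1_def
  by (simp_all add: fa_right_simps sc1_def M.vs.scale_right_distrib mult.commute)

lemma d1_linear: "d1 (c + d) = d1 c + d1 d" "d1 (sc1 k c) = sc2 k (d1 c)" "d1 0 = 0"
  by (intro ext; simp add: d1_def sc1_def sc2_def fa_right_simps M.vs.scale_right_distrib M.vs.scale_right_diff_distrib mult.commute)+

lemma d0_linear: "d0 (m + n) = d0 m + d0 n" "d0 (smul M k m) = sc1 k (d0 m)" "d0 0 = 0"
  by (intro ext; simp add: d0_def sc1_def fa_right_simps M.vs.scale_right_distrib M.vs.scale_right_diff_distrib mult.commute)+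

sublocale Q1: param_quot "cocycles g M A aact 1" L1 sc1 "{c. cocycle1 J c}" "d0 ` part M 0"
proof (rule param_quot.intro)
  interpret s: vector_space sc1 by (rule vector_space_sc1)
  show "vector_space sc1" by (rule vector_space_sc1)
  show "s.subspace {c. cocycle1 J c}" by (rule s.subspaceI) (simp_all add: cocycle1_closed)
  show "s.subspace (d0 ` part M 0)"
  proof (rule s.subspaceI)
    show "0 \<in> d0 ` part M 0" by (rule image_eqI[where f = d0 and x = 0]) (simp_all add: d0_linear(3) M.part_0)
    fix x y k assume "x \<in> d0 ` part M 0" 
    then obtain m where m: "x = d0 m" "m \<in> part M 0" by blast
    show "sc1 k x \<in> d0 ` part M 0" unfolding m(1) d0_linear(2)[symmetric] by (rule imageI[OF M.part_scale[OF m(2)]])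
    assume "y \<in> d0 ` part M 0"
    then obtain n where n: "y = d0 n" "n \<in> part M 0" by blast
    show "x + y \<in> d0 ` part M 0" unfolding m(1) n(1) d0_linear(1)[symmetric] by (rule imageI[OF M.part_add[OF m(2) n(2)]])
  qed
  show "d0 ` part M 0 \<subseteq> {c. cocycle1 J c}" using cocycle1_d0[OF goodJ] by auto
  show "carrier (cocycles g M A aact 1) = L1 ` {c. cocycle1 J c}" by (rule cocycles1_carrier)
  show "inj_on L1 {c. cocycle1 J c}"
  proof (rule inj_onI, rule ext)
    fix c d a assume *: "c \<in> {c. cocycle1 J c}" "d \<in> {c. cocycle1 J c}" "L1 c = L1 d"
    then have cd: "cochain1 J c" "cochain1 J d" by (simp_all add: cocycle1_def)
    have "c (pl a) = d (pl a)" using L1_apply[OF cd(1) pl_simps(1)] L1_apply[OF cd(2) pl_simps(1)] *(3) by simp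
    then show "c a = d a" unfolding cochain1_pl[OF cd(1)] cochain1_pl[OF cd(2)] .
  qed
  show "L1 c \<oplus>\<^bsub>cocycles g M A aact 1\<^esub> L1 d = L1 (c + d)" for c d
    by (intro ext) (simp add: cocycles_def fun_module_simps vec_module_simps L1_def)
  show "k \<odot>\<^bsub>cocycles g M A aact 1\<^esub> L1 c = L1 (sc1 k c)" for k c
    by (intro ext) (simp add: cocycles_def fun_module_simps vec_module_simps L1_def sc1_def)
qed

sublocale Q2: param_quot "cocycles g M A aact 2" L2 sc2 "{f. cocycle2 J f}" "d1 ` {c. cochain1 J c}"
proof (rule param_quot.intro)
  interpret s: vector_space sc2 by (rule vector_space_sc2)
  show "vector_space sc2" by (rule vector_space_sc2)
  have z: "(0 :: ('k, 'g) free_alg \<Rightarrow> ('k, 'g) free_alg \<Rightarrow> 'm) = (\<lambda>a b. 0)" by (intro ext) simp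
  have p: "f + h = (\<lambda>a b. f a b + h a b)" for f h :: "('k, 'g) free_alg \<Rightarrow> ('k, 'g) free_alg \<Rightarrow> 'm" by (intro ext) simp
  show "s.subspace {f. cocycle2 J f}"
    by (rule s.subspaceI) (simp_all only: mem_Collect_eq z p sc2_def cocycle2_zero cocycle2_plus cocycle2_scale)
  show "s.subspace (d1 ` {c. cochain1 J c})"
  proof (rule s.subspaceI)
    show "0 \<in> d1 ` {c. cochain1 J c}" using d1_linear(3) cochain1_closed(1) by (metis image_eqI mem_Collect_eq)
    show "x + y \<in> d1 ` {c. cochain1 J c}" if xy: "x \<in> d1 ` {c. cochain1 J c}" "y \<in> d1 ` {c. cochain1 J c}" for x y
    proof -
      obtain c d where "x = d1 c" "cochain1 J c" "y = d1 d" "cochain1 J d" using xy by blast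
      then show ?thesis by (intro image_eqI[of _ d1 "c + d"]) (simp_all add: d1_linear cochain1_closed)
    qed
    show "sc2 k x \<in> d1 ` {c. cochain1 J c}" if x: "x \<in> d1 ` {c. cochain1 J c}" for k x
    proof -
      obtain c where "x = d1 c" "cochain1 J c" using x by blast
      then show ?thesis by (intro image_eqI[of _ d1 "sc1 k c"]) (simp_all add: d1_linear cochain1_closed)
    qed
  qed
  show "d1 ` {c. cochain1 J c} \<subseteq> {f. cocycle2 J f}" using cocycle2_d1[OF goodJ] by auto
  show "carrier (cocycles g M A aact 2) = L2 ` {f. cocycle2 J f}" by (rule cocycles2_carrier)
  show "inj_on L2 {f. cocycle2 J f}"
  proof (rule inj_onI, rule ext, rule ext)
    fix c d a b assume *: "c \<in> {f. cocycle2 J f}" "d \<in> {f. cocycle2 J f}" "L2 c = L2 d"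
    then have cd: "cochain2 J c" "cochain2 J d" by (simp_all add: cocycle2_def)
    have "c (pl a) (pl b) = d (pl a) (pl b)"
      using L2_apply[OF cd(1) pl_simps(1) pl_simps(1)] L2_apply[OF cd(2) pl_simps(1) pl_simps(1)] *(3) by simp
    then show "c a b = d a b" unfolding cochain2_pl[OF cd(1)] cochain2_pl[OF cd(2)] .
  qed
  show "L2 c \<oplus>\<^bsub>cocycles g M A aact 2\<^esub> L2 d = L2 (c + d)" for c d
    by (intro ext) (simp add: cocycles_def fun_module_simps vec_module_simps L2_def)
  show "k \<odot>\<^bsub>cocycles g M A aact 2\<^esub> L2 c = L2 (sc2 k c)" for k c
    by (intro ext) (simp add: cocycles_def fun_module_simps vec_module_simps L2_def sc2_def)
qed

lemma cohomology_eq: "cohomology g M A aact 1 = Q1.Q" "cohomology g M A aact 2 = Q2.Q"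
  by (simp_all only: cohomology_def Q1.Q_def Q2.Q_def coboundaries1_eq coboundaries2_eq)

end

section \<open>The enveloping algebras as presented algebras\<close>

lemma presented_extend: "presented A \<pi> J \<Longrightarrow> presented (module.extend A F) \<pi> J"
  unfolding presented_def by (simp add: module.defs)

context restricted_setting
begin

definition piU :: "('k, 'g) free_alg \<Rightarrow> ('k, 'g) U_elt" where "piU a = U_ideal g +>\<^bsub>free_algebra\<^esub> a"
definition piu :: "('k, 'g) free_alg \<Rightarrow> ('k, 'g) u_elt" where "piu a = U_to_u g (piU a)"

lemma U_ideal_eq: "U_ideal g = JU"
proof -
  have "U_ideal g = gen_ideal (env_relations g \<union> {0})"
    using presented.genideal_image[OF presented_free, of "env_relations g"] by (simp add: U_ideal_def)
  also have "\<dots> = JU" unfolding JU_def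
  proof (intro equalityI gen_ideal_minimal two_sided_gen_ideal)
    show "env_relations g \<union> {0} \<subseteq> gen_ideal (env_relations g)"
      using gen_ideal_superset[of "env_relations g"] two_sidedD(1)[OF two_sided_gen_ideal] by blast
    show "env_relations g \<subseteq> gen_ideal (env_relations g \<union> {0})"
      using gen_ideal_superset[of "env_relations g \<union> {0}"] by blast
  qed
  finally show ?thesis .
qed

lemma presented_U: "presented (U_alg g) piU JU"
proof -
  have "presented (quot_module free_algebra ((\<lambda>a. a) ` JU)) (\<lambda>a. (\<lambda>a. a) ` JU +>\<^bsub>free_algebra\<^esub> a) JU"
    by (rule presented.presented_quotient[OF presented_free JU.Q]) (simp add: two_sidedD(1)[OF JU.Q])
  then have "presented (quot_module free_algebra (U_ideal g)) piU JU"
    by (simp add: U_ideal_eq piU_def[abs_def])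
  then show ?thesis unfolding U_alg_def by (rule presented_extend)
qed

lemma emb_U: "emb (U_alg g) x = piU (free_gen x)"
  by (simp add: U_alg_def piU_def module.defs env_alg.defs)

lemma p_defect_eq: "p_defect g x = piU (zd x)"
  unfolding p_defect_def emb_U a_minus_def presented.power[OF presented_U] presented.minus[OF presented_U] presented.add[OF presented_U] zd_def
  by simp

lemma u_ideal_eq: "u_ideal g = piU ` Ju"
proof -
  have "u_ideal g = piU ` gen_ideal (zd ` part g 0 \<union> JU)"
    unfolding u_ideal_def presented.genideal_image[OF presented_U, symmetric] image_image p_defect_eq ..
  also have "gen_ideal (zd ` part g 0 \<union> JU) = Ju"
  proof
    show "gen_ideal (zd ` part g 0 \<union> JU) \<subseteq> Ju"
      using zd_Ju JU_subset_Ju by (intro gen_ideal_minimal two_sided_Ju) blast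
    show "Ju \<subseteq> gen_ideal (zd ` part g 0 \<union> JU)"
      using gen_ideal_superset[of "zd ` part g 0 \<union> JU"] by (intro Ju_minimal two_sided_gen_ideal) blast+
  qed
  finally show ?thesis .
qed

lemma presented_u: "presented (u_alg g) piu Ju"
proof -
  have "presented (quot_module (U_alg g) (piU ` Ju)) (\<lambda>a. piU ` Ju +>\<^bsub>U_alg g\<^esub> piU a) Ju"
    by (rule presented.presented_quotient[OF presented_U two_sided_Ju JU_subset_Ju])
  then have "presented (quot_module (U_alg g) (u_ideal g)) piu Ju"
    by (simp add: u_ideal_eq piu_def[abs_def] U_to_u_def)
  then show ?thesis unfolding u_alg_def by (rule presented_extend)
qed

lemma emb_u: "emb (u_alg g) x = piu (free_gen x)"
  by (simp add: u_alg_def piu_def emb_U module.defs env_alg.defs)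

lemma U_act_piU: "U_act M act (piU a) m = fa a m"
proof -
  have "piU a = (\<lambda>b. b + a) ` JU"
    unfolding piU_def U_ideal_eq a_r_coset_eq by (simp add: presented.add[OF presented_free])
  then have "(\<lambda>a. fa a m) ` piU a = (\<lambda>b. fa a m) ` JU"
    unfolding image_image by (auto intro!: image_cong simp: image_image fa_simps goodD(4)[OF good_JU])
  also have "\<dots> = {fa a m}" using two_sidedD(1)[OF JU.Q] by blast
  finally show ?thesis by (simp add: U_act_def)
qed

lemma u_act_piu: "u_act M act (piu a) m = fa a m"
proof -
  have "piu a = (\<lambda>b. piU (b + a)) ` Ju"
    unfolding piu_def U_to_u_def u_ideal_eq a_r_coset_eq image_image presented.add[OF presented_U] ..
  then have "(\<lambda>s. U_act M act s m) ` piu a = (\<lambda>b. fa a m) ` Ju"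
    by (auto intro!: image_cong simp: image_image U_act_piU fa_simps goodD(4)[OF good_Ju])
  also have "\<dots> = {fa a m}" using two_sidedD(1)[OF two_sided_Ju] by blast
  finally show ?thesis by (simp add: u_act_def)
qed

lemma translation_U: "cochain_translation g M act (U_alg g) piU JU (U_act M act)"
  by (intro cochain_translation.intro cochain_translation_axioms.intro restricted_setting_axioms presented_U good_JU emb_U U_act_piU)

lemma translation_u: "cochain_translation g M act (u_alg g) piu Ju (u_act M act)"
  by (intro cochain_translation.intro cochain_translation_axioms.intro restricted_setting_axioms presented_u good_Ju emb_u u_act_piu)

interpretation U: cochain_translation g M act "U_alg g" piU JU "U_act M act" by (rule translation_U)
interpretation u: cochain_translation g M act "u_alg g" piu Ju "u_act M act" by (rule translation_u)

lemma H_eq: "H g M act 1 = U.Q1.Q" "H g M act 2 = U.Q2.Q" "H_res g M act 1 = u.Q1.Q" "H_res g M act 2 = u.Q2.Q"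
  by (simp_all only: H_def H_res_def U.cohomology_eq u.cohomology_eq)

section \<open>The maps of the sequence on representatives\<close>

text \<open>Cochains on both algebras are maps on the same free algebra, so pulling back is the
  inclusion of \<open>Ju\<close>-cocycles into \<open>JU\<close>-cocycles.\<close>

lemma pull_back_1:
  assumes c: "cocycle1 Ju c"
  shows "pull_back g M act 1 (u.Q1.cls c) = U.Q1.cls c"
  unfolding pull_back_def
proof (rule u.Q1.union_cls)
  show "c \<in> {c. cocycle1 Ju c}" using c by simp
  fix d assume d: "d \<in> {c. cocycle1 Ju c}" "d - c \<in> d0 ` part M 0"
  then have dJ: "cochain1 Ju d" "cochain1 JU d" "cocycle1 JU d"
    using cocycle1D(1) cochain1_mono[OF JU_subset_Ju] cocycle1_mono[OF JU_subset_Ju] by blast+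
  have "(\<lambda>xs\<in>cochain_args (U_alg g) 1. u.L1 d (map (U_to_u g) xs)) = U.L1 d"
  proof (rule extensionalityI[where A = "cochain_args (U_alg g) 1"])
    fix xs assume xs: "xs \<in> cochain_args (U_alg g) 1"
    then obtain a where a: "xs = [piU a]" "eps a = 0" using U.args1 by blast
    have "u.L1 d (map (U_to_u g) xs) = d a" unfolding a(1) using u.L1_apply[OF dJ(1) a(2)] by (simp add: piu_def)
    also have "\<dots> = U.L1 d xs" unfolding a(1) by (rule U.L1_apply[OF dJ(2) a(2), symmetric])
    finally show "(\<lambda>xs\<in>cochain_args (U_alg g) 1. u.L1 d (map (U_to_u g) xs)) xs = U.L1 d xs" using xs by simp
  qed (simp_all add: U.L1_def)
  moreover have "U.Q1.cls d = U.Q1.cls c"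
    using d(2) dJ(3) cocycle1_mono[OF JU_subset_Ju c] by (intro U.Q1.cls_eq_iff[THEN iffD2]) simp_all
  ultimately show "coboundaries g M (U_alg g) (U_act M act) 1 +>\<^bsub>cocycles g M (U_alg g) (U_act M act) 1\<^esub>
      (\<lambda>xs\<in>cochain_args (U_alg g) 1. u.L1 d (map (U_to_u g) xs)) = U.Q1.cls c"
    unfolding U.coboundaries1_eq U.Q1.cls_def by simp
qed

lemma pull_back_2:
  assumes f: "cocycle2 Ju f"
  shows "pull_back g M act 2 (u.Q2.cls f) = U.Q2.cls f"
  unfolding pull_back_def
proof (rule u.Q2.union_cls)
  show "f \<in> {f. cocycle2 Ju f}" using f by simp
  fix d assume d: "d \<in> {f. cocycle2 Ju f}" "d - f \<in> d1 ` {c. cochain1 Ju c}"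
  then have dJ: "cochain2 Ju d" "cochain2 JU d" "cocycle2 JU d" "d - f \<in> d1 ` {c. cochain1 JU c}"
    using cocycle2D(1) cochain2_mono[OF JU_subset_Ju] cochain1_mono[OF JU_subset_Ju] cocycle2_mono[OF JU_subset_Ju] by blast+
  have "(\<lambda>xs\<in>cochain_args (U_alg g) 2. u.L2 d (map (U_to_u g) xs)) = U.L2 d"
  proof (rule extensionalityI[where A = "cochain_args (U_alg g) 2"])
    fix xs assume xs: "xs \<in> cochain_args (U_alg g) 2"
    then obtain a b where a: "xs = [piU a, piU b]" "eps a = 0" "eps b = 0" using U.args2 by blast
    have "u.L2 d (map (U_to_u g) xs) = d a b" unfolding a(1) using u.L2_apply[OF dJ(1) a(2,3)] by (simp add: piu_def)
    also have "\<dots> = U.L2 d xs" unfolding a(1) by (rule U.L2_apply[OF dJ(2) a(2,3), symmetric])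
    finally show "(\<lambda>xs\<in>cochain_args (U_alg g) 2. u.L2 d (map (U_to_u g) xs)) xs = U.L2 d xs" using xs by simp
  qed (simp_all add: U.L2_def)
  moreover have "U.Q2.cls d = U.Q2.cls f"
    using dJ(3,4) cocycle2_mono[OF JU_subset_Ju f] by (intro U.Q2.cls_eq_iff[THEN iffD2]) simp_all
  ultimately show "coboundaries g M (U_alg g) (U_act M act) 2 +>\<^bsub>cocycles g M (U_alg g) (U_act M act) 2\<^esub>
      (\<lambda>xs\<in>cochain_args (U_alg g) 2. u.L2 d (map (U_to_u g) xs)) = U.Q2.cls f"
    unfolding U.coboundaries2_eq U.Q2.cls_def by simp
qed

lemma lie_class_eq: "lie_class g M act h = (\<lambda>m x. act x m + h x) ` part M 0"
  unfolding lie_class_def a_r_coset_eq lie_coboundaries_def image_image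
  by (simp add: lie_cocycles_def fun_module_simps vec_module_simps restrict_UNIV)

lemma lie_class_cong:
  assumes "m \<in> part M 0" "\<And>x. h x = act x m + h' x"
  shows "lie_class g M act h = lie_class g M act h'"
proof -
  have e: "act x n + h x = act x (n + m) + h' x" "act x n + h' x = act x (n - m) + h x" for n x
    using assms(2) by (simp_all add: act_simps)
  show ?thesis unfolding lie_class_eq
  proof (intro equalityI subsetI; elim imageE)
    fix u n assume "n \<in> part M 0" "u = (\<lambda>x. act x n + h x)"
    then show "u \<in> (\<lambda>m x. act x m + h' x) ` part M 0"
      by (intro image_eqI[where x = "n + m"]) (simp_all only: e(1) M.part_add assms(1))
  next
    fix u n assume "n \<in> part M 0" "u = (\<lambda>x. act x n + h' x)"
    then show "u \<in> (\<lambda>m x. act x m + h x) ` part M 0"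
      by (intro image_eqI[where x = "n - m"]) (simp_all only: e(2) M.part_diff assms(1))
  qed
qed

lemma cocycle1_add_d0: "cocycle1 JU c \<Longrightarrow> m \<in> part M 0 \<Longrightarrow> cocycle1 JU (d0 m + c)"
  by (intro U.cocycle1_closed(2) cocycle1_d0[OF good_JU])

lemma restrict_H1_cls:
  assumes c: "cocycle1 JU c"
  shows "restrict_H1 g M act (U.Q1.cls c) = lie_class g M act (\<lambda>x. c (free_gen x))"
  unfolding restrict_H1_def
proof (rule U.Q1.union_cls)
  show "c \<in> {c. cocycle1 JU c}" using c by simp
  fix d assume d: "d \<in> {c. cocycle1 JU c}" "d - c \<in> d0 ` part M 0"
  then obtain m where m: "m \<in> part M 0" "d - c = d0 m" by blast
  have "U.L1 d [emb (U_alg g) x] = d (free_gen x)" for x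
    using d(1) cocycle1D(1) unfolding emb_U by (intro U.L1_apply) (auto simp: eps_simps)
  moreover have "d (free_gen x) = act x m + c (free_gen x)" for x
    using fun_cong[OF m(2), of "free_gen x"] by (simp add: d0_def eps_simps algebra_simps)
  ultimately show "lie_class g M act (\<lambda>x. U.L1 d [emb (U_alg g) x]) = lie_class g M act (\<lambda>x. c (free_gen x))"
    using m(1) by (intro lie_class_cong) simp_all
qed

text \<open>A 1-cocycle is determined by its values on letters. This is what allows
  \<open>Phi\<close> to be evaluated through the inverse of restriction.\<close>

lemma inj_on_restrict_H1: "inj_on (restrict_H1 g M act) (carrier U.Q1.Q)"
proof (rule inj_onI)
  fix C D assume "C \<in> carrier U.Q1.Q" "D \<in> carrier U.Q1.Q" and eq: "restrict_H1 g M act C = restrict_H1 g M act D"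
  then obtain c d where c: "cocycle1 JU c" "C = U.Q1.cls c" and d: "cocycle1 JU d" "D = U.Q1.cls d"
    unfolding U.Q1.carrier_Q by blast
  have "(\<lambda>x. act x 0 + c (free_gen x)) \<in> lie_class g M act (\<lambda>x. c (free_gen x))"
    unfolding lie_class_eq by (rule imageI[OF M.part_0])
  then obtain m where m: "m \<in> part M 0" "(\<lambda>x. act x 0 + c (free_gen x)) = (\<lambda>x. act x m + d (free_gen x))"
    using eq unfolding c(2) d(2) restrict_H1_cls[OF c(1)] restrict_H1_cls[OF d(1)] lie_class_eq by auto
  have "c = d0 m + d"
  proof (rule cocycle1_determined[OF c(1) cocycle1_add_d0[OF d(1) m(1)]])
    show "c (free_gen x) = (d0 m + d) (free_gen x)" for x
      using fun_cong[OF m(2), of x] by (simp add: d0_def eps_simps act_simps)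
  qed
  then have "c - d \<in> d0 ` part M 0" using m(1) by simp
  then show "C = D" unfolding c(2) d(2) using c(1) d(1) by (intro U.Q1.cls_eq_iff[THEN iffD2]) simp_all
qed

text \<open>For a 1-cocycle c(x^p) = x^(p-1).c(x), so the defining formula is evaluation at x^p -
  x^[p].\<close>

lemma Psi_cocycle:
  assumes c: "cocycle1 JU c"
  shows "Psi g act (\<lambda>x. c (free_gen x)) = (\<lambda>x\<in>part g 0. c (zd x))"
proof -
  have "d1 c = (\<lambda>a b. 0)" and c1: "cochain1 JU c" using c by (simp_all add: cocycle1_iff[OF good_JU])
  then have "c (zd x) = (act x ^^ (CHAR('k) - 1)) (c (free_gen x)) - c (free_gen (pmap g x))" for x
    unfolding zd_def klinear_diff[OF cochain1D(1)[OF c1]] cochain1_zd[OF c1] by (simp add: fa_gen_power)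
  then show ?thesis by (simp add: Psi_def)
qed

text \<open>Representatives differ by some \<open>d0 m\<close>, which vanishes at z_x because z_x
  annihilates \<open>M\<close>.\<close>

lemma Psi_bar_cls:
  assumes c: "cocycle1 JU c"
  shows "Psi_bar g M act (U.Q1.cls c) = (\<lambda>x\<in>part g 0. c (zd x))"
proof -
  have "Psi g act (\<lambda>x. act x m + c (free_gen x)) = (\<lambda>x\<in>part g 0. c (zd x))" if m: "m \<in> part M 0" for m
  proof -
    have "(\<lambda>x. act x m + c (free_gen x)) = (\<lambda>x. (d0 m + c) (free_gen x))" by (simp add: d0_def eps_simps)
    then have "Psi g act (\<lambda>x. act x m + c (free_gen x)) = (\<lambda>x\<in>part g 0. (d0 m + c) (zd x))"
      using Psi_cocycle[OF cocycle1_add_d0[OF c m]] by simp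
    also have "\<dots> = (\<lambda>x\<in>part g 0. c (zd x))" by (rule restrict_ext) (simp add: d0_def fa_zd)
    finally show ?thesis .
  qed
  then have "Psi g act ` restrict_H1 g M act (U.Q1.cls c) = (\<lambda>m. \<lambda>x\<in>part g 0. c (zd x)) ` part M 0"
    unfolding restrict_H1_cls[OF c] lie_class_eq image_image by (intro image_cong refl)
  also have "\<dots> = {\<lambda>x\<in>part g 0. c (zd x)}" using M.part_0 by blast
  finally have "Psi g act ` restrict_H1 g M act (U.Q1.cls c) = {\<lambda>x\<in>part g 0. c (zd x)}" .
  then show ?thesis by (simp add: Psi_bar_def)
qed

lemma S_inv_carrier: "h \<in> carrier (S_inv g M act) \<longleftrightarrow> h \<in> extensional (part g 0) \<and> (\<forall>x\<in>part g 0. h x \<in> even_invariants M act)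
    \<and> (\<forall>a. \<forall>x\<in>part g 0. \<forall>y\<in>part g 0. h (smul g a x + y) = smul M (a ^ CHAR('k)) (h x) + h y)"
  unfolding S_inv_def semilinear_maps_def fun_module_simps g_even_def vec_module_simps PiE_def by auto

lemma S_inv_ops: "\<zero>\<^bsub>S_inv g M act\<^esub> = (\<lambda>x\<in>part g 0. 0)" "h \<oplus>\<^bsub>S_inv g M act\<^esub> h' = (\<lambda>x\<in>part g 0. h x + h' x)"
  "k \<odot>\<^bsub>S_inv g M act\<^esub> h = (\<lambda>x\<in>part g 0. smul M k (h x))"
  by (simp_all add: S_inv_def semilinear_maps_def fun_module_simps g_even_def vec_module_simps)

lemma S_H1_carrier: "h \<in> carrier (S_H1 g M act) \<longleftrightarrow> h \<in> extensional (part g 0) \<and> (\<forall>x\<in>part g 0. h x \<in> carrier U.Q1.Q)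
    \<and> (\<forall>a. \<forall>x\<in>part g 0. \<forall>y\<in>part g 0. h (smul g a x + y) = (a ^ CHAR('k) \<odot>\<^bsub>U.Q1.Q\<^esub> h x) \<oplus>\<^bsub>U.Q1.Q\<^esub> h y)"
  unfolding S_H1_def semilinear_maps_def fun_module_simps g_even_def vec_module_simps PiE_def H_eq by auto

lemma S_H1_ops: "\<zero>\<^bsub>S_H1 g M act\<^esub> = (\<lambda>x\<in>part g 0. \<zero>\<^bsub>U.Q1.Q\<^esub>)" "h \<oplus>\<^bsub>S_H1 g M act\<^esub> h' = (\<lambda>x\<in>part g 0. h x \<oplus>\<^bsub>U.Q1.Q\<^esub> h' x)"
  "k \<odot>\<^bsub>S_H1 g M act\<^esub> h = (\<lambda>x\<in>part g 0. k \<odot>\<^bsub>U.Q1.Q\<^esub> h x)"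
  by (simp_all only: S_H1_def semilinear_maps_def fun_module_simps g_even_def vec_module_simps H_eq)

lemma cochain_S_inv:
  assumes c: "cochain1 JU c" and d: "cocycle2 Ju (d1 c)"
  shows "(\<lambda>x\<in>part g 0. c (zd x)) \<in> carrier (S_inv g M act)"
  unfolding S_inv_carrier
  by (intro conjI ballI allI) (simp_all add: coboundary_zd_invariant[OF c d] cochain1_zd_semilinear[OF c] part_add part_scale)

subsection \<open>The connecting map\<close>

lemma extension_equiv_tw_sym:
  assumes "extension_equiv (tw b q) (tw b' q')"
  shows "extension_equiv (tw b' q') (tw b q)"
proof -
  obtain \<eta> where e: "even_linear g M \<eta>"
    "\<And>x y. b x y + \<eta> (br g x y) = act x (\<eta> y) - swap_sign g M act y (\<eta> x) + b' x y"
    "\<And>x. x \<in> part g 0 \<Longrightarrow> q x + \<eta> (pmap g x) = (act x ^^ (CHAR('k) - 1)) (\<eta> x) + q' x"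
    using assms unfolding tw_equiv_iff by blast
  note n = klinear_minus[OF klinear_act_power]
  show ?thesis unfolding tw_equiv_iff
  proof (intro exI[of _ "\<lambda>x. - \<eta> x"] conjI allI ballI)
    show "even_linear g M (\<lambda>x. - \<eta> x)"
      using e(1) klinear_scaled[of "smul g" "smul M" \<eta> "- 1"] M.part_scale[of _ _ "- 1"] unfolding even_linear_def by fastforce
    show "b' x y + - \<eta> (br g x y) = act x (- \<eta> y) - swap_sign g M act y (- \<eta> x) + b x y" for x y
      using e(2)[of x y] by (simp add: act_simps sw_simps algebra_simps)
    show "q' x + - \<eta> (pmap g x) = (act x ^^ (CHAR('k) - 1)) (- \<eta> x) + q x" if "x \<in> part g 0" for x
      using e(3)[OF that] by (simp add: n algebra_simps)
  qed
qed

lemma ext_class_eqI: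
  assumes "extension_equiv (tw b q) (tw b' q')" "restricted_extension g M act (tw b q)" "restricted_extension g M act (tw b' q')"
  shows "ext_rel g M act `` {tw b q} = ext_rel g M act `` {tw b' q'}"
  using assms extension_equiv_trans[OF assms(1)] extension_equiv_trans[OF extension_equiv_tw_sym[OF assms(1)]]
  unfolding ext_rel_def by auto

lemma ext_class_eqD:
  assumes "ext_rel g M act `` {E} = ext_rel g M act `` {tw b q}" "restricted_extension g M act (tw b q)"
  shows "extension_equiv E (tw b q)"
proof -
  interpret V: graded_space "total (tw b q)" by (rule graded_tw)
  have "extension_equiv (tw b q) (tw b q)" unfolding extension_equiv_def
    by (rule exI[of _ "\<lambda>x. x"]) (auto simp: rlsa_hom_def even_linear_def bij_def intro!: klinearI V.vs.vector_space_axioms)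
  then have "tw b q \<in> ext_rel g M act `` {tw b q}" using assms(2) by (simp add: ext_rel_def)
  then show ?thesis unfolding assms(1)[symmetric] by (simp add: ext_rel_def)
qed

lemma bounds_linear:
  assumes "bounds f h" "bounds f' h'"
  shows "bounds (\<lambda>a b. smul M k (f a b) + f' a b) (\<lambda>x. smul M k (h x) + h' x)"
proof -
  obtain c c' where c: "cochain1 JU c" "d1 c = f" "\<And>x. x \<in> part g 0 \<Longrightarrow> c (zd x) = h x"
    "cochain1 JU c'" "d1 c' = f'" "\<And>x. x \<in> part g 0 \<Longrightarrow> c' (zd x) = h' x"
    using assms unfolding bounds_def by blast
  have "cochain1 JU (U.sc1 k c + c')" by (intro U.cochain1_closed c)
  moreover have "d1 (U.sc1 k c + c') = (\<lambda>a b. smul M k (f a b) + f' a b)"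
    by (intro ext) (simp add: U.d1_linear U.sc2_def c)
  moreover have "\<forall>x\<in>part g 0. (U.sc1 k c + c') (zd x) = smul M k (h x) + h' x" by (simp add: U.sc1_def c)
  ultimately show ?thesis unfolding bounds_def by blast
qed

lemma bounds_cong: "bounds f h \<Longrightarrow> (\<And>x. x \<in> part g 0 \<Longrightarrow> h x = h' x) \<Longrightarrow> bounds f h'"
  unfolding bounds_def by (metis (no_types, lifting))

lemma E_cocycle_eq:
  assumes f: "cocycle2 Ju f"
  shows "E_cocycle g M act (u.L2 f) = tw (bf f) (qf f)"
proof -
  note fc = cocycle2D(1)[OF f]
  have 1: "u.L2 f [piu (free_gen x), piu (free_gen y)] = gen2 f x y" for x y
    unfolding gen2_def by (rule u.L2_apply[OF fc]) (simp_all add: eps_simps)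
  have 2: "u.L2 f [piu (free_gen x) [^]\<^bsub>u_alg g\<^esub> (CHAR('k) - 1), piu (free_gen x)] = qf f x" for x
    unfolding qf_def presented.power[OF presented_u]
    using char_gt_2 by (intro u.L2_apply[OF fc]) (simp_all add: eps_power eps_simps)
  have "bf f = (\<lambda>x y. gen2 f x y - swap_sign g g (gen2 f) y x)" by (intro ext) (rule bf_def)
  then show ?thesis unfolding E_cocycle_def Let_def emb_u 1 2 by simp
qed

text \<open>Cohomologous cocycles on u(g) differ by the coboundary of a cochain that vanishes at all
  z_x; by \<open>tw_equiv_bounds\<close> with h = 0 their extensions are equivalent.\<close>

lemma F_res_inv_cls:
  assumes f: "cocycle2 Ju f"
  shows "F_res_inv g M act (u.Q2.cls f) = ext_rel g M act `` {tw (bf f) (qf f)}"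
  unfolding F_res_inv_def
proof (rule u.Q2.union_cls)
  show "f \<in> {f. cocycle2 Ju f}" using f by simp
  fix f' assume f': "f' \<in> {f. cocycle2 Ju f}" "f' - f \<in> d1 ` {c. cochain1 Ju c}"
  then have d: "cocycle2 Ju f'" by simp
  obtain c where c: "cochain1 Ju c" "f' - f = d1 c" using f'(2) by blast
  have "(\<lambda>a b. f' a b - f a b) = d1 c" unfolding c(2)[symmetric] by (intro ext) simp
  then have "bounds (\<lambda>a b. f' a b - f a b) (\<lambda>x. 0)"
    unfolding bounds_def using cochain1_mono[OF JU_subset_Ju c(1)] cochain1D(3)[OF c(1) zd_Ju] by (intro exI[of _ c]) simp
  then have "extension_equiv (tw (bf f') (qf f')) (tw (bf f) (qf f))"
    using tw_equiv_bounds[OF f_JU[OF d] f_JU[OF f], of "\<lambda>x. 0"] by simp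
  then show "ext_rel g M act `` {E_cocycle g M act (u.L2 f')} = ext_rel g M act `` {tw (bf f) (qf f)}"
    unfolding E_cocycle_eq[OF d] by (rule ext_class_eqI) (rule restricted_extension_cocycle[OF d], rule restricted_extension_cocycle[OF f])
qed

text \<open>An equivalence yields a cochain on U(g) that bounds the difference of the cocycles and
  vanishes at all z_x; such a cochain descends to u(g). Injectivity suffices to evaluate
  \<open>F_res\<close> at the class of the extension of a cocycle.\<close>

lemma inj_on_F_res_inv: "inj_on (F_res_inv g M act) (carrier u.Q2.Q)"
proof (rule inj_onI)
  fix C D assume "C \<in> carrier u.Q2.Q" "D \<in> carrier u.Q2.Q" and eq: "F_res_inv g M act C = F_res_inv g M act D"
  then obtain f f' where f: "cocycle2 Ju f" "C = u.Q2.cls f" and f': "cocycle2 Ju f'" "D = u.Q2.cls f'"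
    unfolding u.Q2.carrier_Q by blast
  have "extension_equiv (tw (bf f) (qf f)) (tw (bf f') (qf f'))"
    using eq unfolding f(2) f'(2) F_res_inv_cls[OF f(1)] F_res_inv_cls[OF f'(1)]
    by (rule ext_class_eqD[OF _ restricted_extension_cocycle[OF f'(1)]])
  then have "bounds (\<lambda>a b. f a b - f' a b) (\<lambda>x. 0)"
    using tw_equiv_bounds[OF f_JU[OF f(1)] f_JU[OF f'(1)], of "\<lambda>x. 0"] by simp
  then obtain c where c: "cochain1 JU c" "d1 c = (\<lambda>a b. f a b - f' a b)" "\<And>x. x \<in> part g 0 \<Longrightarrow> c (zd x) = 0"
    unfolding bounds_def by blast
  have "cochain1 Ju c" by (rule cochain1_descends[OF c(1) _ c(3)]) (simp_all add: c(2) cocycle2_diff f(1) f'(1))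
  moreover have "f - f' = d1 c" unfolding c(2) by (intro ext) simp
  ultimately have "f - f' \<in> d1 ` {c. cochain1 Ju c}" by blast
  then show "C = D" unfolding f(2) f'(2) using f(1) f'(1) by (intro u.Q2.cls_eq_iff[THEN iffD2]) simp_all
qed

text \<open>The relation \<open>bounds f h\<close> makes the extension of \<open>f\<close>
  equivalent to the twist of the semidirect product by \<open>h\<close>, so both define the same
  class.\<close>

lemma FG_eq:
  assumes h: "h \<in> carrier (S_inv g M act)" and f: "cocycle2 Ju f" and b: "bounds f h"
  shows "(F_res g M act \<circ> G_s0 g M act) h = u.Q2.cls f"
proof -
  have z: "bf (\<lambda>a b. 0) = (\<lambda>x y. 0)" "qf (\<lambda>a b. 0) = (\<lambda>x. 0)"
    by (intro ext; simp add: bf_def gen2_def qf_def swap_sign_def ksign_def)+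
  have "extension_equiv (tw (bf f) (qf f)) (tw (\<lambda>x y. 0) (\<lambda>x. - h x))"
    using tw_equiv_bounds[OF f_JU[OF f] cocycle2_zero, of h] b by (simp add: z)
  moreover have "restricted_extension g M act (tw (\<lambda>x y. 0) (\<lambda>x. - h x))"
    using h by (intro restricted_semilinear_twist(1)) (simp_all add: S_inv_carrier)
  ultimately have "G_s0 g M act h = F_res_inv g M act (u.Q2.cls f)"
    unfolding G_s0_def F_res_inv_cls[OF f] by (intro ext_class_eqI[symmetric] restricted_extension_cocycle[OF f])
  then show ?thesis
    unfolding F_res_def H_eq comp_apply using inj_on_F_res_inv f by (simp add: u.Q2.carrier_Q inv_into_f_f)
qed

lemma FG_exists:
  assumes h: "h \<in> carrier (S_inv g M act)"
  obtains f where "cocycle2 Ju f" "bounds f h" "(F_res g M act \<circ> G_s0 g M act) h = u.Q2.cls f"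
proof -
  have "\<exists>f. cocycle2 Ju f \<and> bounds f h"
    using h by (intro restricted_semilinear_twist(2)) (simp_all add: S_inv_carrier)
  then show ?thesis using that FG_eq[OF h] by blast
qed


lemma module_S_inv: "Module.module ring_of_type_algebra (S_inv g M act)"
proof -
  have "M.vs.subspace (even_invariants M act)"
    by (rule M.vs.subspaceI) (simp_all add: even_invariants_def act_simps M.part_0 M.part_add M.part_scale)
  then show ?thesis unfolding S_inv_def
    by (intro module_semilinear_maps module_vec_module mvec) (simp_all add: g_even_def vec_module_simps part_add part_scale)
qed

text \<open>\<open>bounds\<close> is a linear relation and \<open>FG_eq\<close> makes it the graph
  of the map on cochain level, so no addition of extensions is involved.\<close>

lemma FG_linear: "F_res g M act \<circ> G_s0 g M act \<in> linear_maps (S_inv g M act) u.Q2.Q"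
proof -
  let ?FG = "F_res g M act \<circ> G_s0 g M act" and ?S = "S_inv g M act"
  have lin: "?FG (k \<odot>\<^bsub>?S\<^esub> h \<oplus>\<^bsub>?S\<^esub> h') = u.Q2.cls (u.sc2 k f + f')"
    if h: "h \<in> carrier ?S" "h' \<in> carrier ?S" and f: "cocycle2 Ju f" "bounds f h" "cocycle2 Ju f'" "bounds f' h'" for k h h' f f'
  proof (rule FG_eq)
    have e: "u.sc2 k f + f' = (\<lambda>a b. smul M k (f a b) + f' a b)" by (intro ext) (simp add: u.sc2_def)
    show "cocycle2 Ju (u.sc2 k f + f')" unfolding e by (intro cocycle2_plus cocycle2_scale f)
    show "bounds (u.sc2 k f + f') (k \<odot>\<^bsub>?S\<^esub> h \<oplus>\<^bsub>?S\<^esub> h')"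
      unfolding e by (rule bounds_cong[OF bounds_linear[OF f(2,4)]]) (simp add: S_inv_ops)
    interpret S: Module.module ring_of_type_algebra ?S by (rule module_S_inv)
    show "k \<odot>\<^bsub>?S\<^esub> h \<oplus>\<^bsub>?S\<^esub> h' \<in> carrier ?S" using h by (simp add: scalars_simps)
  qed
  show ?thesis unfolding linear_maps_def
  proof (intro CollectI conjI ballI allI)
    interpret S: Module.module ring_of_type_algebra ?S by (rule module_S_inv)
    show "?FG \<in> carrier ?S \<rightarrow> carrier u.Q2.Q"
    proof
      fix h assume "h \<in> carrier ?S"
      then obtain f where "cocycle2 Ju f" "?FG h = u.Q2.cls f" by (rule FG_exists)
      then show "?FG h \<in> carrier u.Q2.Q" unfolding u.Q2.carrier_Q by simp
    qed
    fix h h' assume h: "h \<in> carrier ?S" "h' \<in> carrier ?S"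
    obtain f where f: "cocycle2 Ju f" "bounds f h" "?FG h = u.Q2.cls f" using h(1) by (rule FG_exists)
    obtain f' where f': "cocycle2 Ju f'" "bounds f' h'" "?FG h' = u.Q2.cls f'" using h(2) by (rule FG_exists)
    have "1 \<odot>\<^bsub>?S\<^esub> h = h" using S.smult_one[OF h(1)] by (simp add: scalars_simps)
    then have "?FG (h \<oplus>\<^bsub>?S\<^esub> h') = u.Q2.cls (u.sc2 1 f + f')" using lin[OF h f(1,2) f'(1,2), of 1] by (simp only:)
    also have "u.sc2 1 f = f" by (intro ext) (simp add: u.sc2_def)
    also have "u.Q2.cls (f + f') = ?FG h \<oplus>\<^bsub>u.Q2.Q\<^esub> ?FG h'"
      unfolding f(3) f'(3) using f(1) f'(1) by (intro u.Q2.cls_add[symmetric]) simp_all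
    finally show "?FG (h \<oplus>\<^bsub>?S\<^esub> h') = ?FG h \<oplus>\<^bsub>u.Q2.Q\<^esub> ?FG h'" .
  next
    interpret S: Module.module ring_of_type_algebra ?S by (rule module_S_inv)
    fix k h assume h: "h \<in> carrier ?S"
    obtain f where f: "cocycle2 Ju f" "bounds f h" "?FG h = u.Q2.cls f" using h by (rule FG_exists)
    have b0: "bounds (\<lambda>a b. 0) \<zero>\<^bsub>?S\<^esub>"
      unfolding bounds_def
    proof (intro exI[of _ 0] conjI U.cochain1_closed ballI)
      show "d1 0 = (\<lambda>a b. 0)" by (intro ext) (simp add: U.d1_linear)
    qed (simp add: S_inv_ops)
    have kh: "k \<odot>\<^bsub>?S\<^esub> h \<in> carrier ?S" using h by (simp add: scalars_simps)
    have "?FG (k \<odot>\<^bsub>?S\<^esub> h \<oplus>\<^bsub>?S\<^esub> \<zero>\<^bsub>?S\<^esub>) = u.Q2.cls (u.sc2 k f + (\<lambda>a b. 0))"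
      by (rule lin[OF h S.zero_closed f(1,2) cocycle2_zero b0])
    also have "u.sc2 k f + (\<lambda>a b. 0) = u.sc2 k f" by (intro ext) simp
    also have "u.Q2.cls (u.sc2 k f) = k \<odot>\<^bsub>u.Q2.Q\<^esub> ?FG h"
      unfolding f(3) using f(1) by (intro u.Q2.cls_smult[symmetric]) simp
    finally show "?FG (k \<odot>\<^bsub>?S\<^esub> h) = k \<odot>\<^bsub>u.Q2.Q\<^esub> ?FG h" using S.r_zero[OF kh] by simp
  qed
qed

subsection \<open>The last map\<close>

text \<open>The 1-cocycle whose class is the value of \<Phi> at \<open>x\<close>.\<close>

definition comm :: "(('k, 'g) free_alg \<Rightarrow> ('k, 'g) free_alg \<Rightarrow> 'm) \<Rightarrow> 'g \<Rightarrow> ('k, 'g) free_alg \<Rightarrow> 'm" where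
  "comm f x = (\<lambda>a. f (zd x) a - f a (zd x))"

lemma comm_linear: "comm (f + f') x = comm f x + comm f' x" "comm (U.sc2 k f) x = U.sc1 k (comm f x)"
  by (intro ext; simp add: comm_def U.sc1_def U.sc2_def M.vs.scale_right_diff_distrib)+

text \<open>A coboundary contributes only an inner 1-cocycle, since c agrees on z_x a and a z_x;
  hence \<Phi> is well defined on classes.\<close>

lemma comm_d1: "x \<in> part g 0 \<Longrightarrow> cochain1 JU c \<Longrightarrow> comm (d1 c) x = d0 (- c (zd x))"
  using cochain1_cong[OF _ cong_zd_central, of c x]
  by (intro ext) (simp add: comm_def d1_def d0_def fa_zd fa_right_simps)

lemma comm_semilinear:
  assumes f: "cocycle2 JU f" and x: "x \<in> part g 0" and y: "y \<in> part g 0"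
  shows "comm f (smul g a x + y) = U.sc1 (a ^ CHAR('k)) (comm f x) + comm f y"
proof
  fix b
  note fc = cocycle2D(1)[OF f]
  have c: "JU.cg (zd (smul g a x + y)) (free_scal (a ^ CHAR('k)) (zd x) + zd y)"
    by (intro JU.cg_trans[OF zd_add] cong_mod_add[OF JU.Q] zd_scale JU.cg_refl x y part_scale)
  show "comm f (smul g a x + y) b = (U.sc1 (a ^ CHAR('k)) (comm f x) + comm f y) b"
    unfolding comm_def cochain2_cong_left[OF fc c] cochain2_cong_right[OF fc c]
    by (simp add: klinearD(1,2)[OF cochain2D(1)[OF fc]] klinearD(1,2)[OF cochain2D(2)[OF fc]] U.sc1_def M.vs.scale_right_diff_distrib)
qed

lemma Phi_cls:
  assumes f: "cocycle2 JU f"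
  shows "Phi g M act (U.Q2.cls f) = (\<lambda>x\<in>part g 0. U.Q1.cls (comm f x))"
  unfolding Phi_def
proof (rule restrict_ext)
  fix x assume x: "x \<in> part g 0"
  have k: "cocycle1 JU (comm f x)" unfolding comm_def by (rule cocycle1_commutator[OF f x])
  have "(\<Union>F\<in>U.Q2.cls f. lie_class g M act (\<lambda>y. F [p_defect g x, emb (U_alg g) y] - F [emb (U_alg g) y, p_defect g x]))
    = restrict_H1 g M act (U.Q1.cls (comm f x))"
  proof (rule U.Q2.union_cls)
    show "f \<in> {f. cocycle2 JU f}" using f by simp
    fix f' assume f': "f' \<in> {f. cocycle2 JU f}" "f' - f \<in> d1 ` {c. cochain1 JU c}"
    then obtain c where c: "cochain1 JU c" "f' - f = d1 c" by blast
    have fc: "cochain2 JU f'" using f'(1) cocycle2D(1) by blast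
    have "U.L2 f' [p_defect g x, emb (U_alg g) y] - U.L2 f' [emb (U_alg g) y, p_defect g x] = comm f' x (free_gen y)" for y
      unfolding p_defect_eq emb_U comm_def by (simp add: U.L2_apply[OF fc] eps_simps)
    moreover have "comm f' x = d0 (- c (zd x)) + comm f x"
    proof -
      have "f' = d1 c + f" unfolding c(2)[symmetric] by simp
      then show ?thesis by (simp only: comm_linear comm_d1[OF x c(1)])
    qed
    moreover have "- c (zd x) \<in> part M 0"
      using M.part_scale[OF cochain1D(4)[OF c(1) zd_fpart[OF x]], of "- 1"] by simp
    ultimately show "lie_class g M act (\<lambda>y. U.L2 f' [p_defect g x, emb (U_alg g) y] - U.L2 f' [emb (U_alg g) y, p_defect g x])
        = restrict_H1 g M act (U.Q1.cls (comm f x))"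
      unfolding restrict_H1_cls[OF k] by (intro lie_class_cong[of "- c (zd x)"]) (simp_all add: d0_def eps_simps)
  qed
  then show "inv_into (carrier (H g M act 1)) (restrict_H1 g M act)
      (\<Union>F\<in>U.Q2.cls f. lie_class g M act (\<lambda>y. F [p_defect g x, emb (U_alg g) y] - F [emb (U_alg g) y, p_defect g x]))
    = U.Q1.cls (comm f x)"
    unfolding H_eq by (simp only:) (rule inv_into_f_f[OF inj_on_restrict_H1], use k in \<open>simp del: One_nat_def add: U.Q1.carrier_Q\<close>)
qed

text \<open>A \<open>p\<close>-semilinear map is linear for the scalar multiplication twisted by the Frobenius map.\<close>

lemma semilinear_choice:
  assumes ex: "\<And>x. x \<in> part g 0 \<Longrightarrow> \<exists>n. R x n" and R0: "R 0 0"
    and R: "\<And>a x y n n'. x \<in> part g 0 \<Longrightarrow> y \<in> part g 0 \<Longrightarrow> R x n \<Longrightarrow> R y n' \<Longrightarrow> R (smul g a x + y) (smul M (a ^ CHAR('k)) n + n')"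
  obtains T where "\<And>x. x \<in> part g 0 \<Longrightarrow> R x (T x)" "\<And>a x y. T (smul g a x + y) = smul M (a ^ CHAR('k)) (T x) + T y"
proof -
  define s where "s a = smul M (a ^ CHAR('k))" for a
  \<comment> \<open>Distributivity over sums of scalars is the additivity of the Frobenius
    map.\<close>
  have s: "vector_space s"
    by unfold_locales (simp_all add: s_def M.vs.scale_right_distrib M.vs.scale_left_distrib freshmans_dream[OF prime_p] power_mult_distrib)
  interpret VP: vector_space_pair "smul g" s by (intro vector_space_pair.intro gvec s)
  obtain B where B: "B \<subseteq> part g 0" "vs.independent B" "part g 0 \<subseteq> vs.span B" by (rule vs.maximal_independent_subset)
  obtain n where n: "\<And>x. x \<in> B \<Longrightarrow> R x (n x)" using ex B(1) by (metis subsetD)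
  define T where "T = VP.construct B n"
  have T: "klinear (smul g) s T" unfolding T_def by (rule VP.linear_construct[OF B(2)])
  have TB: "T x = n x" if "x \<in> B" for x unfolding T_def by (rule VP.construct_basis[OF B(2) that])
  have sl: "T (smul g a x + y) = smul M (a ^ CHAR('k)) (T x) + T y" for a x y
    by (simp only: klinear_add[OF T] klinear_scale[OF T] s_def)
  have "x \<in> part g 0 \<and> R x (T x)" if "x \<in> vs.span B" for x
    using that
  proof (induction rule: vs.span_induct_alt)
    case base show ?case using R0 by (simp add: klinear_zero[OF T] part_0)
  next
    case (step c x y)
    then have "x \<in> part g 0" "R x (T x)" using B(1) n TB by auto
    then show ?case using step R[of x y "T x" "T y" c] unfolding sl by (simp add: part_add part_scale)
  qed
  then show ?thesis using that[of T] sl B(3) by blast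
qed

text \<open>The element m(x) that makes the commutator cocycle at \<open>x\<close> inner is unique
  only up to even invariants. \<open>semilinear_choice\<close> selects it p-semilinearly in
  \<open>x\<close>, and \<open>descent\<close> applies.\<close>

lemma comm_bounding:
  assumes f: "cocycle2 JU f" and ex: "\<And>x. x \<in> part g 0 \<Longrightarrow> comm f x \<in> d0 ` part M 0"
  shows "\<exists>c. cochain1 JU c \<and> cocycle2 Ju (f + d1 c)"
proof -
  define R where "R x n \<longleftrightarrow> n \<in> part M 0 \<and> comm f x = d0 n" for x n
  have f0: "comm f 0 = 0"
    using fun_cong[OF comm_semilinear[OF f part_0 part_0, of 1]] by (intro ext) (simp add: U.sc1_def)
  have R_ex: "\<exists>n. R x n" if "x \<in> part g 0" for x using ex[OF that] unfolding R_def by blast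
  have R_0: "R 0 0" unfolding R_def f0 by (simp add: U.d0_linear M.part_0)
  have R_step: "R (smul g a x + y) (smul M (a ^ CHAR('k)) n + n')"
    if "x \<in> part g 0" "y \<in> part g 0" "R x n" "R y n'" for a x y n n'
    using that(3,4) unfolding R_def comm_semilinear[OF f that(1,2)] by (simp add: U.d0_linear M.part_add M.part_scale)
  obtain T where T: "\<And>x. x \<in> part g 0 \<Longrightarrow> R x (T x)" "\<And>a x y. T (smul g a x + y) = smul M (a ^ CHAR('k)) (T x) + T y"
    by (rule semilinear_choice[of R]) (rule R_ex, assumption, rule R_0, rule R_step, assumption+, rule that)
  have T1: "T x \<in> part M 0" if "x \<in> part g 0" for x using T(1)[OF that] unfolding R_def by blast
  have T2: "f (zd x) (free_gen y) - f (free_gen y) (zd x) = act y (T x)" if "x \<in> part g 0" for x y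
  proof -
    have "comm f x (free_gen y) = d0 (T x) (free_gen y)" using T(1)[OF that] unfolding R_def by simp
    then show ?thesis by (simp add: comm_def d0_def eps_simps)
  qed
  obtain c where c: "cochain1 JU c" "cocycle2 Ju (\<lambda>a b. f a b + d1 c a b)"
    using descent[OF f T1 T(2) T2] by blast
  have "f + d1 c = (\<lambda>a b. f a b + d1 c a b)" by (intro ext) simp
  then show ?thesis using c by auto
qed

section \<open>Exactness\<close>

lemma module_S_H1: "Module.module ring_of_type_algebra (S_H1 g M act)"
  unfolding S_H1_def H_eq
  by (rule module_semilinear_maps[OF U.Q1.module_Q]) (simp add: g_even_def vec_module_simps part_add part_scale)

lemma pull_back_1_linear: "pull_back g M act 1 \<in> linear_maps u.Q1.Q U.Q1.Q"
proof (rule u.Q1.linear_map_Q[where T = U.Q1.cls])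
  note mono = cocycle1_mono[OF JU_subset_Ju]
  show "pull_back g M act 1 (u.Q1.cls c) = U.Q1.cls c" if "c \<in> {c. cocycle1 Ju c}" for c
    using that by (intro pull_back_1) simp
  show "U.Q1.cls c \<in> carrier U.Q1.Q" if "c \<in> {c. cocycle1 Ju c}" for c
    unfolding U.Q1.carrier_Q using that mono by (intro imageI) simp
  show "U.Q1.cls (c + d) = U.Q1.cls c \<oplus>\<^bsub>U.Q1.Q\<^esub> U.Q1.cls d" if "c \<in> {c. cocycle1 Ju c}" "d \<in> {c. cocycle1 Ju c}" for c d
    using that mono by (intro U.Q1.cls_add[symmetric]) simp_all
  show "U.Q1.cls (u.sc1 k c) = k \<odot>\<^bsub>U.Q1.Q\<^esub> U.Q1.cls c" if "c \<in> {c. cocycle1 Ju c}" for k c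
    using that mono by (intro U.Q1.cls_smult[symmetric]) simp
qed

lemma pull_back_2_linear: "pull_back g M act 2 \<in> linear_maps u.Q2.Q U.Q2.Q"
proof (rule u.Q2.linear_map_Q[where T = U.Q2.cls])
  note mono = cocycle2_mono[OF JU_subset_Ju]
  show "pull_back g M act 2 (u.Q2.cls c) = U.Q2.cls c" if "c \<in> {c. cocycle2 Ju c}" for c
    using that by (intro pull_back_2) simp
  show "U.Q2.cls c \<in> carrier U.Q2.Q" if "c \<in> {c. cocycle2 Ju c}" for c
    unfolding U.Q2.carrier_Q using that mono by (intro imageI) simp
  show "U.Q2.cls (c + d) = U.Q2.cls c \<oplus>\<^bsub>U.Q2.Q\<^esub> U.Q2.cls d" if "c \<in> {c. cocycle2 Ju c}" "d \<in> {c. cocycle2 Ju c}" for c d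
    using that mono by (intro U.Q2.cls_add[symmetric]) simp_all
  show "U.Q2.cls (u.sc2 k c) = k \<odot>\<^bsub>U.Q2.Q\<^esub> U.Q2.cls c" if "c \<in> {c. cocycle2 Ju c}" for k c
    using that mono by (intro U.Q2.cls_smult[symmetric]) simp
qed

lemma cocycle1_S_inv:
  assumes "cocycle1 JU c"
  shows "(\<lambda>x\<in>part g 0. c (zd x)) \<in> carrier (S_inv g M act)"
  using assms cocycle2_zero by (intro cochain_S_inv) (simp_all add: cocycle1_iff[OF good_JU])

lemma Psi_bar_linear: "Psi_bar g M act \<in> linear_maps U.Q1.Q (S_inv g M act)"
  by (rule U.Q1.linear_map_Q[where T = "\<lambda>c. \<lambda>x\<in>part g 0. c (zd x)"])
    (simp_all del: One_nat_def add: Psi_bar_cls cocycle1_S_inv S_inv_ops U.sc1_def cong: restrict_cong)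

lemma Phi_linear: "Phi g M act \<in> linear_maps U.Q2.Q (S_H1 g M act)"
proof (rule U.Q2.linear_map_Q[where T = "\<lambda>f. \<lambda>x\<in>part g 0. U.Q1.cls (comm f x)"])
  have k: "comm f x \<in> {c. cocycle1 JU c}" if "cocycle2 JU f" "x \<in> part g 0" for f x
    using cocycle1_commutator[OF that] by (simp add: comm_def)
  fix f assume f: "f \<in> {f. cocycle2 JU f}"
  then have f: "cocycle2 JU f" by simp
  show "Phi g M act (U.Q2.cls f) = (\<lambda>x\<in>part g 0. U.Q1.cls (comm f x))" by (rule Phi_cls[OF f])
  show "(\<lambda>x\<in>part g 0. U.Q1.cls (comm f x)) \<in> carrier (S_H1 g M act)"
    unfolding S_H1_carrier
  proof (intro conjI ballI allI)
    show "(\<lambda>x\<in>part g 0. U.Q1.cls (comm f x)) x \<in> carrier U.Q1.Q" if "x \<in> part g 0" for x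
      using k[OF f that] that unfolding U.Q1.carrier_Q restrict_def by (simp only: if_True imageI)
    fix a x y assume xy: "x \<in> part g 0" "y \<in> part g 0"
    show "(\<lambda>x\<in>part g 0. U.Q1.cls (comm f x)) (smul g a x + y) =
      (a ^ CHAR('k) \<odot>\<^bsub>U.Q1.Q\<^esub> (\<lambda>x\<in>part g 0. U.Q1.cls (comm f x)) x) \<oplus>\<^bsub>U.Q1.Q\<^esub> (\<lambda>x\<in>part g 0. U.Q1.cls (comm f x)) y"
      using xy part_add[OF part_scale[OF xy(1), of a] xy(2)]
      by (simp only: restrict_apply' comm_semilinear[OF f xy] U.Q1.cls_smult[OF k[OF f xy(1)]]
          U.Q1.cls_add[OF U.Q1.Z_closed(3)[OF k[OF f xy(1)]] k[OF f xy(2)]])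
  qed simp
  show "(\<lambda>x\<in>part g 0. U.Q1.cls (comm (U.sc2 c f) x)) = c \<odot>\<^bsub>S_H1 g M act\<^esub> (\<lambda>x\<in>part g 0. U.Q1.cls (comm f x))" for c
    unfolding S_H1_ops by (rule restrict_ext) (simp only: restrict_apply' comm_linear U.Q1.cls_smult[OF k[OF f]])
  fix f' assume "f' \<in> {f. cocycle2 JU f}"
  then have f': "cocycle2 JU f'" by simp
  show "(\<lambda>x\<in>part g 0. U.Q1.cls (comm (f + f') x))
      = (\<lambda>x\<in>part g 0. U.Q1.cls (comm f x)) \<oplus>\<^bsub>S_H1 g M act\<^esub> (\<lambda>x\<in>part g 0. U.Q1.cls (comm f' x))"
    unfolding S_H1_ops by (rule restrict_ext) (simp only: restrict_apply' comm_linear U.Q1.cls_add[OF k[OF f] k[OF f']])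
qed

text \<open>The coboundaries \<open>d0 m\<close> are the same for both algebras.\<close>

lemma exact_H1_res: "a_kernel u.Q1.Q U.Q1.Q (pull_back g M act 1) = {\<zero>\<^bsub>u.Q1.Q\<^esub>}"
proof -
  have "a_kernel u.Q1.Q U.Q1.Q (pull_back g M act 1) = u.Q1.cls ` {c \<in> {c. cocycle1 Ju c}. U.Q1.cls c = \<zero>\<^bsub>U.Q1.Q\<^esub>}"
    by (rule u.Q1.kernel_Q) (simp only: mem_Collect_eq pull_back_1)
  also have "\<dots> = {u.Q1.cls 0}"
  proof (intro equalityI subsetI)
    fix C assume "C \<in> u.Q1.cls ` {c \<in> {c. cocycle1 Ju c}. U.Q1.cls c = \<zero>\<^bsub>U.Q1.Q\<^esub>}"
    then obtain c where c: "C = u.Q1.cls c" "cocycle1 Ju c" "U.Q1.cls c = U.Q1.cls 0" unfolding U.Q1.cls_zero by blast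
    have "c - 0 \<in> d0 ` part M 0"
      using c(3) cocycle1_mono[OF JU_subset_Ju c(2)] U.cocycle1_closed(1) by (intro U.Q1.cls_eq_iff[THEN iffD1]) simp_all
    then have "u.Q1.cls c = u.Q1.cls 0"
      using c(2) u.cocycle1_closed(1) by (intro u.Q1.cls_eq_iff[THEN iffD2]) simp_all
    then show "C \<in> {u.Q1.cls 0}" by (simp add: c(1))
  next
    fix C assume "C \<in> {u.Q1.cls 0}"
    then show "C \<in> u.Q1.cls ` {c \<in> {c. cocycle1 Ju c}. U.Q1.cls c = \<zero>\<^bsub>U.Q1.Q\<^esub>}"
      unfolding U.Q1.cls_zero using u.cocycle1_closed(1) by auto
  qed
  finally show ?thesis unfolding u.Q1.cls_zero .
qed

text \<open>A 1-cocycle on U(g) descends exactly when it vanishes at all z_x, and these are its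
  values under \<Psi>.\<close>

lemma exact_H1: "pull_back g M act 1 ` carrier u.Q1.Q = a_kernel U.Q1.Q (S_inv g M act) (Psi_bar g M act)"
proof -
  have "a_kernel U.Q1.Q (S_inv g M act) (Psi_bar g M act)
      = U.Q1.cls ` {c \<in> {c. cocycle1 JU c}. (\<lambda>x\<in>part g 0. c (zd x)) = \<zero>\<^bsub>S_inv g M act\<^esub>}"
    by (rule U.Q1.kernel_Q) (simp only: mem_Collect_eq Psi_bar_cls)
  also have "{c \<in> {c. cocycle1 JU c}. (\<lambda>x\<in>part g 0. c (zd x)) = \<zero>\<^bsub>S_inv g M act\<^esub>} = {c. cocycle1 Ju c}"
  proof (intro equalityI subsetI)
    fix c assume "c \<in> {c \<in> {c. cocycle1 JU c}. (\<lambda>x\<in>part g 0. c (zd x)) = \<zero>\<^bsub>S_inv g M act\<^esub>}"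
    then have c: "cocycle1 JU c" "(\<lambda>x\<in>part g 0. c (zd x)) = (\<lambda>x\<in>part g 0. 0)" by (simp_all add: S_inv_ops)
    have "c (zd x) = 0" if "x \<in> part g 0" for x using fun_cong[OF c(2), of x] that by simp
    then show "c \<in> {c. cocycle1 Ju c}" using cocycle1_descends[OF c(1)] by simp
  next
    fix c assume "c \<in> {c. cocycle1 Ju c}"
    then have c: "cocycle1 Ju c" by simp
    have "(\<lambda>x\<in>part g 0. c (zd x)) = (\<lambda>x\<in>part g 0. 0)"
      by (rule restrict_ext) (rule cochain1D(3)[OF cocycle1D(1)[OF c] zd_Ju])
    then show "c \<in> {c \<in> {c. cocycle1 JU c}. (\<lambda>x\<in>part g 0. c (zd x)) = \<zero>\<^bsub>S_inv g M act\<^esub>}"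
      using cocycle1_mono[OF JU_subset_Ju c] by (simp add: S_inv_ops)
  qed
  finally show ?thesis unfolding u.Q1.carrier_Q image_image using pull_back_1 by (simp cong: image_cong_simp)
qed

text \<open>A 1-cocycle c with values h at the z_x shows that the zero cocycle represents the image
  of h. Conversely, let c on U(g) and c' on u(g) have the same coboundary, with c(z_x) = h(x); then
  c - c' is a 1-cocycle on U(g), with values h at the z_x because c' vanishes there.\<close>

lemma exact_S_inv:
  "Psi_bar g M act ` carrier U.Q1.Q = a_kernel (S_inv g M act) u.Q2.Q (F_res g M act \<circ> G_s0 g M act)" (is "?L = a_kernel ?S _ ?FG")
proof -
  have L: "?L = (\<lambda>c. \<lambda>x\<in>part g 0. c (zd x)) ` {c. cocycle1 JU c}"
    unfolding U.Q1.carrier_Q image_image by (rule image_cong) (simp_all del: One_nat_def add: Psi_bar_cls)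
  have z: "(0 :: ('k, 'g) free_alg \<Rightarrow> ('k, 'g) free_alg \<Rightarrow> 'm) = (\<lambda>a b. 0)" by (intro ext) simp
  have K: "h \<in> a_kernel ?S u.Q2.Q ?FG \<longleftrightarrow> h \<in> carrier ?S \<and> ?FG h = u.Q2.cls 0" for h
    unfolding u.Q2.cls_zero[symmetric] by (simp add: a_kernel_def kernel_def)
  show ?thesis unfolding L
  proof (intro equalityI subsetI)
    fix h assume "h \<in> (\<lambda>c. \<lambda>x\<in>part g 0. c (zd x)) ` {c. cocycle1 JU c}"
    then obtain c where c: "cocycle1 JU c" "h = (\<lambda>x\<in>part g 0. c (zd x))" by blast
    have h: "h \<in> carrier ?S" unfolding c(2) by (rule cocycle1_S_inv[OF c(1)])
    have "bounds (\<lambda>a b. 0) h" unfolding bounds_def using c by (intro exI[of _ c]) (simp add: cocycle1_iff[OF good_JU])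
    then show "h \<in> a_kernel ?S u.Q2.Q ?FG" unfolding K z using h FG_eq[OF h cocycle2_zero] by blast
  next
    fix h assume "h \<in> a_kernel ?S u.Q2.Q ?FG"
    then have h: "h \<in> carrier ?S" "?FG h = u.Q2.cls 0" unfolding K by blast+
    obtain f where f: "cocycle2 Ju f" "bounds f h" "?FG h = u.Q2.cls f" using h(1) by (rule FG_exists)
    have "f - 0 \<in> d1 ` {c. cochain1 Ju c}"
      using h(2) f(1) cocycle2_zero unfolding f(3) by (intro u.Q2.cls_eq_iff[THEN iffD1]) (simp_all add: z)
    then obtain c' where c': "cochain1 Ju c'" "f = d1 c'" by auto
    obtain c where c: "cochain1 JU c" "d1 c = f" "\<And>x. x \<in> part g 0 \<Longrightarrow> c (zd x) = h x" using f(2) unfolding bounds_def by blast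
    have cc: "cochain1 JU (U.sc1 (- 1) c' + c)" by (intro U.cochain1_closed c(1) cochain1_mono[OF JU_subset_Ju c'(1)])
    have "d1 (U.sc1 (- 1) c' + c) = (\<lambda>a b. 0)"
      unfolding U.d1_linear c(2) c'(2)[symmetric] by (intro ext) (simp add: U.sc2_def)
    then have "cocycle1 JU (U.sc1 (- 1) c' + c)" using cc by (simp add: cocycle1_iff[OF good_JU])
    moreover have "h = (\<lambda>x\<in>part g 0. (U.sc1 (- 1) c' + c) (zd x))"
    proof (rule extensionalityI[where A = "part g 0"])
      show "h \<in> extensional (part g 0)" using h(1) by (simp add: S_inv_carrier)
    qed (simp_all add: U.sc1_def c(3) cochain1D(3)[OF c'(1) zd_Ju])
    ultimately show "h \<in> (\<lambda>c. \<lambda>x\<in>part g 0. c (zd x)) ` {c. cocycle1 JU c}" by blast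
  qed
qed

text \<open>A cocycle on u(g) dies over U(g) exactly if it is d1 c for a cochain c on U(g); the
  values of c at the z_x then form the semilinear map whose image it is.\<close>

lemma exact_H2_res:
  "(F_res g M act \<circ> G_s0 g M act) ` carrier (S_inv g M act) = a_kernel u.Q2.Q U.Q2.Q (pull_back g M act 2)" (is "?FG ` carrier ?S = _")
proof -
  have z: "(0 :: ('k, 'g) free_alg \<Rightarrow> ('k, 'g) free_alg \<Rightarrow> 'm) = (\<lambda>a b. 0)" by (intro ext) simp
  have iff: "U.Q2.cls f = \<zero>\<^bsub>U.Q2.Q\<^esub> \<longleftrightarrow> f \<in> d1 ` {c. cochain1 JU c}" if "cocycle2 Ju f" for f
  proof -
    have "U.Q2.cls f = U.Q2.cls 0 \<longleftrightarrow> f - 0 \<in> d1 ` {c. cochain1 JU c}"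
      using f_JU[OF that] cocycle2_zero by (intro U.Q2.cls_eq_iff) (simp_all add: z)
    then show ?thesis unfolding U.Q2.cls_zero by simp
  qed
  have K: "a_kernel u.Q2.Q U.Q2.Q (pull_back g M act 2) = u.Q2.cls ` {f \<in> {f. cocycle2 Ju f}. U.Q2.cls f = \<zero>\<^bsub>U.Q2.Q\<^esub>}"
    by (rule u.Q2.kernel_Q) (simp only: mem_Collect_eq pull_back_2)
  show ?thesis unfolding K
  proof (intro equalityI subsetI)
    fix C assume "C \<in> ?FG ` carrier ?S"
    then obtain h where h: "h \<in> carrier ?S" "C = ?FG h" by blast
    obtain f where f: "cocycle2 Ju f" "bounds f h" "?FG h = u.Q2.cls f" using h(1) by (rule FG_exists)
    have "f \<in> d1 ` {c. cochain1 JU c}" using f(2) unfolding bounds_def by blast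
    then show "C \<in> u.Q2.cls ` {f \<in> {f. cocycle2 Ju f}. U.Q2.cls f = \<zero>\<^bsub>U.Q2.Q\<^esub>}" unfolding h(2) f(3) using f(1) iff by blast
  next
    fix C assume "C \<in> u.Q2.cls ` {f \<in> {f. cocycle2 Ju f}. U.Q2.cls f = \<zero>\<^bsub>U.Q2.Q\<^esub>}"
    then obtain f where f: "cocycle2 Ju f" "C = u.Q2.cls f" "f \<in> d1 ` {c. cochain1 JU c}" using iff by blast
    then obtain c where c: "cochain1 JU c" "f = d1 c" by blast
    have h: "(\<lambda>x\<in>part g 0. c (zd x)) \<in> carrier ?S" using f(1) unfolding c(2) by (rule cochain_S_inv[OF c(1)])
    have "bounds f (\<lambda>x\<in>part g 0. c (zd x))" unfolding bounds_def using c by (intro exI[of _ c]) simp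
    then have "C = ?FG (\<lambda>x\<in>part g 0. c (zd x))" unfolding f(2) using FG_eq[OF h f(1)] by simp
    then show "C \<in> ?FG ` carrier ?S" using h by (rule image_eqI)
  qed
qed

text \<open>A cocycle on u(g) vanishes at the z_x, so its commutators do. Conversely,
  \<open>comm_bounding\<close> corrects a cocycle with inner commutators to one on u(g) without
  changing its class over U(g).\<close>

lemma exact_H2: "pull_back g M act 2 ` carrier u.Q2.Q = a_kernel U.Q2.Q (S_H1 g M act) (Phi g M act)"
proof -
  have I: "pull_back g M act 2 ` carrier u.Q2.Q = U.Q2.cls ` {f. cocycle2 Ju f}"
    unfolding u.Q2.carrier_Q image_image by (rule image_cong) (simp_all add: pull_back_2)
  have K: "a_kernel U.Q2.Q (S_H1 g M act) (Phi g M act)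
      = U.Q2.cls ` {f \<in> {f. cocycle2 JU f}. (\<lambda>x\<in>part g 0. U.Q1.cls (comm f x)) = \<zero>\<^bsub>S_H1 g M act\<^esub>}"
    by (rule U.Q2.kernel_Q) (simp only: mem_Collect_eq Phi_cls)
  show ?thesis unfolding I K
  proof (intro equalityI subsetI)
    fix C assume "C \<in> U.Q2.cls ` {f. cocycle2 Ju f}"
    then obtain f where f: "C = U.Q2.cls f" "cocycle2 Ju f" by blast
    have "comm f x = 0" if "x \<in> part g 0" for x
      by (intro ext) (simp add: comm_def cochain2D(5,6)[OF cocycle2D(1)[OF f(2)] zd_Ju[OF that]])
    then have "(\<lambda>x\<in>part g 0. U.Q1.cls (comm f x)) = \<zero>\<^bsub>S_H1 g M act\<^esub>"
      unfolding S_H1_ops U.Q1.cls_zero by (intro restrict_ext) simp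
    then show "C \<in> U.Q2.cls ` {f \<in> {f. cocycle2 JU f}. (\<lambda>x\<in>part g 0. U.Q1.cls (comm f x)) = \<zero>\<^bsub>S_H1 g M act\<^esub>}"
      unfolding f(1) using f_JU[OF f(2)] by blast
  next
    fix C assume "C \<in> U.Q2.cls ` {f \<in> {f. cocycle2 JU f}. (\<lambda>x\<in>part g 0. U.Q1.cls (comm f x)) = \<zero>\<^bsub>S_H1 g M act\<^esub>}"
    then obtain f where f: "C = U.Q2.cls f" "cocycle2 JU f" "(\<lambda>x\<in>part g 0. U.Q1.cls (comm f x)) = (\<lambda>x\<in>part g 0. U.Q1.cls 0)"
      unfolding S_H1_ops U.Q1.cls_zero by blast
    have "comm f x \<in> d0 ` part M 0" if x: "x \<in> part g 0" for x
    proof -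
      have "U.Q1.cls (comm f x) = U.Q1.cls 0" using fun_cong[OF f(3), of x] x by simp
      then have "comm f x - 0 \<in> d0 ` part M 0"
        using cocycle1_commutator[OF f(2) x] U.cocycle1_closed(1) by (intro U.Q1.cls_eq_iff[THEN iffD1]) (simp_all add: comm_def)
      then show ?thesis by simp
    qed
    then obtain c where c: "cochain1 JU c" "cocycle2 Ju (f + d1 c)" using comm_bounding[OF f(2)] by blast
    have "(f + d1 c) - f \<in> d1 ` {c. cochain1 JU c}" using c(1) by simp
    then have "U.Q2.cls (f + d1 c) = U.Q2.cls f"
      using f(2) f_JU[OF c(2)] by (intro U.Q2.cls_eq_iff[THEN iffD2]) simp_all
    then show "C \<in> U.Q2.cls ` {f. cocycle2 Ju f}" unfolding f(1) using c(2) by (intro image_eqI[where x = "f + d1 c"]) simp_all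
  qed
qed

lemmas exact_sequence =
  u.Q1.module_Q U.Q1.module_Q module_S_inv u.Q2.module_Q U.Q2.module_Q module_S_H1
  pull_back_1_linear Psi_bar_linear FG_linear pull_back_2_linear Phi_linear
  exact_H1_res exact_H1 exact_S_inv exact_H2_res exact_H2

lemmas exact_sequence_H = exact_sequence[folded H_eq]

end

theorem theorem5p7:
  fixes g :: "('k::field, 'g::ab_group_add) rlsa"
    and M :: "('k, 'm::ab_group_add) rlsa"
    and act :: "'g \<Rightarrow> 'm \<Rightarrow> 'm"
    and p :: nat
  assumes "CHAR('k) = p" and "p > 2"
    and "restricted_lie_superalgebra g"
    and "restricted_lie_superalgebra M" and "strongly_abelian M"
    and "restricted_module g M act"
  shows
    "let K = (ring_of_type_algebra :: 'k ring);
         H1s = H_res g M act 1; H1 = H g M act 1;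
         S1 = S_inv g M act;
         H2s = H_res g M act 2; H2 = H g M act 2;
         S2 = S_H1 g M act;
         i1 = pull_back g M act 1;
         \<rho> = pull_back g M act 2;
         FG = F_res g M act \<circ> G_s0 g M act
     in module K H1s \<and> module K H1 \<and> module K S1 \<and> module K H2s \<and> module K H2 \<and> module K S2 \<and>
        i1 \<in> linear_maps H1s H1 \<and>
        Psi_bar g M act \<in> linear_maps H1 S1 \<and>
        FG \<in> linear_maps S1 H2s \<and>
        \<rho> \<in> linear_maps H2s H2 \<and>
        Phi g M act \<in> linear_maps H2 S2 \<and>
        a_kernel H1s H1 i1 = {\<zero>\<^bsub>H1s\<^esub>} \<and>
        i1 ` carrier H1s = a_kernel H1 S1 (Psi_bar g M act) \<and>
        Psi_bar g M act ` carrier H1 = a_kernel S1 H2s FG \<and>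
        FG ` carrier S1 = a_kernel H2s H2 \<rho> \<and>
        \<rho> ` carrier H2s = a_kernel H2 S2 (Phi g M act)"
proof -
  interpret restricted_setting g M act by unfold_locales (use assms in simp_all)
  show ?thesis unfolding Let_def by (intro conjI exact_sequence_H)
qed

end
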